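(* Let $\varsigma=(s_1,\ldots,s_d)$ be valences. The space $\mathcal S_\varsigma=\mathrm{span}_{\mathbb C}\{\mathcal Z_\alpha\mid\alpha\in\mathrm{LP}_\varsigma\}$ is a simple module over the valenced Temperley–Lieb algebra $\mathsf{TL}_\varsigma=\mathrm p_\varsigma\mathsf{TL}_{2N}(-2)\mathrm p_\varsigma$, where the action is well defined by $$(\mathrm p_\varsigma a\,\mathrm p_\varsigma).\left[\frac{\mathrm p_\varsigma.F}{\prod_{k=1}^d\prod_{q_{k-1}<i<j\le q_k}(x_j-x_i)}\right]_{\mathrm{eval}}=\left[\frac{\mathrm p_\varsigma a\,\mathrm p_\varsigma.F}{\prod_{k=1}^d\prod_{q_{k-1}<i<j\le q_k}(x_j-x_i)}\right]_{\mathrm{eval}},\qquad a\in\mathsf{TL}_{2N}(-2),\ F\in\mathcal S_N.$$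
   Context: **Link patterns.** $\mathrm{LP}_N$ is the set of partitions of $\{1,\ldots,2N\}$ into $N$ pairs (links) that can be drawn as $N$ disjoint curves in the upper half-plane joining points of the real axis. A link pattern is always written $\beta=\{\{a_1,b_1\},\ldots,\{a_N,b_N\}\}$ with $a_1<\cdots<a_N$ and $a_k<b_k$ for all $k$. **Valences.** $\varsigma=(s_1,\ldots,s_d)\in\mathbb Z_{>0}^d$ with $\sum_i s_i=2N$ and $\max_j s_j\le N$; $q_0=0$, $q_j=s_1+\cdots+s_j$. The $j$th block is $\{q_{j-1}+1,\ldots,q_j\}$. $\mathrm{LP}_\varsigma$ is the set of multisets of $N$ pairs $\{i,j\}$, $i\neq j$ in $\{1,\ldots,d\}$, obtained from some element of $\mathrm{LP}_N$ having no link inside a block by replacing each index by the number of its block. This replacement is injective, so each $\alpha\in\mathrm{LP}_\varsigma$ comes from a unique $\iota(\alpha)\in\mathrm{LP}_N$; $\alpha$ is identified with $\iota(\alpha)$ in $\succeq$ and $\mathcal C$. **Order and Dyck tilings.** Identify $\alpha\in\mathrm{LP}_N$ with the Dyck path $\alpha:\{0,\ldots,2N\}\to\mathbb Z_{\ge0}$, $\alpha(0)=0$, with $\alpha(j)-\alpha(j-1)=+1$ if $j$ is a left endpoint of a link and $-1$ if it is a right endpoint. $\beta\succeq\alpha$ means $\beta(j)\ge\alpha(j)$ for all $j$. Then the skew Young diagram $\alpha/\beta$ is the region between the two paths, a union of boxes (a box centred at $(x,y)$, $x+y$ odd, has vertices $(x\pm1,y)$, $(x,y\pm1)$). A Dyck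 tile is a nonempty set of boxes whose centres, from left to right, are the consecutive points of a lattice path with steps $(1,\pm1)$ that starts and ends at the same height and never goes below it (a single box is allowed). A Dyck tiling of $\alpha/\beta$ is a partition of its boxes into Dyck tiles. It is cover-inclusive if, whenever a tile $T_1$ has a box whose centre lies vertically straight above the centre of a box of another tile $T_2$, the horizontal extent of $T_1$ (interval from the leftmost to the rightmost $x$-coordinate of its box centres) is contained in that of $T_2$. $\#\mathcal C(\alpha/\beta)$ is the number of cover-inclusive Dyck tilings of $\alpha/\beta$ (with $\#\mathcal C(\alpha/\alpha)=1$). **Pure partition functions.** For $\alpha\in\mathrm{LP}_\varsigma$ and $x_1<\cdots<x_d$, $$\mathcal Z_\alpha(x_1,\ldots,x_d):=\sum_{\beta\in\mathrm{LP}_N,\ \beta\succeq\alpha}\#\mathcal C(\alpha/\beta)\,\det\big(\mathfrak K(a_k,b_\ell)\big)_{k,\ell=1}^N,\qquad \beta=\{\{a_1,b_1\},\ldots,\{a_N,b_N\}\},$$ with $\mathfrak K(a,b)=\partial_{x_i}^{m_a-1}\partial_{x_j}^{m_b-1}\frac{1}{\pi(x_i-x_j)^2}$ if $a=q_{i-1}+m_a$ lies in block $i$ and $b=q_{j-1}+m_b$ lies in block $j\ne i$, and $\mathfrak K(a,b)=0$ if $a,b$ lie in the same block. These are rational functions. For $\varsigma=(1,\ldots,1)$ (with $2N$ ones) write $\mathcal S_N:=\mathcal S_{(1,\ldots,1)}$; also $\mathcal S_N=\mathrm{span}_{\mathbb C}\{\det(\frac{1}{\pi(x_{a_k}-x_{b_\ell})^2})_{k,\ell=1}^N\mid\beta\in\mathrm{LP}_N\}$,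 a space of rational functions of $x_1,\ldots,x_{2N}$. **Algebras and actions.** $\mathsf{TL}_n(\nu)$ is the unital algebra generated by $e_1,\ldots,e_{n-1}$ with $e_i^2=\nu e_i$, $e_ie_{i\pm1}e_i=e_i$, $e_ie_j=e_je_i$ for $|i-j|>1$. With $\tau_i=1+e_i$, $\mathsf{TL}_n(-2)$ is the quotient of the group algebra $\mathbb C[\mathfrak S_n]$ (with $\tau_i$ the transposition $(i,i+1)$) by the relations $1+\tau_i+\tau_{i+1}+\tau_i\tau_{i+1}+\tau_{i+1}\tau_i+\tau_i\tau_{i+1}\tau_i=0$. $\mathfrak S_{2N}$ acts on $\mathcal S_N$ by permuting variables, $(\sigma.F)(x_1,\ldots,x_{2N})=F(x_{\sigma(1)},\ldots,x_{\sigma(2N)})$, and this action factors through $\mathsf{TL}_{2N}(-2)$. The idempotent $\mathrm p_\varsigma\in\mathsf{TL}_{2N}(-2)$ is the image of $\frac{1}{s_1!\cdots s_d!}\prod_{k=1}^d\sum_{\sigma\in\mathfrak S_{s_k}}\mathrm{sgn}(\sigma)\sigma$, where $\mathfrak S_{s_k}\subset\mathfrak S_{2N}$ is the group of permutations of the $k$th block. $\mathsf{TL}_\varsigma:=\mathrm p_\varsigma\mathsf{TL}_{2N}(-2)\mathrm p_\varsigma$ is an associative algebra with unit $\mathrm p_\varsigma$. A module is simple if it is nonzero and has no nontrivial proper submodule. **Evaluation.** For a function $f(x_1,\ldots,x_{2N})$ extending continuously to points with $x_{q_{k-1}+1}=\cdots=x_{q_k}$ for all $k$, $[f]_{\mathrm{eval}}(\xi_1,\ldots,\xi_d)$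 is its value when $x_{q_{k-1}+1}=\cdots=x_{q_k}=\xi_k$ for all $k$. For $F\in\mathcal S_N$ the quotient in the claim does extend in this way, and every element of $\mathcal S_\varsigma$ is of the form $[\mathrm p_\varsigma.F/\prod_k\prod_{q_{k-1}<i<j\le q_k}(x_j-x_i)]_{\mathrm{eval}}$ with $F\in\mathcal S_N$. *)

theory Defs
  imports
    "HOL-Analysis.Analysis"
    "HOL-Algebra.QuotRing"
    "HOL-Library.Disjoint_Sets"
    "HOL-Library.Multiset"
    "HOL-Library.Function_Algebras"
    "HOL-Combinatorics.Permutations"
    "Jordan_Normal_Form.Determinant"
begin

section \<open>Link patterns and valences\<close>

text \<open>Planarity (disjoint curves in the upper half-plane) is the usual
  condition that no two links cross.\<close>

definition LP :: "nat \<Rightarrow> nat set set set" where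
  "LP N = {\<beta>. partition_on {1..2*N} \<beta> \<and> (\<forall>l\<in>\<beta>. card l = 2) \<and>
     \<not> (\<exists>a b c d. {a, b} \<in> \<beta> \<and> {c, d} \<in> \<beta> \<and> a < c \<and> c < b \<and> b < d)}"

text \<open>The endpoints \<open>a\<^sub>1 < \<dots> < a\<^sub>N\<close> and \<open>b\<^sub>1, \<dots>, b\<^sub>N\<close> of the links, indexed from \<open>0\<close>.\<close>

definition left_end :: "nat set set \<Rightarrow> nat \<Rightarrow> nat" where
  "left_end \<beta> k = sorted_list_of_set (Min ` \<beta>) ! k"

definition right_end :: "nat set set \<Rightarrow> nat \<Rightarrow> nat" where
  "right_end \<beta> k = Max (THE l. l \<in> \<beta> \<and> Min l = left_end \<beta> k)"

text \<open>The list entry \<open>s ! (j - 1)\<close> is \<open>s\<^sub>j\<close>; blocks are numbered from \<open>1\<close>.\<close>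

definition valences :: "nat \<Rightarrow> nat list \<Rightarrow> bool" where
  "valences N s \<longleftrightarrow> sum_list s = 2 * N \<and> (\<forall>v\<in>set s. 0 < v \<and> v \<le> N)"

definition qsum :: "nat list \<Rightarrow> nat \<Rightarrow> nat" where
  "qsum s j = sum_list (take j s)"

definition block :: "nat list \<Rightarrow> nat \<Rightarrow> nat" where
  "block s a = (THE j. 1 \<le> j \<and> j \<le> length s \<and> qsum s (j - 1) < a \<and> a \<le> qsum s j)"

definition block_pos :: "nat list \<Rightarrow> nat \<Rightarrow> nat" where
  "block_pos s a = a - qsum s (block s a - 1)"

definition no_block_link :: "nat list \<Rightarrow> nat set set \<Rightarrow> bool" where
  "no_block_link s \<beta> \<longleftrightarrow> (\<forall>l\<in>\<beta>. \<forall>a\<in>l. \<forall>b\<in>l. a \<noteq> b \<longrightarrow> block s a \<noteq> block s b)"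

definition fuse_pattern :: "nat list \<Rightarrow> nat set set \<Rightarrow> nat set multiset" where
  "fuse_pattern s \<beta> = image_mset (\<lambda>l. block s ` l) (mset_set \<beta>)"

definition LPv :: "nat \<Rightarrow> nat list \<Rightarrow> nat set multiset set" where
  "LPv N s = fuse_pattern s ` {\<beta> \<in> LP N. no_block_link s \<beta>}"

definition unfuse :: "nat \<Rightarrow> nat list \<Rightarrow> nat set multiset \<Rightarrow> nat set set" where
  "unfuse N s \<alpha> = (THE \<beta>. \<beta> \<in> LP N \<and> no_block_link s \<beta> \<and> fuse_pattern s \<beta> = \<alpha>)"


section \<open>Dyck paths and cover-inclusive Dyck tilings\<close>

definition dpath :: "nat set set \<Rightarrow> nat \<Rightarrow> int" where
  "dpath \<beta> j = (\<Sum>i=1..j. if i \<in> Min ` \<beta> then 1 else - 1)"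

definition path_above :: "nat \<Rightarrow> nat set set \<Rightarrow> nat set set \<Rightarrow> bool" where
  "path_above N \<beta> \<alpha> \<longleftrightarrow> (\<forall>j\<le>2*N. dpath \<alpha> j \<le> dpath \<beta> j)"

text \<open>Boxes are represented by their centres. As the paths have steps \<open>\<plusminus>1\<close>, a box lies between
  them as soon as its lower vertex is not below \<open>\<alpha>\<close> and its upper vertex is not above \<open>\<beta>\<close>.\<close>

definition skew_boxes :: "nat \<Rightarrow> nat set set \<Rightarrow> nat set set \<Rightarrow> (nat \<times> int) set" where
  "skew_boxes N \<alpha> \<beta> =
     {(x, y). x \<le> 2*N \<and> odd (int x + y) \<and> dpath \<alpha> x \<le> y - 1 \<and> y + 1 \<le> dpath \<beta> x}"

definition dyck_tile :: "(nat \<times> int) set \<Rightarrow> bool" where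
  "dyck_tile T \<longleftrightarrow> (\<exists>x m h. T = (\<lambda>i. (x + i, h i)) ` {0..m} \<and> h m = h 0 \<and>
     (\<forall>i\<le>m. h 0 \<le> h i) \<and> (\<forall>i<m. \<bar>h (Suc i) - h i\<bar> = 1))"

definition cover_inclusive :: "(nat \<times> int) set set \<Rightarrow> bool" where
  "cover_inclusive \<T> \<longleftrightarrow> (\<forall>T1\<in>\<T>. \<forall>T2\<in>\<T>. T1 \<noteq> T2 \<longrightarrow>
     (\<exists>x y1 y2. (x, y1) \<in> T1 \<and> (x, y2) \<in> T2 \<and> y2 < y1) \<longrightarrow>
     {Min (fst ` T1)..Max (fst ` T1)} \<subseteq> {Min (fst ` T2)..Max (fst ` T2)})"

definition num_ci_tilings :: "nat \<Rightarrow> nat set set \<Rightarrow> nat set set \<Rightarrow> nat" where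
  "num_ci_tilings N \<alpha> \<beta> = card {\<T>. partition_on (skew_boxes N \<alpha> \<beta>) \<T> \<and>
     (\<forall>T\<in>\<T>. dyck_tile T) \<and> cover_inclusive \<T>}"


section \<open>Pure partition functions\<close>

text \<open>A rational function of \<open>x\<^sub>1, \<dots>, x\<^sub>n\<close> with poles only on the diagonals \<open>x\<^sub>i = x\<^sub>j\<close> is
  represented by its values at the real points with pairwise distinct coordinates (which
  determine it), extended by \<open>0\<close> to all other points.
  Coordinates with indices outside \<open>{1..n}\<close> are irrelevant.\<close>

type_synonym cfn = "(nat \<Rightarrow> real) \<Rightarrow> complex"

definition config :: "nat \<Rightarrow> (nat \<Rightarrow> real) set" where
  "config n = {x. inj_on x {1..n}}"

definition pdiff :: "nat \<Rightarrow> ((nat \<Rightarrow> real) \<Rightarrow> real) \<Rightarrow> (nat \<Rightarrow> real) \<Rightarrow> real" where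
  "pdiff i f x = deriv (\<lambda>t. f (x(i := t))) (x i)"

definition kernel :: "nat list \<Rightarrow> nat \<Rightarrow> nat \<Rightarrow> (nat \<Rightarrow> real) \<Rightarrow> real" where
  "kernel s a b =
     (if block s a = block s b then (\<lambda>x. 0)
      else (pdiff (block s a) ^^ (block_pos s a - 1)) ((pdiff (block s b) ^^ (block_pos s b - 1))
             (\<lambda>x. 1 / (pi * (x (block s a) - x (block s b))\<^sup>2))))"

definition pure_pf :: "nat \<Rightarrow> nat list \<Rightarrow> nat set multiset \<Rightarrow> cfn" where
  "pure_pf N s \<alpha> x =
     (if x \<in> config (length s)
      then \<Sum>\<beta> | \<beta> \<in> LP N \<and> path_above N \<beta> (unfuse N s \<alpha>).
             of_nat (num_ci_tilings N (unfuse N s \<alpha>) \<beta>) *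
             of_real (Determinant.det (Matrix.mat N N
               (\<lambda>(k, l). kernel s (left_end \<beta> k) (right_end \<beta> l) x)))
      else 0)"

definition cscale :: "complex \<Rightarrow> ('x \<Rightarrow> complex) \<Rightarrow> 'x \<Rightarrow> complex" where
  "cscale c f = (\<lambda>x. c * f x)"

global_interpretation cfun: vector_space cscale
  by unfold_locales (auto simp: cscale_def fun_eq_iff algebra_simps)

definition Sv :: "nat \<Rightarrow> nat list \<Rightarrow> cfn set" where
  "Sv N s = cfun.span (pure_pf N s ` LPv N s)"

definition SN :: "nat \<Rightarrow> cfn set" where
  "SN N = Sv N (replicate (2*N) 1)"


section \<open>Algebras\<close>

text \<open>Complex algebras are encoded by the record \<^type>\<open>module\<close> of HOL-Algebra, whose
  field \<open>smult\<close> is the multiplication by complex scalars.\<close>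

definition group_alg :: "nat \<Rightarrow> (complex, (nat \<Rightarrow> nat) \<Rightarrow> complex) module" where
  "group_alg n =
     \<lparr>carrier = {f. \<forall>\<sigma>. \<not> \<sigma> permutes {1..n} \<longrightarrow> f \<sigma> = 0},
      mult = (\<lambda>f g \<sigma>. \<Sum>\<rho> | \<rho> permutes {1..n}. \<Sum>\<pi> | \<pi> permutes {1..n}.
                if \<rho> \<circ> \<pi> = \<sigma> then f \<rho> * g \<pi> else 0),
      one = (\<lambda>\<sigma>. if \<sigma> = id then 1 else 0),
      zero = (\<lambda>\<sigma>. 0),
      add = (\<lambda>f g \<sigma>. f \<sigma> + g \<sigma>),
      smult = (\<lambda>c f \<sigma>. c * f \<sigma>)\<rparr>"

definition tau :: "nat \<Rightarrow> (nat \<Rightarrow> nat) \<Rightarrow> complex" where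
  "tau i = (\<lambda>\<sigma>. if \<sigma> = Transposition.transpose i (Suc i) then 1 else 0)"

definition tl_rel :: "nat \<Rightarrow> nat \<Rightarrow> (nat \<Rightarrow> nat) \<Rightarrow> complex" where
  "tl_rel n i = (let G = group_alg n; t = tau i; u = tau (Suc i) in
     \<one>\<^bsub>G\<^esub> \<oplus>\<^bsub>G\<^esub> t \<oplus>\<^bsub>G\<^esub> u \<oplus>\<^bsub>G\<^esub> t \<otimes>\<^bsub>G\<^esub> u \<oplus>\<^bsub>G\<^esub> u \<otimes>\<^bsub>G\<^esub> t \<oplus>\<^bsub>G\<^esub> t \<otimes>\<^bsub>G\<^esub> u \<otimes>\<^bsub>G\<^esub> t)"

definition tl_ideal :: "nat \<Rightarrow> ((nat \<Rightarrow> nat) \<Rightarrow> complex) set" where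
  "tl_ideal n = Idl\<^bsub>group_alg n\<^esub> (tl_rel n ` {i. 1 \<le> i \<and> i + 2 \<le> n})"

text \<open>\<open>TL n\<close> is \<open>TL\<^sub>n(-2)\<close>; elements are cosets in the group algebra.
  In terms of the classes of the transpositions, the Temperley-Lieb generators satisfying
  \<open>e\<^sub>i\<^sup>2 = -2 e\<^sub>i\<close> and \<open>e\<^sub>i e\<^sub>i\<^sub>\<plusminus>\<^sub>1 e\<^sub>i = e\<^sub>i\<close> are here the classes of \<open>-1 - \<tau>\<^sub>i\<close>.\<close>

definition tl_class :: "nat \<Rightarrow> ((nat \<Rightarrow> nat) \<Rightarrow> complex) \<Rightarrow> ((nat \<Rightarrow> nat) \<Rightarrow> complex) set" where
  "tl_class n a = tl_ideal n +>\<^bsub>group_alg n\<^esub> a"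

definition TL :: "nat \<Rightarrow> (complex, ((nat \<Rightarrow> nat) \<Rightarrow> complex) set) module" where
  "TL n = ring.extend (group_alg n Quot tl_ideal n)
     (module.fields (\<lambda>c A. \<Union>a\<in>A. tl_class n (c \<odot>\<^bsub>group_alg n\<^esub> a)))"

definition block_antisym :: "nat list \<Rightarrow> nat \<Rightarrow> (nat \<Rightarrow> nat) \<Rightarrow> complex" where
  "block_antisym s k = (\<lambda>\<sigma>. if \<sigma> permutes {qsum s (k - 1)<..qsum s k} then of_int (sign \<sigma>) else 0)"

definition block_antisymmetrizer :: "nat \<Rightarrow> nat list \<Rightarrow> (nat \<Rightarrow> nat) \<Rightarrow> complex" where
  "block_antisymmetrizer N s = (let G = group_alg (2*N) in
     (1 / (\<Prod>v\<leftarrow>s. fact v)) \<odot>\<^bsub>G\<^esub>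
       foldr (\<lambda>k a. block_antisym s k \<otimes>\<^bsub>G\<^esub> a) [1..<Suc (length s)] \<one>\<^bsub>G\<^esub>)"

definition p_idem :: "nat \<Rightarrow> nat list \<Rightarrow> ((nat \<Rightarrow> nat) \<Rightarrow> complex) set" where
  "p_idem N s = tl_class (2*N) (block_antisymmetrizer N s)"

definition corner :: "('c, 'r) module \<Rightarrow> 'r \<Rightarrow> ('c, 'r) module" where
  "corner R p = R\<lparr>carrier := (\<lambda>a. p \<otimes>\<^bsub>R\<^esub> a \<otimes>\<^bsub>R\<^esub> p) ` carrier R, one := p\<rparr>"

definition TLv :: "nat \<Rightarrow> nat list \<Rightarrow> (complex, ((nat \<Rightarrow> nat) \<Rightarrow> complex) set) module" where
  "TLv N s = corner (TL (2*N)) (p_idem N s)"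


text \<open>All these algebras are associative and unital, and \<open>p_idem\<close> is idempotent.\<close>

lemma finite_perms [simp]: "finite {\<sigma>. \<sigma> permutes {m..n::nat}}"
  by (rule finite_permutations) simp

lemma ring_group_alg: "ring (group_alg n)"
proof -
  let ?P = "{\<sigma>. \<sigma> permutes {1..n}}"
  have comp_P: "\<rho> \<circ> \<pi> \<in> ?P" if "\<rho> \<in> ?P" "\<pi> \<in> ?P" for \<rho> \<pi>
    using that by (auto intro: permutes_compose)
  have id_P: "id \<in> ?P" by (simp add: permutes_id)
  have closed: "(\<Sum>\<rho>\<in>?P. \<Sum>\<pi>\<in>?P. if \<rho> \<circ> \<pi> = \<sigma> then f \<rho> * g \<pi> else 0) = 0"
    if "\<not> \<sigma> permutes {1..n}" for \<sigma> and f g :: "(nat \<Rightarrow> nat) \<Rightarrow> complex"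
    by (rule sum.neutral, intro ballI sum.neutral) (use comp_P that in auto)
  have lassoc: "(\<Sum>\<mu>\<in>?P. \<Sum>\<pi>\<in>?P. if \<mu> \<circ> \<pi> = \<sigma> then
      (\<Sum>\<rho>\<in>?P. \<Sum>\<kappa>\<in>?P. if \<rho> \<circ> \<kappa> = \<mu> then f \<rho> * g \<kappa> else 0) * h \<pi> else 0)
    = (\<Sum>\<rho>\<in>?P. \<Sum>\<kappa>\<in>?P. \<Sum>\<pi>\<in>?P. if \<rho> \<circ> \<kappa> \<circ> \<pi> = \<sigma> then f \<rho> * g \<kappa> * h \<pi> else 0)" (is "?L = ?R")
    for \<sigma> and f g h :: "(nat \<Rightarrow> nat) \<Rightarrow> complex"
  proof -
    have "?L = (\<Sum>\<mu>\<in>?P. \<Sum>\<pi>\<in>?P. \<Sum>\<rho>\<in>?P. \<Sum>\<kappa>\<in>?P.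
        if \<mu> = \<rho> \<circ> \<kappa> then (if \<mu> \<circ> \<pi> = \<sigma> then f \<rho> * g \<kappa> * h \<pi> else 0) else 0)"
      by (intro sum.cong refl) (auto simp: sum_distrib_right intro!: sum.cong sum.neutral)
    also have "\<dots> = (\<Sum>\<mu>\<in>?P. \<Sum>\<rho>\<in>?P. \<Sum>\<kappa>\<in>?P. \<Sum>\<pi>\<in>?P.
        if \<mu> = \<rho> \<circ> \<kappa> then (if \<mu> \<circ> \<pi> = \<sigma> then f \<rho> * g \<kappa> * h \<pi> else 0) else 0)"
      by (rule sum.cong[OF refl], rule trans[OF sum.swap], rule sum.cong[OF refl], rule sum.swap)
    also have "\<dots> = (\<Sum>\<rho>\<in>?P. \<Sum>\<kappa>\<in>?P. \<Sum>\<pi>\<in>?P. \<Sum>\<mu>\<in>?P.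
        if \<mu> = \<rho> \<circ> \<kappa> then (if \<mu> \<circ> \<pi> = \<sigma> then f \<rho> * g \<kappa> * h \<pi> else 0) else 0)"
      by (rule trans[OF sum.swap], rule sum.cong[OF refl], rule trans[OF sum.swap],
          rule sum.cong[OF refl], rule sum.swap)
    also have "\<dots> = ?R"
      by (intro sum.cong refl) (use comp_P in \<open>simp add: sum.delta\<close>)
    finally show ?thesis .
  qed
  have rassoc: "(\<Sum>\<rho>\<in>?P. \<Sum>\<mu>\<in>?P. if \<rho> \<circ> \<mu> = \<sigma> then
      f \<rho> * (\<Sum>\<kappa>\<in>?P. \<Sum>\<pi>\<in>?P. if \<kappa> \<circ> \<pi> = \<mu> then g \<kappa> * h \<pi> else 0) else 0)
    = (\<Sum>\<rho>\<in>?P. \<Sum>\<kappa>\<in>?P. \<Sum>\<pi>\<in>?P. if \<rho> \<circ> \<kappa> \<circ> \<pi> = \<sigma> then f \<rho> * g \<kappa> * h \<pi> else 0)" (is "?L = ?R")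
    for \<sigma> and f g h :: "(nat \<Rightarrow> nat) \<Rightarrow> complex"
  proof -
    have "?L = (\<Sum>\<rho>\<in>?P. \<Sum>\<mu>\<in>?P. \<Sum>\<kappa>\<in>?P. \<Sum>\<pi>\<in>?P.
        if \<mu> = \<kappa> \<circ> \<pi> then (if \<rho> \<circ> \<mu> = \<sigma> then f \<rho> * g \<kappa> * h \<pi> else 0) else 0)"
      by (intro sum.cong refl) (auto simp: sum_distrib_left mult.assoc intro!: sum.cong sum.neutral)
    also have "\<dots> = (\<Sum>\<rho>\<in>?P. \<Sum>\<kappa>\<in>?P. \<Sum>\<pi>\<in>?P. \<Sum>\<mu>\<in>?P.
        if \<mu> = \<kappa> \<circ> \<pi> then (if \<rho> \<circ> \<mu> = \<sigma> then f \<rho> * g \<kappa> * h \<pi> else 0) else 0)"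
      by (rule sum.cong[OF refl], rule trans[OF sum.swap], rule sum.cong[OF refl], rule sum.swap)
    also have "\<dots> = ?R"
      by (intro sum.cong refl) (use comp_P in \<open>simp add: sum.delta o_assoc\<close>)
    finally show ?thesis .
  qed
  have lunit: "(\<Sum>\<rho>\<in>?P. \<Sum>\<pi>\<in>?P. if \<rho> \<circ> \<pi> = \<sigma> then (if \<rho> = id then 1 else 0) * f \<pi> else 0) = f \<sigma>"
    if "\<forall>\<sigma>. \<not> \<sigma> permutes {1..n} \<longrightarrow> f \<sigma> = 0" for \<sigma> and f :: "(nat \<Rightarrow> nat) \<Rightarrow> complex"
  proof -
    have "(\<Sum>\<rho>\<in>?P. \<Sum>\<pi>\<in>?P. if \<rho> \<circ> \<pi> = \<sigma> then (if \<rho> = id then 1 else 0) * f \<pi> else 0)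
      = (\<Sum>\<rho>\<in>?P. if \<rho> = id then (\<Sum>\<pi>\<in>?P. if \<pi> = \<sigma> then f \<pi> else 0) else 0)"
      by (intro sum.cong refl) (auto intro!: sum.cong sum.neutral)
    also have "\<dots> = f \<sigma>" using that id_P by (auto simp: sum.delta)
    finally show ?thesis .
  qed
  have runit: "(\<Sum>\<rho>\<in>?P. \<Sum>\<pi>\<in>?P. if \<rho> \<circ> \<pi> = \<sigma> then f \<rho> * (if \<pi> = id then 1 else 0) else 0) = f \<sigma>"
    if "\<forall>\<sigma>. \<not> \<sigma> permutes {1..n} \<longrightarrow> f \<sigma> = 0" for \<sigma> and f :: "(nat \<Rightarrow> nat) \<Rightarrow> complex"
  proof -
    have "(\<Sum>\<rho>\<in>?P. \<Sum>\<pi>\<in>?P. if \<rho> \<circ> \<pi> = \<sigma> then f \<rho> * (if \<pi> = id then 1 else 0) else 0)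
      = (\<Sum>\<rho>\<in>?P. \<Sum>\<pi>\<in>?P. if \<pi> = id then (if \<rho> = \<sigma> then f \<rho> else 0) else 0)"
      by (intro sum.cong refl) auto
    also have "\<dots> = f \<sigma>" using that id_P by (auto simp: sum.delta)
    finally show ?thesis .
  qed
  show ?thesis
  proof (rule ringI)
    show "abelian_group (group_alg n)"
    proof (rule abelian_groupI)
      fix f assume "f \<in> carrier (group_alg n)"
      then show "\<exists>g\<in>carrier (group_alg n). g \<oplus>\<^bsub>group_alg n\<^esub> f = \<zero>\<^bsub>group_alg n\<^esub>"
        by (intro bexI[of _ "\<lambda>\<sigma>. - f \<sigma>"]) (auto simp: group_alg_def)
    qed (auto simp: group_alg_def fun_eq_iff algebra_simps)
    show "Group.monoid (group_alg n)"
      by (rule Group.monoidI)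
        (simp_all add: group_alg_def closed lassoc rassoc lunit runit id_P[simplified] permutes_id
          del: One_nat_def)
  qed (auto simp: group_alg_def fun_eq_iff distrib_left distrib_right sum.distrib[symmetric]
        intro!: sum.cong)
qed

lemma carrier_group_alg:
  "carrier (group_alg n) = {f. \<forall>\<sigma>. \<not> \<sigma> permutes {1..n} \<longrightarrow> f \<sigma> = 0}"
  by (simp add: group_alg_def)

lemma tau_closed: "1 \<le> i \<Longrightarrow> Suc i \<le> n \<Longrightarrow> tau i \<in> carrier (group_alg n)"
  by (auto simp: carrier_group_alg tau_def permutes_swap_id)

lemma tl_rel_closed: "1 \<le> i \<Longrightarrow> i + 2 \<le> n \<Longrightarrow> tl_rel n i \<in> carrier (group_alg n)"
proof -
  assume i: "1 \<le> i" "i + 2 \<le> n"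
  interpret ring "group_alg n" by (rule ring_group_alg)
  show ?thesis using i by (simp add: tl_rel_def Let_def tau_closed)
qed

lemma ideal_tl_ideal: "ideal (tl_ideal n) (group_alg n)"
  unfolding tl_ideal_def by (rule ring.genideal_ideal[OF ring_group_alg]) (auto intro: tl_rel_closed)

lemma ring_same_ops:
  assumes "ring R" "carrier T = carrier R" "mult T = mult R" "one T = one R" "zero T = zero R" "add T = add R"
  shows "ring T"
proof -
  interpret R: ring R by fact
  show ?thesis
  proof (rule ringI)
    show "abelian_group T"
    proof (rule abelian_groupI)
      fix x assume "x \<in> carrier T"
      then show "\<exists>y\<in>carrier T. y \<oplus>\<^bsub>T\<^esub> x = \<zero>\<^bsub>T\<^esub>"
        using assms R.l_neg R.a_inv_closed by auto
    qed (use assms R.a_assoc R.a_comm in auto)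
    show "Group.monoid T"
      by (rule Group.monoidI) (use assms R.m_assoc in auto)
  qed (use assms R.l_distr R.r_distr in auto)
qed

lemma TL_simps:
  "carrier (TL n) = carrier (group_alg n Quot tl_ideal n)"
  "mult (TL n) = mult (group_alg n Quot tl_ideal n)"
  "one (TL n) = one (group_alg n Quot tl_ideal n)"
  "zero (TL n) = zero (group_alg n Quot tl_ideal n)"
  "add (TL n) = add (group_alg n Quot tl_ideal n)"
  "smult (TL n) = (\<lambda>c A. \<Union>a\<in>A. tl_class n (c \<odot>\<^bsub>group_alg n\<^esub> a))"
  by (simp_all add: TL_def ring.defs module.defs)

lemma ring_TL: "ring (TL n)"
  by (rule ring_same_ops[OF ideal.quotient_is_ring[OF ideal_tl_ideal[of n]]]) (rule TL_simps)+

lemma carrier_TL: "carrier (TL n) = tl_class n ` carrier (group_alg n)"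
  by (auto simp: TL_simps FactRing_simps tl_class_def)

lemma tl_class_mult:
  assumes "a \<in> carrier (group_alg n)" "b \<in> carrier (group_alg n)"
  shows "tl_class n a \<otimes>\<^bsub>TL n\<^esub> tl_class n b = tl_class n (a \<otimes>\<^bsub>group_alg n\<^esub> b)"
  using ideal.rcoset_mult_add[OF ideal_tl_ideal assms]
  by (simp add: TL_simps FactRing_def tl_class_def)

lemma ring_corner:
  assumes "ring R" "p \<in> carrier R" "p \<otimes>\<^bsub>R\<^esub> p = p"
  shows "ring (corner R p)"
proof -
  interpret ring R by fact
  note p = assms(2,3)
  have pp: "p \<otimes>\<^bsub>R\<^esub> (p \<otimes>\<^bsub>R\<^esub> a) = p \<otimes>\<^bsub>R\<^esub> a" if "a \<in> carrier R" for a
    using p that by (simp add: m_assoc[symmetric])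
  show ?thesis
  proof (rule ringI)
    show "abelian_group (corner R p)"
    proof (rule abelian_groupI; clarsimp simp: corner_def p)
      fix a b assume ab: "a \<in> carrier R" "b \<in> carrier R"
      then have "p \<otimes>\<^bsub>R\<^esub> a \<otimes>\<^bsub>R\<^esub> p \<oplus>\<^bsub>R\<^esub> p \<otimes>\<^bsub>R\<^esub> b \<otimes>\<^bsub>R\<^esub> p = p \<otimes>\<^bsub>R\<^esub> (a \<oplus>\<^bsub>R\<^esub> b) \<otimes>\<^bsub>R\<^esub> p"
        using p by (simp add: l_distr r_distr)
      then show "p \<otimes>\<^bsub>R\<^esub> a \<otimes>\<^bsub>R\<^esub> p \<oplus>\<^bsub>R\<^esub> p \<otimes>\<^bsub>R\<^esub> b \<otimes>\<^bsub>R\<^esub> p \<in> (\<lambda>a. p \<otimes>\<^bsub>R\<^esub> a \<otimes>\<^bsub>R\<^esub> p) ` carrier R"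
        using ab by blast
    next
      show "\<zero>\<^bsub>R\<^esub> \<in> (\<lambda>a. p \<otimes>\<^bsub>R\<^esub> a \<otimes>\<^bsub>R\<^esub> p) ` carrier R"
        using p by (intro image_eqI[of _ _ "\<zero>\<^bsub>R\<^esub>"]) auto
    next
      fix a assume a: "a \<in> carrier R"
      show "\<exists>x\<in>carrier R. p \<otimes>\<^bsub>R\<^esub> x \<otimes>\<^bsub>R\<^esub> p \<oplus>\<^bsub>R\<^esub> p \<otimes>\<^bsub>R\<^esub> a \<otimes>\<^bsub>R\<^esub> p = \<zero>\<^bsub>R\<^esub>"
        using a p by (intro bexI[of _ "\<ominus>\<^bsub>R\<^esub> a"]) (auto simp: l_minus r_minus l_neg)
    qed (use p in \<open>auto simp: a_assoc intro: a_comm\<close>)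
    show "Group.monoid (corner R p)"
    proof (rule Group.monoidI; clarsimp simp: corner_def p)
      fix a b assume ab: "a \<in> carrier R" "b \<in> carrier R"
      then have "p \<otimes>\<^bsub>R\<^esub> a \<otimes>\<^bsub>R\<^esub> p \<otimes>\<^bsub>R\<^esub> (p \<otimes>\<^bsub>R\<^esub> b \<otimes>\<^bsub>R\<^esub> p) = p \<otimes>\<^bsub>R\<^esub> (a \<otimes>\<^bsub>R\<^esub> p \<otimes>\<^bsub>R\<^esub> b) \<otimes>\<^bsub>R\<^esub> p"
        using p by (simp add: m_assoc pp)
      then show "p \<otimes>\<^bsub>R\<^esub> a \<otimes>\<^bsub>R\<^esub> p \<otimes>\<^bsub>R\<^esub> (p \<otimes>\<^bsub>R\<^esub> b \<otimes>\<^bsub>R\<^esub> p) \<in> (\<lambda>a. p \<otimes>\<^bsub>R\<^esub> a \<otimes>\<^bsub>R\<^esub> p) ` carrier R"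
        using ab p by (intro image_eqI[of _ _ "a \<otimes>\<^bsub>R\<^esub> p \<otimes>\<^bsub>R\<^esub> b"]) auto
    next
      show "p \<in> (\<lambda>a. p \<otimes>\<^bsub>R\<^esub> a \<otimes>\<^bsub>R\<^esub> p) ` carrier R"
        using p by (intro image_eqI[of _ _ p]) auto
    qed (use p in \<open>auto simp: m_assoc pp\<close>)
  qed (use p in \<open>auto simp: corner_def l_distr r_distr\<close>)
qed

lemma group_alg_mult_apply:
  assumes "\<sigma> permutes {1..n}"
  shows "(f \<otimes>\<^bsub>group_alg n\<^esub> g) \<sigma> = (\<Sum>\<rho> | \<rho> permutes {1..n}. f \<rho> * g (inv_into UNIV \<rho> \<circ> \<sigma>))"
proof -
  have "(\<Sum>\<pi> | \<pi> permutes {1..n}. if \<rho> \<circ> \<pi> = \<sigma> then f \<rho> * g \<pi> else 0)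
     = f \<rho> * g (inv_into UNIV \<rho> \<circ> \<sigma>)" if \<rho>: "\<rho> permutes {1..n}" for \<rho>
  proof -
    have "(\<rho> \<circ> \<pi> = \<sigma>) = (\<pi> = inv_into UNIV \<rho> \<circ> \<sigma>)" for \<pi>
      using permutes_inv_o[OF \<rho>] by (metis comp_assoc id_comp)
    then show ?thesis
      using permutes_compose[OF assms permutes_inv[OF \<rho>]] by (simp add: sum.delta)
  qed
  then show ?thesis
    by (simp add: group_alg_def)
qed

lemma group_alg_mult_commute:
  assumes "\<And>\<rho> \<pi>. \<rho> permutes {1..n} \<Longrightarrow> \<pi> permutes {1..n} \<Longrightarrow> f \<rho> \<noteq> 0 \<Longrightarrow> g \<pi> \<noteq> 0 \<Longrightarrow> \<rho> \<circ> \<pi> = \<pi> \<circ> \<rho>"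
  shows "f \<otimes>\<^bsub>group_alg n\<^esub> g = g \<otimes>\<^bsub>group_alg n\<^esub> f"
proof
  fix \<sigma>
  have "(\<Sum>\<rho> | \<rho> permutes {1..n}. \<Sum>\<pi> | \<pi> permutes {1..n}. if \<rho> \<circ> \<pi> = \<sigma> then f \<rho> * g \<pi> else 0)
     = (\<Sum>\<pi> | \<pi> permutes {1..n}. \<Sum>\<rho> | \<rho> permutes {1..n}. if \<rho> \<circ> \<pi> = \<sigma> then f \<rho> * g \<pi> else 0)"
    by (rule sum.swap)
  also have "\<dots> = (\<Sum>\<pi> | \<pi> permutes {1..n}. \<Sum>\<rho> | \<rho> permutes {1..n}. if \<pi> \<circ> \<rho> = \<sigma> then g \<pi> * f \<rho> else 0)"
    by (intro sum.cong refl) (use assms in force)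
  finally show "(f \<otimes>\<^bsub>group_alg n\<^esub> g) \<sigma> = (g \<otimes>\<^bsub>group_alg n\<^esub> f) \<sigma>"
    by (simp add: group_alg_def)
qed

lemma group_alg_smult:
  "c \<odot>\<^bsub>group_alg n\<^esub> f \<otimes>\<^bsub>group_alg n\<^esub> g = c \<odot>\<^bsub>group_alg n\<^esub> (f \<otimes>\<^bsub>group_alg n\<^esub> g)"
  "f \<otimes>\<^bsub>group_alg n\<^esub> (c \<odot>\<^bsub>group_alg n\<^esub> g) = c \<odot>\<^bsub>group_alg n\<^esub> (f \<otimes>\<^bsub>group_alg n\<^esub> g)"
  "c \<odot>\<^bsub>group_alg n\<^esub> (d \<odot>\<^bsub>group_alg n\<^esub> f) = (c * d) \<odot>\<^bsub>group_alg n\<^esub> f"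
  "f \<in> carrier (group_alg n) \<Longrightarrow> c \<odot>\<^bsub>group_alg n\<^esub> f \<in> carrier (group_alg n)"
  by (auto simp: group_alg_def fun_eq_iff sum_distrib_left mult_ac intro!: sum.cong)

context
  fixes N :: nat and s :: "nat list"
  assumes val: "valences N s"
begin

lemma qsum_mono: "i \<le> j \<Longrightarrow> qsum s i \<le> qsum s j"
  unfolding qsum_def using sum_list_append[of "take i s" "drop i (take j s)"]
  by (metis append_take_drop_id le_add1 min.absorb1 take_take)

lemma block_subset: "{qsum s (k - 1)<..qsum s k} \<subseteq> {1..2*N}"
proof -
  have "qsum s k \<le> sum_list s"
    unfolding qsum_def by (metis append_take_drop_id le_add1 sum_list_append)
  then show ?thesis using val by (auto simp: valences_def)
qed

lemma block_disjoint: "1 \<le> k \<Longrightarrow> 1 \<le> l \<Longrightarrow> k \<noteq> l \<Longrightarrow> {qsum s (k - 1)<..qsum s k} \<inter> {qsum s (l - 1)<..qsum s l} = {}"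
proof (induction k l rule: linorder_wlog)
  case (le k l)
  then show ?case using qsum_mono[of k "l - 1"] by fastforce
qed (simp add: Int_commute)

lemma block_antisym_closed: "block_antisym s k \<in> carrier (group_alg (2*N))"
  using permutes_subset[OF _ block_subset] by (auto simp: carrier_group_alg block_antisym_def)

lemma block_antisym_commute:
  assumes "1 \<le> k" "1 \<le> l"
  shows "block_antisym s k \<otimes>\<^bsub>group_alg (2*N)\<^esub> block_antisym s l
    = block_antisym s l \<otimes>\<^bsub>group_alg (2*N)\<^esub> block_antisym s k"
proof (cases "k = l")
  case False
  show ?thesis
  proof (rule group_alg_mult_commute)
    fix \<rho> \<pi> assume "block_antisym s k \<rho> \<noteq> 0" "block_antisym s l \<pi> \<noteq> 0"
    then have p: "\<rho> permutes {qsum s (k - 1)<..qsum s k}" "\<pi> permutes {qsum s (l - 1)<..qsum s l}"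
      by (auto simp: block_antisym_def split: if_splits)
    show "\<rho> \<circ> \<pi> = \<pi> \<circ> \<rho>"
    proof
      fix x
      have "x \<notin> {qsum s (k - 1)<..qsum s k} \<or> x \<notin> {qsum s (l - 1)<..qsum s l}"
        using block_disjoint[OF assms False] by blast
      moreover have "\<rho> x \<in> {qsum s (k - 1)<..qsum s k} \<longleftrightarrow> x \<in> {qsum s (k - 1)<..qsum s k}"
        "\<pi> x \<in> {qsum s (l - 1)<..qsum s l} \<longleftrightarrow> x \<in> {qsum s (l - 1)<..qsum s l}"
        using permutes_in_image[OF p(1)] permutes_in_image[OF p(2)] by blast+
      ultimately show "(\<rho> \<circ> \<pi>) x = (\<pi> \<circ> \<rho>) x"
        using block_disjoint[OF assms False] permutes_not_in[OF p(1)] permutes_not_in[OF p(2)]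
        by (metis comp_apply disjoint_iff)
    qed
  qed
qed simp

lemma block_antisym_square:
  assumes "1 \<le> k" "k \<le> length s"
  shows "block_antisym s k \<otimes>\<^bsub>group_alg (2*N)\<^esub> block_antisym s k
    = fact (s ! (k - 1)) \<odot>\<^bsub>group_alg (2*N)\<^esub> block_antisym s k"
proof
  fix \<sigma>
  let ?A = "{qsum s (k - 1)<..qsum s k}"
  let ?B = "block_antisym s k"
  have fin: "finite {\<rho>. \<rho> permutes ?A}" by (rule finite_permutations) simp
  have "qsum s k = qsum s (k - 1) + s ! (k - 1)"
    using assms take_Suc_conv_app_nth[of "k - 1" s] by (simp add: qsum_def)
  then have card: "card {\<rho>. \<rho> permutes ?A} = fact (s ! (k - 1))"
    by (subst card_permutations[of ?A "s ! (k - 1)"]) auto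
  interpret ring "group_alg (2*N)" by (rule ring_group_alg)
  show "(?B \<otimes>\<^bsub>group_alg (2*N)\<^esub> ?B) \<sigma> = (fact (s ! (k - 1)) \<odot>\<^bsub>group_alg (2*N)\<^esub> ?B) \<sigma>"
  proof (cases "\<sigma> permutes {1..2*N}")
    case False
    have "?B \<otimes>\<^bsub>group_alg (2*N)\<^esub> ?B \<in> carrier (group_alg (2*N))"
      "fact (s ! (k - 1)) \<odot>\<^bsub>group_alg (2*N)\<^esub> ?B \<in> carrier (group_alg (2*N))"
      by (auto intro: block_antisym_closed group_alg_smult)
    then show ?thesis using False unfolding carrier_group_alg by auto
  next
    case True
    have "(?B \<otimes>\<^bsub>group_alg (2*N)\<^esub> ?B) \<sigma>
      = (\<Sum>\<rho> | \<rho> permutes {1..2*N}. ?B \<rho> * ?B (inv_into UNIV \<rho> \<circ> \<sigma>))"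
      by (rule group_alg_mult_apply[OF True])
    also have "\<dots> = (\<Sum>\<rho> | \<rho> permutes ?A. ?B \<rho> * ?B (inv_into UNIV \<rho> \<circ> \<sigma>))"
      by (rule sum.mono_neutral_right)
        (use permutes_subset[OF _ block_subset[of k]] in \<open>auto simp: block_antisym_def\<close>)
    also have "\<dots> = (\<Sum>\<rho> | \<rho> permutes ?A. ?B \<sigma>)"
    proof (rule sum.cong[OF refl])
      fix \<rho> assume "\<rho> \<in> {\<rho>. \<rho> permutes ?A}"
      then have \<rho>: "\<rho> permutes ?A" by simp
      have iff: "inv_into UNIV \<rho> \<circ> \<sigma> permutes ?A \<longleftrightarrow> \<sigma> permutes ?A"
      proof
        assume "inv_into UNIV \<rho> \<circ> \<sigma> permutes ?A"
        from permutes_compose[OF this \<rho>] show "\<sigma> permutes ?A"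
          using permutes_inv_o(1)[OF \<rho>] by (simp add: o_assoc)
      qed (rule permutes_compose[OF _ permutes_inv[OF \<rho>]])
      have perm: "\<And>\<pi>. \<pi> permutes ?A \<Longrightarrow> permutation \<pi>"
        using permutation_permutes by blast
      have sq: "sign \<rho> * sign \<rho> = 1" by (simp add: sign_def)
      show "?B \<rho> * ?B (inv_into UNIV \<rho> \<circ> \<sigma>) = ?B \<sigma>"
      proof (cases "\<sigma> permutes ?A")
        case True
        have "sign (inv_into UNIV \<rho> \<circ> \<sigma>) = sign \<rho> * sign \<sigma>"
          using perm[OF \<rho>] perm[OF True] perm[OF permutes_inv[OF \<rho>]]
          by (simp add: sign_compose sign_inverse)
        then have "sign \<rho> * sign (inv_into UNIV \<rho> \<circ> \<sigma>) = sign \<sigma>"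
          using sq by (simp add: mult.assoc[symmetric])
        then show ?thesis using True iff \<rho> by (simp add: block_antisym_def flip: of_int_mult)
      qed (use iff in \<open>simp add: block_antisym_def\<close>)
    qed
    also have "\<dots> = (fact (s ! (k - 1)) \<odot>\<^bsub>group_alg (2*N)\<^esub> ?B) \<sigma>"
      using card by (simp add: group_alg_def)
    finally show ?thesis .
  qed
qed

lemma antisym_foldr:
  assumes "\<forall>k\<in>set ks. 1 \<le> k \<and> k \<le> length s"
  shows "foldr (\<lambda>k a. block_antisym s k \<otimes>\<^bsub>group_alg (2*N)\<^esub> a) ks \<one>\<^bsub>group_alg (2*N)\<^esub> \<in> carrier (group_alg (2*N))
    \<and> (\<forall>l\<ge>1. block_antisym s l \<otimes>\<^bsub>group_alg (2*N)\<^esub>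
          foldr (\<lambda>k a. block_antisym s k \<otimes>\<^bsub>group_alg (2*N)\<^esub> a) ks \<one>\<^bsub>group_alg (2*N)\<^esub>
        = foldr (\<lambda>k a. block_antisym s k \<otimes>\<^bsub>group_alg (2*N)\<^esub> a) ks \<one>\<^bsub>group_alg (2*N)\<^esub>
          \<otimes>\<^bsub>group_alg (2*N)\<^esub> block_antisym s l)
    \<and> foldr (\<lambda>k a. block_antisym s k \<otimes>\<^bsub>group_alg (2*N)\<^esub> a) ks \<one>\<^bsub>group_alg (2*N)\<^esub> \<otimes>\<^bsub>group_alg (2*N)\<^esub>
        foldr (\<lambda>k a. block_antisym s k \<otimes>\<^bsub>group_alg (2*N)\<^esub> a) ks \<one>\<^bsub>group_alg (2*N)\<^esub>
      = (\<Prod>k\<leftarrow>ks. fact (s ! (k - 1))) \<odot>\<^bsub>group_alg (2*N)\<^esub>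
        foldr (\<lambda>k a. block_antisym s k \<otimes>\<^bsub>group_alg (2*N)\<^esub> a) ks \<one>\<^bsub>group_alg (2*N)\<^esub>"
  using assms
proof (induction ks)
  interpret ring "group_alg (2*N)" by (rule ring_group_alg)
  note [simp] = block_antisym_closed
  {
    case Nil
    show ?case by simp (simp add: group_alg_def)
  next
    case (Cons k ks)
    define B where "B = block_antisym s k"
    define X where "X = foldr (\<lambda>k a. block_antisym s k \<otimes>\<^bsub>group_alg (2*N)\<^esub> a) ks \<one>\<^bsub>group_alg (2*N)\<^esub>"
    define c :: complex where "c = (\<Prod>k\<leftarrow>ks. fact (s ! (k - 1)))"
    let ?G = "group_alg (2*N)"
    have k: "1 \<le> k" "k \<le> length s" using Cons.prems by auto
    have B: "B \<in> carrier ?G" by (simp add: B_def)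
    have IH: "X \<in> carrier ?G" "\<And>l. 1 \<le> l \<Longrightarrow> block_antisym s l \<otimes>\<^bsub>?G\<^esub> X = X \<otimes>\<^bsub>?G\<^esub> block_antisym s l"
      "X \<otimes>\<^bsub>?G\<^esub> X = c \<odot>\<^bsub>?G\<^esub> X"
      using Cons unfolding X_def c_def by auto
    have BX: "B \<otimes>\<^bsub>?G\<^esub> X = X \<otimes>\<^bsub>?G\<^esub> B" using IH(2)[OF k(1)] by (simp add: B_def)
    have BB: "B \<otimes>\<^bsub>?G\<^esub> B = fact (s ! (k - 1)) \<odot>\<^bsub>?G\<^esub> B" using block_antisym_square[OF k] by (simp add: B_def)
    have comm: "block_antisym s l \<otimes>\<^bsub>?G\<^esub> (B \<otimes>\<^bsub>?G\<^esub> X) = B \<otimes>\<^bsub>?G\<^esub> X \<otimes>\<^bsub>?G\<^esub> block_antisym s l" if "1 \<le> l" for l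
    proof -
      have "block_antisym s l \<otimes>\<^bsub>?G\<^esub> (B \<otimes>\<^bsub>?G\<^esub> X) = B \<otimes>\<^bsub>?G\<^esub> block_antisym s l \<otimes>\<^bsub>?G\<^esub> X"
        using block_antisym_commute[OF that k(1)] B IH(1) by (simp add: B_def flip: m_assoc)
      also have "\<dots> = B \<otimes>\<^bsub>?G\<^esub> X \<otimes>\<^bsub>?G\<^esub> block_antisym s l"
        using IH(2)[OF that] B IH(1) by (simp add: m_assoc)
      finally show ?thesis .
    qed
    have "B \<otimes>\<^bsub>?G\<^esub> X \<otimes>\<^bsub>?G\<^esub> (B \<otimes>\<^bsub>?G\<^esub> X) = B \<otimes>\<^bsub>?G\<^esub> (X \<otimes>\<^bsub>?G\<^esub> B) \<otimes>\<^bsub>?G\<^esub> X"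
      using B IH(1) by (simp add: m_assoc)
    also have "\<dots> = (B \<otimes>\<^bsub>?G\<^esub> B) \<otimes>\<^bsub>?G\<^esub> (X \<otimes>\<^bsub>?G\<^esub> X)"
      using B IH(1) BX[symmetric] by (simp add: m_assoc)
    also have "\<dots> = (fact (s ! (k - 1)) * c) \<odot>\<^bsub>?G\<^esub> (B \<otimes>\<^bsub>?G\<^esub> X)"
      by (simp only: BB IH(3) group_alg_smult mult.commute[of c])
    finally have XX: "B \<otimes>\<^bsub>?G\<^esub> X \<otimes>\<^bsub>?G\<^esub> (B \<otimes>\<^bsub>?G\<^esub> X) = (fact (s ! (k - 1)) * c) \<odot>\<^bsub>?G\<^esub> (B \<otimes>\<^bsub>?G\<^esub> X)" .
    have fold: "foldr (\<lambda>k a. block_antisym s k \<otimes>\<^bsub>?G\<^esub> a) (k # ks) \<one>\<^bsub>?G\<^esub> = B \<otimes>\<^bsub>?G\<^esub> X"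
      by (simp add: B_def X_def)
    have prod: "(\<Prod>k\<leftarrow>k # ks. fact (s ! (k - 1))) = fact (s ! (k - 1)) * c"
      by (simp add: c_def)
    show ?case
      unfolding fold prod using B IH(1) comm XX by blast
  }
qed

lemma block_antisymmetrizer_idem:
  "block_antisymmetrizer N s \<in> carrier (group_alg (2*N))"
  "block_antisymmetrizer N s \<otimes>\<^bsub>group_alg (2*N)\<^esub> block_antisymmetrizer N s = block_antisymmetrizer N s"
proof -
  let ?G = "group_alg (2*N)"
  define X where "X = foldr (\<lambda>k a. block_antisym s k \<otimes>\<^bsub>?G\<^esub> a) [1..<Suc (length s)] \<one>\<^bsub>?G\<^esub>"
  define c :: complex where "c = (\<Prod>v\<leftarrow>s. fact v)"
  have "map (\<lambda>k. fact (s ! (k - 1)) :: complex) [1..<Suc (length s)] = map fact s"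
    by (rule nth_equalityI) (auto simp del: upt_Suc)
  then have c: "(\<Prod>k\<leftarrow>[1..<Suc (length s)]. fact (s ! (k - 1))) = c"
    by (simp add: c_def del: upt_Suc)
  have X: "X \<in> carrier ?G" "X \<otimes>\<^bsub>?G\<^esub> X = c \<odot>\<^bsub>?G\<^esub> X"
    using antisym_foldr[of "[1..<Suc (length s)]"] unfolding X_def[symmetric] c
    by (simp_all only: set_upt) auto
  have a: "block_antisymmetrizer N s = (1 / c) \<odot>\<^bsub>?G\<^esub> X"
    by (simp add: block_antisymmetrizer_def Let_def X_def c_def del: upt_Suc)
  have "c \<noteq> 0" by (auto simp: c_def prod_list_zero_iff)
  then have "1 / c * (1 / c * c) = 1 / c" by simp
  then show "block_antisymmetrizer N s \<otimes>\<^bsub>?G\<^esub> block_antisymmetrizer N s = block_antisymmetrizer N s"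
    unfolding a by (simp only: group_alg_smult X mult.assoc)
  show "block_antisymmetrizer N s \<in> carrier ?G" unfolding a by (intro group_alg_smult X)
qed

lemma p_idem_closed: "p_idem N s \<in> carrier (TL (2*N))"
  by (simp add: p_idem_def carrier_TL block_antisymmetrizer_idem)

lemma p_idem_idem: "p_idem N s \<otimes>\<^bsub>TL (2*N)\<^esub> p_idem N s = p_idem N s"
  by (simp add: p_idem_def tl_class_mult block_antisymmetrizer_idem)

lemma ring_TLv: "ring (TLv N s)"
  unfolding TLv_def by (intro ring_corner ring_TL p_idem_closed p_idem_idem)

end


section \<open>Modules\<close>

definition alg_module ::
  "(complex, 'r) module \<Rightarrow> ('x \<Rightarrow> complex) set \<Rightarrow> ('r \<Rightarrow> ('x \<Rightarrow> complex) \<Rightarrow> 'x \<Rightarrow> complex) \<Rightarrow> bool" where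
  "alg_module A V act \<longleftrightarrow>
     ring A \<and> cfun.subspace V \<and>
     (\<forall>a\<in>carrier A. \<forall>v\<in>V. act a v \<in> V) \<and>
     (\<forall>v\<in>V. act \<one>\<^bsub>A\<^esub> v = v) \<and>
     (\<forall>a\<in>carrier A. \<forall>b\<in>carrier A. \<forall>v\<in>V. act (a \<otimes>\<^bsub>A\<^esub> b) v = act a (act b v)) \<and>
     (\<forall>a\<in>carrier A. \<forall>b\<in>carrier A. \<forall>v\<in>V. act (a \<oplus>\<^bsub>A\<^esub> b) v = act a v + act b v) \<and>
     (\<forall>c. \<forall>a\<in>carrier A. \<forall>v\<in>V. act (c \<odot>\<^bsub>A\<^esub> a) v = cscale c (act a v)) \<and>
     (\<forall>a\<in>carrier A. \<forall>v\<in>V. \<forall>w\<in>V. act a (v + w) = act a v + act a w) \<and>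
     (\<forall>c. \<forall>a\<in>carrier A. \<forall>v\<in>V. act a (cscale c v) = cscale c (act a v))"

definition simple_alg_module ::
  "(complex, 'r) module \<Rightarrow> ('x \<Rightarrow> complex) set \<Rightarrow> ('r \<Rightarrow> ('x \<Rightarrow> complex) \<Rightarrow> 'x \<Rightarrow> complex) \<Rightarrow> bool" where
  "simple_alg_module A V act \<longleftrightarrow>
     alg_module A V act \<and> V \<noteq> {0} \<and>
     (\<forall>W. W \<subseteq> V \<and> alg_module A W act \<longrightarrow> W = {0} \<or> W = V)"


section \<open>Actions and evaluation\<close>

definition ga_act :: "nat \<Rightarrow> ((nat \<Rightarrow> nat) \<Rightarrow> complex) \<Rightarrow> cfn \<Rightarrow> cfn" where
  "ga_act n a F = (\<lambda>x. \<Sum>\<sigma> | \<sigma> permutes {1..n}. a \<sigma> * F (x \<circ> \<sigma>))"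

text \<open>The common value of the action of all representatives of the coset \<open>A\<close>.\<close>

definition tl_act :: "nat \<Rightarrow> ((nat \<Rightarrow> nat) \<Rightarrow> complex) set \<Rightarrow> cfn \<Rightarrow> cfn" where
  "tl_act n A F = (THE G. \<forall>a\<in>A. ga_act n a F = G)"

definition block_quot :: "nat list \<Rightarrow> cfn \<Rightarrow> cfn" where
  "block_quot s F = (\<lambda>x. F x / of_real (\<Prod>k=1..length s.
     \<Prod>(i, j)\<in>{(i, j). qsum s (k - 1) < i \<and> i < j \<and> j \<le> qsum s k}. x j - x i))"

definition fused_filter :: "nat \<Rightarrow> nat list \<Rightarrow> (nat \<Rightarrow> real) \<Rightarrow> (nat \<Rightarrow> real) filter" where
  "fused_filter N s \<xi> = at (\<lambda>a. \<xi> (block s a)) within config (2*N)"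

definition extends_to_fused :: "nat \<Rightarrow> nat list \<Rightarrow> cfn \<Rightarrow> bool" where
  "extends_to_fused N s f \<longleftrightarrow> (\<forall>\<xi>\<in>config (length s). \<exists>l. (f \<longlongrightarrow> l) (fused_filter N s \<xi>))"

definition fused_eval :: "nat \<Rightarrow> nat list \<Rightarrow> cfn \<Rightarrow> cfn" where
  "fused_eval N s f \<xi> =
     (if \<xi> \<in> config (length s) then Lim (fused_filter N s \<xi>) f else 0)"

end

theory Submission
  imports Defs
begin

text \<open>Write a determinant \<open>det (K(a\<^sub>k, b\<^sub>l))\<close> as a signed sum over the pairings (perfect matchings) of the \<open>2N\<close> points that
  link the \<open>a\<close>'s to the \<open>b\<close>'s. A linear combination of such determinants becomes a sum \<open>\<Sum>\<^sub>m c(m) \<Prod>\<^bsub>{a,b}\<in>m\<^esub> K(a, b)\<close> whose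
  coefficient function \<open>c\<close> satisfies the three-term Pluecker relation for every pair of links, and the functions
  satisfying that relation are determined by their values on noncrossing pairings. Under this dictionary the
  counts of cover-inclusive Dyck tilings give a basis that is triangular for evaluation at link patterns, and its element
  indexed by \<open>\<alpha>\<close> vanishes on every pairing with a link \<open>{i, i + 1}\<close> that is not a link of \<open>\<alpha>\<close>. So the functions
  \<open>Z\<^sub>\<alpha>\<close>, \<open>\<alpha> \<in> LP\<^sub>\<varsigma>\<close>, span the fused images of the coefficient functions that vanish on pairings with a link inside a
  block.

  On these, Rolle's theorem identifies the limit of the Vandermonde quotient with the sum over pairings of the
  differentiated kernels, up to a constant. That fusing is injective follows from the second order null vector
  (BPZ) equation, which recovers the unfused function one variable at a time. Hence \<open>S\<^sub>\<varsigma>\<close> is the image of the block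
  antisymmetriser on the space of coefficient functions. That space is simple: antisymmetrising a nonzero
  element over a suitable set of \<open>N\<close> points yields a multiple of one determinant, whose permutations span. A corner
  \<open>pAp\<close> of an algebra acts simply on \<open>pV\<close> whenever \<open>A\<close> acts simply on \<open>V\<close>, unless \<open>pV = 0\<close>.\<close>

section \<open>Pairings\<close>

text \<open>Well-definedness of the action asks that \<open>p.F\<close> be recoverable from its
  evaluation, and evaluation keeps only one Taylor coefficient at each merging point. Let a point
  approach the fusion of the h points that precede it in its block. The null vector equation gives
  its leading exponent r the indicial equation r (r + 1) = h (h + 1). Antisymmetry excludes
  exponents below h, and there is no root above h. So if the retained coefficient, that of order h,
  vanishes, then all Taylor coefficients vanish, and a function rational in the variable is zero.

  The tiling counts enter only through two facts: \<open>\<alpha>/\<alpha>\<close> has one tiling,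
  and the count does not change when a peak of the upper path is flipped to a valley at a place
  where the lower path has no peak. The flip pairs off the terms of \<open>\<Z>\<close>-type sums
  with opposite signs on every pairing that links these two neighbours.

  The bound max s_j \<le> N is what makes the space nonzero.\<close>

abbreviation swp :: "nat \<Rightarrow> nat \<Rightarrow> nat \<Rightarrow> nat" where
  "swp \<equiv> Transposition.transpose"

definition pairings :: "nat \<Rightarrow> nat set set set" where
  "pairings N = {m. partition_on {1..2*N} m \<and> (\<forall>l\<in>m. card l = 2)}"

definition pact :: "(nat \<Rightarrow> nat) \<Rightarrow> nat set set \<Rightarrow> nat set set" where
  "pact \<sigma> m = (`) \<sigma> ` m"

lemma LP_subset_pairings: "LP N \<subseteq> pairings N"
  by (auto simp: LP_def pairings_def)

lemma finite_pairings [simp]: "finite (pairings N)"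
  by (rule finite_subset[of _ "Pow (Pow {1..2*N})"]) (auto simp: pairings_def partition_on_def)

lemma finite_LP [simp]: "finite (LP N)"
  using LP_subset_pairings finite_pairings finite_subset by blast

lemma pairings_finite: "m \<in> pairings N \<Longrightarrow> finite m"
  by (auto simp: pairings_def intro: finite_elements)

lemma pairings_link:
  assumes "m \<in> pairings N" "l \<in> m"
  obtains a b where "l = {a, b}" "a < b" "a \<in> {1..2*N}" "b \<in> {1..2*N}"
proof -
  have "card l = 2" "l \<subseteq> {1..2*N}" using assms by (auto simp: pairings_def partition_on_def)
  then obtain x y where xy: "l = {x, y}" "x \<noteq> y" by (auto simp: card_2_iff)
  then have "x \<in> {1..2*N}" "y \<in> {1..2*N}" using \<open>l \<subseteq> _\<close> by auto
  with xy show ?thesis by (cases "x < y") (auto intro: that simp: insert_commute)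
qed

lemma pairings_linkD:
  assumes "m \<in> pairings N" "{a, b} \<in> m"
  shows "a \<noteq> b" "a \<in> {1..2*N}" "b \<in> {1..2*N}"
proof -
  have "card {a, b} = 2" "{a, b} \<subseteq> {1..2*N}" using assms by (auto simp: pairings_def partition_on_def)
  then show "a \<noteq> b" "a \<in> {1..2*N}" "b \<in> {1..2*N}" by auto
qed

lemma pairings_partner:
  assumes "m \<in> pairings N" "a \<in> {1..2*N}"
  obtains b where "{a, b} \<in> m" "a \<noteq> b"
proof -
  have "a \<in> \<Union>m" using assms by (simp add: pairings_def partition_on_def)
  then obtain l where l: "l \<in> m" "a \<in> l" by blast
  then obtain x y where "l = {x, y}" "x < y" using pairings_link[OF assms(1)] by metis
  with l show ?thesis by (cases "a = x") (auto intro: that that[of x] simp: insert_commute)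
qed

lemma pairings_unique_link:
  assumes "m \<in> pairings N" "l \<in> m" "l' \<in> m" "a \<in> l" "a \<in> l'"
  shows "l = l'"
  using assms unfolding pairings_def partition_on_def disjoint_def by auto

lemma pairings_unique:
  assumes "m \<in> pairings N" "{a, b} \<in> m" "{a, c} \<in> m"
  shows "b = c"
  using pairings_unique_link[OF assms, of a] pairings_linkD[OF assms(1,2)] by (auto simp: doubleton_eq_iff)

lemma card_pairings:
  assumes "m \<in> pairings N"
  shows "card m = N"
proof -
  have p: "partition_on {1..2*N} m" and c2: "\<And>l. l \<in> m \<Longrightarrow> card l = 2" using assms by (auto simp: pairings_def)
  have "\<Union>m = {1..2*N}" using p by (simp add: partition_on_def)
  then have "card (\<Union>m) = 2 * N" by simp
  moreover have "card (\<Union>m) = (\<Sum>l\<in>m. card l)"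
  proof (rule card_Union_disjoint)
    show "pairwise disjnt m" using p by (auto simp: partition_on_def disjoint_def pairwise_def disjnt_def)
    show "finite l" if "l \<in> m" for l using c2[OF that] by (simp add: card_ge_0_finite)
  qed
  ultimately show ?thesis using c2 by simp
qed

lemma pairings_subset_eq:
  assumes "m \<in> pairings N" "m' \<in> pairings N" "m \<subseteq> m'"
  shows "m = m'"
  using assms card_pairings card_subset_eq pairings_finite by metis

lemma pact_id [simp]: "pact id m = m"
  by (simp add: pact_def)

lemma pact_comp: "pact \<sigma> (pact \<rho> m) = pact (\<sigma> \<circ> \<rho>) m"
  by (simp add: pact_def image_comp comp_def)

lemma pact_pairings:
  assumes "\<sigma> permutes {1..2*N}" "m \<in> pairings N"
  shows "pact \<sigma> m \<in> pairings N"
proof -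
  have inj: "inj \<sigma>" using assms(1) by (rule permutes_inj)
  have "partition_on (\<sigma> ` {1..2*N}) (pact \<sigma> m - {{}})"
    unfolding pact_def
    by (rule partition_on_inj_image) (use assms(2) inj in \<open>auto simp: pairings_def intro: inj_on_subset\<close>)
  moreover have c2: "card (\<sigma> ` l) = 2" if "l \<in> m" for l
    using that assms(2) inj card_image[OF inj_on_subset[OF inj], of l] by (auto simp: pairings_def)
  then have "pact \<sigma> m - {{}} = pact \<sigma> m" by (force simp: pact_def)
  ultimately have "partition_on {1..2*N} (pact \<sigma> m)"
    using permutes_image[OF assms(1)] by simp
  moreover have "\<forall>l\<in>pact \<sigma> m. card l = 2" using c2 unfolding pact_def by blast
  ultimately show ?thesis unfolding pairings_def by blast
qed

lemma pact_mem: "{a, b} \<in> m \<Longrightarrow> {\<sigma> a, \<sigma> b} \<in> pact \<sigma> m"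
  using imageI[of "{a, b}" m "(`) \<sigma>"] by (simp add: pact_def)

lemma swp_permutes: "a \<in> S \<Longrightarrow> b \<in> S \<Longrightarrow> swp a b permutes S"
  by (rule permutes_swap_id)

lemma pact_swp_pairings:
  "m \<in> pairings N \<Longrightarrow> a \<in> {1..2*N} \<Longrightarrow> b \<in> {1..2*N} \<Longrightarrow> pact (swp a b) m \<in> pairings N"
  by (intro pact_pairings swp_permutes)

lemma pact_swp_swp [simp]: "pact (swp a b) (pact (swp a b) m) = m"
  by (simp add: pact_comp)

lemma pact_swp_commute: "pact (swp a b) m = pact (swp b a) m"
  by (simp add: transpose_commute)

lemma pact_swp_link:
  assumes "m \<in> pairings N" "{a, b} \<in> m"
  shows "pact (swp a b) m = m"
proof -
  have "swp a b ` l = l" if l: "l \<in> m" for l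
  proof (cases "l = {a, b}")
    case False
    then have "a \<notin> l" "b \<notin> l" using pairings_unique_link[OF assms(1) l assms(2)] by auto
    then have "\<And>x. x \<in> l \<Longrightarrow> swp a b x = x" by (auto simp: Transposition.transpose_def)
    then show ?thesis by auto
  qed auto
  then show ?thesis by (auto simp: pact_def)
qed

lemma pact_swp_eq:
  assumes "m \<in> pairings N" "{a, b} \<in> m" "{a', b'} \<in> m" "{a, b} \<noteq> {a', b'}"
  shows "pact (swp b a') m = (m - {{a, b}, {a', b'}}) \<union> {{a, a'}, {b, b'}}"
proof -
  note d = pairings_linkD[OF assms(1)]
  have ne: "a \<noteq> b" "a' \<noteq> b'" using d assms(2,3) by auto
  have dis: "a \<noteq> a'" "a \<noteq> b'" "b \<noteq> a'" "b \<noteq> b'"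
    using pairings_unique_link[OF assms(1,2,3)] assms(4) by auto
  have "m = (m - {{a, b}, {a', b'}}) \<union> {{a, b}, {a', b'}}" using assms by auto
  then have "pact (swp b a') m = (`) (swp b a') ` (m - {{a, b}, {a', b'}}) \<union> (`) (swp b a') ` {{a, b}, {a', b'}}"
    unfolding pact_def by (metis image_Un)
  moreover have "swp b a' ` l = l" if l: "l \<in> m - {{a, b}, {a', b'}}" for l
  proof -
    have "b \<notin> l" "a' \<notin> l"
      using l pairings_unique_link[OF assms(1) _ assms(2), of l] pairings_unique_link[OF assms(1) _ assms(3), of l] by auto
    then have "\<And>x. x \<in> l \<Longrightarrow> swp b a' x = x" by (auto simp: Transposition.transpose_def)
    then show ?thesis by auto
  qed
  then have "(`) (swp b a') ` (m - {{a, b}, {a', b'}}) = m - {{a, b}, {a', b'}}"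
    by (auto simp: image_iff)
  moreover have "swp b a' ` {a, b} = {a, a'}" "swp b a' ` {a', b'} = {b, b'}"
    using ne dis by (auto simp: Transposition.transpose_def)
  ultimately show ?thesis by simp
qed

section \<open>Coefficient functions on pairings\<close>

text \<open>Four points have three pairings. Exchanging \<open>b\<close> with \<open>a'\<close> or
  with \<open>b'\<close> turns one of them into the other two, so the condition says that the three
  values sum to zero, whatever the other links are.\<close>

definition pluecker :: "nat \<Rightarrow> (nat set set \<Rightarrow> 'a::real_normed_field) set" where
  "pluecker N = {c. (\<forall>m. m \<notin> pairings N \<longrightarrow> c m = 0) \<and>
     (\<forall>m\<in>pairings N. \<forall>a b a' b'. {a, b} \<in> m \<longrightarrow> {a', b'} \<in> m \<longrightarrow> {a, b} \<noteq> {a', b'} \<longrightarrow>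
        c m + c (pact (swp b a') m) + c (pact (swp b b') m) = 0)}"

lemma pluecker_outside: "c \<in> pluecker N \<Longrightarrow> m \<notin> pairings N \<Longrightarrow> c m = 0"
  by (simp add: pluecker_def)

lemma pluecker_rel:
  assumes "c \<in> pluecker N" "m \<in> pairings N" "{a, b} \<in> m" "{a', b'} \<in> m" "{a, b} \<noteq> {a', b'}"
  shows "c m + c (pact (swp b a') m) + c (pact (swp b b') m) = 0"
  using assms by (auto simp: pluecker_def)

lemma pluecker_zero: "(\<lambda>m. 0) \<in> pluecker N"
  by (simp add: pluecker_def)

lemma pluecker_add:
  assumes "c \<in> pluecker N" "d \<in> pluecker N"
  shows "(\<lambda>m. c m + d m) \<in> pluecker N"
proof -
  have "c m + d m + (c m' + d m') + (c m'' + d m'') = 0"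
    if "c m + c m' + c m'' = 0" "d m + d m' + d m'' = 0" for m m' m''
    using that by (simp add: algebra_simps)
  then show ?thesis using assms by (auto simp: pluecker_def)
qed

lemma pluecker_scale:
  assumes "c \<in> pluecker N"
  shows "(\<lambda>m. k * c m) \<in> pluecker N"
proof -
  have "k * c m + k * c m' + k * c m'' = 0" if "c m + c m' + c m'' = 0" for m m' m''
    using that by (metis distrib_left mult_zero_right)
  then show ?thesis using assms by (auto simp: pluecker_def)
qed

lemma pluecker_sum:
  assumes "\<And>i. i \<in> I \<Longrightarrow> c i \<in> pluecker N"
  shows "(\<lambda>m. \<Sum>i\<in>I. k i * c i m) \<in> pluecker N"
  using assms
proof (induction I rule: infinite_finite_induct)
  case (insert i I)
  then show ?case
    using pluecker_add[OF pluecker_scale[of "c i"], of N "\<lambda>m. \<Sum>i\<in>I. k i * c i m" "k i"] by simp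
qed (simp_all add: pluecker_zero)

lemma swp_conj: "inj \<sigma> \<Longrightarrow> \<sigma> \<circ> swp a b = swp (\<sigma> a) (\<sigma> b) \<circ> \<sigma>"
  by (rule ext) (auto simp: Transposition.transpose_def inj_eq)

lemma pluecker_pact:
  assumes "c \<in> pluecker N" and \<sigma>: "\<sigma> permutes {1..2*N}"
  shows "(\<lambda>m. c (pact \<sigma> m)) \<in> pluecker N"
proof -
  have "c (pact \<sigma> m) = 0" if "m \<notin> pairings N" for m
  proof (rule pluecker_outside[OF assms(1)], rule notI)
    assume "pact \<sigma> m \<in> pairings N"
    then have "pact (inv_into UNIV \<sigma>) (pact \<sigma> m) \<in> pairings N" by (rule pact_pairings[OF permutes_inv[OF \<sigma>]])
    with that show False by (simp add: pact_comp permutes_inv_o[OF \<sigma>])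
  qed
  moreover have "c (pact \<sigma> m) + c (pact \<sigma> (pact (swp b a') m)) + c (pact \<sigma> (pact (swp b b') m)) = 0"
    if "m \<in> pairings N" "{a, b} \<in> m" "{a', b'} \<in> m" "{a, b} \<noteq> {a', b'}" for m a b a' b'
  proof -
    have inj: "inj \<sigma>" by (rule permutes_inj[OF \<sigma>])
    have "\<sigma> ` {a, b} \<noteq> \<sigma> ` {a', b'}" using that(4) inj by (simp add: inj_image_eq_iff del: image_insert)
    then show ?thesis
      using pluecker_rel[OF assms(1) pact_pairings[OF \<sigma> that(1)] pact_mem[OF that(2)] pact_mem[OF that(3)]]
      by (simp add: pact_comp swp_conj[OF inj])
  qed
  ultimately show ?thesis by (auto simp: pluecker_def)
qed

section \<open>Bicoloured points and the expansion of a determinant\<close>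

lemma eq_neg_self: "x = - x \<Longrightarrow> x = (0::'a::field_char_0)"
  by (metis add.right_inverse mult_2 mult_eq_0_iff zero_neq_numeral)

text \<open>The determinant of a matrix indexed by \<open>a\<^sub>k\<close>, \<open>b\<^sub>l\<close> expands over the pairings matching
  every \<open>a\<^sub>k\<close> with some \<open>b\<^sub>l\<close>.\<close>

definition bicolour :: "nat \<Rightarrow> (nat \<Rightarrow> nat) \<Rightarrow> (nat \<Rightarrow> nat) \<Rightarrow> bool" where
  "bicolour N a b \<longleftrightarrow> inj_on a {0..<N} \<and> inj_on b {0..<N} \<and>
     a ` {0..<N} \<inter> b ` {0..<N} = {} \<and> a ` {0..<N} \<union> b ` {0..<N} = {1..2*N}"

definition link_up :: "nat \<Rightarrow> (nat \<Rightarrow> nat) \<Rightarrow> (nat \<Rightarrow> nat) \<Rightarrow> (nat \<Rightarrow> nat) \<Rightarrow> nat set set" where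
  "link_up N a b \<pi> = (\<lambda>k. {a k, b (\<pi> k)}) ` {0..<N}"

text \<open>By \<open>link_up_inj\<close> at most one permutation contributes: the value is a sign
  on the pairings that match every a with some b, and 0 on all others.\<close>

definition fcoef :: "nat \<Rightarrow> (nat \<Rightarrow> nat) \<Rightarrow> (nat \<Rightarrow> nat) \<Rightarrow> nat set set \<Rightarrow> 'a::real_normed_field" where
  "fcoef N a b m = (\<Sum>\<pi> | \<pi> permutes {0..<N} \<and> link_up N a b \<pi> = m. of_int (sign \<pi>))"

lemma finite_perms_N [simp]: "finite {\<pi>. \<pi> permutes {0..<N::nat} \<and> P \<pi>}"
  by (rule finite_subset[OF _ finite_permutations[of "{0..<N}"]]) auto

context
  fixes N :: nat and a b :: "nat \<Rightarrow> nat"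
  assumes bic: "bicolour N a b"
begin

lemma bicolourD:
  "inj_on a {0..<N}" "inj_on b {0..<N}"
  "i < N \<Longrightarrow> j < N \<Longrightarrow> a i \<noteq> b j"
  "i < N \<Longrightarrow> a i \<in> {1..2*N}" "i < N \<Longrightarrow> b i \<in> {1..2*N}"
proof -
  have "a ` {0..<N} \<inter> b ` {0..<N} = {}" and un: "a ` {0..<N} \<union> b ` {0..<N} = {1..2*N}"
    using bic by (auto simp: bicolour_def)
  then show "i < N \<Longrightarrow> j < N \<Longrightarrow> a i \<noteq> b j" by fastforce
  show "i < N \<Longrightarrow> a i \<in> {1..2*N}" unfolding un[symmetric] by simp
  show "i < N \<Longrightarrow> b i \<in> {1..2*N}" unfolding un[symmetric] by simp
qed (use bic in \<open>auto simp: bicolour_def\<close>)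

lemma bicolour_cases:
  assumes "x \<in> {1..2*N}"
  obtains i where "i < N" "x = a i" | i where "i < N" "x = b i"
proof -
  have "x \<in> a ` {0..<N} \<union> b ` {0..<N}" using bic assms by (simp add: bicolour_def)
  then show ?thesis using that by auto
qed

lemma a_eq_iff: "i < N \<Longrightarrow> j < N \<Longrightarrow> a i = a j \<longleftrightarrow> i = j"
  using bicolourD(1) by (auto simp: inj_on_def)

lemma b_eq_iff: "i < N \<Longrightarrow> j < N \<Longrightarrow> b i = b j \<longleftrightarrow> i = j"
  using bicolourD(2) by (auto simp: inj_on_def)

lemma permutes_lt: "\<pi> permutes {0..<N} \<Longrightarrow> k < N \<Longrightarrow> \<pi> k < N"
  by (metis atLeastLessThan_iff permutes_in_image zero_le)

lemma link_up_mem_iff: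
  assumes "\<pi> permutes {0..<N}" "i < N" "j < N"
  shows "{a i, b j} \<in> link_up N a b \<pi> \<longleftrightarrow> \<pi> i = j"
proof
  assume "{a i, b j} \<in> link_up N a b \<pi>"
  then obtain k where k: "k < N" "{a i, b j} = {a k, b (\<pi> k)}" by (auto simp: link_up_def)
  then have "a i = a k \<and> b j = b (\<pi> k)"
    using bicolourD(3) assms permutes_lt[OF assms(1), of k] by (metis doubleton_eq_iff)
  then show "\<pi> i = j" using k assms a_eq_iff b_eq_iff permutes_lt by metis
qed (use assms in \<open>auto simp: link_up_def\<close>)

lemma link_up_inj:
  assumes "\<pi> permutes {0..<N}" "\<rho> permutes {0..<N}" "link_up N a b \<pi> = link_up N a b \<rho>"
  shows "\<pi> = \<rho>"
proof
  fix k show "\<pi> k = \<rho> k"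
  proof (cases "k < N")
    case True
    then show ?thesis
      using link_up_mem_iff[OF assms(1) True permutes_lt[OF assms(1) True]]
        link_up_mem_iff[OF assms(2) True permutes_lt[OF assms(1) True]] assms(3) by auto
  next
    case False
    then show ?thesis using assms(1,2) by (simp add: permutes_def)
  qed
qed

lemma link_up_pairings:
  assumes "\<pi> permutes {0..<N}"
  shows "link_up N a b \<pi> \<in> pairings N"
proof -
  let ?m = "link_up N a b \<pi>"
  have im: "\<pi> ` {0..<N} = {0..<N}" by (rule permutes_image[OF assms])
  have "\<Union>?m = a ` {0..<N} \<union> b ` (\<pi> ` {0..<N})" by (auto simp: link_up_def)
  then have "\<Union>?m = {1..2*N}" using bic by (simp add: im bicolour_def)
  moreover have "l \<inter> l' = {}" if "l \<in> ?m" "l' \<in> ?m" "l \<noteq> l'" for l l'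
  proof -
    obtain k k' where k: "k < N" "k' < N" "l = {a k, b (\<pi> k)}" "l' = {a k', b (\<pi> k')}"
      using \<open>l \<in> ?m\<close> \<open>l' \<in> ?m\<close> unfolding link_up_def by force
    then have "k \<noteq> k'" "\<pi> k \<noteq> \<pi> k'" using that permutes_inj[OF assms] by (auto dest: injD)
    then have "a k \<noteq> a k'" "b (\<pi> k) \<noteq> b (\<pi> k')" "a k \<noteq> b (\<pi> k')" "a k' \<noteq> b (\<pi> k)"
      using k a_eq_iff b_eq_iff bicolourD(3) permutes_lt[OF assms] by metis+
    then show ?thesis using k by auto
  qed
  moreover have "card l = 2" if l: "l \<in> ?m" for l
  proof -
    obtain k where "k < N" "l = {a k, b (\<pi> k)}" using l by (auto simp: link_up_def)
    then show ?thesis using bicolourD(3)[of k "\<pi> k"] permutes_lt[OF assms, of k] by simp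
  qed
  moreover have "{} \<notin> ?m" by (auto simp: link_up_def)
  ultimately show ?thesis
    unfolding pairings_def partition_on_def disjoint_def by blast
qed

lemma fcoef_outside: "m \<notin> pairings N \<Longrightarrow> fcoef N a b m = 0"
  unfolding fcoef_def by (rule sum.neutral) (auto dest: link_up_pairings)

lemma fcoef_link_up:
  assumes "\<pi> permutes {0..<N}"
  shows "fcoef N a b (link_up N a b \<pi>) = of_int (sign \<pi>)"
proof -
  have "{\<rho>. \<rho> permutes {0..<N} \<and> link_up N a b \<rho> = link_up N a b \<pi>} = {\<pi>}"
    using link_up_inj assms by blast
  then show ?thesis by (simp add: fcoef_def)
qed

lemma fcoef_other:
  assumes "\<And>\<pi>. \<pi> permutes {0..<N} \<Longrightarrow> m \<noteq> link_up N a b \<pi>"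
  shows "fcoef N a b m = 0"
  unfolding fcoef_def by (rule sum.neutral) (use assms in auto)

lemma link_up_swp_b:
  assumes "\<pi> permutes {0..<N}" "i < N" "j < N"
  shows "pact (swp (b i) (b j)) (link_up N a b \<pi>) = link_up N a b (swp i j \<circ> \<pi>)"
proof -
  have "swp (b i) (b j) ` {a k, b (\<pi> k)} = {a k, b ((swp i j \<circ> \<pi>) k)}" if "k < N" for k
    using that assms bicolourD(3)[of k] b_eq_iff permutes_lt[OF assms(1) that]
    by (auto simp: Transposition.transpose_def)
  then show ?thesis unfolding pact_def link_up_def image_image by (intro image_cong refl) auto
qed

lemma link_up_swp_a:
  assumes "\<pi> permutes {0..<N}" "i < N" "j < N"
  shows "pact (swp (a i) (a j)) (link_up N a b \<pi>) = link_up N a b (\<pi> \<circ> swp i j)"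
proof -
  have 1: "swp (a i) (a j) ` {a k, b (\<pi> k)} = {a (swp i j k), b ((\<pi> \<circ> swp i j) (swp i j k))}" if "k < N" for k
  proof -
    have "a i \<noteq> b (\<pi> k)" "a j \<noteq> b (\<pi> k)"
      using bicolourD(3)[OF _ permutes_lt[OF assms(1) that]] assms by auto
    then show ?thesis using that assms a_eq_iff by (auto simp: Transposition.transpose_def)
  qed
  have im: "swp i j ` {0..<N} = {0..<N}"
    by (rule permutes_image[OF swp_permutes]) (use assms in auto)
  have "pact (swp (a i) (a j)) (link_up N a b \<pi>)
      = (\<lambda>k. {a (swp i j k), b ((\<pi> \<circ> swp i j) (swp i j k))}) ` {0..<N}"
    unfolding pact_def link_up_def image_image by (intro image_cong refl) (use 1 in auto)
  also have "\<dots> = (\<lambda>k. {a k, b ((\<pi> \<circ> swp i j) k)}) ` (swp i j ` {0..<N})"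
    by (simp add: image_image)
  finally show ?thesis by (simp only: im link_up_def)
qed

lemma sign_swp:
  assumes "\<pi> permutes {0..<N}" "i < N" "j < N" "i \<noteq> j"
  shows "sign (swp i j \<circ> \<pi>) = - sign \<pi>" "sign (\<pi> \<circ> swp i j) = - sign \<pi>"
proof -
  have "permutation \<pi>" using assms(1) permutation_permutes by blast
  then show "sign (swp i j \<circ> \<pi>) = - sign \<pi>" "sign (\<pi> \<circ> swp i j) = - sign \<pi>"
    using assms(4) by (simp_all add: sign_compose permutation_swap_id sign_swap_id)
qed

text \<open>Common to row and column exchanges; \<open>g\<close> is the effect of the exchange on
  the permutation. The involution hypothesis serves the pairings outside the expansion: the exchange
  cannot move them into it.\<close>

lemma fcoef_swp_aux:
  assumes "m \<in> pairings N"
    and "\<And>\<pi>. \<pi> permutes {0..<N} \<Longrightarrow> g \<pi> permutes {0..<N} \<and> sign (g \<pi>) = - sign \<pi> \<and>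
           pact \<tau> (link_up N a b \<pi>) = link_up N a b (g \<pi>)"
    and "\<And>m. pact \<tau> (pact \<tau> m) = m"
  shows "fcoef N a b (pact \<tau> m) = - (fcoef N a b m :: 'a::real_normed_field)"
proof (cases "\<exists>\<pi>. \<pi> permutes {0..<N} \<and> m = link_up N a b \<pi>")
  case True
  then show ?thesis using assms(2) by (auto simp: fcoef_link_up)
next
  case False
  then have "fcoef N a b m = (0::'a)" by (intro fcoef_other) auto
  moreover have "fcoef N a b (pact \<tau> m) = (0::'a)"
  proof (intro fcoef_other notI)
    fix \<pi> assume \<pi>: "\<pi> permutes {0..<N}" "pact \<tau> m = link_up N a b \<pi>"
    then have "m = link_up N a b (g \<pi>)" using assms(2)[OF \<pi>(1)] assms(3)[of m] by simp
    then show False using False assms(2)[OF \<pi>(1)] by blast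
  qed
  ultimately show ?thesis by simp
qed

lemma fcoef_swp_b:
  assumes "m \<in> pairings N" "i < N" "j < N" "i \<noteq> j"
  shows "fcoef N a b (pact (swp (b i) (b j)) m) = - fcoef N a b m"
  by (rule fcoef_swp_aux[where g = "\<lambda>\<pi>. swp i j \<circ> \<pi>"])
    (use assms in \<open>auto simp: link_up_swp_b sign_swp intro!: permutes_compose swp_permutes\<close>)

lemma fcoef_swp_a:
  assumes "m \<in> pairings N" "i < N" "j < N" "i \<noteq> j"
  shows "fcoef N a b (pact (swp (a i) (a j)) m) = - fcoef N a b m"
  by (rule fcoef_swp_aux[where g = "\<lambda>\<pi>. \<pi> \<circ> swp i j"])
    (use assms in \<open>auto simp: link_up_swp_a sign_swp intro!: permutes_compose swp_permutes\<close>)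

lemma fcoef_swp:
  assumes "m \<in> pairings N" "x \<noteq> y"
    and "x \<in> a ` {0..<N} \<and> y \<in> a ` {0..<N} \<or> x \<in> b ` {0..<N} \<and> y \<in> b ` {0..<N}"
  shows "fcoef N a b (pact (swp x y) m) = - fcoef N a b m"
  using assms(3)
proof
  assume "x \<in> a ` {0..<N} \<and> y \<in> a ` {0..<N}"
  then obtain i j where "x = a i" "y = a j" "i < N" "j < N" by auto
  then show ?thesis using fcoef_swp_a[OF assms(1), of i j] assms(2) by auto
next
  assume "x \<in> b ` {0..<N} \<and> y \<in> b ` {0..<N}"
  then obtain i j where "x = b i" "y = b j" "i < N" "j < N" by auto
  then show ?thesis using fcoef_swp_b[OF assms(1), of i j] assms(2) by auto
qed

lemma fcoef_pigeon:
  assumes "x \<in> {1..2*N}" "y \<in> {1..2*N}" "z \<in> {1..2*N}"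
  obtains "x \<in> a ` {0..<N} \<and> y \<in> a ` {0..<N} \<or> x \<in> b ` {0..<N} \<and> y \<in> b ` {0..<N}"
  | "x \<in> a ` {0..<N} \<and> z \<in> a ` {0..<N} \<or> x \<in> b ` {0..<N} \<and> z \<in> b ` {0..<N}"
  | "y \<in> a ` {0..<N} \<and> z \<in> a ` {0..<N} \<or> y \<in> b ` {0..<N} \<and> z \<in> b ` {0..<N}"
proof -
  have "{1..2*N} = a ` {0..<N} \<union> b ` {0..<N}" using bic by (simp add: bicolour_def)
  then show ?thesis using assms that by blast
qed

text \<open>Two of the three points \<open>y\<close>, \<open>x'\<close>, \<open>y'\<close> have the
  same colour. Their exchange fixes one of the three pairings and interchanges the other two, so the
  antisymmetric \<open>fcoef\<close> is zero on the former and takes opposite values on the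
  latter.\<close>

lemma fcoef_pluecker: "fcoef N a b \<in> pluecker N"
proof -
  have "fcoef N a b m + fcoef N a b (pact (swp y x') m) + fcoef N a b (pact (swp y y') m) = (0::'a::real_normed_field)"
    if m: "m \<in> pairings N" and l: "{x, y} \<in> m" "{x', y'} \<in> m" "{x, y} \<noteq> {x', y'}" for m x y x' y'
  proof -
    let ?F = "fcoef N a b :: _ \<Rightarrow> 'a"
    define m2 where "m2 = pact (swp y x') m"
    define m3 where "m3 = pact (swp y y') m"
    note d = pairings_linkD[OF m l(1)] pairings_linkD[OF m l(2)]
    have dis: "x \<noteq> x'" "x \<noteq> y'" "y \<noteq> x'" "y \<noteq> y'"
      using pairings_unique_link[OF m l(1,2)] l(3) by auto
    have P: "m2 \<in> pairings N" "m3 \<in> pairings N"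
      using pact_swp_pairings[OF m] d by (auto simp: m2_def m3_def)
    have m2: "m2 = (m - {{x, y}, {x', y'}}) \<union> {{x, x'}, {y, y'}}"
      unfolding m2_def by (rule pact_swp_eq[OF m l])
    have m3: "m3 = (m - {{x, y}, {x', y'}}) \<union> {{x, y'}, {y, x'}}"
      using pact_swp_eq[OF m l(1), of y' x'] l by (simp add: m3_def insert_commute)
    have fix2: "pact (swp y y') m2 = m2" using pact_swp_link[OF P(1)] m2 by auto
    have fix3: "pact (swp y x') m3 = m3" using pact_swp_link[OF P(2)] m3 by auto
    have fix1: "pact (swp x' y') m = m" using pact_swp_link[OF m l(2)] .
    have "pact (swp x' y') m2 = (m2 - {{y, y'}, {x', x}}) \<union> {{y, x'}, {y', x}}"
      using pact_swp_eq[OF P(1), of y y' x' x] m2 dis d by (auto simp: insert_commute pact_swp_commute doubleton_eq_iff)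
    also have "\<dots> = m3"
    proof -
      have "{y, y'} \<notin> m" "{x', x} \<notin> m"
        using pairings_unique_link[OF m l(1)] pairings_unique_link[OF m l(2)] dis d by (auto simp: doubleton_eq_iff)
      then show ?thesis unfolding m2 m3 by (auto simp: insert_commute)
    qed
    finally have fix23: "pact (swp x' y') m2 = m3" .
    show ?thesis
      unfolding m2_def[symmetric] m3_def[symmetric]
    proof (rule fcoef_pigeon[OF d(3,5,6)])
      assume "y \<in> a ` {0..<N} \<and> x' \<in> a ` {0..<N} \<or> y \<in> b ` {0..<N} \<and> x' \<in> b ` {0..<N}"
      note F = fcoef_swp[OF _ dis(3) this, where ?'a = 'a]
      have "?F m2 = - ?F m" using F[OF m] by (simp add: m2_def)
      moreover have "?F m3 = 0" using F[OF P(2)] eq_neg_self unfolding fix3 by blast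
      ultimately show "?F m + ?F m2 + ?F m3 = 0" by simp
    next
      assume "y \<in> a ` {0..<N} \<and> y' \<in> a ` {0..<N} \<or> y \<in> b ` {0..<N} \<and> y' \<in> b ` {0..<N}"
      note F = fcoef_swp[OF _ dis(4) this, where ?'a = 'a]
      have "?F m3 = - ?F m" using F[OF m] by (simp add: m3_def)
      moreover have "?F m2 = 0" using F[OF P(1)] eq_neg_self unfolding fix2 by blast
      ultimately show "?F m + ?F m2 + ?F m3 = 0" by simp
    next
      assume "x' \<in> a ` {0..<N} \<and> y' \<in> a ` {0..<N} \<or> x' \<in> b ` {0..<N} \<and> y' \<in> b ` {0..<N}"
      note F = fcoef_swp[OF _ d(4) this, where ?'a = 'a]
      have "?F m3 = - ?F m2" using F[OF P(1)] unfolding fix23 .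
      moreover have "?F m = 0" using F[OF m] eq_neg_self unfolding fix1 by blast
      ultimately show "?F m + ?F m2 + ?F m3 = 0" by simp
    qed
  qed
  then show ?thesis using fcoef_outside by (auto simp: pluecker_def)
qed

text \<open>Every \<open>b\<close> is then linked to an \<open>a\<close>, and there are equally many of both.\<close>

lemma pairing_is_link_up:
  assumes m: "m \<in> pairings N" and nb: "\<And>i j. i < N \<Longrightarrow> j < N \<Longrightarrow> {b i, b j} \<notin> m"
  obtains \<pi> where "\<pi> permutes {0..<N}" "m = link_up N a b \<pi>"
proof -
  have "\<exists>i<N. {a i, b j} \<in> m" if j: "j < N" for j
  proof -
    obtain x where x: "{b j, x} \<in> m" using pairings_partner[OF m bicolourD(5)[OF j]] by metis
    show ?thesis
    proof (rule bicolour_cases[OF pairings_linkD(3)[OF m x]])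
      fix i assume "i < N" "x = a i" then show ?thesis using x by (auto simp: insert_commute)
    qed (use nb j x in blast)
  qed
  then obtain g where g: "\<And>j. j < N \<Longrightarrow> g j < N \<and> {a (g j), b j} \<in> m" by metis
  define h where "h = (\<lambda>j. if j < N then g j else j)"
  have "inj_on h {0..<N}"
  proof (rule inj_onI)
    fix j k assume jk: "j \<in> {0..<N}" "k \<in> {0..<N}" "h j = h k"
    then have "{a (g j), b j} \<in> m" "{a (g j), b k} \<in> m" using g[of j] g[of k] by (auto simp: h_def)
    then have "b j = b k" by (rule pairings_unique[OF m])
    then show "j = k" using jk b_eq_iff by auto
  qed
  moreover have "h ` {0..<N} \<subseteq> {0..<N}" using g by (auto simp: h_def)
  ultimately have "bij_betw h {0..<N} {0..<N}"
    by (simp add: bij_betw_def endo_inj_surj)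
  then have h: "h permutes {0..<N}" by (rule bij_imp_permutes) (auto simp: h_def)
  define \<pi> where "\<pi> = inv_into UNIV h"
  have \<pi>: "\<pi> permutes {0..<N}" unfolding \<pi>_def by (rule permutes_inv[OF h])
  have "link_up N a b \<pi> \<subseteq> m"
  proof
    fix l assume "l \<in> link_up N a b \<pi>"
    then obtain k where k: "k < N" "l = {a k, b (\<pi> k)}" by (auto simp: link_up_def)
    have "h (\<pi> k) = k" unfolding \<pi>_def using permutes_inverses(1)[OF h] .
    then have "g (\<pi> k) = k" using permutes_lt[OF \<pi> k(1)] by (simp add: h_def)
    then show "l \<in> m" using g[OF permutes_lt[OF \<pi> k(1)]] k by simp
  qed
  then have "m = link_up N a b \<pi>" using pairings_subset_eq[OF link_up_pairings[OF \<pi>] m] by simp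
  with \<pi> show ?thesis by (rule that)
qed

text \<open>Antisymmetry forces the value 0 on a pairing that links two b's. All other pairings
  arise from \<open>link_up N a b id\<close> by permuting the b's, so one value determines the
  function.\<close>

lemma antisym_eq_fcoef:
  fixes c :: "nat set set \<Rightarrow> 'a::real_normed_field"
  assumes out: "\<And>m. m \<notin> pairings N \<Longrightarrow> c m = 0"
    and anti: "\<And>m i j. m \<in> pairings N \<Longrightarrow> i < N \<Longrightarrow> j < N \<Longrightarrow> i \<noteq> j \<Longrightarrow> c (pact (swp (b i) (b j)) m) = - c m"
  shows "c m = c (link_up N a b id) * fcoef N a b m"
proof (cases "m \<in> pairings N")
  case False
  then show ?thesis using out[OF False] fcoef_outside[OF False, where ?'a = 'a] by simp
next
  case m: True
  show ?thesis
  proof (cases "\<exists>i j. i < N \<and> j < N \<and> {b i, b j} \<in> m")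
    case True
    then obtain i j where ij: "i < N" "j < N" "{b i, b j} \<in> m" by blast
    then have ne: "i \<noteq> j" using pairings_linkD(1)[OF m] by blast
    have "pact (swp (b i) (b j)) m = m" by (rule pact_swp_link[OF m ij(3)])
    then have "c m = - c m" "(fcoef N a b m :: 'a) = - fcoef N a b m"
      using anti[OF m ij(1,2) ne] fcoef_swp_b[OF m ij(1,2) ne, where ?'a = 'a] by auto
    then have "c m = 0" "(fcoef N a b m :: 'a) = 0" using eq_neg_self by blast+
    then show ?thesis by simp
  next
    case False
    then obtain \<pi> where \<pi>: "\<pi> permutes {0..<N}" "m = link_up N a b \<pi>"
      using pairing_is_link_up[OF m] by metis
    from \<pi>(1) finite_atLeastLessThan[of 0 N] have "c (link_up N a b \<pi>) = of_int (sign \<pi>) * c (link_up N a b id)"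
    proof (induction rule: permutes_induct)
      case (swap i j \<rho>)
      then have "c (link_up N a b (swp i j \<circ> \<rho>)) = - c (link_up N a b \<rho>)"
        using anti[OF link_up_pairings, of \<rho> i j] link_up_swp_b[of \<rho> i j] by auto
      moreover have "sign (swp i j \<circ> \<rho>) = - sign \<rho>" using swap sign_swp(1)[of \<rho> i j] by simp
      ultimately show ?case using swap by (simp only: of_int_minus mult_minus_left)
    qed simp_all
    then show ?thesis using \<pi> by (simp add: fcoef_link_up)
  qed
qed

end

section \<open>Noncrossing pairings and their paths\<close>

lemma LP_noncrossing:
  assumes "\<beta> \<in> LP N" "{a, b} \<in> \<beta>" "{c, d} \<in> \<beta>" "a < c" "c < b" "b < d"
  shows False
  using assms unfolding LP_def by blast

lemma sum_pact_swp:
  fixes g :: "nat set \<Rightarrow> 'b::comm_monoid_add"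
  assumes m: "m \<in> pairings N" and l: "{a, b} \<in> m" "{a', b'} \<in> m" "{a, b} \<noteq> {a', b'}"
  shows "sum g (pact (swp b a') m) = sum g (m - {{a, b}, {a', b'}}) + (g {a, a'} + g {b, b'})"
    and "sum g m = sum g (m - {{a, b}, {a', b'}}) + (g {a, b} + g {a', b'})"
proof -
  let ?R = "m - {{a, b}, {a', b'}}"
  have fin: "finite ?R" using pairings_finite[OF m] by simp
  have dis: "a \<noteq> a'" "a \<noteq> b'" "b \<noteq> a'" "b \<noteq> b'"
    using pairings_unique_link[OF m l(1,2)] l(3) by auto
  have "a \<noteq> b" "a' \<noteq> b'" using pairings_linkD(1)[OF m] l by auto
  then have ne: "{a, a'} \<noteq> {b, b'}" using dis by (auto simp: doubleton_eq_iff)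
  have notin: "{a, a'} \<notin> ?R" "{b, b'} \<notin> ?R"
    using pairings_unique_link[OF m l(1), of "{a, a'}" a] pairings_unique_link[OF m l(1), of "{b, b'}" b] dis
    by (auto simp: doubleton_eq_iff)
  have "pact (swp b a') m = ?R \<union> {{a, a'}, {b, b'}}" by (rule pact_swp_eq[OF m l])
  also have "sum g \<dots> = sum g ?R + sum g {{a, a'}, {b, b'}}"
    by (rule sum.union_disjoint) (use fin notin in auto)
  finally show "sum g (pact (swp b a') m) = sum g ?R + (g {a, a'} + g {b, b'})" using ne by simp
  have "m = ?R \<union> {{a, b}, {a', b'}}" using l by auto
  then have "sum g m = sum g (?R \<union> {{a, b}, {a', b'}})" by simp
  also have "\<dots> = sum g ?R + sum g {{a, b}, {a', b'}}"
    by (rule sum.union_disjoint) (use fin in auto)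
  finally show "sum g m = sum g ?R + (g {a, b} + g {a', b'})" using l(3) by simp
qed

text \<open>Uncrossing two links in either of the two ways decreases this weight, since
  \<open>L (4N - L)\<close> is increasing and strictly concave in the length \<open>L\<close>.\<close>

definition weight :: "nat \<Rightarrow> nat set set \<Rightarrow> int" where
  "weight N m = (\<Sum>l\<in>m. (int (Max l) - int (Min l)) * (4 * int N - (int (Max l) - int (Min l))))"

lemma weight_nonneg:
  assumes "m \<in> pairings N"
  shows "0 \<le> weight N m"
  unfolding weight_def
proof (rule sum_nonneg)
  fix l assume "l \<in> m"
  then obtain a b where "l = {a, b}" "a < b" "a \<in> {1..2*N}" "b \<in> {1..2*N}"
    using pairings_link[OF assms] by metis
  then show "0 \<le> (int (Max l) - int (Min l)) * (4 * int N - (int (Max l) - int (Min l)))"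
    by (intro mult_nonneg_nonneg) auto
qed

text \<open>Induction on the weight: by the three-term relation the value at a pairing with a
  crossing is minus the sum of the values at its two uncrossings, both of smaller weight.\<close>

lemma pluecker_eq_zero:
  assumes c: "c \<in> pluecker N" and LP0: "\<And>\<gamma>. \<gamma> \<in> LP N \<Longrightarrow> c \<gamma> = 0"
  shows "c m = 0"
proof (induction "nat (weight N m)" arbitrary: m rule: less_induct)
  case less
  show ?case
  proof (cases "m \<in> pairings N")
    case False
    then show ?thesis by (rule pluecker_outside[OF c])
  next
    case m: True
    show ?thesis
    proof (cases "m \<in> LP N")
      case True
      then show ?thesis by (rule LP0)
    next
      case False
      then have "\<exists>p q r t. {p, q} \<in> m \<and> {r, t} \<in> m \<and> p < r \<and> r < q \<and> q < t"
        using m by (simp add: LP_def pairings_def) blast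
      then obtain p q r t where l: "{p, q} \<in> m" "{r, t} \<in> m" and o: "p < r" "r < q" "q < t"
        by blast
      have ne: "{p, q} \<noteq> {r, t}" "{p, q} \<noteq> {t, r}" using o by (auto simp: doubleton_eq_iff)
      have l': "{t, r} \<in> m" using l(2) by (simp add: insert_commute)
      have rng: "p \<in> {1..2*N}" "q \<in> {1..2*N}" "r \<in> {1..2*N}" "t \<in> {1..2*N}"
        using pairings_linkD[OF m] l by auto
      have P: "pact (swp q r) m \<in> pairings N" "pact (swp q t) m \<in> pairings N"
        using pact_swp_pairings[OF m] rng by auto
      let ?g = "\<lambda>l. (int (Max l) - int (Min l)) * (4 * int N - (int (Max l) - int (Min l)))"
      note w = sum_pact_swp[OF m l ne(1), of ?g, folded weight_def]
      note w' = sum_pact_swp[OF m l(1) l' ne(2), of ?g, folded weight_def]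
      have g: "?g {u, v} = (int v - int u) * (4 * int N - (int v - int u))" if "u < v" for u v
        using that by simp
      \<comment> \<open>The product is the weight lost when the crossing links become {p, r} and {q,
        t}; the product 2 (r - p) (t - q) below is the loss for {p, t} and {r, q}.\<close>
      have "0 < (int q - int r) * (8 * int N - 2 * int t + 2 * int p)" using o rng by simp
      then have lt1: "weight N (pact (swp q r) m) < weight N m"
        unfolding w using g[of p q] g[of r t] g[of p r] g[of q t] o by (simp add: algebra_simps)
      have "0 < 2 * ((int r - int p) * (int t - int q))" using o by simp
      moreover have "?g {q, r} = ?g {r, q}" by (simp add: insert_commute)
      ultimately have lt2: "weight N (pact (swp q t) m) < weight N m"
        unfolding w' using g[of p q] g[of r t] g[of p t] g[of r q] o w'(2) w(2)
        by (simp add: algebra_simps insert_commute)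
      then have "c (pact (swp q r) m) = 0" "c (pact (swp q t) m) = 0"
        using less lt1 lt2 weight_nonneg[OF P(1)] weight_nonneg[OF P(2)] weight_nonneg[OF m] by auto
      then show ?thesis using pluecker_rel[OF c m l ne(1)] by simp
    qed
  qed
qed

section \<open>Height functions of pairings\<close>

lemma sum_links:
  fixes g :: "nat \<Rightarrow> 'b::comm_monoid_add"
  assumes "m \<in> pairings N"
  shows "(\<Sum>i=1..2*N. g i) = (\<Sum>l\<in>m. sum g l)"
proof -
  have p: "\<Union>m = {1..2*N}" "disjoint m" and c2: "\<And>l. l \<in> m \<Longrightarrow> card l = 2"
    using assms by (auto simp: pairings_def partition_on_def)
  have "sum g (\<Union>m) = (sum \<circ> sum) g m"
    by (rule sum.Union_disjoint) (use p c2 in \<open>auto simp: disjoint_def card_ge_0_finite\<close>)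
  then show ?thesis using p by simp
qed

text \<open>\<open>dpath\<close> with an arbitrary set of up-steps, so that the colouring that
  belongs to one pairing can be summed along the links of another.\<close>

definition cpath :: "nat set \<Rightarrow> nat \<Rightarrow> int" where
  "cpath A j = (\<Sum>i=1..j. if i \<in> A then 1 else - 1)"

lemma dpath_eq_cpath: "dpath \<beta> = cpath (Min ` \<beta>)"
  by (simp add: fun_eq_iff dpath_def cpath_def)

lemma cpath_0 [simp]: "cpath A 0 = 0"
  by (simp add: cpath_def)

lemma cpath_Suc: "cpath A (Suc j) = cpath A j + (if Suc j \<in> A then 1 else - 1)"
  by (simp add: cpath_def)

lemma cpath_step:
  assumes "0 < j"
  shows "cpath A j = cpath A (j - 1) + (if j \<in> A then 1 else - 1)"
  using cpath_Suc[of A "j - 1"] assms by simp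

lemma cpath_parity: "even (cpath A j + int j)"
  by (induction j) (auto simp: cpath_Suc)

lemma cpath_bound: "\<bar>cpath A j\<bar> \<le> int j"
  by (induction j) (auto simp: cpath_Suc)

lemma cpath_links:
  assumes "m \<in> pairings N" "j \<le> 2 * N"
  shows "cpath A j = (\<Sum>l\<in>m. \<Sum>i\<in>l. if i \<le> j then if i \<in> A then 1 else - 1 else 0)"
proof -
  have "cpath A j = (\<Sum>i=1..2*N. if i \<le> j then if i \<in> A then 1 else - 1 else 0)"
    unfolding cpath_def by (rule sum.mono_neutral_cong_left) (use assms(2) in auto)
  then show ?thesis using sum_links[OF assms(1)] by simp
qed

lemma pairings_Min:
  assumes "m \<in> pairings N" "{a, b} \<in> m" "a < b"
  shows "a \<in> Min ` m" "b \<notin> Min ` m"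
proof -
  have "Min {a, b} = a" using assms(3) by simp
  then show "a \<in> Min ` m" using assms(2) by (metis imageI)
  show "b \<notin> Min ` m"
  proof
    assume "b \<in> Min ` m"
    then obtain l where l: "l \<in> m" "b = Min l" by blast
    obtain u v where "l = {u, v}" "u < v" using pairings_link[OF assms(1) l(1)] by metis
    then have "b \<in> l" "l = {b, v}" "b < v" using l by auto
    then show False using pairings_unique_link[OF assms(1) l(1) assms(2), of b] assms(3) by (auto simp: doubleton_eq_iff)
  qed
qed

text \<open>Sum the steps link by link. A bichromatic link adds 0 to the height at \<open>j\<close>
  unless exactly one end lies at or before \<open>j\<close>; then it adds 1 or -1, and the colouring
  of \<open>m\<close> itself always gives 1.\<close>

lemma cpath_le_dpath:
  assumes m: "m \<in> pairings N" and "j \<le> 2 * N"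
    and A: "\<And>u v. {u, v} \<in> m \<Longrightarrow> u \<in> A \<longleftrightarrow> v \<notin> A"
  shows "cpath A j \<le> dpath m j"
  unfolding dpath_eq_cpath cpath_links[OF assms(1,2)]
proof (rule sum_mono)
  fix l assume "l \<in> m"
  then obtain u v where l: "l = {u, v}" "u < v" "{u, v} \<in> m" using pairings_link[OF m] by metis
  show "(\<Sum>i\<in>l. if i \<le> j then if i \<in> A then 1 else - 1 else 0)
      \<le> (\<Sum>i\<in>l. if i \<le> j then if i \<in> Min ` m then 1 else - 1 else (0::int))"
    using pairings_Min[OF m l(3,2)] A[OF l(3)] l(2) unfolding l(1) by simp
qed

lemma dpath_open:
  assumes m: "m \<in> pairings N" and "j \<le> 2 * N"
  shows "dpath m j = int (card {l \<in> m. Min l \<le> j \<and> j < Max l})"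
proof -
  have "dpath m j = (\<Sum>l\<in>m. if Min l \<le> j \<and> j < Max l then 1 else 0)"
    unfolding dpath_eq_cpath cpath_links[OF assms]
  proof (rule sum.cong[OF refl])
    fix l assume "l \<in> m"
    then obtain u v where l: "l = {u, v}" "u < v" "{u, v} \<in> m" using pairings_link[OF m] by metis
    show "(\<Sum>i\<in>l. if i \<le> j then if i \<in> Min ` m then 1 else - 1 else 0)
        = (if Min l \<le> j \<and> j < Max l then 1 else (0::int))"
      using pairings_Min[OF m l(3,2)] l(2) unfolding l(1) by simp
  qed
  then show ?thesis using pairings_finite[OF m] by (simp add: sum.If_cases Int_def)
qed

lemma dpath_nonneg: "m \<in> pairings N \<Longrightarrow> j \<le> 2 * N \<Longrightarrow> 0 \<le> dpath m j"
  by (simp add: dpath_open)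

text \<open>The height counts open links. By planarity a link open just before \<open>a\<close> also
  passes over \<open>b\<close>, and a link open at \<open>b\<close> was open before
  \<open>a\<close>; in between, {a, b} is open in addition.\<close>

lemma LP_return:
  assumes \<beta>: "\<beta> \<in> LP N" and l: "{a, b} \<in> \<beta>" "a < b"
  shows "dpath \<beta> b = dpath \<beta> (a - 1)" "a \<le> j \<Longrightarrow> j < b \<Longrightarrow> dpath \<beta> (a - 1) < dpath \<beta> j"
proof -
  have m: "\<beta> \<in> pairings N" using \<beta> LP_subset_pairings by blast
  have rng: "1 \<le> a" "a \<le> 2*N" "b \<le> 2*N" using pairings_linkD[OF m l(1)] by auto
  define O' where "O' = (\<lambda>j. {l \<in> \<beta>. Min l \<le> j \<and> j < Max l})"
  have fin: "finite (O' j)" for j using pairings_finite[OF m] by (simp add: O'_def)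
  have d: "j \<le> 2 * N \<Longrightarrow> dpath \<beta> j = int (card (O' j))" for j
    using dpath_open[OF m] by (simp add: O'_def)
  have open_above: "Min k < a \<and> b < Max k" if "k \<in> O' (a - 1)" for k
  proof -
    have kO: "k \<in> \<beta>" "Min k \<le> a - 1" "a - 1 < Max k" using that by (auto simp: O'_def)
    obtain u v where uv: "k = {u, v}" "u < v" using pairings_link[OF m kO(1)] by metis
    then have k: "k = {u, v}" "u < v" "{u, v} \<in> \<beta>" "u \<le> a - 1" "a - 1 < v" using kO by auto
    have "u < a" "a \<le> v" using k rng by auto
    moreover have "a \<noteq> v" "b \<noteq> v"
      using pairings_unique_link[OF m l(1) k(3)] \<open>u < a\<close> k l(2) by (auto simp: doubleton_eq_iff)
    moreover have "\<not> v < b" using LP_noncrossing[OF \<beta> k(3) l(1)] \<open>u < a\<close> \<open>a \<le> v\<close> \<open>a \<noteq> v\<close> by auto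
    ultimately show ?thesis using k by auto
  qed
  show "dpath \<beta> (a - 1) < dpath \<beta> j" if j: "a \<le> j" "j < b"
  proof -
    have "insert {a, b} (O' (a - 1)) \<subseteq> O' j"
      using open_above j l unfolding O'_def by fastforce
    moreover have "{a, b} \<notin> O' (a - 1)" using open_above[of "{a, b}"] l(2) by auto
    ultimately have "card (O' (a - 1)) < card (O' j)"
      using card_mono[OF fin] fin by (metis Suc_le_eq card_insert_disjoint)
    then show ?thesis using d[of j] d[of "a - 1"] j rng by simp
  qed
  have "O' b = O' (a - 1)"
  proof (rule antisym; rule subsetI)
    fix k assume k: "k \<in> O' (a - 1)"
    then show "k \<in> O' b" using open_above[OF k] l(2) by (simp add: O'_def)
  next
    fix k assume "k \<in> O' b"
    then have kO: "k \<in> \<beta>" "Min k \<le> b" "b < Max k" by (auto simp: O'_def)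
    obtain u v where uv: "k = {u, v}" "u < v" using pairings_link[OF m kO(1)] by metis
    then have k: "k = {u, v}" "u < v" "{u, v} \<in> \<beta>" "u \<le> b" "b < v" using kO by auto
    have "u \<noteq> b" "u \<noteq> a"
      using pairings_unique_link[OF m l(1) k(3), of a] pairings_unique_link[OF m l(1) k(3), of b] k l(2)
      by (auto simp: doubleton_eq_iff)
    moreover have "\<not> (a < u \<and> u < b)" using LP_noncrossing[OF \<beta> l(1) k(3) _ _ k(5)] by blast
    ultimately have "u < a" using k(4) by linarith
    then show "k \<in> O' (a - 1)" using k l(2) unfolding O'_def by auto
  qed
  then show "dpath \<beta> b = dpath \<beta> (a - 1)" using d[of b] d[of "a - 1"] rng by simp
qed

text \<open>By \<open>LP_return\<close> the partner of a left endpoint is the place where the path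
  first comes back to the height it had before, so the up-steps determine the links.\<close>

lemma LP_eqI:
  assumes "\<beta> \<in> LP N" "\<gamma> \<in> LP N" "Min ` \<beta> = Min ` \<gamma>"
  shows "\<beta> = \<gamma>"
proof -
  have m: "\<beta> \<in> pairings N" "\<gamma> \<in> pairings N" using assms LP_subset_pairings by blast+
  have d: "dpath \<beta> = dpath \<gamma>" using assms(3) by (simp add: dpath_eq_cpath)
  have "\<beta> \<subseteq> \<gamma>"
  proof
    fix l assume "l \<in> \<beta>"
    then obtain a b where l: "l = {a, b}" "a < b" "{a, b} \<in> \<beta>" "a \<in> {1..2*N}" using pairings_link[OF m(1)] by metis
    then have "a \<in> Min ` \<gamma>" using pairings_Min[OF m(1)] assms(3) by blast
    obtain b' where l': "{a, b'} \<in> \<gamma>" "a \<noteq> b'" using pairings_partner[OF m(2) l(4)] by metis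
    have "\<not> b' < a" using pairings_Min(2)[OF m(2), of b' a] l' \<open>a \<in> Min ` \<gamma>\<close> by (auto simp: insert_commute)
    then have "a < b'" using l' by simp
    note r = LP_return[OF assms(1) l(3,2)] LP_return[OF assms(2) l'(1) this]
    have "b = b'"
    proof (rule linorder_cases[of b b'])
      assume "b < b'" then show ?thesis using r(4)[of b] r(1) d l(2) by simp
    next
      assume "b' < b" then show ?thesis using r(2)[of b'] r(3) d \<open>a < b'\<close> by simp
    qed
    then show "l \<in> \<gamma>" using l l' by simp
  qed
  then show ?thesis by (rule pairings_subset_eq[OF m])
qed

lemma LP_dpath_inj:
  assumes "\<beta> \<in> LP N" "\<gamma> \<in> LP N" "\<And>j. j \<le> 2 * N \<Longrightarrow> dpath \<beta> j = dpath \<gamma> j"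
  shows "\<beta> = \<gamma>"
proof (rule LP_eqI[OF assms(1,2)])
  have m: "\<beta> \<in> pairings N" "\<gamma> \<in> pairings N" using assms LP_subset_pairings by blast+
  have sub: "Min ` m \<subseteq> {1..2*N}" if m: "m \<in> pairings N" for m
  proof
    fix i assume "i \<in> Min ` m"
    then obtain l where l: "l \<in> m" "i = Min l" by blast
    obtain u v where "l = {u, v}" "u < v" "u \<in> {1..2*N}" using pairings_link[OF m l(1)] by metis
    then show "i \<in> {1..2*N}" using l by simp
  qed
  have "i \<in> Min ` \<beta> \<longleftrightarrow> i \<in> Min ` \<gamma>" if "i \<in> {1..2*N}" for i
    using cpath_step[of i "Min ` \<beta>"] cpath_step[of i "Min ` \<gamma>"] assms(3)[of i] assms(3)[of "i - 1"] that
    unfolding dpath_eq_cpath by (auto split: if_splits)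
  then show "Min ` \<beta> = Min ` \<gamma>" using sub[OF m(1)] sub[OF m(2)] by blast
qed

text \<open>Elimination along the area under the path. Apart from its value 1 at
  \<open>\<alpha>\<close>, \<open>z \<alpha>\<close> lives on patterns of strictly larger area, so
  one subtraction clears the lowest level on which \<open>c\<close> is still nonzero;
  \<open>k\<close> counts the levels not yet cleared. Once no level is left,
  \<open>pluecker_eq_zero\<close> applies.\<close>

lemma pluecker_span_triangular:
  fixes z :: "nat set set \<Rightarrow> nat set set \<Rightarrow> 'a::real_normed_field"
  assumes L: "L \<subseteq> LP N"
    and z: "\<And>\<alpha>. \<alpha> \<in> L \<Longrightarrow> z \<alpha> \<in> pluecker N" "\<And>\<alpha>. \<alpha> \<in> L \<Longrightarrow> z \<alpha> \<alpha> = 1"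
    and tri: "\<And>\<alpha> \<gamma> j. \<alpha> \<in> L \<Longrightarrow> \<gamma> \<in> LP N \<Longrightarrow> z \<alpha> \<gamma> \<noteq> 0 \<Longrightarrow> j \<le> 2 * N \<Longrightarrow> dpath \<alpha> j \<le> dpath \<gamma> j"
    and z0: "\<And>\<alpha> \<gamma>. \<alpha> \<in> L \<Longrightarrow> \<gamma> \<in> LP N - L \<Longrightarrow> z \<alpha> \<gamma> = 0"
    and c: "c \<in> pluecker N" "\<And>\<gamma>. \<gamma> \<in> LP N - L \<Longrightarrow> c \<gamma> = 0"
  shows "\<exists>y. c = (\<lambda>m. \<Sum>\<alpha>\<in>L. y \<alpha> * z \<alpha> m)"
proof -
  define area where "area \<gamma> = (\<Sum>j\<le>2*N. dpath \<gamma> j)" for \<gamma>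
  \<comment> \<open>A crude bound for all areas: a path with unit steps has height at most
    \<open>j\<close> at \<open>j\<close>.\<close>
  define M where "M = (\<Sum>j\<le>2*N. int j)"
  have finL: "finite L" using L finite_LP finite_subset by blast
  have le_M: "area \<gamma> \<le> M" for \<gamma>
    unfolding area_def M_def dpath_eq_cpath by (rule sum_mono) (use cpath_bound in \<open>auto simp: abs_le_iff\<close>)
  have area_mono: "area \<alpha> \<le> area \<gamma>" "area \<alpha> = area \<gamma> \<Longrightarrow> \<alpha> = \<gamma>"
    if "\<alpha> \<in> L" "\<gamma> \<in> LP N" "z \<alpha> \<gamma> \<noteq> 0" for \<alpha> \<gamma>
  proof -
    show "area \<alpha> \<le> area \<gamma>" unfolding area_def by (rule sum_mono) (use tri that in auto)
    assume eq: "area \<alpha> = area \<gamma>"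
    have "\<forall>j\<in>{..2*N}. dpath \<gamma> j - dpath \<alpha> j = 0"
    proof (subst sum_nonneg_eq_0_iff[symmetric])
      show "(\<Sum>j\<le>2*N. dpath \<gamma> j - dpath \<alpha> j) = 0" using eq by (simp add: area_def sum_subtractf)
    qed (use tri[OF that] in auto)
    then show "\<alpha> = \<gamma>" using LP_dpath_inj[of \<alpha> N \<gamma>] that L by auto
  qed
  have "\<exists>y. c = (\<lambda>m. \<Sum>\<alpha>\<in>L. y \<alpha> * z \<alpha> m)"
    if "c \<in> pluecker N" "\<And>\<gamma>. \<gamma> \<in> LP N - L \<Longrightarrow> c \<gamma> = 0"
      "\<And>\<gamma>. \<gamma> \<in> LP N \<Longrightarrow> area \<gamma> < M + 1 - int k \<Longrightarrow> c \<gamma> = 0" for k c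
    using that
  proof (induction k arbitrary: c)
    case 0
    have "c m = 0" for m
      by (rule pluecker_eq_zero[OF 0(1)]) (use 0(3) le_M in \<open>auto simp: zless_add1_eq order_le_less\<close>)
    then show ?case by (intro exI[of _ "\<lambda>_. 0"]) auto
  next
    case (Suc k)
    define w where "w = (\<lambda>\<alpha>. if area \<alpha> = M - int k then c \<alpha> else 0)"
    define c' where "c' = (\<lambda>m. c m + (- 1) * (\<Sum>\<alpha>\<in>L. w \<alpha> * z \<alpha> m))"
    have "c' \<in> pluecker N"
      unfolding c'_def by (intro pluecker_add pluecker_scale pluecker_sum Suc.prems(1) z(1))
    moreover have "c' \<gamma> = 0" if "\<gamma> \<in> LP N - L" for \<gamma>
      using Suc.prems(2)[OF that] z0[OF _ that] by (simp add: c'_def)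
    moreover have "c' \<gamma> = 0" if \<gamma>: "\<gamma> \<in> LP N" "area \<gamma> < M + 1 - int k" for \<gamma>
    proof (cases "area \<gamma> = M - int k")
      case False
      then have lt: "area \<gamma> < M - int k" using \<gamma> by simp
      have "w \<alpha> * z \<alpha> \<gamma> = 0" if "\<alpha> \<in> L" for \<alpha>
        using area_mono(1)[OF that \<gamma>(1)] lt by (auto simp: w_def)
      then have "(\<Sum>\<alpha>\<in>L. w \<alpha> * z \<alpha> \<gamma>) = 0" by (rule sum.neutral[OF ballI])
      moreover have "c \<gamma> = 0" using Suc.prems(3)[OF \<gamma>(1)] lt by simp
      ultimately show ?thesis by (simp add: c'_def)
    next
      case True
      have "(\<Sum>\<alpha>\<in>L. w \<alpha> * z \<alpha> \<gamma>) = (\<Sum>\<alpha>\<in>L. if \<alpha> = \<gamma> then c \<gamma> else 0)"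
      proof (rule sum.cong[OF refl])
        fix \<alpha> assume "\<alpha> \<in> L"
        then show "w \<alpha> * z \<alpha> \<gamma> = (if \<alpha> = \<gamma> then c \<gamma> else 0)"
          using area_mono(2)[OF \<open>\<alpha> \<in> L\<close> \<gamma>(1)] True z(2)[OF \<open>\<alpha> \<in> L\<close>] by (auto simp: w_def)
      qed
      also have "\<dots> = c \<gamma>" using Suc.prems(2)[of \<gamma>] \<gamma>(1) finL by simp
      finally show ?thesis by (simp add: c'_def)
    qed
    ultimately obtain y where y: "c' = (\<lambda>m. \<Sum>\<alpha>\<in>L. y \<alpha> * z \<alpha> m)" using Suc.IH by blast
    have "c = (\<lambda>m. \<Sum>\<alpha>\<in>L. (y \<alpha> + w \<alpha>) * z \<alpha> m)"
    proof
      fix m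
      have "c' m = (\<Sum>\<alpha>\<in>L. y \<alpha> * z \<alpha> m)" using y by simp
      then show "c m = (\<Sum>\<alpha>\<in>L. (y \<alpha> + w \<alpha>) * z \<alpha> m)"
        by (simp add: c'_def distrib_right sum.distrib algebra_simps)
    qed
    then show ?case by (rule exI[of _ "\<lambda>\<alpha>. y \<alpha> + w \<alpha>"])
  qed
  moreover have "c \<gamma> = 0" if "\<gamma> \<in> LP N" "area \<gamma> < M + 1 - int (nat (M + 1))" for \<gamma>
  proof -
    have "0 \<le> area \<gamma>"
      unfolding area_def using that(1) LP_subset_pairings by (intro sum_nonneg) (auto intro: dpath_nonneg)
    then show ?thesis using that(2) by linarith
  qed
  ultimately show ?thesis using c by blast
qed

section \<open>Determinants of link patterns\<close>

lemma left_right_end: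
  assumes m: "\<beta> \<in> pairings N"
  shows "bicolour N (left_end \<beta>) (right_end \<beta>)" "left_end \<beta> ` {0..<N} = Min ` \<beta>"
    "link_up N (left_end \<beta>) (right_end \<beta>) id = \<beta>"
proof -
  have fin: "finite \<beta>" by (rule pairings_finite[OF m])
  have inj: "inj_on Min \<beta>"
  proof (rule inj_onI)
    fix l l' assume l: "l \<in> \<beta>" "l' \<in> \<beta>" "Min l = Min l'"
    have "Min l \<in> l" "Min l' \<in> l'" using l pairings_link[OF m] by (metis Min_in finite.simps insert_not_empty)+
    then show "l = l'" using pairings_unique_link[OF m l(1,2)] l(3) by auto
  qed
  have card: "card (Min ` \<beta>) = N" using card_image[OF inj] card_pairings[OF m] by simp
  let ?xs = "sorted_list_of_set (Min ` \<beta>)"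
  have len: "length ?xs = N" using card by simp
  have le: "left_end \<beta> = (!) ?xs" by (simp add: left_end_def fun_eq_iff)
  show img: "left_end \<beta> ` {0..<N} = Min ` \<beta>"
    unfolding le using nth_image[of N ?xs] len fin by (simp add: atLeast0LessThan lessThan_def)
  have injl: "inj_on (left_end \<beta>) {0..<N}"
    unfolding le using inj_on_nth[of ?xs "{0..<N}"] len by simp
  have ex: "{left_end \<beta> k, right_end \<beta> k} \<in> \<beta> \<and> left_end \<beta> k < right_end \<beta> k" if "k < N" for k
  proof -
    have "left_end \<beta> k \<in> Min ` \<beta>" using that img by force
    then obtain l where l: "l \<in> \<beta>" "Min l = left_end \<beta> k" by auto
    then have "(THE l. l \<in> \<beta> \<and> Min l = left_end \<beta> k) = l"
      using inj by (intro the_equality) (auto simp: inj_on_def)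
    then have r: "right_end \<beta> k = Max l" by (simp add: right_end_def)
    obtain a b where "l = {a, b}" "a < b" using pairings_link[OF m l(1)] by metis
    then show ?thesis using r l by auto
  qed
  show lu: "link_up N (left_end \<beta>) (right_end \<beta>) id = \<beta>"
  proof (rule antisym; rule subsetI)
    fix l assume "l \<in> link_up N (left_end \<beta>) (right_end \<beta>) id"
    then show "l \<in> \<beta>" using ex by (auto simp: link_up_def)
  next
    fix l assume l: "l \<in> \<beta>"
    then have "Min l \<in> left_end \<beta> ` {0..<N}" using img by simp
    then obtain k where k: "k < N" "Min l = left_end \<beta> k" by auto
    have "Min {left_end \<beta> k, right_end \<beta> k} = Min l" using ex[OF k(1)] k(2) by simp
    then have "l = {left_end \<beta> k, right_end \<beta> k}" using inj l ex[OF k(1)] by (metis inj_onD)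
    then show "l \<in> link_up N (left_end \<beta>) (right_end \<beta>) id" using k by (auto simp: link_up_def)
  qed
  have un: "left_end \<beta> ` {0..<N} \<union> right_end \<beta> ` {0..<N} = {1..2*N}"
  proof -
    have "\<Union>\<beta> = {1..2*N}" using m by (simp add: pairings_def partition_on_def)
    moreover have "\<Union>\<beta> = left_end \<beta> ` {0..<N} \<union> right_end \<beta> ` {0..<N}"
      by (subst lu[symmetric]) (auto simp: link_up_def)
    ultimately show ?thesis by simp
  qed
  have dis: "left_end \<beta> ` {0..<N} \<inter> right_end \<beta> ` {0..<N} = {}"
  proof -
    have "right_end \<beta> k \<notin> Min ` \<beta>" if "k < N" for k using ex[OF that] pairings_Min(2)[OF m] by blast
    then show ?thesis unfolding img by (metis (no_types, lifting) atLeastLessThan_iff disjoint_iff imageE)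
  qed
  have "inj_on (right_end \<beta>) {0..<N}"
  proof (rule inj_onI)
    fix j k assume jk: "j \<in> {0..<N}" "k \<in> {0..<N}" "right_end \<beta> j = right_end \<beta> k"
    then have "left_end \<beta> j = left_end \<beta> k"
      using pairings_unique[OF m, of "right_end \<beta> j"] ex[of j] ex[of k] by (simp add: insert_commute)
    then show "j = k" using injl jk by (auto dest: inj_onD)
  qed
  then show "bicolour N (left_end \<beta>) (right_end \<beta>)"
    using injl dis un by (simp add: bicolour_def)
qed

text \<open>The coefficients of the determinant of a link pattern when it is expanded into products
  of kernels over pairings.\<close>

definition lcoef :: "nat \<Rightarrow> nat set set \<Rightarrow> nat set set \<Rightarrow> 'a::real_normed_field" where
  "lcoef N \<beta> = fcoef N (left_end \<beta>) (right_end \<beta>)"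

lemma lcoef_pluecker: "\<beta> \<in> pairings N \<Longrightarrow> lcoef N \<beta> \<in> pluecker N"
  unfolding lcoef_def by (intro fcoef_pluecker left_right_end)

lemma lcoef_self:
  assumes "\<beta> \<in> pairings N"
  shows "lcoef N \<beta> \<beta> = (1::'a::real_normed_field)"
  using fcoef_link_up[OF left_right_end(1)[OF assms] permutes_id, where ?'a = 'a]
  unfolding left_right_end(3)[OF assms] lcoef_def by (simp add: sign_id)

lemma lcoef_nonzero_bichromatic:
  assumes "\<beta> \<in> pairings N" "lcoef N \<beta> m \<noteq> (0::'a::real_normed_field)" "{u, v} \<in> m"
  shows "u \<in> Min ` \<beta> \<longleftrightarrow> v \<notin> Min ` \<beta>"
proof -
  note bic = left_right_end(1)[OF assms(1)]
  obtain \<pi> where \<pi>: "\<pi> permutes {0..<N}" "m = link_up N (left_end \<beta>) (right_end \<beta>) \<pi>"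
    using fcoef_other[OF bic, of m, where ?'a = 'a] assms(2) unfolding lcoef_def by metis
  then obtain k where k: "k < N" "{u, v} = {left_end \<beta> k, right_end \<beta> (\<pi> k)}"
    using assms(3) by (auto simp: link_up_def)
  have k': "\<pi> k < N" by (rule permutes_lt[OF bic \<pi>(1) k(1)])
  have "left_end \<beta> k \<in> Min ` \<beta>" unfolding left_right_end(2)[OF assms(1), symmetric] using k by simp
  moreover have "right_end \<beta> (\<pi> k) \<notin> Min ` \<beta>"
    unfolding left_right_end(2)[OF assms(1), symmetric] using bicolourD(3)[OF bic _ k'] by fastforce
  ultimately show ?thesis using k(2) by (auto simp: doubleton_eq_iff)
qed

text \<open>Every pairing in the expansion is bichromatic for the left and right ends of
  \<open>\<beta>\<close>, which is the situation of \<open>cpath_le_dpath\<close>.\<close>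

lemma lcoef_triangular:
  assumes "\<beta> \<in> pairings N" "m \<in> pairings N" "lcoef N \<beta> m \<noteq> (0::'a::real_normed_field)" "j \<le> 2 * N"
  shows "dpath \<beta> j \<le> dpath m j"
  using cpath_le_dpath[OF assms(2,4)] lcoef_nonzero_bichromatic[OF assms(1,3)]
  by (simp add: dpath_eq_cpath[of \<beta>])

section \<open>Fused kernels and their derivatives\<close>

text \<open>The derivative of order \<open>p\<close> in x and \<open>q\<close> in y of 1 / (pi (x -
  y)^2), at x - y = \<open>t\<close>; the signs of the y-derivatives cancel. Division by zero gives
  the value 0 at \<open>t = 0\<close>, which agrees with the convention for two points of one
  block.\<close>

definition kap :: "nat \<Rightarrow> nat \<Rightarrow> real \<Rightarrow> real" where
  "kap p q t = (- 1) ^ p * fact (p + q + 1) / (pi * t ^ (p + q + 2))"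

text \<open>Makes the value of a link independent of its orientation, so \<open>klink\<close> may
  orient it by \<open>Min\<close> and \<open>Max\<close>.\<close>

lemma kap_minus: "kap q p (- t) = kap p q t"
proof -
  have "kap q p (- t) = (- 1) ^ q * fact (q + p + 1) / (pi * ((- 1) ^ (p + q) * t ^ (p + q + 2)))"
    unfolding kap_def power_minus[of t] by (simp add: add.commute)
  also have "\<dots> = kap p q t"
    unfolding kap_def by (cases "even p"; cases "even q") (simp_all add: add.commute)
  finally show ?thesis .
qed

lemma kap_zero [simp]: "kap p q 0 = 0"
  by (simp add: kap_def)

lemma kap_Suc_right: "kap p (Suc q) t = - kap (Suc p) q t"
  by (simp add: kap_def)

lemma inverse_power_DERIV:
  fixes t :: real
  assumes "t \<noteq> 0"
  shows "((\<lambda>t. C / t ^ Suc k) has_real_derivative - (C * real (Suc k)) / t ^ Suc (Suc k)) (at t)"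
proof -
  have "((\<lambda>t. t ^ Suc k) has_real_derivative real (Suc k) * t ^ k) (at t)"
    using DERIV_pow[of "Suc k" t] by simp
  from DERIV_divide[OF DERIV_const[of C] this] assms
  have "((\<lambda>t. C / t ^ Suc k) has_real_derivative
      (0 * t ^ Suc k - C * (real (Suc k) * t ^ k)) / (t ^ Suc k * t ^ Suc k)) (at t)" by simp
  moreover have "(0 * t ^ Suc k - C * (real (Suc k) * t ^ k)) / (t ^ Suc k * t ^ Suc k) = - (C * real (Suc k)) / t ^ Suc (Suc k)"
    using assms by (simp add: field_simps)
  ultimately show ?thesis by simp
qed

lemma kap_DERIV:
  assumes "t \<noteq> 0"
  shows "(kap p q has_real_derivative kap (Suc p) q t) (at t)"
proof -
  define C :: real where "C = (- 1) ^ p * fact (p + q + 1) / pi"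
  have "kap p q = (\<lambda>t. C / t ^ Suc (p + q + 1))" by (simp add: kap_def C_def fun_eq_iff)
  moreover have "- (C * real (Suc (p + q + 1))) / t ^ Suc (Suc (p + q + 1)) = kap (Suc p) q t"
  proof -
    have "fact (Suc p + q + 1) = real (Suc (p + q + 1)) * fact (p + q + 1)" by simp
    then show ?thesis by (simp add: kap_def C_def mult_ac del: fact_Suc of_nat_Suc)
  qed
  ultimately show ?thesis using inverse_power_DERIV[OF assms, of C "p + q + 1"] by simp
qed

definition klink :: "(nat \<Rightarrow> nat) \<Rightarrow> (nat \<Rightarrow> real) \<Rightarrow> nat set \<Rightarrow> real" where
  "klink e x l = kap (e (Min l)) (e (Max l)) (x (Min l) - x (Max l))"

definition kprod :: "(nat \<Rightarrow> nat) \<Rightarrow> (nat \<Rightarrow> real) \<Rightarrow> nat set set \<Rightarrow> real" where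
  "kprod e x m = (\<Prod>l\<in>m. klink e x l)"

lemma klink_pair: "klink e x {a, b} = kap (e a) (e b) (x a - x b)"
proof (rule linorder_cases[of a b])
  assume "b < a"
  then have "klink e x {a, b} = kap (e b) (e a) (x b - x a)" by (simp add: klink_def)
  also have "\<dots> = kap (e a) (e b) (x a - x b)" using kap_minus[of "e b" "e a" "x a - x b"] by simp
  finally show ?thesis .
qed (auto simp: klink_def)

lemma kprod_cong:
  assumes "m \<in> pairings N" "\<And>j. j \<in> {1..2*N} \<Longrightarrow> e j = e' j" "\<And>j. j \<in> {1..2*N} \<Longrightarrow> x j = x' j"
  shows "kprod e x m = kprod e' x' m"
  unfolding kprod_def
proof (rule prod.cong[OF refl])
  fix l assume "l \<in> m"
  then obtain a b where "l = {a, b}" "a \<in> {1..2*N}" "b \<in> {1..2*N}" using pairings_link[OF assms(1)] by metis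
  then show "klink e x l = klink e' x' l" using assms(2,3) by (simp add: klink_pair)
qed

lemma kprod_pact:
  assumes m: "m \<in> pairings N" and \<sigma>: "inj \<sigma>"
  shows "kprod e x (pact \<sigma> m) = kprod (e \<circ> \<sigma>) (x \<circ> \<sigma>) m"
proof -
  have "inj_on ((`) \<sigma>) m" using \<sigma> by (auto simp: inj_on_def inj_image_eq_iff)
  then have "kprod e x (pact \<sigma> m) = (\<Prod>l\<in>m. klink e x (\<sigma> ` l))"
    unfolding kprod_def pact_def by (simp add: prod.reindex)
  also have "\<dots> = kprod (e \<circ> \<sigma>) (x \<circ> \<sigma>) m"
    unfolding kprod_def
  proof (rule prod.cong[OF refl])
    fix l assume "l \<in> m"
    then obtain a b where "l = {a, b}" using pairings_link[OF m] by metis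
    then show "klink e x (\<sigma> ` l) = klink (e \<circ> \<sigma>) (x \<circ> \<sigma>) l" by (simp add: klink_pair)
  qed
  finally show ?thesis .
qed

text \<open>The partial derivative, of order \<open>e j\<close> in the \<open>j\<close>-th variable,
  of the rational function with coefficients \<open>c\<close> on the pairings.\<close>

definition wsum :: "nat \<Rightarrow> (nat set set \<Rightarrow> 'a::real_normed_field) \<Rightarrow> (nat \<Rightarrow> nat) \<Rightarrow> (nat \<Rightarrow> real) \<Rightarrow> 'a" where
  "wsum N c e x = (\<Sum>m\<in>pairings N. c m * of_real (kprod e x m))"

lemma wsum_cong:
  assumes "\<And>j. j \<in> {1..2*N} \<Longrightarrow> e j = e' j" "\<And>j. j \<in> {1..2*N} \<Longrightarrow> x j = x' j"
  shows "wsum N c e x = wsum N c e' x'"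
  unfolding wsum_def using kprod_cong assms by (intro sum.cong refl) metis

text \<open>No kernel that occurs with a nonzero coefficient sits at its pole. Points may coincide
  as long as no such pairing links them.\<close>

definition separates :: "nat \<Rightarrow> (nat set set \<Rightarrow> 'a::zero) \<Rightarrow> (nat \<Rightarrow> real) \<Rightarrow> bool" where
  "separates N c x \<longleftrightarrow> (\<forall>m\<in>pairings N. c m \<noteq> 0 \<longrightarrow> (\<forall>a b. {a, b} \<in> m \<longrightarrow> x a \<noteq> x b))"

definition antisym_pair :: "nat \<Rightarrow> (nat set set \<Rightarrow> 'a::uminus) \<Rightarrow> nat \<Rightarrow> nat \<Rightarrow> bool" where
  "antisym_pair N c a b \<longleftrightarrow> a \<in> {1..2*N} \<and> b \<in> {1..2*N} \<and> a \<noteq> b \<and>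
     (\<forall>m\<in>pairings N. c (pact (swp a b) m) = - c m)"

lemma sum_pairings_pact:
  fixes g :: "nat set set \<Rightarrow> 'b::comm_monoid_add"
  assumes \<sigma>: "\<sigma> permutes {1..2*N}"
  shows "(\<Sum>m\<in>pairings N. g (pact \<sigma> m)) = (\<Sum>m\<in>pairings N. g m)"
proof (rule sum.reindex_bij_witness[where i = "pact (inv_into UNIV \<sigma>)" and j = "pact \<sigma>"])
qed (auto simp: pact_comp permutes_inv_o[OF \<sigma>] intro: pact_pairings[OF \<sigma>] pact_pairings[OF permutes_inv[OF \<sigma>]])

text \<open>The exchange of the two points preserves exponents and positions but reverses the sign
  of \<open>c\<close>, so the sum equals its own negative.\<close>

lemma wsum_antisym_zero:
  assumes anti: "antisym_pair N c a b" and "e a = e b" "x a = x b"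
  shows "wsum N c e x = 0"
proof -
  have ab: "a \<in> {1..2*N}" "b \<in> {1..2*N}" using anti by (auto simp: antisym_pair_def)
  have inv: "e \<circ> swp a b = e" "x \<circ> swp a b = x" using assms by (auto simp: Transposition.transpose_def)
  have "wsum N c e x = (\<Sum>m\<in>pairings N. c (pact (swp a b) m) * of_real (kprod e x (pact (swp a b) m)))"
    unfolding wsum_def by (rule sum_pairings_pact[OF swp_permutes[OF ab], symmetric])
  also have "\<dots> = (\<Sum>m\<in>pairings N. - (c m * of_real (kprod e x m)))"
  proof (rule sum.cong[OF refl])
    fix m assume m: "m \<in> pairings N"
    show "c (pact (swp a b) m) * of_real (kprod e x (pact (swp a b) m)) = - (c m * of_real (kprod e x m))"
      using anti m kprod_pact[OF m inj_transpose, of e x a b] unfolding inv by (simp add: antisym_pair_def)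
  qed
  also have "\<dots> = - wsum N c e x" by (simp add: wsum_def sum_negf)
  finally show ?thesis by (rule eq_neg_self)
qed

lemma klink_DERIV:
  assumes l: "l = {u, w}" "u \<noteq> w" "x u \<noteq> x w"
  shows "((\<lambda>t. klink e (\<lambda>j. x j + t * v j) l) has_real_derivative
      (\<Sum>j\<in>l. v j * klink (e(j := Suc (e j))) x l)) (at 0)"
proof -
  have "((\<lambda>t. (x u - x w) + t * (v u - v w)) has_real_derivative (v u - v w)) (at 0)"
    by (auto intro!: derivative_eq_intros)
  moreover have "(kap (e u) (e w) has_real_derivative kap (Suc (e u)) (e w) (x u - x w))
      (at ((x u - x w) + 0 * (v u - v w)))" using kap_DERIV[of "x u - x w"] l(3) by simp
  ultimately have "((\<lambda>t. kap (e u) (e w) ((x u - x w) + t * (v u - v w))) has_real_derivative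
      kap (Suc (e u)) (e w) (x u - x w) * (v u - v w)) (at 0)"
    by (rule DERIV_chain2[rotated])
  moreover have "(\<lambda>t. kap (e u) (e w) ((x u - x w) + t * (v u - v w))) = (\<lambda>t. klink e (\<lambda>j. x j + t * v j) l)"
    by (simp add: l klink_pair algebra_simps)
  moreover have "kap (Suc (e u)) (e w) (x u - x w) * (v u - v w) = (\<Sum>j\<in>l. v j * klink (e(j := Suc (e j))) x l)"
    using l(2) by (simp add: l klink_pair kap_Suc_right algebra_simps)
  ultimately show ?thesis by simp
qed

lemma prod_DERIV:
  fixes f :: "'i \<Rightarrow> real \<Rightarrow> real"
  assumes "finite A" "\<And>i. i \<in> A \<Longrightarrow> (f i has_real_derivative f' i) (at t)"
  shows "((\<lambda>t. \<Prod>i\<in>A. f i t) has_real_derivative (\<Sum>i\<in>A. f' i * (\<Prod>k\<in>A - {i}. f k t))) (at t)"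
  using assms
proof (induction A rule: finite_induct)
  case (insert a A)
  have "((\<lambda>t. f a t * (\<Prod>i\<in>A. f i t)) has_real_derivative
      f' a * (\<Prod>i\<in>A. f i t) + (\<Sum>i\<in>A. f' i * (\<Prod>k\<in>A - {i}. f k t)) * f a t) (at t)"
    using insert by (intro DERIV_mult) auto
  moreover have "(\<Sum>i\<in>A. f' i * (\<Prod>k\<in>A - {i}. f k t)) * f a t = (\<Sum>i\<in>A. f' i * (\<Prod>k\<in>insert a A - {i}. f k t))"
    unfolding sum_distrib_right
  proof (rule sum.cong[OF refl])
    fix i assume "i \<in> A"
    then have "insert a A - {i} = insert a (A - {i})" using insert by auto
    then show "f' i * (\<Prod>k\<in>A - {i}. f k t) * f a t = f' i * (\<Prod>k\<in>insert a A - {i}. f k t)"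
      using insert by (simp add: algebra_simps)
  qed
  ultimately show ?case using insert by simp
qed simp

lemma kprod_DERIV:
  assumes m: "m \<in> pairings N" and sep: "\<And>a b. {a, b} \<in> m \<Longrightarrow> x a \<noteq> x b"
  shows "((\<lambda>t. kprod e (\<lambda>j. x j + t * v j) m) has_real_derivative
      (\<Sum>j=1..2*N. v j * kprod (e(j := Suc (e j))) x m)) (at 0)"
proof -
  have "((\<lambda>t. \<Prod>l\<in>m. klink e (\<lambda>j. x j + t * v j) l) has_real_derivative
      (\<Sum>l\<in>m. (\<Sum>j\<in>l. v j * klink (e(j := Suc (e j))) x l) * (\<Prod>k\<in>m - {l}. klink e (\<lambda>j. x j + 0 * v j) k))) (at 0)"
  proof (rule prod_DERIV[OF pairings_finite[OF m]])
    fix l assume l: "l \<in> m"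
    then obtain a b where "l = {a, b}" "a \<noteq> b" using pairings_link[OF m] by (metis less_irrefl)
    then show "((\<lambda>t. klink e (\<lambda>j. x j + t * v j) l) has_real_derivative
      (\<Sum>j\<in>l. v j * klink (e(j := Suc (e j))) x l)) (at 0)"
      using sep[of a b] l by (intro klink_DERIV) auto
  qed
  moreover have "(\<Sum>j\<in>l. v j * klink (e(j := Suc (e j))) x l) * (\<Prod>k\<in>m - {l}. klink e (\<lambda>j. x j + 0 * v j) k)
      = (\<Sum>j\<in>l. v j * kprod (e(j := Suc (e j))) x m)" if l: "l \<in> m" for l
    unfolding sum_distrib_right
  proof (rule sum.cong[OF refl])
    fix j assume j: "j \<in> l"
    have "(\<Prod>k\<in>m - {l}. klink e (\<lambda>j. x j + 0 * v j) k) = (\<Prod>k\<in>m - {l}. klink (e(j := Suc (e j))) x k)"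
    proof (rule prod.cong[OF refl])
      fix k assume k: "k \<in> m - {l}"
      then have "j \<notin> k" using pairings_unique_link[OF m l, of k j] j by auto
      moreover obtain a b where "k = {a, b}" using pairings_link[OF m, of k] k by blast
      ultimately show "klink e (\<lambda>j. x j + 0 * v j) k = klink (e(j := Suc (e j))) x k"
        by (auto simp: klink_pair)
    qed
    then show "v j * klink (e(j := Suc (e j))) x l * (\<Prod>k\<in>m - {l}. klink e (\<lambda>j. x j + 0 * v j) k)
        = v j * kprod (e(j := Suc (e j))) x m"
      unfolding kprod_def using prod.remove[OF pairings_finite[OF m] l, of "klink (e(j := Suc (e j))) x"] by simp
  qed
  then have "(\<Sum>l\<in>m. (\<Sum>j\<in>l. v j * klink (e(j := Suc (e j))) x l) * (\<Prod>k\<in>m - {l}. klink e (\<lambda>j. x j + 0 * v j) k))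
      = (\<Sum>j=1..2*N. v j * kprod (e(j := Suc (e j))) x m)"
    unfolding sum_links[OF m] by (rule sum.cong[OF refl])
  ultimately show ?thesis unfolding kprod_def[of e] by (simp only:)
qed

lemma wsum_DERIV:
  fixes c :: "nat set set \<Rightarrow> real"
  assumes "separates N c x"
  shows "((\<lambda>t. wsum N c e (\<lambda>j. x j + t * v j)) has_real_derivative
      (\<Sum>j=1..2*N. v j * wsum N c (e(j := Suc (e j))) x)) (at 0)"
proof -
  have "((\<lambda>t. c m * kprod e (\<lambda>j. x j + t * v j) m) has_real_derivative
      c m * (\<Sum>j=1..2*N. v j * kprod (e(j := Suc (e j))) x m)) (at 0)" if m: "m \<in> pairings N" for m
  proof (cases "c m = 0")
    case False
    then show ?thesis using assms m by (intro DERIV_cmult kprod_DERIV) (auto simp: separates_def)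
  qed simp
  then have "((\<lambda>t. \<Sum>m\<in>pairings N. c m * kprod e (\<lambda>j. x j + t * v j) m) has_real_derivative
      (\<Sum>m\<in>pairings N. c m * (\<Sum>j=1..2*N. v j * kprod (e(j := Suc (e j))) x m))) (at 0)"
    by (intro DERIV_sum) auto
  moreover have "(\<Sum>m\<in>pairings N. c m * (\<Sum>j=1..2*N. v j * kprod (e(j := Suc (e j))) x m))
      = (\<Sum>j=1..2*N. v j * wsum N c (e(j := Suc (e j))) x)"
    unfolding wsum_def sum_distrib_left by (subst sum.swap) (simp add: algebra_simps)
  ultimately show ?thesis by (simp add: wsum_def)
qed

lemma wsum_DERIV_coord:
  fixes c :: "nat set set \<Rightarrow> real"
  assumes sep: "separates N c (x(a := t))" and a: "a \<in> {1..2*N}"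
  shows "((\<lambda>t. wsum N c e (x(a := t))) has_real_derivative wsum N c (e(a := Suc (e a))) (x(a := t))) (at t)"
proof -
  define v :: "nat \<Rightarrow> real" where "v = (\<lambda>j. if j = a then 1 else 0)"
  have "((\<lambda>h. wsum N c e (\<lambda>j. (x(a := t)) j + h * v j)) has_real_derivative
      (\<Sum>j=1..2*N. v j * wsum N c (e(j := Suc (e j))) (x(a := t)))) (at 0)"
    by (rule wsum_DERIV[OF sep])
  moreover have "(\<Sum>j=1..2*N. v j * wsum N c (e(j := Suc (e j))) (x(a := t))) = wsum N c (e(a := Suc (e a))) (x(a := t))"
    using a by (simp add: v_def if_distrib[of "\<lambda>y. y * _"] sum.delta cong: if_cong)
  moreover have "(\<lambda>j. (x(a := t)) j + h * v j) = x(a := t + h)" for h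
    by (auto simp: v_def)
  ultimately have "((\<lambda>h. wsum N c e (x(a := t + h))) has_real_derivative wsum N c (e(a := Suc (e a))) (x(a := t))) (at 0)"
    by simp
  then show ?thesis
    using DERIV_shift[of "\<lambda>t. wsum N c e (x(a := t))" _ 0 t] by (simp add: add.commute)
qed

lemma kprod_tendsto:
  assumes m: "m \<in> pairings N" and lim: "\<And>j. j \<in> {1..2*N} \<Longrightarrow> ((\<lambda>z. X z j) \<longlongrightarrow> x j) F"
    and sep: "\<And>a b. {a, b} \<in> m \<Longrightarrow> x a \<noteq> x b"
  shows "((\<lambda>z. kprod e (X z) m) \<longlongrightarrow> kprod e x m) F"
  unfolding kprod_def
proof (rule tendsto_prod)
  fix l assume l: "l \<in> m"
  then obtain a b where ab: "l = {a, b}" "a \<in> {1..2*N}" "b \<in> {1..2*N}" using pairings_link[OF m] by metis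
  have "((\<lambda>z. kap (e a) (e b) (X z a - X z b)) \<longlongrightarrow> kap (e a) (e b) (x a - x b)) F"
    using sep[of a b] l ab by (intro isCont_tendsto_compose[OF DERIV_isCont[OF kap_DERIV]] tendsto_diff lim) auto
  then show "((\<lambda>z. klink e (X z) l) \<longlongrightarrow> klink e x l) F" by (simp add: ab klink_pair)
qed

lemma wsum_tendsto:
  assumes "\<And>j. j \<in> {1..2*N} \<Longrightarrow> ((\<lambda>z. X z j) \<longlongrightarrow> x j) F" "separates N c x"
  shows "((\<lambda>z. wsum N c e (X z)) \<longlongrightarrow> wsum N c e x) F"
  unfolding wsum_def
proof (rule tendsto_sum)
  fix m assume m: "m \<in> pairings N"
  show "((\<lambda>z. c m * of_real (kprod e (X z) m)) \<longlongrightarrow> c m * of_real (kprod e x m)) F"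
  proof (cases "c m = 0")
    case False
    then show ?thesis using assms m
      by (intro tendsto_mult tendsto_const tendsto_of_real kprod_tendsto[OF m]) (auto simp: separates_def)
  qed simp
qed

section \<open>Mean value theorem with several zeros\<close>

text \<open>Rolle's theorem between neighbouring zeros. The bound \<open>Max Z\<close> on the new
  zeros makes the one found between the two largest zeros distinct from those of the induction
  hypothesis.\<close>

lemma zeros_of_derivative:
  fixes f f' :: "real \<Rightarrow> real"
  assumes der: "\<And>z. z \<in> {u<..<v} \<Longrightarrow> (f has_real_derivative f' z) (at z)"
    and "finite Z" "card Z = Suc k" "Z \<subseteq> {u<..<v}" "\<And>z. z \<in> Z \<Longrightarrow> f z = 0"
  shows "\<exists>Z'. finite Z' \<and> card Z' = k \<and> Z' \<subseteq> {u<..<Max Z} \<and> (\<forall>z\<in>Z'. f' z = 0)"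
  using assms(2-)
proof (induction k arbitrary: Z)
  case 0
  then show ?case by (intro exI[of _ "{}"]) auto
next
  case (Suc k)
  define b where "b = Max Z"
  define Y where "Y = Z - {b}"
  have ne: "Z \<noteq> {}" using Suc by auto
  have b: "b \<in> Z" unfolding b_def using Suc ne by simp
  have Y: "finite Y" "card Y = Suc k" "Y \<subseteq> {u<..<v}" "\<And>z. z \<in> Y \<Longrightarrow> f z = 0"
    using Suc.prems b by (auto simp: Y_def)
  define a where "a = Max Y"
  have "Y \<noteq> {}" using Y(2) by auto
  then have a: "a \<in> Y" unfolding a_def using Y(1) by simp
  have "a \<le> b" unfolding b_def using a Suc.prems by (auto simp: Y_def)
  then have ab: "a < b" using a by (auto simp: Y_def)
  obtain Z' where Z': "finite Z'" "card Z' = k" "Z' \<subseteq> {u<..<a}" "\<forall>z\<in>Z'. f' z = 0"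
    using Suc.IH[OF Y] by (auto simp: a_def)
  have rng: "\<And>z. a \<le> z \<Longrightarrow> z \<le> b \<Longrightarrow> z \<in> {u<..<v}" using a b Y(3) Suc.prems(3) by force
  obtain w where w: "a < w" "w < b" "f' w = 0"
  proof -
    have "\<exists>w. a < w \<and> w < b \<and> (\<lambda>h. f' w * h) = (\<lambda>v. 0)"
    proof (rule Rolle_deriv[OF ab])
      show "f a = f b" using Y(4)[OF a] Suc.prems(4)[OF b] by simp
      show "continuous_on {a..b} f"
        by (rule DERIV_continuous_on) (use der rng in \<open>auto intro: has_field_derivative_at_within\<close>)
      show "(f has_derivative (\<lambda>h. f' z * h)) (at z)" if "a < z" "z < b" for z
        using der[of z] rng[of z] that by (simp add: has_field_derivative_def)
    qed
    then obtain w where "a < w" "w < b" "(\<lambda>h. f' w * h) = (\<lambda>v. 0)" by blast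
    moreover from this(3) have "f' w = 0" by (metis mult.right_neutral)
    ultimately show ?thesis using that by blast
  qed
  have "w \<notin> Z'" using w Z' by auto
  then have "card (insert w Z') = Suc k" using Z' by simp
  moreover have "insert w Z' \<subseteq> {u<..<Max Z}" using Z'(3) w rng[of w] ab unfolding b_def[symmetric] by auto
  ultimately show ?case using Z' w by (intro exI[of _ "insert w Z'"]) auto
qed

lemma zero_of_iterated_derivative:
  fixes f :: "nat \<Rightarrow> real \<Rightarrow> real"
  assumes "\<And>i z. z \<in> {u<..<v} \<Longrightarrow> (f i has_real_derivative f (Suc i) z) (at z)"
    and "finite Z" "card Z = Suc k" "Z \<subseteq> {u<..<v}" "\<And>z. z \<in> Z \<Longrightarrow> f 0 z = 0"
  shows "\<exists>z\<in>{u<..<v}. f k z = 0"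
  using assms
proof (induction k arbitrary: Z f)
  case 0
  then obtain z where "Z = {z}" by (auto simp: card_Suc_eq)
  then show ?case using 0 by auto
next
  case (Suc k)
  obtain Z' where Z': "finite Z'" "card Z' = Suc k" "Z' \<subseteq> {u<..<Max Z}" "\<forall>z\<in>Z'. f 1 z = 0"
    using zeros_of_derivative[of u v "f 0" "f 1" Z "Suc k"] Suc.prems by force
  have "Max Z \<in> Z" using Suc.prems by (intro Max_in) auto
  then have "Z' \<subseteq> {u<..<v}" using Z'(3) Suc.prems(4) by force
  then have "\<exists>z\<in>{u<..<v}. f (Suc k) z = 0"
    using Suc.IH[of "\<lambda>i. f (Suc i)" Z'] Suc.prems(1) Z' by auto
  then show ?case .
qed

lemma prod_linear_monic:
  assumes "finite (X :: real set)"
  shows "degree (\<Prod>w\<in>X. [:- w, 1:]) = card X \<and> lead_coeff (\<Prod>w\<in>X. [:- w, 1:]) = 1"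
  using assms
proof (induction X rule: finite_induct)
  case (insert w X)
  let ?P = "\<Prod>w\<in>X. [:- w, 1:]"
  have "?P \<noteq> 0" using insert by auto
  then have "degree ([:- w, 1:] * ?P) = Suc (card X)"
    using insert by (subst degree_mult_eq) auto
  moreover have "lead_coeff ([:- w, 1:] * ?P) = 1"
  proof -
    have lc: "lead_coeff ?P = 1" using insert(3) by blast
    show ?thesis unfolding lead_coeff_mult lc by simp
  qed
  ultimately show ?case
    unfolding prod.insert[OF insert(1,2)] card_insert_disjoint[OF insert(1,2)] by simp
qed simp

lemma higher_pderiv_monic:
  fixes p :: "real poly"
  assumes "degree p = k" "lead_coeff p = 1"
  shows "(pderiv ^^ k) p = [:fact k:]"
proof -
  have "degree ((pderiv ^^ k) p) = 0" using assms(1) by (simp add: degree_higher_pderiv)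
  moreover have "coeff ((pderiv ^^ k) p) 0 = fact k"
    using assms by (simp add: coeff_higher_pderiv pochhammer_fact)
  ultimately show ?thesis by (metis degree_eq_zeroE coeff_pCons_0)
qed

text \<open>The remainder formula of polynomial interpolation for the interpolant 0. With
  \<open>C\<close> chosen so that the function minus \<open>C\<close> times the monic polynomial
  \<open>p\<close> also vanishes at \<open>z\<close>, there is one more zero than
  \<open>card X\<close>, and the derivative of \<open>p\<close> of order \<open>card X\<close> is a
  factorial.\<close>

lemma mean_value_zeros:
  fixes f :: "nat \<Rightarrow> real \<Rightarrow> real"
  assumes der: "\<And>i z. z \<in> {u<..<v} \<Longrightarrow> (f i has_real_derivative f (Suc i) z) (at z)"
    and X: "finite X" "X \<subseteq> {u<..<v}" "\<And>w. w \<in> X \<Longrightarrow> f 0 w = 0" and z: "z \<in> {u<..<v}"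
  shows "\<exists>\<eta>\<in>{u<..<v}. f 0 z = (\<Prod>w\<in>X. z - w) * f (card X) \<eta> / fact (card X)"
proof (cases "z \<in> X")
  case True
  then have "(\<Prod>w\<in>X. z - w) = 0" using X(1) by auto
  then show ?thesis using X(3)[OF True] z by auto
next
  case False
  define p where "p = (\<Prod>w\<in>X. [:- w, 1:])"
  have polyp: "poly p y = (\<Prod>w\<in>X. y - w)" for y by (simp add: p_def poly_prod)
  have "poly p z \<noteq> 0" using False X(1) by (auto simp: polyp)
  define C where "C = f 0 z / poly p z"
  define g where "g = (\<lambda>i y. f i y - C * poly ((pderiv ^^ i) p) y)"
  have "\<exists>\<eta>\<in>{u<..<v}. g (card X) \<eta> = 0"
  proof (rule zero_of_iterated_derivative[of u v g "insert z X"])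
    show "(g i has_real_derivative g (Suc i) y) (at y)" if "y \<in> {u<..<v}" for i y
      unfolding g_def using der[OF that] by (auto intro!: derivative_eq_intros poly_DERIV simp: )
    show "g 0 y = 0" if "y \<in> insert z X" for y
      using that X(3) X(1) \<open>poly p z \<noteq> 0\<close> by (auto simp: g_def C_def polyp)
  qed (use X z False in auto)
  then obtain \<eta> where \<eta>: "\<eta> \<in> {u<..<v}" "g (card X) \<eta> = 0" by blast
  have "(pderiv ^^ card X) p = [:fact (card X):]"
    using prod_linear_monic[OF X(1)] by (intro higher_pderiv_monic) (auto simp: p_def)
  then have "f (card X) \<eta> = C * fact (card X)" using \<eta>(2) by (simp add: g_def)
  then have "f 0 z = poly p z * f (card X) \<eta> / fact (card X)" using \<open>poly p z \<noteq> 0\<close> by (simp add: C_def)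
  then show ?thesis using \<eta>(1) by (auto simp: polyp)
qed

text \<open>L'Hopital's rule, one derivative per induction step.\<close>

lemma taylor_vanishing:
  fixes f :: "nat \<Rightarrow> real \<Rightarrow> real"
  assumes "0 < d" "\<And>i z. \<bar>z\<bar> < d \<Longrightarrow> (f i has_real_derivative f (Suc i) z) (at z)"
    and "\<And>i. i < r \<Longrightarrow> f i 0 = 0"
  shows "((\<lambda>t. f 0 t / t ^ r) \<longlongrightarrow> f r 0 / fact r) (at 0)"
  using assms
proof (induction r arbitrary: f)
  case 0
  then have "isCont (f 0) 0" using DERIV_isCont[of "f 0" "f 1 0" 0] by simp
  then show ?case by (simp add: isCont_def)
next
  case (Suc r)
  have IH: "((\<lambda>t. f 1 t / t ^ r) \<longlongrightarrow> f (Suc r) 0 / fact r) (at 0)"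
    using Suc.IH[of "\<lambda>i. f (Suc i)"] Suc.prems by simp
  have cont: "isCont (f 0) 0" using DERIV_isCont[OF Suc.prems(2)[of 0 0]] Suc.prems(1) by simp
  have nz: "eventually (\<lambda>t::real. t \<noteq> 0) (at 0)" by (simp add: eventually_at_filter)
  have near: "eventually (\<lambda>t::real. \<bar>t\<bar> < d) (at 0)"
    using eventually_at_ball[OF Suc.prems(1), of 0 UNIV] by eventually_elim (simp add: dist_real_def)
  show ?case
  proof (rule lhopital)
    show "(f 0 \<longlongrightarrow> 0) (at 0)" using cont Suc.prems(3)[of 0] by (simp add: isCont_def)
    show "((\<lambda>t::real. t ^ Suc r) \<longlongrightarrow> 0) (at 0)"
      using tendsto_power[OF tendsto_ident_at[of "0::real" UNIV], of "Suc r"] by simp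
    show "eventually (\<lambda>t::real. t ^ Suc r \<noteq> 0) (at 0)" using nz by eventually_elim simp
    show "eventually (\<lambda>t::real. real (Suc r) * t ^ r \<noteq> 0) (at 0)" using nz by eventually_elim simp
    show "eventually (\<lambda>t. (f 0 has_real_derivative f 1 t) (at t)) (at 0)"
      using near by eventually_elim (use Suc.prems(2)[of _ 0] in simp)
    show "eventually (\<lambda>t. ((\<lambda>t. t ^ Suc r) has_real_derivative real (Suc r) * t ^ r) (at t)) (at 0)"
      using DERIV_pow[of "Suc r"] by simp
    have "((\<lambda>t. (f 1 t / t ^ r) / real (Suc r)) \<longlongrightarrow> (f (Suc r) 0 / fact r) / real (Suc r)) (at 0)"
      by (intro tendsto_divide IH tendsto_const) simp
    then show "((\<lambda>t. f 1 t / (real (Suc r) * t ^ r)) \<longlongrightarrow> f (Suc r) 0 / fact (Suc r)) (at 0)"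
      by (simp add: mult.commute)
  qed
qed

section \<open>The null vector equation\<close>

definition partner :: "nat set set \<Rightarrow> nat \<Rightarrow> nat" where
  "partner m a = (THE b. {a, b} \<in> m)"

lemma partner_eq:
  assumes "m \<in> pairings N" "{a, b} \<in> m"
  shows "partner m a = b"
  unfolding partner_def using assms pairings_unique[OF assms(1)] by (intro the_equality) auto

lemma partner_link:
  assumes "m \<in> pairings N" "a \<in> {1..2*N}"
  shows "{a, partner m a} \<in> m"
proof -
  obtain b where "{a, b} \<in> m" using pairings_partner[OF assms] by metis
  then show ?thesis using partner_eq[OF assms(1)] by simp
qed

lemma kprod_link:
  assumes m: "m \<in> pairings N" and l: "{a, b} \<in> m"
    and e: "\<And>j. j \<notin> {a, b} \<Longrightarrow> e' j = e j" and x: "\<And>j. j \<notin> {a, b} \<Longrightarrow> x' j = x j"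
  shows "kprod e' x' m = kap (e' a) (e' b) (x' a - x' b) * kprod e x (m - {{a, b}})"
proof -
  have "kprod e' x' m = klink e' x' {a, b} * kprod e' x' (m - {{a, b}})"
    unfolding kprod_def by (rule prod.remove[OF pairings_finite[OF m] l])
  moreover have "kprod e' x' (m - {{a, b}}) = kprod e x (m - {{a, b}})"
    unfolding kprod_def
  proof (rule prod.cong[OF refl])
    fix k assume k: "k \<in> m - {{a, b}}"
    then obtain u v where uv: "k = {u, v}" using pairings_link[OF m, of k] by blast
    have "u \<notin> {a, b}" "v \<notin> {a, b}"
      using k uv pairings_unique_link[OF m l, of k u] pairings_unique_link[OF m l, of k v] by auto
    then show "klink e' x' k = klink e x k" using e x by (simp add: uv klink_pair)
  qed
  ultimately show ?thesis by (simp add: klink_pair)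
qed

lemma wsum_real: "wsum N (c :: _ \<Rightarrow> real) e x = (\<Sum>m\<in>pairings N. c m * kprod e x m)"
  by (simp add: wsum_def)

section \<open>The equation for the undifferentiated function\<close>

context
  fixes N y :: nat and c :: "nat set set \<Rightarrow> real" and x :: "nat \<Rightarrow> real"
  assumes c: "c \<in> pluecker N" and y: "y \<in> {1..2*N}"
begin

text \<open>Depends only on the set of the three points \<open>partner m y\<close>,
  \<open>k\<close>, \<open>partner m k\<close> and on the remaining links, hence takes the same
  value for all three ways to pair these points and \<open>y\<close>.\<close>

definition triple_prod :: "nat set set \<Rightarrow> nat \<Rightarrow> real" where
  "triple_prod m k = kap 0 0 (x y - x (partner m y)) * kap 0 0 (x y - x k) * kap 0 0 (x y - x (partner m k)) *
     kprod (\<lambda>_. 0) x (m - {{y, partner m y}, {k, partner m k}})"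

definition triples :: "(nat set set \<times> nat) set" where
  "triples = (SIGMA m:pairings N. {1..2*N} - {y, partner m y})"

text \<open>Cyclic rotation of the triple (partner of \<open>y\<close>, \<open>k\<close>, partner of
  \<open>k\<close>): afterwards \<open>y\<close> is linked to the old \<open>k\<close>, and the
  marked point is the old partner of \<open>k\<close>.\<close>

definition rotate_triple :: "nat set set \<times> nat \<Rightarrow> nat set set \<times> nat" where
  "rotate_triple = (\<lambda>(m, k). (pact (swp (partner m y) k) m, partner m k))"

lemma rotate_triple:
  assumes "(m, k) \<in> triples"
  defines "b \<equiv> partner m y" and "l \<equiv> partner m k"
  shows "rotate_triple (m, k) \<in> triples" "triple_prod (pact (swp b k) m) l = triple_prod m k"
    "partner (pact (swp b k) m) y = k" "partner (pact (swp b k) m) l = b"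
proof -
  have m: "m \<in> pairings N" and k: "k \<in> {1..2*N}" "k \<noteq> y" "k \<noteq> b"
    using assms by (auto simp: triples_def)
  have L: "{y, b} \<in> m" "{k, l} \<in> m" using partner_link[OF m] y k by (auto simp: b_def l_def)
  have ne: "{y, b} \<noteq> {k, l}" using k by (auto simp: doubleton_eq_iff)
  have dis: "y \<noteq> k" "y \<noteq> l" "b \<noteq> k" "b \<noteq> l" "y \<noteq> b" "k \<noteq> l"
    using pairings_unique_link[OF m L] ne pairings_linkD(1)[OF m] L by auto
  have rng: "b \<in> {1..2*N}" "l \<in> {1..2*N}" using pairings_linkD[OF m] L by auto
  define m' where "m' = pact (swp b k) m"
  have m': "m' \<in> pairings N" unfolding m'_def by (rule pact_swp_pairings[OF m rng(1) k(1)])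
  have eq: "m' = (m - {{y, b}, {k, l}}) \<union> {{y, k}, {b, l}}" unfolding m'_def by (rule pact_swp_eq[OF m L ne])
  have p: "partner m' y = k" "partner m' l = b" "partner m' b = l"
    using partner_eq[OF m'] eq by (auto simp: insert_commute)
  show "partner (pact (swp b k) m) y = k" "partner (pact (swp b k) m) l = b" using p by (simp_all add: m'_def)
  show "rotate_triple (m, k) \<in> triples"
    using m' rng dis p(1) by (simp add: triples_def rotate_triple_def b_def[symmetric] l_def[symmetric] m'_def[symmetric])
  have "{y, k} \<notin> m" "{b, l} \<notin> m"
    using pairings_unique_link[OF m L(1), of "{y, k}" y] pairings_unique_link[OF m L(1), of "{b, l}" b] dis
    by (auto simp: doubleton_eq_iff)
  then have "m' - {{y, k}, {l, b}} = m - {{y, b}, {k, l}}"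
    using eq by (auto simp: insert_commute)
  then show "triple_prod (pact (swp b k) m) l = triple_prod m k"
    unfolding m'_def[symmetric] triple_prod_def p b_def[symmetric] l_def[symmetric] by simp
qed

lemma rotate_triple_sum:
  assumes "(m, k) \<in> triples"
  shows "c m + c (fst (rotate_triple (m, k))) + c (fst (rotate_triple (rotate_triple (m, k)))) = 0"
    "rotate_triple (rotate_triple (rotate_triple (m, k))) = (m, k)"
proof -
  define b where "b = partner m y"
  define l where "l = partner m k"
  have m: "m \<in> pairings N" and k: "k \<in> {1..2*N}" "k \<noteq> y" "k \<noteq> b"
    using assms by (auto simp: triples_def b_def)
  have L: "{y, b} \<in> m" "{k, l} \<in> m" using partner_link[OF m] y k by (auto simp: b_def l_def)
  have ne: "{y, b} \<noteq> {k, l}" using k by (auto simp: doubleton_eq_iff)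
  have dis: "y \<noteq> k" "y \<noteq> l" "b \<noteq> k" "b \<noteq> l"
    using pairings_unique_link[OF m L] ne by auto
  define m1 where "m1 = pact (swp b k) m"
  have r1: "rotate_triple (m, k) = (m1, l)" by (simp add: rotate_triple_def b_def l_def m1_def)
  note R1 = rotate_triple[OF assms, folded b_def l_def, folded m1_def, unfolded r1]
  define m2 where "m2 = pact (swp k l) m1"
  have r2: "rotate_triple (m1, l) = (m2, b)" by (simp add: rotate_triple_def R1 m2_def)
  note R2 = rotate_triple[OF R1(1), unfolded R1(3,4), folded m2_def, unfolded r2]
  have "m2 = pact (swp b l) (pact (swp k l) m)"
  proof -
    have "swp k l \<circ> swp b k = swp b l \<circ> swp k l"
      using dis by (auto simp: fun_eq_iff Transposition.transpose_def)
    then show ?thesis by (simp add: m2_def m1_def pact_comp)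
  qed
  then have m2: "m2 = pact (swp b l) m" by (simp only: pact_swp_link[OF m L(2)])
  show "c m + c (fst (rotate_triple (m, k))) + c (fst (rotate_triple (rotate_triple (m, k)))) = 0"
    using pluecker_rel[OF c m L ne] by (simp only: r1 r2 fst_conv) (simp add: m1_def m2)
  have "pact (swp l b) m2 = m" by (simp add: m2 pact_swp_commute[of l b])
  then have r3: "rotate_triple (m2, b) = (m, k)" by (simp only: rotate_triple_def prod.case R2(3,4))
  show "rotate_triple (rotate_triple (rotate_triple (m, k))) = (m, k)" by (simp only: r1 r2 r3)
qed

text \<open>Along an orbit of \<open>rotate_triple\<close> the product is constant while the three
  coefficients sum to zero. Summing over all triples three times, once per rotation, gives 3 S =
  0.\<close>

lemma sum_triples: "(\<Sum>m\<in>pairings N. c m * (\<Sum>k\<in>{1..2*N} - {y, partner m y}. triple_prod m k)) = 0"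
proof -
  define S where "S = (\<Sum>z\<in>triples. c (fst z) * triple_prod (fst z) (snd z))"
  let ?r = rotate_triple
  have T: "?r z \<in> triples \<and> ?r (?r (?r z)) = z \<and> triple_prod (fst (?r z)) (snd (?r z)) = triple_prod (fst z) (snd z)
      \<and> c (fst z) + c (fst (?r z)) + c (fst (?r (?r z))) = 0" if "z \<in> triples" for z
  proof (cases z)
    case (Pair m k)
    then show ?thesis
      using rotate_triple(1,2)[of m k] rotate_triple_sum[of m k] that
      by (simp add: rotate_triple_def)
  qed
  have S1: "S = (\<Sum>z\<in>triples. c (fst (?r z)) * triple_prod (fst z) (snd z))"
    unfolding S_def
    by (rule sum.reindex_bij_witness[where i = ?r and j = "\<lambda>z. ?r (?r z)"]) (use T in auto)
  have S2: "S = (\<Sum>z\<in>triples. c (fst (?r (?r z))) * triple_prod (fst z) (snd z))"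
    unfolding S_def
    by (rule sum.reindex_bij_witness[where i = "\<lambda>z. ?r (?r z)" and j = ?r]) (use T in auto)
  have "(\<Sum>z\<in>triples. (c (fst z) + c (fst (?r z)) + c (fst (?r (?r z)))) * triple_prod (fst z) (snd z)) = S + S + S"
    by (simp only: distrib_right sum.distrib S_def[symmetric] S1[symmetric] S2[symmetric])
  moreover have "(\<Sum>z\<in>triples. (c (fst z) + c (fst (?r z)) + c (fst (?r (?r z)))) * triple_prod (fst z) (snd z)) = 0"
    by (rule sum.neutral) (use T in auto)
  ultimately have "S = 0" by simp
  moreover have "(\<Sum>m\<in>pairings N. c m * (\<Sum>k\<in>{1..2*N} - {y, partner m y}. triple_prod m k)) = S"
    unfolding S_def triples_def sum_distrib_left by (subst sum.Sigma) (auto simp: case_prod_beta)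
  ultimately show ?thesis by simp
qed

context
  fixes m :: "nat set set"
  assumes m: "m \<in> pairings N" and sep: "\<And>a b. {a, b} \<in> m \<Longrightarrow> x a \<noteq> x b"
    and sepy: "\<And>j. j \<in> {1..2*N} \<Longrightarrow> j \<noteq> y \<Longrightarrow> x j \<noteq> x y"
begin

text \<open>The operator is that of the second order BPZ equation with kappa = 2 and conformal
  weights 1. It is split over the links of a pairing: the link at \<open>y\<close> contributes
  nothing, and by \<open>null_vector_other_link\<close> each other link leaves a triple
  product.\<close>

lemma null_vector_own_link:
  assumes l: "{y, b} \<in> m"
  shows "kprod ((\<lambda>_. 0)(y := 2)) x m + 2 * (1 / (x b - x y) * kprod ((\<lambda>_. 0)(b := 1)) x m
     - (1 / (x b - x y))\<^sup>2 * kprod (\<lambda>_. 0) x m) = 0"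
proof -
  have "y \<noteq> b" by (rule pairings_linkD(1)[OF m l])
  define d where "d = x y - x b"
  have d: "d \<noteq> 0" "x b - x y = - d" using sep[OF l] by (auto simp: d_def)
  let ?R = "kprod (\<lambda>_. 0) x (m - {{y, b}})"
  have k: "kprod ((\<lambda>_. 0)(y := 2)) x m = kap 2 0 d * ?R" "kprod ((\<lambda>_. 0)(b := 1)) x m = kap 0 1 d * ?R"
    "kprod (\<lambda>_. 0) x m = kap 0 0 d * ?R"
    using \<open>y \<noteq> b\<close> by (subst kprod_link[OF m l, of _ "\<lambda>_. 0" _ x]; simp add: d_def)+
  have "kap 2 0 d + 2 * (1 / (- d) * kap 0 1 d - (1 / (- d))\<^sup>2 * kap 0 0 d) = 0"
    using d(1) by (simp add: kap_def numeral_eq_Suc field_simps)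
  then have "(kap 2 0 d + 2 * (1 / (- d) * kap 0 1 d - (1 / (- d))\<^sup>2 * kap 0 0 d)) * ?R = 0" by simp
  then show ?thesis unfolding k d(2) by (simp add: algebra_simps)
qed

lemma null_vector_other_link:
  assumes l: "{k, l} \<in> m" and ne: "k \<noteq> y" "l \<noteq> y"
  shows "(1 / (x k - x y) * kprod ((\<lambda>_. 0)(k := 1)) x m - (1 / (x k - x y))\<^sup>2 * kprod (\<lambda>_. 0) x m)
      + (1 / (x l - x y) * kprod ((\<lambda>_. 0)(l := 1)) x m - (1 / (x l - x y))\<^sup>2 * kprod (\<lambda>_. 0) x m)
    = - pi * triple_prod m k"
proof -
  define b where "b = partner m y"
  have yb: "{y, b} \<in> m" unfolding b_def by (rule partner_link[OF m y])
  have "k \<noteq> l" "k \<in> {1..2*N}" "l \<in> {1..2*N}" using pairings_linkD[OF m l] by auto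
  have pk: "partner m k = l" by (rule partner_eq[OF m l])
  have nl: "{y, b} \<noteq> {k, l}" using ne by (auto simp: doubleton_eq_iff)
  define u v where "u = x k - x y" and "v = x l - x y"
  have uv: "u \<noteq> 0" "v \<noteq> 0" "u \<noteq> v"
    using sepy[OF \<open>k \<in> _\<close> ne(1)] sepy[OF \<open>l \<in> _\<close> ne(2)] sep[OF l] by (auto simp: u_def v_def)
  let ?R = "kprod (\<lambda>_. 0) x (m - {{k, l}})"
  have d: "x k - x l = u - v" by (simp add: u_def v_def)
  have k: "kprod ((\<lambda>_. 0)(k := 1)) x m = kap 1 0 (u - v) * ?R" "kprod ((\<lambda>_. 0)(l := 1)) x m = kap 0 1 (u - v) * ?R"
    "kprod (\<lambda>_. 0) x m = kap 0 0 (u - v) * ?R"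
    using \<open>k \<noteq> l\<close> by (subst kprod_link[OF m l, of _ "\<lambda>_. 0" _ x]; simp add: d)+
  have R: "?R = kap 0 0 (x y - x b) * kprod (\<lambda>_. 0) x (m - {{y, b}, {k, l}})"
  proof -
    have "?R = klink (\<lambda>_. 0) x {y, b} * kprod (\<lambda>_. 0) x (m - {{k, l}} - {{y, b}})"
      unfolding kprod_def by (rule prod.remove) (use pairings_finite[OF m] yb nl in auto)
    moreover have "m - {{k, l}} - {{y, b}} = m - {{y, b}, {k, l}}" by auto
    ultimately show ?thesis by (simp add: klink_pair)
  qed
  have id: "(1 / u * kap 1 0 (u - v) - (1 / u)\<^sup>2 * kap 0 0 (u - v)) + (1 / v * kap 0 1 (u - v) - (1 / v)\<^sup>2 * kap 0 0 (u - v))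
      = - pi * (kap 0 0 (- u) * kap 0 0 (- v))"
  proof -
    define w where "w = u - v"
    have w: "w \<noteq> 0" "u = v + w" using uv by (auto simp: w_def)
    have "kap 1 0 w = - 2 / (pi * w ^ 3)" "kap 0 1 w = 2 / (pi * w ^ 3)" "kap 0 0 w = 1 / (pi * w ^ 2)"
      "kap 0 0 (- u) = 1 / (pi * u ^ 2)" "kap 0 0 (- v) = 1 / (pi * v ^ 2)"
      by (simp_all add: kap_def numeral_eq_Suc)
    moreover have "(1 / u * (- 2 / (pi * w ^ 3)) - (1 / u)\<^sup>2 * (1 / (pi * w ^ 2))) + (1 / v * (2 / (pi * w ^ 3)) - (1 / v)\<^sup>2 * (1 / (pi * w ^ 2)))
        = - pi * (1 / (pi * u ^ 2) * (1 / (pi * v ^ 2)))"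
    proof -
      \<comment> \<open>The left-hand side is (2 u v - u^2 - v^2) / (u^2 v^2 w^2), and the numerator
        is - w^2.\<close>
      have "(1 / u * (- 2 / w ^ 3) - 1 / u\<^sup>2 / w\<^sup>2) + (1 / v * (2 / w ^ 3) - 1 / v\<^sup>2 / w\<^sup>2) = - (1 / (u\<^sup>2 * v\<^sup>2))"
        using w(1) uv(1,2) by (simp add: field_simps power2_eq_square power3_eq_cube) (simp add: w(2) algebra_simps)
      then have "((1 / u * (- 2 / w ^ 3) - 1 / u\<^sup>2 / w\<^sup>2) + (1 / v * (2 / w ^ 3) - 1 / v\<^sup>2 / w\<^sup>2)) / pi = - (1 / (u\<^sup>2 * v\<^sup>2)) / pi"
        by simp
      then show ?thesis by (simp add: power_one_over power_divide add_divide_distrib diff_divide_distrib mult.commute mult.left_commute)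
    qed
    ultimately show ?thesis unfolding w_def[symmetric] by simp
  qed
  have "(1 / u * (kap 1 0 (u - v) * ?R) - (1 / u)\<^sup>2 * (kap 0 0 (u - v) * ?R)) + (1 / v * (kap 0 1 (u - v) * ?R) - (1 / v)\<^sup>2 * (kap 0 0 (u - v) * ?R))
      = ((1 / u * kap 1 0 (u - v) - (1 / u)\<^sup>2 * kap 0 0 (u - v)) + (1 / v * kap 0 1 (u - v) - (1 / v)\<^sup>2 * kap 0 0 (u - v))) * ?R"
    by (simp add: algebra_simps)
  also have "\<dots> = - pi * triple_prod m k"
    unfolding id R triple_prod_def pk b_def[symmetric] by (simp add: u_def v_def)
  finally show ?thesis unfolding k u_def[symmetric] v_def[symmetric] .
qed

lemma triple_prod_partner:
  assumes "k \<in> {1..2*N}"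
  shows "triple_prod m (partner m k) = triple_prod m k"
proof -
  have "{k, partner m k} \<in> m" by (rule partner_link[OF m assms])
  then have "{partner m k, k} \<in> m" by (simp add: insert_commute)
  then have "partner m (partner m k) = k" by (rule partner_eq[OF m])
  then show ?thesis by (simp add: triple_prod_def insert_commute)
qed

lemma null_vector_pairing:
  "kprod ((\<lambda>_. 0)(y := 2)) x m + 2 * (\<Sum>j\<in>{1..2*N} - {y}. 1 / (x j - x y) * kprod ((\<lambda>_. 0)(j := 1)) x m
       - (1 / (x j - x y))\<^sup>2 * kprod (\<lambda>_. 0) x m)
    = - pi * (\<Sum>k\<in>{1..2*N} - {y, partner m y}. triple_prod m k)"
proof -
  define f where "f = (\<lambda>j. 1 / (x j - x y) * kprod ((\<lambda>_. 0)(j := 1)) x m - (1 / (x j - x y))\<^sup>2 * kprod (\<lambda>_. 0) x m)"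
  define g where "g = (\<lambda>j. if j = y then 0 else f j)"
  define b where "b = partner m y"
  define h where "h = (\<lambda>k. if k = y \<or> k = b then 0 else triple_prod m k)"
  define K where "K = kprod ((\<lambda>_. 0)(y := 2)) x m"
  have yb: "{y, b} \<in> m" unfolding b_def by (rule partner_link[OF m y])
  have "y \<noteq> b" by (rule pairings_linkD(1)[OF m yb])
  \<comment> \<open>The factor 2 on the left matches the right-hand side, where both ends of a link
    give the same triple product.\<close>
  have "(if l = {y, b} then K else 0) + 2 * sum g l = - pi * sum h l" if l: "l \<in> m" for l
  proof (cases "l = {y, b}")
    case True
    then show ?thesis using null_vector_own_link[OF yb] \<open>y \<noteq> b\<close> by (simp add: g_def h_def f_def K_def)
  next
    case False
    obtain u v where uv: "l = {u, v}" "u < v" "u \<in> {1..2*N}" using pairings_link[OF m l] by metis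
    have ne: "u \<noteq> y" "v \<noteq> y" "u \<noteq> b" "v \<noteq> b"
      using pairings_unique_link[OF m yb l, of y] pairings_unique_link[OF m yb l, of b] False uv by auto
    have uvm: "{u, v} \<in> m" using l uv by simp
    have "triple_prod m v = triple_prod m u" using triple_prod_partner[OF uv(3)] partner_eq[OF m uvm] by simp
    then show ?thesis
      using null_vector_other_link[OF uvm ne(1,2)] False uv(1,2) ne by (simp add: g_def h_def f_def)
  qed
  then have "(\<Sum>l\<in>m. (if l = {y, b} then K else 0) + 2 * sum g l) = (\<Sum>l\<in>m. - pi * sum h l)"
    by (rule sum.cong[OF refl])
  then have "K + 2 * (\<Sum>l\<in>m. sum g l) = - pi * (\<Sum>l\<in>m. sum h l)"
    using pairings_finite[OF m] yb by (simp add: sum.distrib sum_distrib_left)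
  moreover have "(\<Sum>l\<in>m. sum g l) = (\<Sum>j\<in>{1..2*N} - {y}. f j)"
    unfolding sum_links[OF m, symmetric] by (rule sum.mono_neutral_cong_right) (auto simp: g_def)
  moreover have "(\<Sum>l\<in>m. sum h l) = (\<Sum>k\<in>{1..2*N} - {y, b}. triple_prod m k)"
    unfolding sum_links[OF m, symmetric] by (rule sum.mono_neutral_cong_right) (auto simp: h_def)
  ultimately show ?thesis by (simp add: K_def f_def b_def)
qed

end

lemma null_vector_base:
  assumes sep: "separates N c x" and sepy: "\<And>j. j \<in> {1..2*N} \<Longrightarrow> j \<noteq> y \<Longrightarrow> x j \<noteq> x y"
  shows "wsum N c ((\<lambda>_. 0)(y := 2)) x + 2 * (\<Sum>j\<in>{1..2*N} - {y}. 1 / (x j - x y) * wsum N c ((\<lambda>_. 0)(j := 1)) x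
       - (1 / (x j - x y))\<^sup>2 * wsum N c (\<lambda>_. 0) x) = 0"
proof -
  let ?D = "\<lambda>m. kprod ((\<lambda>_. 0)(y := 2)) x m + 2 * (\<Sum>j\<in>{1..2*N} - {y}. 1 / (x j - x y) * kprod ((\<lambda>_. 0)(j := 1)) x m
       - (1 / (x j - x y))\<^sup>2 * kprod (\<lambda>_. 0) x m)"
  have "wsum N c ((\<lambda>_. 0)(y := 2)) x + 2 * (\<Sum>j\<in>{1..2*N} - {y}. 1 / (x j - x y) * wsum N c ((\<lambda>_. 0)(j := 1)) x
       - (1 / (x j - x y))\<^sup>2 * wsum N c (\<lambda>_. 0) x) = (\<Sum>m\<in>pairings N. c m * ?D m)"
  proof -
    have exch: "(\<Sum>j\<in>J. t j * (\<Sum>m\<in>P. c m * A j m) - s j * (\<Sum>m\<in>P. c m * B m))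
        = (\<Sum>m\<in>P. c m * (\<Sum>j\<in>J. t j * A j m - s j * B m))" for J P and t s :: "nat \<Rightarrow> real" and A B
      unfolding sum_distrib_left sum_subtractf[symmetric]
      by (subst sum.swap) (intro sum.cong refl, simp add: algebra_simps)
    have "(\<Sum>j\<in>{1..2*N} - {y}. 1 / (x j - x y) * wsum N c ((\<lambda>_. 0)(j := 1)) x
       - (1 / (x j - x y))\<^sup>2 * wsum N c (\<lambda>_. 0) x)
      = (\<Sum>m\<in>pairings N. c m * (\<Sum>j\<in>{1..2*N} - {y}. 1 / (x j - x y) * kprod ((\<lambda>_. 0)(j := 1)) x m
       - (1 / (x j - x y))\<^sup>2 * kprod (\<lambda>_. 0) x m))"
      unfolding wsum_real by (rule exch)
    then show ?thesis
      by (simp only:) (simp add: wsum_real distrib_left sum.distrib sum_distrib_left[of 2] mult.left_commute[of 2])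
  qed
  also have "\<dots> = (\<Sum>m\<in>pairings N. - pi * (c m * (\<Sum>k\<in>{1..2*N} - {y, partner m y}. triple_prod m k)))"
  proof (rule sum.cong[OF refl])
    fix m assume m: "m \<in> pairings N"
    show "c m * ?D m = - pi * (c m * (\<Sum>k\<in>{1..2*N} - {y, partner m y}. triple_prod m k))"
    proof (cases "c m = 0")
      case False
      then have "\<And>a b. {a, b} \<in> m \<Longrightarrow> x a \<noteq> x b" using sep m by (auto simp: separates_def)
      from null_vector_pairing[OF m this sepy] show ?thesis by simp
    qed simp
  qed
  also have "\<dots> = - pi * (\<Sum>m\<in>pairings N. c m * (\<Sum>k\<in>{1..2*N} - {y, partner m y}. triple_prod m k))"
    by (rule sum_distrib_left[symmetric])
  also have "\<dots> = 0" by (simp only: sum_triples mult_zero_right)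
  finally show ?thesis .
qed

end

section \<open>The differentiated equation\<close>

lemma leibniz_step:
  fixes a b :: "nat \<Rightarrow> real"
  shows "(\<Sum>r\<le>n. real (n choose r) * (a (Suc r) * b (n - r) + a r * b (Suc (n - r))))
       = (\<Sum>r\<le>Suc n. real (Suc n choose r) * (a r * b (Suc n - r)))"
proof -
  have "(\<Sum>r\<le>Suc n. real (Suc n choose r) * (a r * b (Suc n - r)))
      = a 0 * b (Suc n) + (\<Sum>r\<le>n. real ((n choose r) + (n choose Suc r)) * (a (Suc r) * b (n - r)))"
    by (subst sum.atMost_Suc_shift) simp
  moreover have "(\<Sum>r\<le>n. real (n choose r) * (a r * b (Suc (n - r)))) = (\<Sum>r\<le>Suc n. real (n choose r) * (a r * b (Suc n - r)))"
    by (simp add: Suc_diff_le)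
  moreover have "\<dots> = a 0 * b (Suc n) + (\<Sum>r\<le>n. real (n choose Suc r) * (a (Suc r) * b (n - r)))"
    by (subst sum.atMost_Suc_shift) simp
  ultimately show ?thesis by (simp add: sum.distrib distrib_left distrib_right)
qed

text \<open>The derivative of order \<open>n\<close> in \<open>x j\<close>, by Leibniz' rule, of 1 /
  (x j - x y) times the function that has the derivatives \<open>e\<close> at all other points; the
  value \<open>e j\<close> is overridden.\<close>

definition leibniz :: "nat \<Rightarrow> (nat set set \<Rightarrow> real) \<Rightarrow> nat \<Rightarrow> nat \<Rightarrow> nat \<Rightarrow> (nat \<Rightarrow> nat) \<Rightarrow> (nat \<Rightarrow> real) \<Rightarrow> real" where
  "leibniz N c y n j e x = (\<Sum>r\<le>n. real (n choose r) *
     ((- 1) ^ r * fact r / (x j - x y) ^ Suc r * wsum N c (e(j := n - r)) x))"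

lemma leibniz_DERIV_same:
  assumes sep: "separates N c (x(j := t))" and j: "j \<in> {1..2*N}" "j \<noteq> y" and ne: "t \<noteq> x y"
  shows "((\<lambda>t. leibniz N c y n j e (x(j := t))) has_real_derivative leibniz N c y (Suc n) j e (x(j := t))) (at t)"
proof -
  define a where "a = (\<lambda>r t. (- 1) ^ r * fact r / (t - x y) ^ Suc r)"
  define b where "b = (\<lambda>i t. wsum N c (e(j := i)) (x(j := t)))"
  have da: "(a r has_real_derivative a (Suc r) t) (at t)" for r
  proof -
    have "((\<lambda>s. (- 1) ^ r * fact r / s ^ Suc r) has_real_derivative - ((- 1) ^ r * fact r * real (Suc r)) / (t - x y) ^ Suc (Suc r)) (at (t - x y))"
      by (rule inverse_power_DERIV) (use ne in simp)
    then have "((\<lambda>s. (- 1) ^ r * fact r / (s - x y) ^ Suc r) has_real_derivative - ((- 1) ^ r * fact r * real (Suc r)) / (t - x y) ^ Suc (Suc r) * 1) (at t)"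
      by (rule DERIV_chain2) (auto intro!: derivative_eq_intros)
    then show ?thesis by (simp add: a_def mult_ac)
  qed
  have db: "(b i has_real_derivative b (Suc i) t) (at t)" for i
    using wsum_DERIV_coord[OF sep j(1), of "e(j := i)"] by (simp add: b_def)
  have "((\<lambda>t. \<Sum>r\<le>n. real (n choose r) * (a r t * b (n - r) t)) has_real_derivative
      (\<Sum>r\<le>n. real (n choose r) * (a (Suc r) t * b (n - r) t + b (Suc (n - r)) t * a r t))) (at t)"
    by (intro DERIV_sum DERIV_cmult DERIV_mult da db)
  moreover have "(\<Sum>r\<le>n. real (n choose r) * (a (Suc r) t * b (n - r) t + b (Suc (n - r)) t * a r t))
      = (\<Sum>r\<le>Suc n. real (Suc n choose r) * (a r t * b (Suc n - r) t))"
    using leibniz_step[of n "\<lambda>r. a r t" "\<lambda>i. b i t"] by (simp add: mult.commute)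
  ultimately show ?thesis using j(2) by (simp add: leibniz_def a_def b_def)
qed

lemma leibniz_DERIV_other:
  assumes sep: "separates N c (x(k := t))" and k: "k \<in> {1..2*N}" "k \<noteq> j" "k \<noteq> y"
  shows "((\<lambda>t. leibniz N c y n j e (x(k := t))) has_real_derivative leibniz N c y n j (e(k := Suc (e k))) (x(k := t))) (at t)"
proof -
  have *: "((\<lambda>t. wsum N c (e(j := i)) (x(k := t))) has_real_derivative wsum N c ((e(k := Suc (e k)))(j := i)) (x(k := t))) (at t)" for i
    using wsum_DERIV_coord[OF sep k(1), of "e(j := i)"] k(2) by (simp add: fun_upd_twist)
  define K where "K = (\<lambda>r. real (n choose r) * ((- 1) ^ r * fact r / (x j - x y) ^ Suc r))"
  have L: "leibniz N c y n j e' (x(k := t)) = (\<Sum>r\<le>n. K r * wsum N c (e'(j := n - r)) (x(k := t)))" for e' t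
    using k(2,3) by (simp only: leibniz_def K_def mult.assoc fun_upd_other not_sym)
  show ?thesis unfolding L by (intro DERIV_sum DERIV_cmult *)
qed

lemma eventually_ne_coord:
  fixes x :: "nat \<Rightarrow> real"
  assumes "\<And>j. ((\<lambda>t. X t j) \<longlongrightarrow> x j) F" "finite P"
  shows "eventually (\<lambda>t. \<forall>(a, b)\<in>P. x a \<noteq> x b \<longrightarrow> X t a \<noteq> X t b) F"
proof -
  have "eventually (\<lambda>t. x a \<noteq> x b \<longrightarrow> X t a \<noteq> X t b) F" for a b
  proof (cases "x a = x b")
    case False
    have "((\<lambda>t. X t a - X t b) \<longlongrightarrow> x a - x b) F" by (intro tendsto_diff assms(1))
    then have "eventually (\<lambda>t. X t a - X t b \<noteq> 0) F" by (rule tendsto_imp_eventually_ne) (use False in simp)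
    then show ?thesis by eventually_elim simp
  qed simp
  then show ?thesis using assms(2) by (simp add: eventually_ball_finite case_prod_beta)
qed

lemma separates_open:
  assumes sep: "separates N c x" and lim: "\<And>j. ((\<lambda>t. X t j) \<longlongrightarrow> x j) F"
  shows "eventually (\<lambda>t. separates N c (X t)) F"
proof -
  have "eventually (\<lambda>t. \<forall>(a, b)\<in>{1..2*N} \<times> {1..2*N}. x a \<noteq> x b \<longrightarrow> X t a \<noteq> X t b) F"
    by (rule eventually_ne_coord[OF lim]) simp
  then show ?thesis
  proof eventually_elim
    case (elim t)
    have "X t a \<noteq> X t b" if "m \<in> pairings N" "c m \<noteq> 0" "{a, b} \<in> m" for m a b
      using elim sep that pairings_linkD(2,3)[OF that(1,3)] unfolding separates_def by blast
    then show ?case by (simp add: separates_def)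
  qed
qed

text \<open>Because the conformal weight is 1, the two terms of a point \<open>j\<close> in
  \<open>null_vector_base\<close> combine to the total derivative in \<open>x j\<close> of the
  function divided by x j - x y. Further derivatives in \<open>x j\<close> therefore only raise the
  order in \<open>leibniz\<close>, which is \<open>Suc (e j)\<close>. Induction on the total number
  of derivatives.\<close>

lemma null_vector:
  assumes c: "c \<in> pluecker N" and y: "y \<in> {1..2*N}"
    and "e y = 0" "separates N c x" "\<And>j. j \<in> {1..2*N} \<Longrightarrow> j \<noteq> y \<Longrightarrow> x j \<noteq> x y"
  shows "wsum N c (e(y := 2)) x + 2 * (\<Sum>j\<in>{1..2*N} - {y}. leibniz N c y (Suc (e j)) j e x) = 0"
  using assms(3-)
proof (induction "\<Sum>j=1..2*N. e j" arbitrary: e x)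
  case 0
  then have e0: "e j = 0" if "j \<in> {1..2*N}" for j using that by auto
  have w: "wsum N c (e(j := i)) x = wsum N c ((\<lambda>_. 0)(j := i)) x" for i j
    by (rule wsum_cong) (use e0 in auto)
  have "leibniz N c y (Suc (e j)) j e x
      = 1 / (x j - x y) * wsum N c ((\<lambda>_. 0)(j := 1)) x - (1 / (x j - x y))\<^sup>2 * wsum N c (\<lambda>_. 0) x"
    if j: "j \<in> {1..2*N} - {y}" for j
  proof -
    have "wsum N c (e(j := 0)) x = wsum N c (\<lambda>_. 0) x" using w[of j 0] by (simp add: fun_upd_idem)
    then show ?thesis
      using e0[of j] j by (simp add: leibniz_def w power2_eq_square)
  qed
  then have S: "(\<Sum>j\<in>{1..2*N} - {y}. leibniz N c y (Suc (e j)) j e x) = (\<Sum>j\<in>{1..2*N} - {y}.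
      1 / (x j - x y) * wsum N c ((\<lambda>_. 0)(j := 1)) x - (1 / (x j - x y))\<^sup>2 * wsum N c (\<lambda>_. 0) x)"
    by (rule sum.cong[OF refl])
  show ?case unfolding w S by (rule null_vector_base[OF c y 0(3) 0(4)])
next
  case (Suc n)
  have "\<exists>k\<in>{1..2*N}. e k \<noteq> 0" by (rule ccontr) (use Suc(2) in auto)
  then obtain k where k: "k \<in> {1..2*N}" "e k \<noteq> 0" by blast
  have ky: "k \<noteq> y" using k Suc.prems(1) by auto
  define e0 where "e0 = e(k := e k - 1)"
  have e: "e = e0(k := Suc (e0 k))" using k by (auto simp: e0_def)
  have "(\<Sum>j=1..2*N. e j) = e k + (\<Sum>j\<in>{1..2*N} - {k}. e j)" by (rule sum.remove) (use k in auto)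
  moreover have "(\<Sum>j=1..2*N. e0 j) = e0 k + (\<Sum>j\<in>{1..2*N} - {k}. e0 j)" by (rule sum.remove) (use k in auto)
  moreover have "(\<Sum>j\<in>{1..2*N} - {k}. e0 j) = (\<Sum>j\<in>{1..2*N} - {k}. e j)"
    by (rule sum.cong) (auto simp: e0_def)
  ultimately have n: "n = (\<Sum>j=1..2*N. e0 j)" using Suc(2) k(2) by (simp add: e0_def)
  have e0y: "e0 y = 0" using Suc.prems(1) ky by (simp add: e0_def)
  \<comment> \<open>The equation with one derivative less at \<open>k\<close>, as a function of
    \<open>x k\<close>. Its hypotheses are open conditions, so it holds near the given value and may
    be differentiated there.\<close>
  let ?F = "\<lambda>t. wsum N c (e0(y := 2)) (x(k := t)) + 2 * (\<Sum>j\<in>{1..2*N} - {y}. leibniz N c y (Suc (e0 j)) j e0 (x(k := t)))"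
  have lim: "((\<lambda>t. (x(k := t)) j) \<longlongrightarrow> x j) (nhds (x k))" for j
    by (cases "j = k") (auto simp: filterlim_ident)
  have "eventually (\<lambda>t. \<forall>(a, b)\<in>{1..2*N} \<times> {y}. x a \<noteq> x b \<longrightarrow> (x(k := t)) a \<noteq> (x(k := t)) b) (nhds (x k))"
    by (rule eventually_ne_coord[OF lim]) simp
  then have "eventually (\<lambda>t. ?F t = 0) (nhds (x k))"
    using separates_open[OF Suc.prems(2) lim]
  proof eventually_elim
    case (elim t)
    show ?case by (rule Suc.hyps(1)[OF n e0y elim(2)]) (use elim(1) Suc.prems(3) in auto)
  qed
  then have "(?F has_real_derivative 0) (at (x k))"
    using DERIV_cong_ev[OF refl _ refl, of ?F "\<lambda>_. 0" "x k" 0] by simp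
  moreover have "(?F has_real_derivative wsum N c (e(y := 2)) (x(k := x k))
      + 2 * (\<Sum>j\<in>{1..2*N} - {y}. leibniz N c y (Suc (e j)) j e (x(k := x k)))) (at (x k))"
  proof (intro DERIV_add DERIV_cmult DERIV_sum)
    have sep: "separates N c (x(k := x k))" using Suc.prems(2) by simp
    show "((\<lambda>t. wsum N c (e0(y := 2)) (x(k := t))) has_real_derivative wsum N c (e(y := 2)) (x(k := x k))) (at (x k))"
      using wsum_DERIV_coord[OF sep k(1), of "e0(y := 2)"] ky
      by (subst e) (simp add: fun_upd_twist)
    fix j assume j: "j \<in> {1..2*N} - {y}"
    show "((\<lambda>t. leibniz N c y (Suc (e0 j)) j e0 (x(k := t))) has_real_derivative
        leibniz N c y (Suc (e j)) j e (x(k := x k))) (at (x k))"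
    proof (cases "j = k")
      case True
      have "leibniz N c y i k e = leibniz N c y i k e0" for i by (simp add: leibniz_def e0_def fun_eq_iff)
      moreover have "Suc (e j) = Suc (Suc (e0 k))" using True k(2) by (simp add: e0_def)
      ultimately show ?thesis
        using leibniz_DERIV_same[OF sep k(1) ky Suc.prems(3)[OF k(1) ky], of "Suc (e0 k)" e0] True by simp
    next
      case False
      then have "e j = e0 j" by (simp add: e0_def)
      then show ?thesis
        using leibniz_DERIV_other[OF sep k(1) not_sym[OF False] ky, of "Suc (e0 j)" e0] e by simp
    qed
  qed
  ultimately show ?case using DERIV_unique by fastforce
qed

section \<open>Fusing loses no information\<close>

text \<open>Of the three pairings in the relation for the links at \<open>a\<close> and
  \<open>b\<close>, one contains the link {a, b} and drops out; the other two differ by the exchange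
  of \<open>a\<close> and \<open>b\<close>.\<close>

lemma vanishing_antisym:
  assumes c: "c \<in> pluecker N" and ab: "a \<in> {1..2*N}" "b \<in> {1..2*N}" "a \<noteq> b"
    and van: "\<And>m. m \<in> pairings N \<Longrightarrow> {a, b} \<in> m \<Longrightarrow> c m = 0"
  shows "antisym_pair N c a b"
  unfolding antisym_pair_def
proof (intro conjI ballI ab)
  fix m assume m: "m \<in> pairings N"
  show "c (pact (swp a b) m) = - c m"
  proof (cases "{a, b} \<in> m")
    case True
    then show ?thesis using van[OF m True] pact_swp_link[OF m True] by simp
  next
    case False
    define a' b' where "a' = partner m a" and "b' = partner m b"
    have l: "{a, a'} \<in> m" "{b, b'} \<in> m" using partner_link[OF m] ab by (auto simp: a'_def b'_def)
    have l': "{a', a} \<in> m" "{b', b} \<in> m" using l by (simp_all add: insert_commute)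
    have "a' \<noteq> b" using False l by auto
    then have ne: "{a', a} \<noteq> {b, b'}" "{a', a} \<noteq> {b', b}" using ab(3) by (auto simp: doubleton_eq_iff)
    have rng: "b' \<in> {1..2*N}" using pairings_linkD[OF m l(2)] by simp
    have "pact (swp a b') m = (m - {{a', a}, {b', b}}) \<union> {{a', b'}, {a, b}}"
      by (rule pact_swp_eq[OF m l'(1,2) ne(2)])
    then have "c (pact (swp a b') m) = 0"
      by (intro van pact_swp_pairings[OF m ab(1) rng]) auto
    then show ?thesis using pluecker_rel[OF c m l'(1) l(2) ne(1)] by (simp add: add_eq_0_iff)
  qed
qed

text \<open>Over the common denominator \<open>Q\<close>, nonzero at \<open>\<xi>\<close>, the
  numerator is a polynomial that vanishes to every order at \<open>\<xi>\<close>, hence the zero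
  polynomial.\<close>

lemma eval_rational_zero:
  fixes F :: "real \<Rightarrow> real" and D z :: "'i \<Rightarrow> real" and n :: "'i \<Rightarrow> nat"
  assumes fin: "finite P" and F: "\<And>y. F y = (\<Sum>i\<in>P. D i / (y - z i) ^ n i)"
    and \<xi>: "\<And>i. i \<in> P \<Longrightarrow> z i \<noteq> \<xi>"
    and van: "\<And>r. ((\<lambda>t. F (\<xi> + t) / t ^ r) \<longlongrightarrow> 0) (at 0)"
    and y: "\<And>i. i \<in> P \<Longrightarrow> z i \<noteq> y"
  shows "F y = 0"
proof -
  define Q where "Q = (\<Prod>k\<in>P. [:- z k, 1:] ^ n k)"
  define G where "G = (\<Sum>i\<in>P. Polynomial.smult (D i) (\<Prod>k\<in>P - {i}. [:- z k, 1:] ^ n k))"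
  have polyQ: "poly Q y = (\<Prod>k\<in>P. (y - z k) ^ n k)" for y
    by (simp add: Q_def poly_prod poly_power)
  have polyG: "poly G y = F y * poly Q y" if "\<And>i. i \<in> P \<Longrightarrow> z i \<noteq> y" for y
  proof -
    have "poly G y = (\<Sum>i\<in>P. D i * (\<Prod>k\<in>P - {i}. (y - z k) ^ n k))"
      by (simp add: G_def poly_sum poly_prod poly_power)
    also have "\<dots> = (\<Sum>i\<in>P. D i / (y - z i) ^ n i * poly Q y)"
    proof (rule sum.cong[OF refl])
      fix i assume i: "i \<in> P"
      have Qy: "poly Q y = (y - z i) ^ n i * (\<Prod>k\<in>P - {i}. (y - z k) ^ n k)"
        unfolding polyQ by (rule prod.remove[OF fin i])
      have "D i / w * (w * R) = D i * R" if "w \<noteq> 0" for w R :: real using that by simp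
      moreover have "(y - z i) ^ n i \<noteq> 0" using that[OF i] by simp
      ultimately have "D i / (y - z i) ^ n i * ((y - z i) ^ n i * (\<Prod>k\<in>P - {i}. (y - z k) ^ n k))
          = D i * (\<Prod>k\<in>P - {i}. (y - z k) ^ n k)" by blast
      then show "D i * (\<Prod>k\<in>P - {i}. (y - z k) ^ n k) = D i / (y - z i) ^ n i * poly Q y"
        unfolding Qy by (rule sym)
    qed
    also have "\<dots> = F y * poly Q y" by (simp add: F sum_distrib_right)
    finally show ?thesis .
  qed
  have "G = 0"
  proof (rule ccontr)
    assume "G \<noteq> 0"
    from order_decomp[OF this, of \<xi>] obtain q where q: "G = [:- \<xi>, 1:] ^ Polynomial.order \<xi> G * q" "\<not> [:- \<xi>, 1:] dvd q" by blast
    define r where "r = Polynomial.order \<xi> G"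
    have q0: "poly q \<xi> \<noteq> 0" using q(2) by (simp add: poly_eq_0_iff_dvd)
    have "((\<lambda>t. \<xi> + t) \<longlongrightarrow> \<xi> + 0) (at (0::real))" by (intro tendsto_intros)
    then have shift: "((\<lambda>t. \<xi> + t) \<longlongrightarrow> \<xi>) (at (0::real))" by simp
    have ne: "eventually (\<lambda>t. \<forall>i\<in>P. z i \<noteq> \<xi> + t) (at (0::real))"
      using fin
    proof (rule eventually_ball_finite, intro ballI)
      fix i assume "i \<in> P"
      then show "eventually (\<lambda>t. z i \<noteq> \<xi> + t) (at 0)"
        using tendsto_imp_eventually_ne[OF shift, of "z i"] \<xi>[OF \<open>i \<in> P\<close>] by (auto elim: eventually_mono)
    qed
    have "((\<lambda>t. F (\<xi> + t) / t ^ r * poly Q (\<xi> + t)) \<longlongrightarrow> 0 * poly Q \<xi>) (at 0)"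
      by (intro tendsto_mult van tendsto_poly shift)
    moreover have "eventually (\<lambda>t. F (\<xi> + t) / t ^ r * poly Q (\<xi> + t) = poly q (\<xi> + t)) (at 0)"
    proof -
      have "eventually (\<lambda>t::real. t \<noteq> 0) (at 0)" by (simp add: eventually_at_filter)
      with ne show ?thesis
      proof eventually_elim
        case (elim t)
        have "F (\<xi> + t) * poly Q (\<xi> + t) = poly G (\<xi> + t)" using polyG[of "\<xi> + t"] elim(1) by simp
        also have "\<dots> = t ^ r * poly q (\<xi> + t)" by (subst q(1)) (simp add: r_def poly_power)
        finally show ?case using elim(2) by (simp add: field_simps)
      qed
    qed
    ultimately have "((\<lambda>t. poly q (\<xi> + t)) \<longlongrightarrow> 0) (at 0)" by (simp add: tendsto_cong)
    moreover have "((\<lambda>t. poly q (\<xi> + t)) \<longlongrightarrow> poly q \<xi>) (at 0)" by (intro tendsto_poly shift)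
    ultimately have "poly q \<xi> = 0" by (rule tendsto_unique[OF trivial_limit_at, rotated])
    with q0 show False by simp
  qed
  then have "F y * poly Q y = 0" using polyG[of y] y by simp
  moreover have "poly Q y \<noteq> 0" using y fin by (auto simp: polyQ)
  ultimately show ?thesis by simp
qed

text \<open>The position inside the block, counted from 0. It is also the number of derivatives that
  fusion leaves at the point.\<close>

definition bpos :: "(nat \<Rightarrow> nat) \<Rightarrow> nat \<Rightarrow> nat" where
  "bpos blk a = card {l \<in> {1..<a}. blk l = blk a}"

text \<open>The derivatives present once the points up to \<open>n\<close> have been fused.
  \<open>pexp\<close> differs only at \<open>n\<close> itself, which then carries none: it describes
  the moment before \<open>n\<close> is merged.\<close>

definition fexp :: "(nat \<Rightarrow> nat) \<Rightarrow> nat \<Rightarrow> nat \<Rightarrow> nat" where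
  "fexp blk n b = (if b \<le> n then bpos blk b else 0)"

definition pexp :: "(nat \<Rightarrow> nat) \<Rightarrow> nat \<Rightarrow> nat \<Rightarrow> nat" where
  "pexp blk n b = (if b < n then bpos blk b else 0)"

definition locus :: "nat \<Rightarrow> (nat \<Rightarrow> nat) \<Rightarrow> nat \<Rightarrow> (nat \<Rightarrow> real) \<Rightarrow> bool" where
  "locus N blk n x \<longleftrightarrow> (\<forall>i\<in>{1..2*N}. \<forall>j\<in>{1..2*N}. i \<noteq> j \<longrightarrow> (x i = x j \<longleftrightarrow> blk i = blk j \<and> i \<le> n \<and> j \<le> n))"

lemma locusD: "locus N blk n x \<Longrightarrow> i \<in> {1..2*N} \<Longrightarrow> j \<in> {1..2*N} \<Longrightarrow> i \<noteq> j \<Longrightarrow>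
    x i = x j \<longleftrightarrow> blk i = blk j \<and> i \<le> n \<and> j \<le> n"
  by (simp add: locus_def)

lemma taylor_wsum:
  fixes c :: "nat set set \<Rightarrow> real"
  assumes sep: "separates N c x" and a: "a \<in> {1..2*N}"
    and van: "\<And>i. i < r \<Longrightarrow> wsum N c (e(a := n + i)) x = 0"
  shows "((\<lambda>t. wsum N c (e(a := n)) (x(a := x a + t)) / t ^ r) \<longlongrightarrow> wsum N c (e(a := n + r)) x / fact r) (at 0)"
proof -
  have lim: "((\<lambda>t. (x(a := x a + t)) j) \<longlongrightarrow> x j) (nhds (0::real))" for j
    using tendsto_add[OF tendsto_const[of "x a"] filterlim_ident[of "nhds (0::real)"]]
    by (cases "j = a") auto
  from separates_open[OF sep lim] obtain d where d: "0 < d" "\<And>t. dist t 0 < d \<Longrightarrow> separates N c (x(a := x a + t))"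
    unfolding eventually_nhds_metric by blast
  define f where "f = (\<lambda>i t. wsum N c (e(a := n + i)) (x(a := x a + t)))"
  have "(f i has_real_derivative f (Suc i) t) (at t)" if "\<bar>t\<bar> < d" for i t
  proof -
    have "separates N c (x(a := x a + t))" using d(2) that by (simp add: dist_real_def)
    from wsum_DERIV_coord[OF this a, of "e(a := n + i)"]
    have "((\<lambda>s. wsum N c (e(a := n + i)) (x(a := s))) has_real_derivative f (Suc i) t) (at (t + x a))"
      by (simp add: f_def add.commute)
    then show ?thesis unfolding DERIV_shift by (simp add: f_def add.commute)
  qed
  moreover have "f i 0 = 0" if "i < r" for i using van[OF that] by (simp add: f_def)
  ultimately have "((\<lambda>t. f 0 t / t ^ r) \<longlongrightarrow> f r 0 / fact r) (at 0)"
    using taylor_vanishing[OF d(1), of f r] by blast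
  then show ?thesis by (simp add: f_def)
qed

context
  fixes N :: nat and c :: "nat set set \<Rightarrow> real" and blk :: "nat \<Rightarrow> nat"
  assumes c: "c \<in> pluecker N"
    and blk_mono: "\<And>i j. 1 \<le> i \<Longrightarrow> i \<le> j \<Longrightarrow> j \<le> 2 * N \<Longrightarrow> blk i \<le> blk j"
    and c0: "\<And>m a b. m \<in> pairings N \<Longrightarrow> {a, b} \<in> m \<Longrightarrow> blk a = blk b \<Longrightarrow> c m = 0"
begin

lemma bpos_pred:
  assumes a: "1 \<le> a" "a \<le> 2 * N" and pos: "0 < bpos blk a"
  shows "2 \<le> a" "blk (a - 1) = blk a" "bpos blk a = Suc (bpos blk (a - 1))"
    "{l \<in> {1..<a}. blk l = blk a} = insert (a - 1) {l \<in> {1..<a - 1}. blk l = blk (a - 1)}"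
proof -
  have "{l \<in> {1..<a}. blk l = blk a} \<noteq> {}" using pos unfolding bpos_def by (metis card.empty less_irrefl)
  then obtain l where l: "1 \<le> l" "l < a" "blk l = blk a" by auto
  then show a2: "2 \<le> a" by simp
  have "blk l \<le> blk (a - 1)" "blk (a - 1) \<le> blk a" using l a by (intro blk_mono; simp)+
  then show eq: "blk (a - 1) = blk a" using l by simp
  show S: "{l \<in> {1..<a}. blk l = blk a} = insert (a - 1) {l \<in> {1..<a - 1}. blk l = blk (a - 1)}"
    using a2 eq by auto
  show "bpos blk a = Suc (bpos blk (a - 1))" unfolding bpos_def S by (subst card_insert_disjoint) auto
qed

lemma bpos_exists:
  assumes "1 \<le> a" "a \<le> 2 * N" "i < bpos blk a"
  shows "\<exists>b. 1 \<le> b \<and> b < a \<and> blk b = blk a \<and> bpos blk b = i"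
  using assms
proof (induction a rule: less_induct)
  case (less a)
  note p = bpos_pred[OF less.prems(1,2)]
  have "0 < bpos blk a" using less.prems by simp
  note p = p[OF this]
  show ?case
  proof (cases "i = bpos blk (a - 1)")
    case True
    then show ?thesis using p by (intro exI[of _ "a - 1"]) auto
  next
    case False
    then have "i < bpos blk (a - 1)" using less.prems(3) p(3) by simp
    then have "\<exists>b. 1 \<le> b \<and> b < a - 1 \<and> blk b = blk (a - 1) \<and> bpos blk b = i"
      using less.prems p(1) by (intro less.IH) auto
    then obtain b where "1 \<le> b" "b < a - 1" "blk b = blk (a - 1)" "bpos blk b = i" by blast
    then show ?thesis using p by (intro exI[of _ b]) auto
  qed
qed

lemma bpos_Suc:
  assumes "1 \<le> j" "j < k" "k \<le> 2 * N" "blk k = blk j"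
  shows "blk (Suc j) = blk j" "bpos blk (Suc j) = Suc (bpos blk j)"
proof -
  have "blk j \<le> blk (Suc j)" "blk (Suc j) \<le> blk k" using assms by (intro blk_mono; simp)+
  then show eq: "blk (Suc j) = blk j" using assms by simp
  have "j \<in> {l \<in> {1..<Suc j}. blk l = blk (Suc j)}" using assms eq by simp
  then have "0 < bpos blk (Suc j)" unfolding bpos_def by (subst card_gt_0_iff) auto
  then show "bpos blk (Suc j) = Suc (bpos blk j)" using bpos_pred(3)[of "Suc j"] assms by simp
qed

text \<open>Supplies the constant of the indicial equation in \<open>vanish_step\<close>: each
  earlier point of the block enters there with the factor \<open>bpos\<close> + 1.\<close>

lemma sum_bpos:
  assumes "1 \<le> a" "a \<le> 2 * N"
  shows "2 * (\<Sum>j | j \<in> {1..<a} \<and> blk j = blk a. real (bpos blk j) + 1) = real (bpos blk a) * (real (bpos blk a) + 1)"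
  using assms
proof (induction a rule: less_induct)
  case (less a)
  show ?case
  proof (cases "bpos blk a = 0")
    case True
    then have S: "{j \<in> {1..<a}. blk j = blk a} = {}" unfolding bpos_def by simp
    show ?thesis unfolding S by (simp add: True)
  next
    case False
    then have "0 < bpos blk a" by simp
    note p = bpos_pred[OF less.prems this]
    show ?thesis unfolding p(4)
      using less.IH[of "a - 1"] less.prems p(1,3) by (simp add: algebra_simps)
  qed
qed

lemma block_antisym_pair:
  "a \<in> {1..2*N} \<Longrightarrow> b \<in> {1..2*N} \<Longrightarrow> a \<noteq> b \<Longrightarrow> blk a = blk b \<Longrightarrow> antisym_pair N c a b"
  using c0 by (intro vanishing_antisym[OF c]) auto

lemma wsum_dup:
  assumes "a \<in> {1..2*N}" "b \<in> {1..2*N}" "a \<noteq> b" "blk a = blk b" "e a = e b" "x a = x b"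
  shows "wsum N c e x = 0"
  by (rule wsum_antisym_zero[where e = e and x = x, OF block_antisym_pair[OF assms(1-4)] assms(5,6)])

lemma locus_separates: "locus N blk n x \<Longrightarrow> separates N c x"
  unfolding separates_def
proof (intro ballI impI allI)
  fix m a b assume L: "locus N blk n x" and m: "m \<in> pairings N" "c m \<noteq> 0" "{a, b} \<in> m"
  have "blk a \<noteq> blk b" using c0 m by blast
  then show "x a \<noteq> x b" using locusD[OF L] pairings_linkD[OF m(1,3)] by blast
qed

text \<open>The directional derivative along a motion that stays on the locus: the point
  \<open>j\<close> moves together with all points fused to it, or alone if it is not fused.\<close>

lemma locus_shift:
  assumes L: "locus N blk n x" and j: "j \<in> {1..2*N}"
    and van: "\<And>x. locus N blk n x \<Longrightarrow> wsum N c e x = 0"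
  shows "(\<Sum>k | k \<in> {1..2*N} \<and> (k = j \<or> k \<le> n \<and> j \<le> n \<and> blk k = blk j). wsum N c (e(k := Suc (e k))) x) = 0"
proof -
  define S where "S = {k \<in> {1..2*N}. k = j \<or> k \<le> n \<and> j \<le> n \<and> blk k = blk j}"
  define v :: "nat \<Rightarrow> real" where "v = (\<lambda>k. if k \<in> S then 1 else 0)"
  have lim: "((\<lambda>t. x k + t * v k) \<longlongrightarrow> x k) (nhds (0::real))" for k
    using tendsto_add[OF tendsto_const[of "x k"] tendsto_mult[OF filterlim_ident[of "nhds (0::real)"] tendsto_const[of "v k"]]] by simp
  have "eventually (\<lambda>t. \<forall>(a, b)\<in>{1..2*N} \<times> {1..2*N}. x a \<noteq> x b \<longrightarrow> x a + t * v a \<noteq> x b + t * v b) (nhds 0)"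
    by (rule eventually_ne_coord[OF lim]) simp
  then have "eventually (\<lambda>t. wsum N c e (\<lambda>k. x k + t * v k) = 0) (nhds 0)"
  proof eventually_elim
    case (elim t)
    have "x p + t * v p = x q + t * v q \<longleftrightarrow> blk p = blk q \<and> p \<le> n \<and> q \<le> n"
      if pq: "p \<in> {1..2*N}" "q \<in> {1..2*N}" "p \<noteq> q" for p q
    proof (cases "x p = x q")
      case True
      then have *: "blk p = blk q \<and> p \<le> n \<and> q \<le> n" using locusD[OF L pq] by simp
      then have "p \<in> S \<longleftrightarrow> q \<in> S" using pq by (auto simp: S_def)
      then show ?thesis using True * by (simp add: v_def)
    next
      case False
      then show ?thesis using locusD[OF L pq] elim pq by auto
    qed
    then have "locus N blk n (\<lambda>k. x k + t * v k)" unfolding locus_def by blast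
    then show ?case by (rule van)
  qed
  then have "((\<lambda>t. wsum N c e (\<lambda>k. x k + t * v k)) has_real_derivative 0) (at 0)"
    using DERIV_cong_ev[OF refl _ refl, of "\<lambda>t. wsum N c e (\<lambda>k. x k + t * v k)" "\<lambda>_. 0" 0 0] by simp
  with wsum_DERIV[OF locus_separates[OF L], of e v]
  have "(\<Sum>k=1..2*N. v k * wsum N c (e(k := Suc (e k))) x) = 0" by (rule DERIV_unique)
  moreover have "(\<Sum>k=1..2*N. v k * wsum N c (e(k := Suc (e k))) x) = (\<Sum>k\<in>S. wsum N c (e(k := Suc (e k))) x)"
    by (rule sum.mono_neutral_cong_right) (auto simp: v_def S_def)
  ultimately show ?thesis by (simp add: S_def)
qed

section \<open>Splitting the last point off a fused cluster\<close>

context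
  fixes a :: nat
  assumes a: "a \<in> {1..2*N}" and pos: "0 < bpos blk a"
    and fused: "\<And>x. locus N blk a x \<Longrightarrow> wsum N c (fexp blk a) x = 0"
begin

abbreviation (input) "expo \<equiv> pexp blk a"
abbreviation (input) "ht \<equiv> bpos blk a"

lemma E_less: "b < a \<Longrightarrow> expo b = bpos blk b" and E_ge: "a \<le> b \<Longrightarrow> expo b = 0"
  by (simp_all add: pexp_def)

lemma q_facts: "2 \<le> a" "a - 1 \<in> {1..2*N}" "blk (a - 1) = blk a" "bpos blk a = Suc (bpos blk (a - 1))"
proof -
  have a': "1 \<le> a" "a \<le> 2 * N" using a by simp_all
  note p = bpos_pred[OF a' pos]
  show "2 \<le> a" "blk (a - 1) = blk a" "bpos blk a = Suc (bpos blk (a - 1))" by (rule p)+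
  show "a - 1 \<in> {1..2*N}" unfolding atLeastAtMost_iff using p(1) a' by linarith
qed

text \<open>The additional derivative gives \<open>j\<close> the exponent of its successor, which
  sits at the same place, so antisymmetry kills the sum.\<close>

lemma dup_Suc:
  assumes j: "1 \<le> j" "Suc j < a" "blk (Suc j) = blk j" and e: "e (Suc j) = expo (Suc j)" "e j = expo j"
    and x: "x (Suc j) = x j"
  shows "wsum N c (e(j := Suc (e j))) x = 0"
proof (rule wsum_dup[of j "Suc j"])
  have "bpos blk (Suc j) = Suc (bpos blk j)" using bpos_Suc(2)[of j "Suc j"] j a by simp
  then show "(e(j := Suc (e j))) j = (e(j := Suc (e j))) (Suc j)" using e j by (simp add: E_less)
qed (use j a x in auto)

text \<open>Moving the cluster of \<open>a\<close> differentiates each of its points in turn. Points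
  before \<open>a - 1\<close> then repeat the exponent of their successor, so just the terms of
  \<open>a - 1\<close> and \<open>a\<close> remain.\<close>

lemma shift_own_block:
  assumes L: "locus N blk a x" and van: "\<And>x. locus N blk a x \<Longrightarrow> wsum N c (expo(a := i)) x = 0"
  shows "wsum N c (expo(a - 1 := ht, a := i)) x + wsum N c (expo(a := Suc i)) x = 0"
proof -
  let ?e = "expo(a := i)"
  define S where "S = {k \<in> {1..2*N}. k = a \<or> k \<le> a \<and> a \<le> a \<and> blk k = blk a}"
  have "(\<Sum>k\<in>S. wsum N c (?e(k := Suc (?e k))) x) = 0"
    unfolding S_def by (rule locus_shift[OF L a van])
  moreover have "(\<Sum>k\<in>S. wsum N c (?e(k := Suc (?e k))) x) = (\<Sum>k\<in>{a - 1, a}. wsum N c (?e(k := Suc (?e k))) x)"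
  proof (rule sum.mono_neutral_right)
    show "{a - 1, a} \<subseteq> S" using a q_facts by (auto simp: S_def)
    show "\<forall>k\<in>S - {a - 1, a}. wsum N c (?e(k := Suc (?e k))) x = 0"
    proof
      fix k assume k: "k \<in> S - {a - 1, a}"
      then have k': "1 \<le> k" "Suc k < a" "k \<in> {1..2*N}" "blk k = blk a" by (auto simp: S_def)
      have eq: "blk (Suc k) = blk k" using bpos_Suc(1)[of k a] k' a by simp
      show "wsum N c (?e(k := Suc (?e k))) x = 0"
      proof (rule dup_Suc[OF k'(1,2) eq])
        show "x (Suc k) = x k" using locusD[OF L, of "Suc k" k] k' a eq by simp
      qed (use k' in auto)
    qed
  qed (auto simp: S_def)
  ultimately have "wsum N c (?e(a - 1 := Suc (?e (a - 1)))) x + wsum N c (?e(a := Suc (?e a))) x = 0"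
    using q_facts(1) by simp
  moreover have qa: "a \<noteq> a - 1" "a - 1 < a" using q_facts(1) by linarith+
  have "Suc (?e (a - 1)) = ht" using qa(1) by (simp only: fun_upd_other[OF not_sym[OF qa(1)]] E_less[OF qa(2)] q_facts(4))
  then have "?e(a - 1 := Suc (?e (a - 1))) = expo(a - 1 := ht, a := i)" by (simp only: fun_upd_twist[OF qa(1)])
  moreover have "?e(a := Suc (?e a)) = expo(a := Suc i)" by simp
  ultimately show ?thesis by (simp only:)
qed

text \<open>Within a cluster only the last point can take one more derivative without repeating the
  exponent of its successor, and that term is the whole derivative along the motion of the cluster.
  A point that is not fused moves alone.\<close>

lemma shift_other_block:
  assumes L: "locus N blk a x" and van: "\<And>x. locus N blk a x \<Longrightarrow> wsum N c (expo(a := i)) x = 0"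
    and j: "j \<in> {1..2*N}" "j \<noteq> a" "\<not> (j < a \<and> blk j = blk a)"
  shows "wsum N c (expo(j := Suc (expo j), a := i)) x = 0"
proof -
  let ?e = "expo(a := i)"
  have ej: "?e(j := Suc (?e j)) = expo(j := Suc (expo j), a := i)" using j(2) by auto
  have L': "x (Suc k) = x k" if "1 \<le> k" "Suc k < a" "blk (Suc k) = blk k" for k
    using locusD[OF L, of "Suc k" k] that a by simp
  show ?thesis
  proof (cases "Suc j < a \<and> blk (Suc j) = blk j")
    case True
    then have "wsum N c (?e(j := Suc (?e j))) x = 0"
      using j L'[of j] by (intro dup_Suc) auto
    then show ?thesis unfolding ej .
  next
    case False
    define S where "S = {k \<in> {1..2*N}. k = j \<or> k \<le> a \<and> j \<le> a \<and> blk k = blk j}"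
    have "(\<Sum>k\<in>S. wsum N c (?e(k := Suc (?e k))) x) = 0"
      unfolding S_def by (rule locus_shift[OF L j(1) van])
    moreover have "(\<Sum>k\<in>S. wsum N c (?e(k := Suc (?e k))) x) = (\<Sum>k\<in>{j}. wsum N c (?e(k := Suc (?e k))) x)"
    proof (rule sum.mono_neutral_right)
      show "{j} \<subseteq> S" using j by (auto simp: S_def)
      show "\<forall>k\<in>S - {j}. wsum N c (?e(k := Suc (?e k))) x = 0"
      proof
        fix k assume "k \<in> S - {j}"
        then have k: "k \<in> {1..2*N}" "k \<noteq> j" "k \<le> a" "j \<le> a" "blk k = blk j" by (auto simp: S_def)
        have "k \<noteq> a" "j < a" using k j by auto
        then have ka: "k < a" using k by simp
        have "\<not> j < k"
        proof
          assume "j < k"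
          then have "blk (Suc j) = blk j" using bpos_Suc(1)[of j k] k j a by auto
          then show False using False \<open>j < k\<close> ka by auto
        qed
        then have kj: "k < j" using k by simp
        have eq: "blk (Suc k) = blk k" using bpos_Suc(1)[of k j] k j kj by auto
        have "Suc k < a" using kj \<open>j < a\<close> by simp
        then show "wsum N c (?e(k := Suc (?e k))) x = 0"
          using k eq L'[of k] by (intro dup_Suc) auto
      qed
    qed (auto simp: S_def)
    ultimately have "wsum N c (?e(j := Suc (?e j))) x = 0" by simp
    then show ?thesis unfolding ej .
  qed
qed

text \<open>From \<open>r\<close> = 2 on, the exponent left at \<open>j\<close> is smaller than
  \<open>bpos blk j\<close> and is thus already taken by an earlier point at the same place. Only
  the first two terms of Leibniz' rule survive.\<close>

lemma leibniz_simplify: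
  assumes x: "\<And>i j. i \<in> {1..2*N} \<Longrightarrow> j \<in> {1..2*N} \<Longrightarrow> i < a \<Longrightarrow> j < a \<Longrightarrow> blk i = blk j \<Longrightarrow> x i = x j"
    and j: "j \<in> {1..2*N}"
  shows "leibniz N c a (Suc (expo j)) j expo x = 1 / (x j - x a) * wsum N c (expo(j := Suc (expo j))) x
     - (real (expo j) + 1) * (1 / (x j - x a))\<^sup>2 * wsum N c expo x"
proof -
  let ?f = "\<lambda>r. real (Suc (expo j) choose r) * ((- 1) ^ r * fact r / (x j - x a) ^ Suc r * wsum N c (expo(j := Suc (expo j) - r)) x)"
  have "leibniz N c a (Suc (expo j)) j expo x = (\<Sum>r\<in>{0, 1}. ?f r)"
    unfolding leibniz_def
  proof (rule sum.mono_neutral_right)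
    show "\<forall>r\<in>{..Suc (expo j)} - {0, 1}. ?f r = 0"
    proof
      fix r assume r: "r \<in> {..Suc (expo j)} - {0, 1}"
      then have r2: "2 \<le> r" "r \<le> Suc (expo j)" by auto
      then have "0 < expo j" by linarith
      then have ja: "j < a" by (rule contrapos_pp) (simp add: E_ge)
      then have Ej: "expo j = bpos blk j" by (rule E_less)
      have "Suc (expo j) - r < bpos blk j" using r2 \<open>0 < expo j\<close> Ej by linarith
      then obtain b where b: "1 \<le> b" "b < j" "blk b = blk j" "bpos blk b = Suc (expo j) - r"
        using bpos_exists[of j] j by auto
      have "wsum N c (expo(j := Suc (expo j) - r)) x = 0"
      proof (rule wsum_dup[of j b])
        show "(expo(j := Suc (expo j) - r)) j = (expo(j := Suc (expo j) - r)) b"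
          using b ja by (simp add: E_less)
        show "x j = x b" using b ja j by (intro x) auto
      qed (use b j in auto)
      then show "?f r = 0" by simp
    qed
  qed auto
  moreover have "?f 1 = - ((real (expo j) + 1) * (1 / (x j - x a))\<^sup>2 * wsum N c expo x)"
  proof -
    define d where "d = x j - x a"
    have "expo(j := Suc (expo j) - 1) = expo" by auto
    then show ?thesis unfolding d_def[symmetric] by (cases "d = 0") (simp_all add: power2_eq_square field_simps)
  qed
  ultimately show ?thesis by simp
qed

text \<open>Put \<open>a\<close> at distance t from its cluster in the null vector equation and
  compare the terms of order t^(r - 2). With \<open>A\<close> the Taylor derivative of order
  \<open>r\<close>, all lower ones being zero, this reads A (r (r + 1) - ht (ht + 1)) / r! = 0, and
  the bracket is positive for \<open>r\<close> above \<open>ht\<close>.\<close>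

lemma vanish_step:
  assumes L: "locus N blk a x" and r: "ht < r"
    and IH: "\<And>i x. i < r \<Longrightarrow> locus N blk a x \<Longrightarrow> wsum N c (expo(a := i)) x = 0"
  shows "wsum N c (expo(a := r)) x = 0"
proof -
  define A where "A = wsum N c (expo(a := r)) x"
  define X where "X = (\<lambda>t. x(a := x a + t))"
  define q where "q = a - 1"
  define B where "B = {j. j \<in> {1..<a} \<and> blk j = blk a}"
  define J where "J = {1..2*N} - {a} - B"
  have sep: "separates N c x" by (rule locus_separates[OF L])
  have Ea: "expo a = 0" by (simp add: E_ge)
  have E0: "expo(a := 0) = expo" using Ea by auto
  have qB: "q \<in> B" "q < a" using q_facts by (auto simp: q_def B_def)
  have Bsub: "B \<subseteq> {1..2*N} - {a}" using a by (auto simp: B_def)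
  have xB: "x j = x a" if "j \<in> B" for j using locusD[OF L, of j a] that a by (auto simp: B_def)
  have xJ: "x j \<noteq> x a" if "j \<in> J" for j using locusD[OF L, of j a] that a by (auto simp: B_def J_def)
  \<comment> \<open>\<open>ht\<close> is positive, so \<open>r\<close> is at least 2;
    \<open>k = r - 2\<close> is the order at which the equation is compared.\<close>
  obtain k where k: "r = Suc (Suc k)" using r pos by (metis Suc_lessE less_imp_Suc_add add_Suc_right not0_implies_Suc not_less0)
  have T\<phi>: "((\<lambda>t. wsum N c expo (X t) / t ^ r) \<longlongrightarrow> A / fact r) (at 0)"
    using taylor_wsum[OF sep a, of r expo 0] IH[OF _ L] unfolding X_def A_def by (simp add: E0)
  have T2: "((\<lambda>t. wsum N c (expo(a := 2)) (X t) / t ^ k) \<longlongrightarrow> A / fact k) (at 0)"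
    using taylor_wsum[OF sep a, of k expo 2] IH[OF _ L] k unfolding X_def A_def by simp
  \<comment> \<open>The function with the extra derivative at \<open>a - 1\<close> vanishes to order
    r - 1, and \<open>shift_own_block\<close> identifies its next derivative as - A.\<close>
  have T\<psi>: "((\<lambda>t. wsum N c (expo(q := ht)) (X t) / t ^ Suc k) \<longlongrightarrow> - A / fact (Suc k)) (at 0)"
  proof -
    have rel: "wsum N c ((expo(q := ht))(a := i)) x = - wsum N c (expo(a := Suc i)) x" if "i < r" for i
      using shift_own_block[OF L IH, of i] that unfolding q_def by (simp add: add_eq_0_iff2)
    have z: "wsum N c ((expo(q := ht))(a := 0 + i)) x = 0" if "i < Suc k" for i
      using rel[of i] IH[OF _ L, of "Suc i"] that k by simp
    have "(expo(q := ht))(a := 0) = expo(q := ht)" using Ea qB by auto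
    then show ?thesis
      using taylor_wsum[OF sep a z, of "Suc k"] rel[of "Suc k"] k unfolding X_def A_def by simp
  qed
  have T\<chi>: "\<exists>C. ((\<lambda>t. wsum N c (expo(j := Suc (expo j))) (X t) / t ^ r) \<longlongrightarrow> C) (at 0)" if j: "j \<in> J" for j
  proof -
    have j': "j \<in> {1..2*N}" "j \<noteq> a" "\<not> (j < a \<and> blk j = blk a)" using j by (auto simp: J_def B_def)
    have z: "wsum N c ((expo(j := Suc (expo j)))(a := 0 + i)) x = 0" if "i < r" for i
      using shift_other_block[OF L IH[OF that] j'] by simp
    have "(expo(j := Suc (expo j)))(a := 0) = expo(j := Suc (expo j))" using Ea j'(2) by auto
    then show ?thesis using taylor_wsum[OF sep a z, of r] unfolding X_def by auto
  qed
  then obtain C where T\<chi>: "\<And>j. j \<in> J \<Longrightarrow> ((\<lambda>t. wsum N c (expo(j := Suc (expo j))) (X t) / t ^ r) \<longlongrightarrow> C j) (at 0)"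
    by metis
  \<comment> \<open>The left-hand side of the null vector equation divided by t^(r - 2), arranged so
    that every quotient has a limit. The points outside the cluster keep a factor t^2 and disappear
    in the limit.\<close>
  define G where "G = (\<lambda>t. wsum N c (expo(a := 2)) (X t) / t ^ k - 2 * (wsum N c (expo(q := ht)) (X t) / t ^ Suc k)
      - real ht * (real ht + 1) * (wsum N c expo (X t) / t ^ r)
      + 2 * (\<Sum>j\<in>J. t\<^sup>2 * (1 / (x j - (x a + t)) * (wsum N c (expo(j := Suc (expo j))) (X t) / t ^ r)
           - (real (expo j) + 1) * (1 / (x j - (x a + t)))\<^sup>2 * (wsum N c expo (X t) / t ^ r))))"
  have lim: "((\<lambda>t. (X t) j) \<longlongrightarrow> x j) (at 0)" for j
    using tendsto_add[OF tendsto_const[of "x a"] tendsto_ident_at[of "0::real" UNIV]]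
    by (cases "j = a") (auto simp: X_def)
  have G: "(G \<longlongrightarrow> A / fact k - 2 * (- A / fact (Suc k)) - real ht * (real ht + 1) * (A / fact r)
      + 2 * (\<Sum>j\<in>J. 0\<^sup>2 * (1 / (x j - x a) * C j - (real (expo j) + 1) * (1 / (x j - x a))\<^sup>2 * (A / fact r)))) (at 0)"
    unfolding G_def
  proof (intro tendsto_add tendsto_diff tendsto_mult tendsto_const T2 T\<psi> T\<phi> tendsto_sum tendsto_power tendsto_ident_at)
    fix j assume j: "j \<in> J"
    have "((\<lambda>t. x j - (x a + t)) \<longlongrightarrow> x j - (x a + 0)) (at (0::real))" by (intro tendsto_intros)
    then show t: "((\<lambda>t. 1 / (x j - (x a + t))) \<longlongrightarrow> 1 / (x j - x a)) (at 0)"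
      using xJ[OF j] by (intro tendsto_divide tendsto_const) auto
    then show "((\<lambda>t. 1 / (x j - (x a + t))) \<longlongrightarrow> 1 / (x j - x a)) (at 0)" .
    show "((\<lambda>t. wsum N c (expo(j := Suc (expo j))) (X t) / t ^ r) \<longlongrightarrow> C j) (at 0)" by (rule T\<chi>[OF j])
  qed
  have ev: "eventually (\<lambda>t. G t = 0) (at 0)"
  proof -
    have "eventually (\<lambda>t. \<forall>(i, j)\<in>{1..2*N} \<times> {1..2*N}. x i \<noteq> x j \<longrightarrow> X t i \<noteq> X t j) (at 0)"
      by (rule eventually_ne_coord[OF lim]) simp
    moreover have "eventually (\<lambda>t::real. t \<noteq> 0) (at 0)" by (simp add: eventually_at_filter)
    ultimately show ?thesis using separates_open[OF sep lim]
    proof eventually_elim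
      case (elim t)
      have Xj: "X t j = x j" if "j \<noteq> a" for j using that by (simp add: X_def)
      have Xa: "X t a = x a + t" by (simp add: X_def)
      have ne: "X t j \<noteq> X t a" if "j \<in> {1..2*N}" "j \<noteq> a" for j
      proof (cases "x j = x a")
        case True
        then show ?thesis using elim(2) that by (simp add: Xj Xa)
      next
        case False
        then show ?thesis using elim(1) that a by blast
      qed
      define \<phi> \<psi> where "\<phi> = wsum N c expo (X t)" and "\<psi> = wsum N c (expo(q := ht)) (X t)"
      define g where "g = (\<lambda>j. 1 / (X t j - X t a) * wsum N c (expo(j := Suc (expo j))) (X t)
          - (real (expo j) + 1) * (1 / (X t j - X t a))\<^sup>2 * \<phi>)"
      have xeq: "X t i = X t j" if "i \<in> {1..2*N}" "j \<in> {1..2*N}" "i < a" "j < a" "blk i = blk j" for i j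
        using locusD[OF L, of i j] that by (cases "i = j") (auto simp: Xj)
      have "wsum N c (expo(a := 2)) (X t) + 2 * (\<Sum>j\<in>{1..2*N} - {a}. leibniz N c a (Suc (expo j)) j expo (X t)) = 0"
        by (rule null_vector[where x = "X t" and e = "pexp blk a", OF c a Ea elim(3) ne])
      also have "(\<Sum>j\<in>{1..2*N} - {a}. leibniz N c a (Suc (expo j)) j expo (X t)) = (\<Sum>j\<in>{1..2*N} - {a}. g j)"
        unfolding g_def \<phi>_def by (rule sum.cong[OF refl], rule leibniz_simplify, erule (4) xeq) simp
      also have "\<dots> = sum g J + sum g B"
        unfolding J_def by (rule sum.subset_diff[OF Bsub]) simp
      \<comment> \<open>At distance - t each point of the cluster contributes its multiple of 1 /
        t^2. The first order term survives only at \<open>q = a - 1\<close>; elsewhere the added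
        derivative repeats an exponent.\<close>
      also have "sum g B = - (\<psi> / t) - real ht * (real ht + 1) / 2 * \<phi> / t\<^sup>2"
      proof -
        have "g j = (if j = q then - (\<psi> / t) else 0) - (real (bpos blk j) + 1) * (\<phi> / t\<^sup>2)" if j: "j \<in> B" for j
        proof -
          have ja: "j < a" "1 \<le> j" "blk j = blk a" "j \<noteq> a" using j by (auto simp: B_def)
          have d: "X t j - X t a = - t" using xB[OF j] by (simp add: Xj[OF ja(4)] Xa)
          have w: "wsum N c (expo(j := Suc (expo j))) (X t) = (if j = q then \<psi> else 0)"
          proof (cases "j = q")
            case True
            then have "Suc (expo j) = ht" using q_facts(1,4) by (simp add: q_def E_less)
            then show ?thesis using True by (simp add: \<psi>_def)
          next
            case False
            then have "Suc j < a" using ja by (simp add: q_def)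
            moreover have eq: "blk (Suc j) = blk j" using bpos_Suc(1)[of j a] ja a by simp
            ultimately show ?thesis
              using ja a xeq[of "Suc j" j] False by (simp add: dup_Suc)
          qed
          show ?thesis unfolding g_def d w using elim(2) ja by (simp add: E_less power2_eq_square field_simps)
        qed
        then have "sum g B = (\<Sum>j\<in>B. (if j = q then - (\<psi> / t) else 0) - (real (bpos blk j) + 1) * (\<phi> / t\<^sup>2))"
          by (rule sum.cong[OF refl])
        also have "\<dots> = - (\<psi> / t) - (\<Sum>j\<in>B. real (bpos blk j) + 1) * (\<phi> / t\<^sup>2)"
        proof -
          have "finite B" by (simp add: B_def)
          then show ?thesis using qB by (simp add: sum_subtractf sum_distrib_right sum_divide_distrib)
        qed
        also have "(\<Sum>j\<in>B. real (bpos blk j) + 1) = real ht * (real ht + 1) / 2"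
          using sum_bpos[of a] a by (simp add: B_def)
        finally show ?thesis by simp
      qed
      finally have eq: "wsum N c (expo(a := 2)) (X t) + 2 * (sum g J + (- (\<psi> / t) - real ht * (real ht + 1) / 2 * \<phi> / t\<^sup>2)) = 0" .
      have "G t = (wsum N c (expo(a := 2)) (X t) + 2 * (sum g J + (- (\<psi> / t) - real ht * (real ht + 1) / 2 * \<phi> / t\<^sup>2))) / t ^ k"
      proof -
        have tr: "t ^ r = t\<^sup>2 * t ^ k" "t ^ Suc k = t * t ^ k" by (simp_all add: k power2_eq_square)
        have gJ: "(\<Sum>j\<in>J. t\<^sup>2 * (1 / (x j - (x a + t)) * (wsum N c (expo(j := Suc (expo j))) (X t) / t ^ r)
             - (real (expo j) + 1) * (1 / (x j - (x a + t)))\<^sup>2 * (wsum N c expo (X t) / t ^ r))) = sum g J / t ^ k"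
          unfolding sum_divide_distrib
        proof (rule sum.cong[OF refl])
          fix j assume "j \<in> J"
          then have "j \<noteq> a" by (auto simp: J_def)
          then show "t\<^sup>2 * (1 / (x j - (x a + t)) * (wsum N c (expo(j := Suc (expo j))) (X t) / t ^ r)
             - (real (expo j) + 1) * (1 / (x j - (x a + t)))\<^sup>2 * (wsum N c expo (X t) / t ^ r)) = g j / t ^ k"
            unfolding g_def \<phi>_def tr using elim(2) by (simp add: Xj Xa right_diff_distrib diff_divide_distrib)
        qed
        have "P / T - 2 * (\<psi> / (t * T)) - S * (\<phi> / (t\<^sup>2 * T)) + 2 * (g' / T)
            = (P + 2 * (g' + (- (\<psi> / t) - S / 2 * \<phi> / t\<^sup>2))) / T" if "T \<noteq> 0" for P T S g' :: real
          using that elim(2) by (simp add: field_simps power2_eq_square)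
        moreover have "t ^ k \<noteq> 0" using elim(2) by simp
        ultimately show ?thesis
          unfolding G_def gJ unfolding tr \<phi>_def[symmetric] \<psi>_def[symmetric] by blast
      qed
      then show ?case using eq by simp
    qed
  qed
  have "(G \<longlongrightarrow> 0) (at 0)" unfolding tendsto_cong[OF ev] by (rule tendsto_const)
  from tendsto_unique[OF trivial_limit_at G this]
  have "A / fact k - 2 * (- A / fact (Suc k)) - real ht * (real ht + 1) * (A / fact r) = 0" by simp
  moreover have "fact r = (real k + 2) * ((real k + 1) * fact k)" "fact (Suc k) = (real k + 1) * fact k"
    by (simp_all add: k algebra_simps)
  \<comment> \<open>Used with u = r and p = r - 1, for which u p + 2 u = r (r + 1).\<close>
  moreover have "A / f - 2 * (- A / (p * f)) - S * (A / (u * (p * f))) = A * (u * p + 2 * u - S) / (u * (p * f))"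
    if "f \<noteq> 0" "p \<noteq> 0" "u \<noteq> 0" for f p u S :: real
    using that by (simp add: field_simps)
  from this[of "fact k" "real k + 1" "real k + 2" "real ht * (real ht + 1)"]
  have "A / fact k - 2 * (- A / ((real k + 1) * fact k)) - real ht * (real ht + 1) * (A / ((real k + 2) * ((real k + 1) * fact k)))
      = A * ((real k + 2) * (real k + 1) + 2 * (real k + 2) - real ht * (real ht + 1)) / ((real k + 2) * ((real k + 1) * fact k))"
    by simp
  moreover have "(real k + 2) * ((real k + 1) * fact k) \<noteq> 0" by simp
  ultimately have "A * ((real k + 2) * (real k + 1) + 2 * (real k + 2) - real ht * (real ht + 1)) = 0"
    by (simp only: divide_eq_0_iff) blast
  moreover have "real ht * (real ht + 1) < (real k + 2) * (real k + 1) + 2 * (real k + 2)"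
  proof -
    have "real ht + 1 \<le> real r" using r by simp
    then have "real ht * (real ht + 1) < real r * (real r + 1)"
      by (intro mult_strict_mono') auto
    then show ?thesis by (simp add: k algebra_simps)
  qed
  ultimately show ?thesis by (simp add: A_def)
qed

text \<open>Below order \<open>ht\<close> an earlier point of the block has the same exponent, order
  \<open>ht\<close> is the hypothesis \<open>fused\<close>, and above it the indicial equation
  decides.\<close>

lemma vanish_all:
  assumes "locus N blk a x"
  shows "wsum N c (expo(a := r)) x = 0"
  using assms
proof (induction r arbitrary: x rule: less_induct)
  case (less r)
  show ?case
  proof (rule linorder_cases[of r ht])
    assume "r < ht"
    then obtain b where b: "1 \<le> b" "b < a" "blk b = blk a" "bpos blk b = r"
      using bpos_exists[of a r] a by auto
    show ?thesis
    proof (rule wsum_dup[of a b])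
      show "x a = x b" using locusD[OF less.prems, of a b] a b by auto
    qed (use a b in \<open>auto simp: E_less\<close>)
  next
    assume "r = ht"
    then have "expo(a := r) = fexp blk a" by (auto simp: fexp_def pexp_def fun_eq_iff)
    then show ?thesis using fused[OF less.prems] by simp
  next
    assume "ht < r"
    then show ?thesis using vanish_step[OF less.prems] less.IH by blast
  qed
qed

text \<open>In the variable of \<open>a\<close> the sum is rational, with poles only at points of
  other blocks. By \<open>vanish_all\<close> its Taylor series at the cluster is zero, so it
  vanishes wherever \<open>a\<close> is placed.\<close>

lemma unfuse_step:
  assumes L: "locus N blk (a - 1) x"
  shows "wsum N c (pexp blk a) x = 0"
proof -
  define q where "q = a - 1"
  define x1 where "x1 = x(a := x q)"
  have qa: "q \<noteq> a" "q \<in> {1..2*N}" "blk q = blk a" "q < a" using q_facts by (auto simp: q_def)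
  have L1: "locus N blk a x1"
    unfolding locus_def
  proof (intro ballI impI)
    fix i j assume ij: "i \<in> {1..2*N}" "j \<in> {1..2*N}" "i \<noteq> j"
    have *: "x q = x j \<longleftrightarrow> blk a = blk j \<and> j \<le> a" if "j \<in> {1..2*N}" "j \<noteq> a" for j
      using locusD[OF L qa(2) that(1)] that qa by (cases "j = q") (auto simp: q_def)
    show "x1 i = x1 j \<longleftrightarrow> blk i = blk j \<and> i \<le> a \<and> j \<le> a"
    proof (cases "i = a \<or> j = a")
      case True
      then show ?thesis using *[of i] *[of j] ij by (auto simp: x1_def)
    next
      case False
      then show ?thesis using locusD[OF L ij] by (auto simp: x1_def)
    qed
  qed
  \<comment> \<open>Partial fractions in the variable of \<open>a\<close>: each pairing contributes
    one pole, at the place of the partner of \<open>a\<close>.\<close>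
  define P where "P = {m \<in> pairings N. c m \<noteq> 0}"
  define F where "F = (\<lambda>y. wsum N c expo (x(a := y)))"
  define D where "D = (\<lambda>m. c m * (fact (expo (partner m a) + 1) / pi * kprod expo x (m - {{a, partner m a}})))"
  have "F (x a) = 0"
  proof (rule eval_rational_zero[where F = F and y = "x a" and P = P and D = D and z = "\<lambda>m. x (partner m a)" and n = "\<lambda>m. expo (partner m a) + 2" and \<xi> = "x q"])
    show "finite P" by (simp add: P_def)
    show "F y = (\<Sum>m\<in>P. D m / (y - x (partner m a)) ^ (expo (partner m a) + 2))" for y
    proof -
      have "F y = (\<Sum>m\<in>P. c m * kprod expo (x(a := y)) m)"
        unfolding F_def wsum_real by (rule sum.mono_neutral_right) (auto simp: P_def)
      also have "\<dots> = (\<Sum>m\<in>P. D m / (y - x (partner m a)) ^ (expo (partner m a) + 2))"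
      proof (rule sum.cong[OF refl])
        fix m assume "m \<in> P"
        then have m: "m \<in> pairings N" by (simp add: P_def)
        note l = partner_link[OF m a]
        have "a \<noteq> partner m a" by (rule pairings_linkD(1)[OF m l])
        then have "kprod expo (x(a := y)) m = kap (expo a) (expo (partner m a)) (y - x (partner m a)) * kprod expo x (m - {{a, partner m a}})"
          by (subst kprod_link[OF m l, of expo expo _ x]) auto
        then show "c m * kprod expo (x(a := y)) m = D m / (y - x (partner m a)) ^ (expo (partner m a) + 2)"
          by (simp add: D_def kap_def E_ge mult_ac)
      qed
      finally show ?thesis .
    qed
    have P: "blk (partner m a) \<noteq> blk a" "partner m a \<in> {1..2*N}" "partner m a \<noteq> a" if "m \<in> P" for m
    proof -
      have m: "m \<in> pairings N" "c m \<noteq> 0" using that by (auto simp: P_def)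
      note l = partner_link[OF m(1) a]
      show "blk (partner m a) \<noteq> blk a" using c0[OF m(1) l] m(2) by auto
      then show "partner m a \<noteq> a" by auto
      show "partner m a \<in> {1..2*N}" by (rule pairings_linkD(3)[OF m(1) l])
    qed
    show "x (partner m a) \<noteq> x q" if "m \<in> P" for m
      using locusD[OF L P(2)[OF that] qa(2)] P[OF that] qa by auto
    show "x (partner m a) \<noteq> x a" if "m \<in> P" for m
      using locusD[OF L P(2)[OF that] a] P[OF that] by auto
    show "((\<lambda>t. F (x q + t) / t ^ r) \<longlongrightarrow> 0) (at 0)" for r
    proof -
      have "((\<lambda>t. wsum N c (expo(a := 0)) (x1(a := x1 a + t)) / t ^ r) \<longlongrightarrow> wsum N c (expo(a := 0 + r)) x1 / fact r) (at 0)"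
        by (rule taylor_wsum[OF locus_separates[OF L1] a]) (simp add: vanish_all[OF L1])
      moreover have "expo(a := 0) = expo" by (auto simp: E_ge)
      moreover have "x1(a := x1 a + t) = x(a := x q + t)" for t by (simp add: x1_def)
      ultimately show ?thesis by (simp add: vanish_all[OF L1] F_def)
    qed
  qed
  then show ?thesis by (simp add: F_def)
qed

end

text \<open>Let the two ends of every link of \<open>m0\<close> approach each other at distance t
  while different links stay apart. Only \<open>m0\<close> has a pole of the full order 2N, so
  t^(2N) times the sum tends to \<open>c m0\<close> / pi^N.\<close>

lemma wsum_config_zero:
  assumes zero: "\<And>x. inj_on x {1..2*N} \<Longrightarrow> wsum N c (\<lambda>_. 0) x = 0" and m0: "m0 \<in> pairings N"
  shows "c m0 = 0"
proof -
  \<comment> \<open>\<open>u j\<close> is the left end of the link of \<open>j\<close>: a separate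
    integer site for every link. \<open>X\<close> shifts the right end by t.\<close>
  define u where "u = (\<lambda>j. min j (partner m0 j))"
  define X where "X = (\<lambda>t j. real (u j) + (if j \<in> Min ` m0 then 0 else t))"
  have u: "u j = u k \<longleftrightarrow> j = k \<or> {j, k} \<in> m0" if "j \<in> {1..2*N}" "k \<in> {1..2*N}" for j k
  proof
    assume eq: "u j = u k"
    have lj: "{j, partner m0 j} \<in> m0" "{k, partner m0 k} \<in> m0" using partner_link[OF m0] that by auto
    have "u i \<in> {i, partner m0 i}" for i by (simp add: u_def min_def)
    from this[of j] this[of k] eq have "u j \<in> {j, partner m0 j}" "u j \<in> {k, partner m0 k}" by simp_all
    then have "{j, partner m0 j} = {k, partner m0 k}" using pairings_unique_link[OF m0 lj] by blast
    then show "j = k \<or> {j, k} \<in> m0" using lj by (auto simp: doubleton_eq_iff)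
  next
    assume "j = k \<or> {j, k} \<in> m0"
    then show "u j = u k"
    proof
      assume l: "{j, k} \<in> m0"
      then have "partner m0 j = k" "partner m0 k = j" using partner_eq[OF m0] by (auto simp: insert_commute)
      then show ?thesis by (simp add: u_def min.commute)
    qed simp
  qed
  have minl: "(j \<in> Min ` m0 \<longleftrightarrow> k \<notin> Min ` m0)" if "{j, k} \<in> m0" for j k
  proof (cases "j < k")
    case True
    then show ?thesis using pairings_Min[OF m0 that] by auto
  next
    case False
    then have "k < j" using pairings_linkD(1)[OF m0 that] by auto
    then show ?thesis using pairings_Min[OF m0, of k j] that by (auto simp: insert_commute)
  qed
  have Xlim: "((\<lambda>t. X t j) \<longlongrightarrow> real (u j)) (at_right 0)" for j
    by (cases "j \<in> Min ` m0") (auto simp: X_def intro!: tendsto_eq_intros)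
  have small: "eventually (\<lambda>t::real. 0 < t \<and> t < 1) (at_right 0)"
    using eventually_at_right_less[of "0::real"] eventually_at_right_real[of 0 1] by (auto elim: eventually_elim2)
  have inj: "inj_on (X t) {1..2*N}" if t: "0 < t" "t < 1" for t
  proof (rule inj_onI)
    fix j k assume jk: "j \<in> {1..2*N}" "k \<in> {1..2*N}" "X t j = X t k"
    have "\<bar>real (u j) - real (u k)\<bar> < 1" using jk(3) t by (auto simp: X_def split: if_splits)
    then have "u j = u k" by linarith
    then have "j = k \<or> {j, k} \<in> m0" using u jk by simp
    moreover have "j \<in> Min ` m0 \<longleftrightarrow> k \<in> Min ` m0"
      using jk(3) t \<open>u j = u k\<close> by (auto simp: X_def split: if_splits)
    ultimately show "j = k" using minl by auto
  qed
  have lim: "((\<lambda>t. c m * (\<Prod>l\<in>m. t\<^sup>2 * klink (\<lambda>_. 0) (X t) l)) \<longlongrightarrow> c m * (\<Prod>l\<in>m. if l \<in> m0 then 1 / pi else 0)) (at_right 0)"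
    if m: "m \<in> pairings N" for m
  proof (intro tendsto_mult tendsto_const tendsto_prod)
    fix l assume l: "l \<in> m"
    obtain j k where jk: "l = {j, k}" "j < k" "j \<in> {1..2*N}" "k \<in> {1..2*N}" using pairings_link[OF m l] by metis
    show "((\<lambda>t. t\<^sup>2 * klink (\<lambda>_. 0) (X t) l) \<longlongrightarrow> (if l \<in> m0 then 1 / pi else 0)) (at_right 0)"
    proof (cases "l \<in> m0")
      case True
      have "t\<^sup>2 * klink (\<lambda>_. 0) (X t) l = 1 / pi" if "0 < t" for t
      proof -
        have "\<bar>X t j - X t k\<bar> = t"
          using u[OF jk(3,4)] minl[of j k] True jk that by (auto simp: X_def)
        then have "(X t j - X t k)\<^sup>2 = t\<^sup>2" by (metis power2_abs)
        moreover have "kap 0 0 d = 1 / (pi * d\<^sup>2)" for d by (simp add: kap_def numeral_2_eq_2)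
        ultimately show ?thesis using that by (simp add: jk(1) klink_pair)
      qed
      then have "eventually (\<lambda>t. t\<^sup>2 * klink (\<lambda>_. 0) (X t) l = 1 / pi) (at_right 0)"
        using small by (auto elim: eventually_mono)
      then show ?thesis using True by (simp add: tendsto_eventually)
    next
      case False
      then have "real (u j) \<noteq> real (u k)" using u[OF jk(3,4)] jk by auto
      then have "((\<lambda>t. t\<^sup>2 * kap 0 0 (X t j - X t k)) \<longlongrightarrow> 0\<^sup>2 * kap 0 0 (real (u j) - real (u k))) (at_right 0)"
        by (intro tendsto_mult tendsto_power tendsto_ident_at
            isCont_tendsto_compose[OF DERIV_isCont[OF kap_DERIV]] tendsto_diff Xlim) simp
      then show ?thesis using False by (simp add: jk(1) klink_pair)
    qed
  qed
  have lim': "((\<lambda>t. \<Sum>m\<in>pairings N. c m * (\<Prod>l\<in>m. t\<^sup>2 * klink (\<lambda>_. 0) (X t) l)) \<longlongrightarrow>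
      (\<Sum>m\<in>pairings N. c m * (\<Prod>l\<in>m. if l \<in> m0 then 1 / pi else 0))) (at_right 0)"
    by (intro tendsto_sum lim)
  have val: "(\<Sum>m\<in>pairings N. c m * (\<Prod>l\<in>m. if l \<in> m0 then 1 / pi else 0)) = c m0 * (1 / pi) ^ N"
  proof -
    have "(\<Prod>l\<in>m. if l \<in> m0 then 1 / pi else 0) = (if m = m0 then (1 / pi) ^ N else 0)" if m: "m \<in> pairings N" for m
    proof (cases "m = m0")
      case False
      then obtain l where "l \<in> m" "l \<notin> m0" using pairings_subset_eq[OF m m0] by blast
      then show ?thesis using False pairings_finite[OF m] by (auto intro!: prod_zero)
    qed (simp add: card_pairings[OF m0])
    then have "(\<Sum>m\<in>pairings N. c m * (\<Prod>l\<in>m. if l \<in> m0 then 1 / pi else 0))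
        = (\<Sum>m\<in>pairings N. if m = m0 then c m0 * (1 / pi) ^ N else 0)"
      by (intro sum.cong refl) auto
    then show ?thesis using m0 by simp
  qed
  have ev: "eventually (\<lambda>t. (\<Sum>m\<in>pairings N. c m * (\<Prod>l\<in>m. t\<^sup>2 * klink (\<lambda>_. 0) (X t) l)) = 0) (at_right 0)"
    using small
  proof eventually_elim
    case (elim t)
    have "(\<Sum>m\<in>pairings N. c m * (\<Prod>l\<in>m. t\<^sup>2 * klink (\<lambda>_. 0) (X t) l)) = (t\<^sup>2) ^ N * wsum N c (\<lambda>_. 0) (X t)"
      unfolding wsum_real sum_distrib_left
      by (intro sum.cong refl) (simp add: prod.distrib card_pairings kprod_def)
    then show ?case using zero[OF inj] elim by simp
  qed
  have "((\<lambda>t::real. 0) \<longlongrightarrow> c m0 * (1 / pi) ^ N) (at_right (0::real))"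
    using lim' unfolding val tendsto_cong[OF ev] .
  then have "0 = c m0 * (1 / pi) ^ N"
    by (rule tendsto_unique[OF trivial_limit_at_right_real tendsto_const])
  then show ?thesis by simp
qed

text \<open>Unfuse the points from the last to the first. A point that opens its block changes
  neither the exponents nor the locus; any other is split off by \<open>unfuse_step\<close>. With
  nothing fused, \<open>wsum_config_zero\<close> reads off the coefficients.\<close>

lemma fused_injective:
  assumes zero: "\<And>x. locus N blk (2*N) x \<Longrightarrow> wsum N c (fexp blk (2*N)) x = 0"
  shows "c m = 0"
proof (cases "m \<in> pairings N")
  case m: True
  have "\<forall>x. locus N blk n x \<longrightarrow> wsum N c (fexp blk n) x = 0" if "n \<le> 2 * N" for n
    using that
  proof (induction n rule: inc_induct)
    case base
    then show ?case using zero by blast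
  next
    case (step n)
    define a where "a = Suc n"
    have a: "a \<in> {1..2*N}" "a - 1 = n" using step.hyps by (auto simp: a_def)
    show ?case
    proof (cases "bpos blk a = 0")
      case True
      have none: "blk i \<noteq> blk a" if "1 \<le> i" "i < a" for i
        using True that unfolding bpos_def by auto
      have E: "fexp blk a = fexp blk n" using True by (auto simp: fexp_def a_def fun_eq_iff le_Suc_eq)
      have "locus N blk a x \<longleftrightarrow> locus N blk n x" for x
      proof -
        have "(blk i = blk j \<and> i \<le> a \<and> j \<le> a) \<longleftrightarrow> (blk i = blk j \<and> i \<le> n \<and> j \<le> n)"
          if "i \<in> {1..2*N}" "j \<in> {1..2*N}" "i \<noteq> j" for i j
          using none[of i] none[of j] that by (auto simp: a_def le_Suc_eq)
        then show ?thesis unfolding locus_def by (intro ball_cong refl imp_cong) simp_all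
      qed
      then show ?thesis using step.IH E by (simp add: a_def)
    next
      case False
      then have pos: "0 < bpos blk a" by simp
      have "wsum N c (fexp blk a) x = 0" if "locus N blk a x" for x using step.IH that by (simp add: a_def)
      from unfuse_step[OF a(1) pos this] have "wsum N c (pexp blk a) x = 0" if "locus N blk n x" for x
        using that unfolding a(2) by blast
      moreover have "pexp blk a = fexp blk n" by (auto simp: pexp_def fexp_def a_def fun_eq_iff less_Suc_eq_le)
      ultimately show ?thesis by simp
    qed
  qed
  note z = mp[OF spec[OF this[OF le0]]]
  show ?thesis
  proof (rule wsum_config_zero[OF _ m])
    fix x :: "nat \<Rightarrow> real" assume inj: "inj_on x {1..2*N}"
    have L: "locus N blk 0 x"
      unfolding locus_def
    proof (intro ballI impI)
      fix i j assume ij: "i \<in> {1..2*N}" "j \<in> {1..2*N}" "i \<noteq> j"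
      then have "x i \<noteq> x j" using inj_on_eq_iff[OF inj ij(1,2)] by simp
      then show "x i = x j \<longleftrightarrow> blk i = blk j \<and> i \<le> 0 \<and> j \<le> 0" using ij(1) by simp
    qed
    have "wsum N c (\<lambda>_. 0) x = wsum N c (fexp blk 0) x" by (rule wsum_cong) (auto simp: fexp_def)
    also have "\<dots> = 0" by (rule z[OF L])
    finally show "wsum N c (\<lambda>_. 0) x = 0" .
  qed
qed (rule pluecker_outside[OF c])

end

section \<open>Pure partition functions vanish on links outside their peaks\<close>

text \<open>Otherwise \<open>i\<close> is linked to the right beyond \<open>Suc i\<close>, and
  \<open>Suc i\<close> to the left beyond \<open>i\<close>, and the two links cross.\<close>

lemma LP_peak_link:
  assumes \<beta>: "\<beta> \<in> LP N" and i: "i \<in> Min ` \<beta>" "Suc i \<notin> Min ` \<beta>" "1 \<le> i" "Suc i \<le> 2 * N"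
  shows "{i, Suc i} \<in> \<beta>"
proof -
  have m: "\<beta> \<in> pairings N" using \<beta> LP_subset_pairings by blast
  obtain b where b: "{i, b} \<in> \<beta>" "i \<noteq> b" using pairings_partner[OF m, of i] i by auto
  obtain a where a: "{Suc i, a} \<in> \<beta>" "Suc i \<noteq> a" using pairings_partner[OF m, of "Suc i"] i by auto
  have "\<not> b < i" using pairings_Min(2)[OF m, of b i] b i by (auto simp: insert_commute)
  moreover have "\<not> Suc i < a" using pairings_Min(1)[OF m, of "Suc i" a] a i by auto
  ultimately have o: "i < b" "a < Suc i" using a b by auto
  show ?thesis
  proof (cases "b = Suc i")
    case False
    have "a \<noteq> i" using False pairings_unique[OF m b(1), of "Suc i"] a by (auto simp: insert_commute)
    then have "a < i" "Suc i < b" using o False by auto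
    then show ?thesis using LP_noncrossing[OF \<beta>, of a "Suc i" i b] a b by (auto simp: insert_commute)
  qed (use b in simp)
qed

lemma flip_set_inverse: "i \<in> A \<Longrightarrow> Suc i \<notin> A \<Longrightarrow> A = insert i (insert (Suc i) (A - {i}) - {Suc i})"
  by auto

lemma cpath_flip:
  assumes "i \<in> A" "Suc i \<notin> A" "1 \<le> i"
  shows "cpath (insert (Suc i) (A - {i})) j = cpath A j - (if j = i then 2 else 0)"
proof (induction j)
  case (Suc j)
  then show ?case using assms by (auto simp: cpath_Suc)
qed (use assms in simp)

section \<open>Flipping a peak of a link pattern\<close>

context
  fixes N i p q :: nat and \<beta> \<beta>' :: "nat set set"
  assumes m: "\<beta> \<in> pairings N" and l: "{i, Suc i} \<in> \<beta>" "{p, q} \<in> \<beta>" and pq: "p < i" "Suc i < q"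
    and \<beta>': "\<beta>' = pact (swp (Suc i) p) \<beta>"
begin

lemma flip_eq: "\<beta>' = (\<beta> - {{i, Suc i}, {p, q}}) \<union> {{i, p}, {Suc i, q}}"
  unfolding \<beta>' using pq by (intro pact_swp_eq[OF m l]) (auto simp: doubleton_eq_iff)

lemma flip_pairings: "\<beta>' \<in> pairings N"
  unfolding \<beta>' using pact_swp_pairings[OF m] pairings_linkD[OF m] l by auto

lemma flip_Min: "Min ` \<beta>' = insert (Suc i) (Min ` \<beta> - {i})"
proof -
  have l': "{p, i} \<in> \<beta>'" "{Suc i, q} \<in> \<beta>'" by (auto simp: flip_eq)
  note M = pairings_Min[OF m] pairings_Min[OF flip_pairings]
  note ends = M(1)[OF l(2)] M(3)[OF l'(1) pq(1)] M(3)[OF l'(2) pq(2)] M(4)[OF l'(1) pq(1)]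
  have mem: "x \<in> Min ` \<beta>' \<longleftrightarrow> x \<in> Min ` \<beta>" if "x \<notin> {i, Suc i}" for x
  proof (cases "x = p")
    case False
    have "Min ` \<beta>' = Min ` (\<beta> - {{i, Suc i}, {p, q}}) \<union> {p, Suc i}"
      using pq unfolding flip_eq by simp
    moreover have "Min ` \<beta> = Min ` (\<beta> - {{i, Suc i}, {p, q}}) \<union> {i, p}"
    proof -
      have "\<beta> = (\<beta> - {{i, Suc i}, {p, q}}) \<union> {{i, Suc i}, {p, q}}" using l by auto
      then have "Min ` \<beta> = Min ` (\<beta> - {{i, Suc i}, {p, q}}) \<union> Min ` {{i, Suc i}, {p, q}}" by (metis image_Un)
      then show ?thesis using pq by simp
    qed
    ultimately show ?thesis using that False by auto
  qed (use ends pq in auto)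
  show ?thesis
  proof (intro Set.set_eqI)
    fix x
    have "x = i \<or> x = Suc i \<or> x \<notin> {i, Suc i}" by auto
    then show "x \<in> Min ` \<beta>' \<longleftrightarrow> x \<in> insert (Suc i) (Min ` \<beta> - {i})"
      using mem[of x] ends by auto
  qed
qed

text \<open>The colourings of \<open>\<beta>\<close> and \<open>\<beta>'\<close> differ by
  exchanging \<open>i\<close> and \<open>Suc i\<close>. Hence \<open>lcoef N \<beta>\<close>
  precomposed with this exchange is antisymmetric in the right ends of \<open>\<beta>'\<close> and
  is a multiple of \<open>lcoef N \<beta>'\<close>; the factor, read off at \<open>\<beta>'\<close>,
  is -1. A pairing with the link {i, Suc i} is fixed by the exchange.\<close>

lemma flip_lcoef:
  assumes k: "k \<in> pairings N" "{i, Suc i} \<in> k"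
  shows "lcoef N \<beta> k = - (lcoef N \<beta>' k :: 'a::real_normed_field)"
proof -
  let ?F = "lcoef N \<beta> :: _ \<Rightarrow> 'a"
  let ?\<tau> = "swp i (Suc i)"
  note bic = left_right_end(1)[OF m]
  note bic' = left_right_end(1)[OF flip_pairings]
  have rng: "i \<in> {1..2*N}" "Suc i \<in> {1..2*N}" "p \<in> {1..2*N}" using pairings_linkD[OF m] l by auto
  have comp: "{1..2*N} - Min ` \<beta> \<subseteq> right_end \<beta> ` {0..<N}"
    using bic left_right_end(2)[OF m] by (auto simp: bicolour_def)
  have aux: "?F (pact ?\<tau> k) = ?F (pact ?\<tau> (link_up N (left_end \<beta>') (right_end \<beta>') id))
      * fcoef N (left_end \<beta>') (right_end \<beta>') k" for k
  proof (rule antisym_eq_fcoef[OF bic', where c = "\<lambda>k. ?F (pact ?\<tau> k)"])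
    fix k assume "k \<notin> pairings N"
    then have "pact ?\<tau> k \<notin> pairings N" using pact_swp_pairings[of "pact ?\<tau> k" N i "Suc i"] rng by auto
    then show "?F (pact ?\<tau> k) = 0" unfolding lcoef_def by (rule fcoef_outside[OF bic])
  next
    fix k j j' assume k: "k \<in> pairings N" and j: "j < N" "j' < N" "j \<noteq> j'"
    let ?x = "right_end \<beta>' j" and ?y = "right_end \<beta>' j'"
    have "right_end \<beta>' ` {0..<N} \<subseteq> {1..2*N} - Min ` \<beta>'"
      using bic' left_right_end(2)[OF flip_pairings] by (auto simp: bicolour_def)
    from subsetD[OF this imageI[of j]] subsetD[OF this imageI[of j']] j
    have xy: "?x \<in> {1..2*N} - Min ` \<beta>'" "?y \<in> {1..2*N} - Min ` \<beta>'" by simp_all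
    have \<tau>: "?\<tau> z \<in> {1..2*N} - Min ` \<beta>" if "z \<in> {1..2*N} - Min ` \<beta>'" for z
    proof (cases "z = i")
      case True
      then show ?thesis using pairings_Min(2)[OF m l(1)] rng(2) by simp
    next
      case False
      then have "z \<notin> Min ` \<beta>" "z \<noteq> Suc i" using that unfolding flip_Min by blast+
      then show ?thesis using False that by (simp add: transpose_apply_other)
    qed
    have "?\<tau> ?x \<in> right_end \<beta> ` {0..<N}" "?\<tau> ?y \<in> right_end \<beta> ` {0..<N}"
      using subsetD[OF comp \<tau>[OF xy(1)]] subsetD[OF comp \<tau>[OF xy(2)]] .
    moreover have "?x \<noteq> ?y" using b_eq_iff[OF bic'] j by simp
    then have "?\<tau> ?x \<noteq> ?\<tau> ?y" by (metis transpose_involutory)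
    ultimately have "?F (pact (swp (?\<tau> ?x) (?\<tau> ?y)) (pact ?\<tau> k)) = - ?F (pact ?\<tau> k)"
      unfolding lcoef_def by (intro fcoef_swp[OF bic] pact_swp_pairings[OF k] rng(1,2) disjI2 conjI)
    moreover have "pact ?\<tau> (pact (swp ?x ?y) k) = pact (swp (?\<tau> ?x) (?\<tau> ?y)) (pact ?\<tau> k)"
      unfolding pact_comp by (rule arg_cong[of _ _ "\<lambda>\<sigma>. pact \<sigma> k"], rule swp_conj) (rule inj_transpose)
    ultimately show "?F (pact ?\<tau> (pact (swp ?x ?y) k)) = - ?F (pact ?\<tau> k)" by simp
  qed
  have F: "?F (pact ?\<tau> k) = ?F (pact ?\<tau> \<beta>') * lcoef N \<beta>' k" for k
    unfolding lcoef_def[of N \<beta>'] by (rule aux[unfolded left_right_end(3)[OF flip_pairings]])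
  have "pact ?\<tau> \<beta>' = pact (swp (?\<tau> (Suc i)) (?\<tau> p)) (pact ?\<tau> \<beta>)"
    unfolding \<beta>' pact_comp by (rule arg_cong[of _ _ "\<lambda>\<sigma>. pact \<sigma> \<beta>"], rule swp_conj) (rule inj_transpose)
  also have "\<dots> = pact (swp i p) \<beta>"
    using pq by (simp add: pact_swp_link[OF m l(1)] transpose_apply_other)
  finally have "?F (pact ?\<tau> \<beta>') = ?F (pact (swp i p) \<beta>)" by simp
  also have "\<dots> = - ?F \<beta>"
  proof -
    have "i \<in> left_end \<beta> ` {0..<N}" "p \<in> left_end \<beta> ` {0..<N}"
      unfolding left_right_end(2)[OF m] using pairings_Min(1)[OF m l(1)] pairings_Min(1)[OF m l(2)] pq by auto
    then show ?thesis unfolding lcoef_def using pq by (intro fcoef_swp[OF bic m]) auto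
  qed
  finally show ?thesis using F[of k] pact_swp_link[OF k] lcoef_self[OF m, where ?'a = 'a] by simp
qed

end

text \<open>A positive height before \<open>i\<close> means that some link passes over the peak.
  Reconnecting with the innermost one, whose left end is \<open>Max E\<close>, creates no
  crossing.\<close>

lemma flip_to_valley:
  assumes \<beta>: "\<beta> \<in> LP N" and l: "{i, Suc i} \<in> \<beta>" and pos: "0 < dpath \<beta> (i - 1)"
  obtains p q where "{p, q} \<in> \<beta>" "p < i" "Suc i < q" "pact (swp (Suc i) p) \<beta> \<in> LP N"
proof -
  have m: "\<beta> \<in> pairings N" using \<beta> LP_subset_pairings by blast
  have rng: "1 \<le> i" "Suc i \<le> 2 * N" using pairings_linkD[OF m l] by auto
  define E where "E = {u. \<exists>v. {u, v} \<in> \<beta> \<and> u < i \<and> i \<le> v}"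
  have "card {k \<in> \<beta>. Min k \<le> i - 1 \<and> i - 1 < Max k} \<noteq> 0"
    using pos dpath_open[OF m, of "i - 1"] rng by auto
  then have "{k \<in> \<beta>. Min k \<le> i - 1 \<and> i - 1 < Max k} \<noteq> {}" by (metis card.empty)
  then obtain k where k: "k \<in> \<beta>" "Min k \<le> i - 1" "i - 1 < Max k" by blast
  obtain u v where "k = {u, v}" "u < v" using pairings_link[OF m k(1)] by metis
  then have "u \<in> E" using k rng unfolding E_def by auto
  moreover have finE: "finite E" by (rule finite_subset[of _ "{..<i}"]) (auto simp: E_def)
  ultimately have "Max E \<in> E" by (intro Max_in) auto
  then obtain q where q: "{Max E, q} \<in> \<beta>" "Max E < i" "i \<le> q" unfolding E_def by auto
  define p where "p = Max E"
  have max: "\<not> (p < u \<and> u < i \<and> i \<le> v)" if "{u, v} \<in> \<beta>" for u v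
    using that Max_ge[OF finE, of u] unfolding p_def E_def by fastforce
  note pq = q[folded p_def]
  have "q \<noteq> i" "q \<noteq> Suc i" using pairings_unique_link[OF m l pq(1)] pq by (auto simp: doubleton_eq_iff)
  then have iq: "Suc i < q" using pq by auto
  note eq = flip_eq[OF m l pq(1,2) iq refl]
  note pr = flip_pairings[OF m l pq(1,2) iq refl]
  have old: "\<not> (a < c \<and> c < b \<and> b < d)" if "{a, b} \<in> \<beta>" "{c, d} \<in> \<beta>" for a b c d
    using LP_noncrossing[OF \<beta> that] by blast
  have away: "x \<notin> {i, Suc i, p, q} \<and> y \<notin> {i, Suc i, p, q}"
    if "{x, y} \<in> \<beta> - {{i, Suc i}, {p, q}}" for x y
    using that pairings_unique_link[OF m l, of "{x, y}"] pairings_unique_link[OF m pq(1), of "{x, y}"] by auto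
  have new: "{a, b} \<in> pact (swp (Suc i) p) \<beta> \<Longrightarrow> {a, b} \<in> \<beta> - {{i, Suc i}, {p, q}} \<or>
      a = p \<and> b = i \<or> a = i \<and> b = p \<or> a = Suc i \<and> b = q \<or> a = q \<and> b = Suc i" for a b
    unfolding eq by (auto simp: doubleton_eq_iff)
  have "\<not> (a < c \<and> c < b \<and> b < d)"
    if ab: "{a, b} \<in> pact (swp (Suc i) p) \<beta>" and cd: "{c, d} \<in> pact (swp (Suc i) p) \<beta>" for a b c d
  proof
    assume o: "a < c \<and> c < b \<and> b < d"
    consider "{a, b} \<in> \<beta> - {{i, Suc i}, {p, q}}" | "a = p" "b = i" | "a = Suc i" "b = q"
      using new[OF ab] o pq(2) iq by auto
    then show False
    proof cases
      case 1
      note ab' = away[OF 1]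
      consider "{c, d} \<in> \<beta> - {{i, Suc i}, {p, q}}" | "c = p" "d = i" | "c = Suc i" "d = q"
        using new[OF cd] o pq(2) iq by auto
      then show False
      proof cases
        case c: 1 then show False using old[of a b c d] 1 o by auto
      next
        case 2 then show False using old[of a b p q] 1 o pq iq by auto
      next
        case 3
        then have "a < i" "i \<le> b" using o ab' by auto
        then show False using old[of a b p q] max[of a b] 1 o pq iq 3 ab' by (cases "a < p") auto
      qed
    next
      case 2
      then have cd': "{c, d} \<in> \<beta> - {{i, Suc i}, {p, q}}" using new[OF cd] o pq(2) iq by auto
      show False using max[of c d] cd' o 2 by auto
    next
      case 3
      then have cd': "{c, d} \<in> \<beta> - {{i, Suc i}, {p, q}}" using new[OF cd] o pq(2) iq by auto
      show False using old[of p q c d] cd' pq o 3 by auto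
    qed
  qed
  then have "pact (swp (Suc i) p) \<beta> \<in> LP N"
    using pr unfolding LP_def pairings_def by blast
  then show ?thesis using that pq iq by blast
qed

text \<open>The inverse move needs no choice: at a valley \<open>i\<close> is linked to the left and
  \<open>Suc i\<close> to the right, and joining the outer ends over the new link {i, Suc i} stays
  planar.\<close>

lemma flip_to_peak:
  assumes \<beta>: "\<beta> \<in> LP N" and i: "i \<notin> Min ` \<beta>" "Suc i \<in> Min ` \<beta>" "1 \<le> i" "Suc i \<le> 2 * N"
  obtains p q where "p < i" "Suc i < q" "pact (swp (Suc i) p) \<beta> \<in> LP N"
    "{i, Suc i} \<in> pact (swp (Suc i) p) \<beta>" "{p, q} \<in> pact (swp (Suc i) p) \<beta>"
proof -
  have m: "\<beta> \<in> pairings N" using \<beta> LP_subset_pairings by blast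
  obtain p where p: "{i, p} \<in> \<beta>" "i \<noteq> p" using pairings_partner[OF m, of i] i by auto
  obtain q where q: "{Suc i, q} \<in> \<beta>" "Suc i \<noteq> q" using pairings_partner[OF m, of "Suc i"] i by auto
  have "\<not> i < p" using pairings_Min(1)[OF m p(1)] i by auto
  moreover have "\<not> q < Suc i" using pairings_Min(2)[OF m, of q "Suc i"] q i by (auto simp: insert_commute)
  ultimately have pq: "p < i" "Suc i < q" using p q by auto
  have ne: "{i, p} \<noteq> {Suc i, q}" using pq by (auto simp: doubleton_eq_iff)
  have eq: "pact (swp (Suc i) p) \<beta> = (\<beta> - {{i, p}, {Suc i, q}}) \<union> {{i, Suc i}, {p, q}}"
    using pact_swp_eq[OF m p(1) q(1) ne] by (simp add: pact_swp_commute)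
  have pr: "pact (swp (Suc i) p) \<beta> \<in> pairings N"
    using pact_swp_pairings[OF m] pairings_linkD[OF m] p q by auto
  have p': "{p, i} \<in> \<beta>" using p by (simp add: insert_commute)
  have old: "\<not> (a < c \<and> c < b \<and> b < d)" if "{a, b} \<in> \<beta>" "{c, d} \<in> \<beta>" for a b c d
    using LP_noncrossing[OF \<beta> that] by blast
  have away: "x \<notin> {i, Suc i, p, q} \<and> y \<notin> {i, Suc i, p, q}"
    if "{x, y} \<in> \<beta> - {{i, p}, {Suc i, q}}" for x y
    using that pairings_unique_link[OF m p(1), of "{x, y}"] pairings_unique_link[OF m q(1), of "{x, y}"] by auto
  have new: "{a, b} \<in> pact (swp (Suc i) p) \<beta> \<Longrightarrow> {a, b} \<in> \<beta> - {{i, p}, {Suc i, q}} \<or>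
      a = p \<and> b = q \<or> a = q \<and> b = p \<or> a = i \<and> b = Suc i \<or> a = Suc i \<and> b = i" for a b
    unfolding eq by (auto simp: doubleton_eq_iff)
  have "\<not> (a < c \<and> c < b \<and> b < d)"
    if ab: "{a, b} \<in> pact (swp (Suc i) p) \<beta>" and cd: "{c, d} \<in> pact (swp (Suc i) p) \<beta>" for a b c d
  proof
    assume o: "a < c \<and> c < b \<and> b < d"
    consider "{a, b} \<in> \<beta> - {{i, p}, {Suc i, q}}" | "a = p" "b = q"
      using new[OF ab] o pq by auto
    then show False
    proof cases
      case 1
      note ab' = away[OF 1]
      consider "{c, d} \<in> \<beta> - {{i, p}, {Suc i, q}}" | "c = p" "d = q" | "c = i" "d = Suc i"
        using new[OF cd] o pq by auto
      then show False
      proof cases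
        case c: 1 then show False using old[of a b c d] 1 o by auto
      next
        case 2
        have "b < i \<or> Suc i < b" using ab' by auto
        then show False using old[of a b p i] old[of a b "Suc i" q] 1 p' q o 2 pq by auto
      qed (use o in auto)
    next
      case 2
      then have cd': "{c, d} \<in> \<beta> - {{i, p}, {Suc i, q}}" using new[OF cd] o pq by auto
      have "c < i \<or> Suc i < c" using away[OF cd'] by auto
      then show False using old[of p i c d] old[of "Suc i" q c d] cd' p' q o 2 pq by auto
    qed
  qed
  then have "pact (swp (Suc i) p) \<beta> \<in> LP N"
    using pr unfolding LP_def pairings_def by blast
  then show ?thesis using that[OF pq] eq by blast
qed

section \<open>Cover-inclusive tilings under a flip\<close>

lemma cover_inclusiveD:
  assumes "cover_inclusive \<T>" "T1 \<in> \<T>" "T2 \<in> \<T>" "T1 \<noteq> T2" "(x, y1) \<in> T1" "(x, y2) \<in> T2" "y2 < y1"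
  shows "{Min (fst ` T1)..Max (fst ` T1)} \<subseteq> {Min (fst ` T2)..Max (fst ` T2)}"
  using assms unfolding cover_inclusive_def by blast

lemma Min_Max_interval: "Min {x..x + k} = (x::nat)" "Max {x..x + k} = x + k"
  by (auto intro: Min_eqI Max_eqI)

definition tile_shape :: "(nat \<times> int) set \<Rightarrow> nat \<Rightarrow> nat \<Rightarrow> (nat \<Rightarrow> int) \<Rightarrow> bool" where
  "tile_shape T x k h \<longleftrightarrow> h k = h 0 \<and> (\<forall>i\<le>k. h 0 \<le> h i) \<and> (\<forall>i<k. \<bar>h (Suc i) - h i\<bar> = 1) \<and>
     fst ` T = {x..x + k} \<and> (\<forall>c y. (c, y) \<in> T \<longleftrightarrow> x \<le> c \<and> c \<le> x + k \<and> y = h (c - x))"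

lemma dyck_tile_shape:
  assumes "dyck_tile T"
  shows "\<exists>x k h. tile_shape T x k h"
proof -
  obtain x k h where T: "T = (\<lambda>i. (x + i, h i)) ` {0..k}" and h: "h k = h 0" "\<forall>i\<le>k. h 0 \<le> h i"
    "\<forall>i<k. \<bar>h (Suc i) - h i\<bar> = 1" using assms unfolding dyck_tile_def by blast
  have "fst ` T = (\<lambda>i. x + i) ` {0..k}" unfolding T by (simp add: image_image)
  then have "fst ` T = {x..x + k}" by simp
  moreover have "(c, y) \<in> T \<longleftrightarrow> x \<le> c \<and> c \<le> x + k \<and> y = h (c - x)" for c y
    unfolding T by (auto simp: image_iff intro!: bexI[of _ "c - x"])
  ultimately have "tile_shape T x k h" using h by (simp add: tile_shape_def)
  then show ?thesis by blast
qed

lemma tile_shapeD: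
  assumes "tile_shape T x k h"
  shows "h k = h 0" "i \<le> k \<Longrightarrow> h 0 \<le> h i" "i < k \<Longrightarrow> \<bar>h (Suc i) - h i\<bar> = 1"
    "fst ` T = {x..x + k}" "(c, y) \<in> T \<longleftrightarrow> x \<le> c \<and> c \<le> x + k \<and> y = h (c - x)"
  using assms unfolding tile_shape_def by blast+

context
  fixes N i :: nat and \<alpha> \<beta> :: "nat set set"
  assumes \<alpha>: "\<alpha> \<in> pairings N" and i: "1 \<le> i" "Suc i \<le> 2 * N"
    and nopeak: "\<not> (i \<in> Min ` \<alpha> \<and> Suc i \<notin> Min ` \<alpha>)"
    and peak: "i \<in> Min ` \<beta>" "Suc i \<notin> Min ` \<beta>"
    and above: "path_above N \<beta> \<alpha>"
begin

lemma dpath_peak: "dpath \<beta> (i - 1) = dpath \<beta> i - 1" "dpath \<beta> (Suc i) = dpath \<beta> i - 1"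
  using cpath_step[of i "Min ` \<beta>"] cpath_Suc[of "Min ` \<beta>" i] peak i by (auto simp: dpath_eq_cpath)

lemma dpath_nopeak:
  assumes "dpath \<alpha> (i - 1) < dpath \<alpha> i" "dpath \<alpha> (Suc i) < dpath \<alpha> i"
  shows False
  using cpath_step[of i "Min ` \<alpha>"] cpath_Suc[of "Min ` \<alpha>" i] assms nopeak i
  by (auto simp: dpath_eq_cpath split: if_splits)

text \<open>Both heights have the parity of \<open>i\<close>, so they differ by an even number, and
  equality would give \<open>\<alpha>\<close> a peak at \<open>i\<close> too.\<close>

lemma dpath_below_peak: "dpath \<alpha> i \<le> dpath \<beta> i - 2"
proof -
  have le: "dpath \<alpha> j \<le> dpath \<beta> j" if "j \<le> 2 * N" for j using above that by (simp add: path_above_def)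
  have "dpath \<alpha> i \<noteq> dpath \<beta> i"
    using dpath_nopeak le[of "i - 1"] le[of "Suc i"] dpath_peak i by auto
  moreover have "even (dpath \<alpha> i + int i)" "even (dpath \<beta> i + int i)"
    by (simp_all only: dpath_eq_cpath cpath_parity)
  then have "dpath \<alpha> i \<noteq> dpath \<beta> i - 1" by presburger
  ultimately show ?thesis using le[of i] i by simp
qed

lemma dpath_peak_pos: "0 < dpath \<beta> (i - 1)"
  using dpath_below_peak dpath_nonneg[OF \<alpha>, of i] i dpath_peak by simp

context
  fixes \<beta>' :: "nat set set"
  assumes \<beta>': "Min ` \<beta>' = insert (Suc i) (Min ` \<beta> - {i})"
begin

lemma dpath_flip: "dpath \<beta>' j = dpath \<beta> j - (if j = i then 2 else 0)"
  unfolding dpath_eq_cpath \<beta>' by (rule cpath_flip[OF peak i(1)])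

lemma path_above_flip: "path_above N \<beta>' \<alpha>"
  using above dpath_below_peak by (auto simp: path_above_def dpath_flip)

text \<open>The box directly under the peak of the upper path, the only one lost in the
  flip.\<close>

definition top_box :: "nat \<times> int" where "top_box = (i, dpath \<beta> i - 1)"

lemma skew_boxes_flip:
  "skew_boxes N \<alpha> \<beta> = insert top_box (skew_boxes N \<alpha> \<beta>')" "top_box \<notin> skew_boxes N \<alpha> \<beta>'"
proof -
  define a where "a = dpath \<alpha> i"
  define b where "b = dpath \<beta> i"
  have ab: "even (b + int i)" "a \<le> b - 2"
    using cpath_parity[of "Min ` \<beta>" i] dpath_below_peak by (simp_all only: a_def b_def dpath_eq_cpath)
  show "skew_boxes N \<alpha> \<beta> = insert top_box (skew_boxes N \<alpha> \<beta>')"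
  proof (intro Set.set_eqI)
    fix z :: "nat \<times> int"
    obtain x y where z: "z = (x, y)" by (cases z)
    show "z \<in> skew_boxes N \<alpha> \<beta> \<longleftrightarrow> z \<in> insert top_box (skew_boxes N \<alpha> \<beta>')"
    proof (cases "x = i")
      case True
      have "odd (int i + y) \<and> a \<le> y - 1 \<and> y + 1 \<le> b \<longleftrightarrow>
          y = b - 1 \<or> odd (int i + y) \<and> a \<le> y - 1 \<and> y + 1 \<le> b - 2"
        using ab by presburger
      then show ?thesis using i by (simp add: z True skew_boxes_def top_box_def dpath_flip a_def b_def)
    next
      case False
      then show ?thesis by (simp add: z skew_boxes_def top_box_def dpath_flip)
    qed
  qed
  show "top_box \<notin> skew_boxes N \<alpha> \<beta>'"
    by (simp add: skew_boxes_def top_box_def dpath_flip)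
qed

definition ci_tilings :: "nat set set \<Rightarrow> (nat \<times> int) set set set" where
  "ci_tilings \<gamma> = {\<T>. partition_on (skew_boxes N \<alpha> \<gamma>) \<T> \<and> (\<forall>T\<in>\<T>. dyck_tile T) \<and> cover_inclusive \<T>}"

text \<open>By cover-inclusivity, below a tile with a local maximum over \<open>i\<close> there would be
  another such tile, until \<open>\<alpha>\<close> itself has a peak at \<open>i\<close>.\<close>

lemma no_local_max:
  assumes \<T>: "\<T> \<in> ci_tilings \<beta>"
  shows "T \<in> \<T> \<Longrightarrow> (i, y) \<in> T \<Longrightarrow> (i - 1, y - 1) \<in> T \<Longrightarrow> (Suc i, y - 1) \<in> T \<Longrightarrow> False"
proof (induction "nat y" arbitrary: y T rule: less_induct)
  case less
  have part: "partition_on (skew_boxes N \<alpha> \<beta>) \<T>" and tiles: "\<And>T. T \<in> \<T> \<Longrightarrow> dyck_tile T"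
    and ci: "cover_inclusive \<T>" using \<T> by (auto simp: ci_tilings_def)
  have sub: "\<And>z. z \<in> T \<Longrightarrow> z \<in> skew_boxes N \<alpha> \<beta>" using part less.prems(1) by (auto simp: partition_on_def)
  note s = sub[OF less.prems(2)] sub[OF less.prems(3)] sub[OF less.prems(4)]
  have par: "odd (int i + y)" "dpath \<alpha> i \<le> y - 1" "y + 1 \<le> dpath \<beta> i"
    "dpath \<alpha> (i - 1) \<le> y - 2" "dpath \<alpha> (Suc i) \<le> y - 2"
    using s by (auto simp: skew_boxes_def)
  have "even (dpath \<alpha> i + int i)" by (simp only: dpath_eq_cpath cpath_parity)
  then have "dpath \<alpha> i \<noteq> y - 2" using par(1) by presburger
  moreover have "dpath \<alpha> i \<noteq> y - 1" using dpath_nopeak par by auto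
  ultimately have le: "dpath \<alpha> i \<le> y - 3" using par by auto
  moreover have "odd (int i + (y - 2))" using par(1) by presburger
  ultimately have "(i, y - 2) \<in> skew_boxes N \<alpha> \<beta>" using par(3) i by (simp add: skew_boxes_def)
  then have "(i, y - 2) \<in> \<Union>\<T>" by (simp only: partition_onD1[OF part])
  then obtain T' where T': "T' \<in> \<T>" "(i, y - 2) \<in> T'" by (rule UnionE)
  obtain x k h where "tile_shape T x k h" using dyck_tile_shape[OF tiles[OF less.prems(1)]] by blast
  note T = tile_shapeD(4,5)[OF this]
  obtain x' k' h' where "tile_shape T' x' k' h'" using dyck_tile_shape[OF tiles[OF T'(1)]] by blast
  note T'' = tile_shapeD(3,4,5)[OF this]
  have ne: "T \<noteq> T'"
  proof
    assume "T = T'"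
    then show False using T'(2) less.prems(2) T(2)[of i y] T(2)[of i "y - 2"] by simp
  qed
  have "{Min (fst ` T)..Max (fst ` T)} \<subseteq> {Min (fst ` T')..Max (fst ` T')}"
    by (rule cover_inclusiveD[OF ci less.prems(1) T'(1) ne less.prems(2) T'(2)]) simp
  then have "{x..x + k} \<subseteq> {x'..x' + k'}" unfolding T(1) T''(2) Min_Max_interval .
  then have sub': "x' \<le> x \<and> x + k \<le> x' + k'" by simp
  have "x \<le> i - 1" using less.prems(3) T(2)[of "i - 1" "y - 1"] by simp
  moreover have "Suc i \<le> x + k" using less.prems(4) T(2)[of "Suc i" "y - 1"] by simp
  ultimately have rng: "x' \<le> i - 1" "Suc i \<le> x' + k'" using sub' by linarith+
  then have rng': "i - 1 \<le> x' + k'" "x' \<le> Suc i" by linarith+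
  have h'i: "h' (i - x') = y - 2" using T''(3)[of i] T'(2) by simp
  have disj: "z \<notin> T'" if "z \<in> T" for z
    using that disjointD[OF partition_onD2[OF part] less.prems(1) T'(1) ne] by blast
  \<comment> \<open>On both sides the box at height y - 1 belongs to \<open>T\<close>, so
    \<open>T'\<close> has to step down there and has a local maximum over \<open>i\<close> as well,
    two units lower.\<close>
  have "h' (i - 1 - x') \<noteq> y - 1"
    using disj[OF less.prems(3)] T''(3)[of "i - 1" "y - 1"] rng rng' by simp
  moreover have "\<bar>h' (i - x') - h' (i - 1 - x')\<bar> = 1"
  proof -
    have "Suc (i - 1 - x') = i - x'" using rng i by simp
    then show ?thesis using T''(1)[of "i - 1 - x'"] rng i by simp
  qed
  ultimately have "h' (i - 1 - x') = y - 2 - 1" using h'i by linarith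
  then have left: "(i - 1, y - 2 - 1) \<in> T'" using T''(3)[of "i - 1" "y - 2 - 1"] rng rng' by simp
  have "h' (Suc i - x') \<noteq> y - 1"
    using disj[OF less.prems(4)] T''(3)[of "Suc i" "y - 1"] rng rng' by simp
  moreover have "\<bar>h' (Suc i - x') - h' (i - x')\<bar> = 1"
  proof -
    have "Suc (i - x') = Suc i - x'" using rng i by simp
    then show ?thesis using T''(1)[of "i - x'"] rng i by simp
  qed
  ultimately have "h' (Suc i - x') = y - 2 - 1" using h'i by linarith
  then have right: "(Suc i, y - 2 - 1) \<in> T'" using T''(3)[of "Suc i" "y - 2 - 1"] rng rng' by simp
  have "nat (y - 2) < nat y" using le dpath_nonneg[OF \<alpha>, of i] i by simp
  then show False by (rule less.hyps[OF _ T'(1,2) left right])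
qed

text \<open>Under the peak there is no room for the tile to go up on either side. It cannot end
  there with further boxes either, as a tile stays at or above the height of its ends, and passing
  through would be the local maximum excluded by \<open>no_local_max\<close>.\<close>

lemma top_tile:
  assumes \<T>: "\<T> \<in> ci_tilings \<beta>"
  shows "{top_box} \<in> \<T>"
proof -
  have part: "partition_on (skew_boxes N \<alpha> \<beta>) \<T>" and tiles: "\<And>T. T \<in> \<T> \<Longrightarrow> dyck_tile T"
    using \<T> by (auto simp: ci_tilings_def)
  have "top_box \<in> skew_boxes N \<alpha> \<beta>" using skew_boxes_flip by simp
  then obtain T where T: "T \<in> \<T>" "top_box \<in> T" using part by (auto simp: partition_on_def)
  have sub: "\<And>z. z \<in> T \<Longrightarrow> z \<in> skew_boxes N \<alpha> \<beta>" using part T(1) by (auto simp: partition_on_def)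
  obtain x k h where "tile_shape T x k h" using dyck_tile_shape[OF tiles[OF T(1)]] by blast
  note h = tile_shapeD(5)[OF this] tile_shapeD(1,2,3,5)[OF this]
  define t where "t = i - x"
  have t: "i = x + t" "t \<le> k" "h t = dpath \<beta> i - 1"
    using T(2) h(5)[of i "dpath \<beta> i - 1"] by (auto simp: top_box_def t_def)
  have nb: "h j \<noteq> h t + 1" if "j \<le> k" "j = Suc t \<or> Suc j = t" for j
  proof -
    have "(x + j, h j) \<in> skew_boxes N \<alpha> \<beta>" using sub h(5)[of "x + j"] that(1) by simp
    then have "h j + 1 \<le> dpath \<beta> (x + j)" by (simp add: skew_boxes_def)
    moreover have "x + j = Suc i \<or> x + j = i - 1" using that(2) t by auto
    ultimately show ?thesis using dpath_peak t by auto
  qed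
  have "k = 0"
  proof (rule ccontr)
    assume "k \<noteq> 0"
    have step: "\<bar>h (Suc t) - h t\<bar> = 1" if "t < k" using h(4) that by blast
    have step': "\<bar>h t - h (t - 1)\<bar> = 1" if "0 < t" using h(4)[of "t - 1"] that t by simp
    consider "t = 0" | "t = k" | "0 < t" "t < k" using t by linarith
    then show False
    proof cases
      case 1
      then show False using step nb[of "Suc t"] h(3)[of "Suc t"] \<open>k \<noteq> 0\<close> by auto
    next
      case 2
      then show False using step' nb[of "t - 1"] h(2) h(3)[of "t - 1"] \<open>k \<noteq> 0\<close> by auto
    next
      case 3
      have "h (Suc t) \<noteq> h t + 1" using nb[of "Suc t"] 3 by simp
      moreover have "h (t - 1) \<noteq> h t + 1" using nb[of "t - 1"] 3 by simp
      ultimately have "h (Suc t) = h t - 1" "h (t - 1) = h t - 1"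
        using step[OF 3(2)] step'[OF 3(1)] by linarith+
      then have "(i, h t) \<in> T" "(i - 1, h t - 1) \<in> T" "(Suc i, h t - 1) \<in> T"
        using h(5)[of i] h(5)[of "i - 1"] h(5)[of "Suc i"] t 3 by auto
      then show False by (rule no_local_max[OF \<T> T(1)])
    qed
  qed
  have "T = {top_box}"
  proof (intro Set.set_eqI)
    fix z :: "nat \<times> int"
    obtain a b where z: "z = (a, b)" by (cases z)
    show "z \<in> T \<longleftrightarrow> z \<in> {top_box}"
      unfolding z h(1) top_box_def using t \<open>k = 0\<close> by auto
  qed
  then show ?thesis using T by simp
qed

text \<open>Adding the top box as a tile of its own is a bijection. It keeps cover-inclusivity,
  since nothing lies above the box and its extent is the single column \<open>i\<close>; it is onto
  by \<open>top_tile\<close>.\<close>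

lemma num_ci_tilings_flip: "num_ci_tilings N \<alpha> \<beta> = num_ci_tilings N \<alpha> \<beta>'"
proof -
  have top: "dyck_tile {top_box}"
    unfolding dyck_tile_def top_box_def
    by (rule exI[of _ i], rule exI[of _ 0], rule exI[of _ "\<lambda>_. dpath \<beta> i - 1"]) auto
  have "bij_betw (insert {top_box}) (ci_tilings \<beta>') (ci_tilings \<beta>)"
  proof (rule bij_betw_imageI)
    have notin: "{top_box} \<notin> \<T>" if "\<T> \<in> ci_tilings \<beta>'" for \<T>
      using that skew_boxes_flip(2) by (auto simp: ci_tilings_def partition_on_def)
    then show "inj_on (insert {top_box}) (ci_tilings \<beta>')"
      by (intro inj_onI) (metis insert_ident)
    show "insert {top_box} ` ci_tilings \<beta>' = ci_tilings \<beta>"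
    proof (rule antisym; rule subsetI)
      fix \<U> assume "\<U> \<in> insert {top_box} ` ci_tilings \<beta>'"
      then obtain \<T> where \<U>: "\<U> = insert {top_box} \<T>" and \<T>: "\<T> \<in> ci_tilings \<beta>'" by blast
      have part: "partition_on (skew_boxes N \<alpha> \<beta>') \<T>" and tiles: "\<And>T. T \<in> \<T> \<Longrightarrow> dyck_tile T"
        and ci: "cover_inclusive \<T>" using \<T> by (auto simp: ci_tilings_def)
      have disj: "disjnt {top_box} (\<Union>\<T>)" using part skew_boxes_flip(2) by (simp add: partition_on_def)
      have "partition_on (skew_boxes N \<alpha> \<beta>) \<U>"
        unfolding \<U> partition_on_insert[OF disj] skew_boxes_flip(1) using part skew_boxes_flip(2) by simp
      moreover have "cover_inclusive \<U>"
        unfolding cover_inclusive_def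
      proof (intro ballI impI)
        fix T1 T2 assume T: "T1 \<in> \<U>" "T2 \<in> \<U>" "T1 \<noteq> T2"
          and ex: "\<exists>x y1 y2. (x, y1) \<in> T1 \<and> (x, y2) \<in> T2 \<and> y2 < y1"
        consider "T1 \<in> \<T>" "T2 \<in> \<T>" | "T1 = {top_box}" "T2 \<in> \<T>" | "T1 \<in> \<T>" "T2 = {top_box}"
          using T \<U> by auto
        then show "{Min (fst ` T1)..Max (fst ` T1)} \<subseteq> {Min (fst ` T2)..Max (fst ` T2)}"
        proof cases
          case 1 then show ?thesis using ci T ex unfolding cover_inclusive_def by blast
        next
          case 2
          then have "\<exists>y. (i, y) \<in> T2" using ex by (auto simp: top_box_def)
          then have "i \<in> fst ` T2" by force
          moreover obtain x k h where "tile_shape T2 x k h" using dyck_tile_shape[OF tiles[OF 2(2)]] by blast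
          note tile_shapeD(4)[OF this]
          ultimately show ?thesis using 2(1) by (simp add: top_box_def Min_Max_interval)
        next
          case 3
          then obtain y where y: "(i, y) \<in> T1" "dpath \<beta> i - 1 < y" using ex by (auto simp: top_box_def)
          have "(i, y) \<in> skew_boxes N \<alpha> \<beta>'" using y 3 part by (auto simp: partition_on_def)
          then show ?thesis using y by (simp add: skew_boxes_def dpath_flip)
        qed
      qed
      ultimately show "\<U> \<in> ci_tilings \<beta>" using top tiles by (auto simp: ci_tilings_def \<U>)
    next
      fix \<U> assume \<U>: "\<U> \<in> ci_tilings \<beta>"
      note tt = top_tile[OF \<U>]
      define \<T> where "\<T> = \<U> - {{top_box}}"
      have eq: "\<U> = insert {top_box} \<T>" using tt by (auto simp: \<T>_def)
      have part: "partition_on (skew_boxes N \<alpha> \<beta>) \<U>" using \<U> by (auto simp: ci_tilings_def)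
      have "T \<inter> {top_box} = {}" if "T \<in> \<T>" for T
        using disjointD[OF partition_onD2[OF part] _ tt, of T] that by (simp add: \<T>_def)
      then have "disjnt {top_box} (\<Union>\<T>)" unfolding disjnt_def by blast
      from part[unfolded eq partition_on_insert[OF this]]
      have "partition_on (skew_boxes N \<alpha> \<beta>') \<T>"
        unfolding skew_boxes_flip(1) using skew_boxes_flip(2) by simp
      moreover have "cover_inclusive \<T>" "\<forall>T\<in>\<T>. dyck_tile T"
        using \<U> by (auto simp: ci_tilings_def \<T>_def cover_inclusive_def)
      ultimately have "\<T> \<in> ci_tilings \<beta>'" by (simp add: ci_tilings_def)
      then show "\<U> \<in> insert {top_box} ` ci_tilings \<beta>'" using eq by blast
    qed
  qed
  then have "card (ci_tilings \<beta>') = card (ci_tilings \<beta>)" by (rule bij_betw_same_card)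
  then show ?thesis by (simp add: num_ci_tilings_def ci_tilings_def)
qed

end

end

section \<open>The coefficients of a pure partition function\<close>

definition zcoef :: "nat \<Rightarrow> nat set set \<Rightarrow> nat set set \<Rightarrow> 'a::real_normed_field" where
  "zcoef N \<alpha> m = (\<Sum>\<beta> | \<beta> \<in> LP N \<and> path_above N \<beta> \<alpha>. of_nat (num_ci_tilings N \<alpha> \<beta>) * lcoef N \<beta> m)"

lemma zcoef_pluecker: "zcoef N \<alpha> \<in> pluecker N"
  unfolding zcoef_def using LP_subset_pairings by (intro pluecker_sum lcoef_pluecker) auto

lemma num_ci_tilings_self: "num_ci_tilings N \<alpha> \<alpha> = 1"
proof -
  have "skew_boxes N \<alpha> \<alpha> = {}" by (auto simp: skew_boxes_def)
  then have "{\<T>. partition_on (skew_boxes N \<alpha> \<alpha>) \<T> \<and> (\<forall>T\<in>\<T>. dyck_tile T) \<and> cover_inclusive \<T>} = {{}}"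
    by (auto simp: partition_on_empty cover_inclusive_def)
  then show ?thesis by (simp add: num_ci_tilings_def)
qed

text \<open>A contributing \<open>\<beta>\<close> lies above \<open>\<alpha>\<close> by the range of
  summation and below it by \<open>lcoef_triangular\<close>, so it is
  \<open>\<alpha>\<close>.\<close>

lemma zcoef_self:
  assumes \<alpha>: "\<alpha> \<in> LP N"
  shows "zcoef N \<alpha> \<alpha> = (1::'a::real_normed_field)"
proof -
  have m: "\<alpha> \<in> pairings N" using \<alpha> LP_subset_pairings by blast
  have "zcoef N \<alpha> \<alpha> = (\<Sum>\<beta> | \<beta> \<in> LP N \<and> path_above N \<beta> \<alpha>. if \<beta> = \<alpha> then (1::'a) else 0)"
    unfolding zcoef_def
  proof (rule sum.cong[OF refl])
    fix \<beta> assume \<beta>: "\<beta> \<in> {\<beta> \<in> LP N. path_above N \<beta> \<alpha>}"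
    then have mb: "\<beta> \<in> pairings N" using LP_subset_pairings by blast
    show "of_nat (num_ci_tilings N \<alpha> \<beta>) * lcoef N \<beta> \<alpha> = (if \<beta> = \<alpha> then 1 else (0::'a))"
    proof (cases "lcoef N \<beta> \<alpha> = (0::'a)")
      case False
      have "\<beta> = \<alpha>"
        using lcoef_triangular[OF mb m False] \<beta> \<alpha>
        by (intro LP_dpath_inj[of _ N] antisym) (auto simp: path_above_def)
      then show ?thesis using lcoef_self[OF m, where ?'a = 'a] by (simp add: num_ci_tilings_self)
    qed (use lcoef_self[OF m, where ?'a = 'a] in auto)
  qed
  also have "\<dots> = 1" using \<alpha> by (simp add: path_above_def)
  finally show ?thesis .
qed

lemma zcoef_triangular:
  assumes "\<gamma> \<in> LP N" "zcoef N \<alpha> \<gamma> \<noteq> (0::'a::real_normed_field)" "j \<le> 2 * N"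
  shows "dpath \<alpha> j \<le> dpath \<gamma> j"
proof -
  obtain \<beta> where \<beta>: "\<beta> \<in> LP N" "path_above N \<beta> \<alpha>" "lcoef N \<beta> \<gamma> \<noteq> (0::'a)"
    using assms(2) unfolding zcoef_def by (metis (no_types, lifting) mem_Collect_eq mult_zero_right sum.neutral)
  then have "dpath \<beta> j \<le> dpath \<gamma> j"
    using lcoef_triangular[OF _ _ \<beta>(3) assms(3)] assms(1) LP_subset_pairings by blast
  then show ?thesis using \<beta>(2) assms(3) unfolding path_above_def by force
qed

text \<open>The flip at \<open>i\<close> is a bijection from the patterns with a peak at
  \<open>i\<close> to those with a valley there. It preserves the number of tilings and reverses the
  sign of \<open>lcoef\<close> at \<open>k\<close>, so these terms cancel. For any other pattern
  \<open>i\<close> and \<open>Suc i\<close> have the same colour, and \<open>lcoef\<close> vanishes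
  at \<open>k\<close>.\<close>

lemma zcoef_nopeak:
  assumes \<alpha>: "\<alpha> \<in> LP N" and nopeak: "{i, Suc i} \<notin> \<alpha>"
    and k: "k \<in> pairings N" "{i, Suc i} \<in> k"
  shows "zcoef N \<alpha> k = (0::'a::real_normed_field)"
proof -
  let ?f = "\<lambda>\<beta>. of_nat (num_ci_tilings N \<alpha> \<beta>) * lcoef N \<beta> k :: 'a"
  have i: "1 \<le> i" "Suc i \<le> 2 * N" using pairings_linkD[OF k] by auto
  have m\<alpha>: "\<alpha> \<in> pairings N" using \<alpha> LP_subset_pairings by blast
  have np: "\<not> (i \<in> Min ` \<alpha> \<and> Suc i \<notin> Min ` \<alpha>)" using LP_peak_link[OF \<alpha> _ _ i] nopeak by blast
  define P where "P = {\<beta> \<in> LP N. path_above N \<beta> \<alpha> \<and> i \<in> Min ` \<beta> \<and> Suc i \<notin> Min ` \<beta>}"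
  define V where "V = {\<beta> \<in> LP N. path_above N \<beta> \<alpha> \<and> i \<notin> Min ` \<beta> \<and> Suc i \<in> Min ` \<beta>}"
  have down: "\<exists>\<beta>'\<in>V. Min ` \<beta>' = insert (Suc i) (Min ` \<beta> - {i}) \<and> ?f \<beta>' = - ?f \<beta>" if \<beta>: "\<beta> \<in> P" for \<beta>
  proof -
    have b: "\<beta> \<in> LP N" "path_above N \<beta> \<alpha>" "i \<in> Min ` \<beta>" "Suc i \<notin> Min ` \<beta>" using \<beta> by (auto simp: P_def)
    have m: "\<beta> \<in> pairings N" using b LP_subset_pairings by blast
    have l: "{i, Suc i} \<in> \<beta>" by (rule LP_peak_link[OF b(1,3,4) i])
    have pos: "0 < dpath \<beta> (i - 1)" by (rule dpath_peak_pos[OF m\<alpha> i np b(3,4,2)])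
    obtain p q where pq: "{p, q} \<in> \<beta>" "p < i" "Suc i < q" "pact (swp (Suc i) p) \<beta> \<in> LP N"
      by (rule flip_to_valley[OF b(1) l pos])
    note fl = flip_Min[OF m l pq(1-3) refl] flip_lcoef[OF m l pq(1-3) refl k, where ?'a = 'a]
    have "path_above N (pact (swp (Suc i) p) \<beta>) \<alpha>"
      by (rule path_above_flip[OF m\<alpha> i np b(3,4,2) fl(1)])
    then have "pact (swp (Suc i) p) \<beta> \<in> V" using fl(1) pq(4) by (auto simp: V_def)
    moreover have "?f (pact (swp (Suc i) p) \<beta>) = - ?f \<beta>"
      using fl(2) num_ci_tilings_flip[OF m\<alpha> i np b(3,4,2) fl(1)] by simp
    ultimately show ?thesis using fl(1) by blast
  qed
  have up: "\<exists>\<beta>\<in>P. Min ` \<beta>' = insert (Suc i) (Min ` \<beta> - {i})" if \<beta>': "\<beta>' \<in> V" for \<beta>'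
  proof -
    have b: "\<beta>' \<in> LP N" "path_above N \<beta>' \<alpha>" "i \<notin> Min ` \<beta>'" "Suc i \<in> Min ` \<beta>'" using \<beta>' by (auto simp: V_def)
    obtain p q where pq: "p < i" "Suc i < q" "pact (swp (Suc i) p) \<beta>' \<in> LP N"
      "{i, Suc i} \<in> pact (swp (Suc i) p) \<beta>'" "{p, q} \<in> pact (swp (Suc i) p) \<beta>'"
      by (rule flip_to_peak[OF b(1,3,4) i])
    define \<beta> where "\<beta> = pact (swp (Suc i) p) \<beta>'"
    have m: "\<beta> \<in> pairings N" using pq(3) LP_subset_pairings by (auto simp: \<beta>_def)
    have "\<beta>' = pact (swp (Suc i) p) \<beta>" by (simp add: \<beta>_def)
    note M = flip_Min[OF m pq(4,5)[folded \<beta>_def] pq(1,2) this]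
    have pk: "i \<in> Min ` \<beta>" "Suc i \<notin> Min ` \<beta>" using pairings_Min[OF m pq(4)[folded \<beta>_def]] by auto
    have d: "dpath \<beta>' j = dpath \<beta> j - (if j = i then 2 else 0)" for j
      unfolding dpath_eq_cpath M by (rule cpath_flip[OF pk i(1)])
    have "dpath \<beta>' j \<le> dpath \<beta> j" for j by (simp add: d)
    then have "path_above N \<beta> \<alpha>" using b(2) unfolding path_above_def by (meson order_trans)
    then have "\<beta> \<in> P" using pq(3) pk by (simp add: P_def \<beta>_def)
    with M show ?thesis by blast
  qed
  from down obtain \<theta> where \<theta>: "\<And>\<beta>. \<beta> \<in> P \<Longrightarrow> \<theta> \<beta> \<in> V \<and> Min ` \<theta> \<beta> = insert (Suc i) (Min ` \<beta> - {i}) \<and> ?f (\<theta> \<beta>) = - ?f \<beta>"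
    by metis
  have bij: "bij_betw \<theta> P V"
  proof (rule bij_betw_imageI)
    show "inj_on \<theta> P"
    proof (rule inj_onI)
      fix \<beta> \<gamma> assume bg: "\<beta> \<in> P" "\<gamma> \<in> P" "\<theta> \<beta> = \<theta> \<gamma>"
      then have "insert (Suc i) (Min ` \<beta> - {i}) = insert (Suc i) (Min ` \<gamma> - {i})" using \<theta> by metis
      moreover have "i \<in> Min ` \<beta>" "Suc i \<notin> Min ` \<beta>" "i \<in> Min ` \<gamma>" "Suc i \<notin> Min ` \<gamma>"
        using bg unfolding P_def by simp_all
      ultimately have "Min ` \<beta> = Min ` \<gamma>" by (metis flip_set_inverse)
      moreover have "\<beta> \<in> LP N" "\<gamma> \<in> LP N" using bg unfolding P_def by simp_all
      ultimately show "\<beta> = \<gamma>" by (intro LP_eqI[of \<beta> N \<gamma>])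
    qed
    show "\<theta> ` P = V"
    proof (rule antisym; rule subsetI)
      fix \<beta>' assume \<beta>': "\<beta>' \<in> V"
      obtain \<beta> where \<beta>: "\<beta> \<in> P" "Min ` \<beta>' = insert (Suc i) (Min ` \<beta> - {i})" using up[OF \<beta>'] by blast
      then have "\<theta> \<beta> = \<beta>'" using \<theta>[OF \<beta>(1)] \<beta>' by (intro LP_eqI[of _ N]) (auto simp: V_def)
      then show "\<beta>' \<in> \<theta> ` P" using \<beta> by blast
    qed (use \<theta> in auto)
  qed
  have "zcoef N \<alpha> k = sum ?f (P \<union> V)"
    unfolding zcoef_def
  proof (rule sum.mono_neutral_right)
    show "\<forall>\<beta>\<in>{\<beta> \<in> LP N. path_above N \<beta> \<alpha>} - (P \<union> V). ?f \<beta> = 0"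
    proof
      fix \<beta> assume \<beta>: "\<beta> \<in> {\<beta> \<in> LP N. path_above N \<beta> \<alpha>} - (P \<union> V)"
      then have m: "\<beta> \<in> pairings N" using LP_subset_pairings by blast
      have "\<not> (i \<in> Min ` \<beta> \<longleftrightarrow> Suc i \<notin> Min ` \<beta>)" using \<beta> by (auto simp: P_def V_def)
      then show "?f \<beta> = 0" using lcoef_nonzero_bichromatic[OF m _ k(2), where ?'a = 'a] by auto
    qed
  qed (auto simp: P_def V_def)
  also have "\<dots> = sum ?f P + sum ?f V"
    by (rule sum.union_disjoint) (auto simp: P_def V_def)
  also have "sum ?f V = (\<Sum>\<beta>\<in>P. ?f (\<theta> \<beta>))" using sum.reindex_bij_betw[OF bij, of ?f] by simp
  also have "\<dots> = - sum ?f P" unfolding sum_negf[symmetric] by (rule sum.cong) (use \<theta> in auto)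
  finally show ?thesis by simp
qed

section \<open>Blocks\<close>

context
  fixes N :: nat and s :: "nat list"
  assumes val: "valences N s"
begin

lemma qsum_length: "qsum s (length s) = 2 * N"
  using val by (simp add: qsum_def valences_def)

lemma blockI:
  assumes "1 \<le> j" "j \<le> length s" "qsum s (j - 1) < a" "a \<le> qsum s j"
  shows "block s a = j"
  unfolding block_def
proof (rule the_equality)
  fix k assume k: "1 \<le> k \<and> k \<le> length s \<and> qsum s (k - 1) < a \<and> a \<le> qsum s k"
  show "k = j"
  proof (rule linorder_cases[of k j])
    assume "k < j"
    then have "qsum s k \<le> qsum s (j - 1)" by (intro qsum_mono[OF val]) simp
    then show ?thesis using k assms by simp
  next
    assume "j < k"
    then have "qsum s j \<le> qsum s (k - 1)" by (intro qsum_mono[OF val]) simp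
    then show ?thesis using k assms by simp
  qed
qed (use assms in simp)

lemma block_bounds:
  assumes "a \<in> {1..2*N}"
  shows "1 \<le> block s a" "block s a \<le> length s" "qsum s (block s a - 1) < a" "a \<le> qsum s (block s a)"
proof -
  define j where "j = (LEAST j. a \<le> qsum s j)"
  have ex: "a \<le> qsum s (length s)" using assms qsum_length by simp
  have j: "a \<le> qsum s j" unfolding j_def by (rule LeastI[of "\<lambda>j. a \<le> qsum s j", OF ex])
  have le: "j \<le> length s" unfolding j_def by (rule Least_le) (rule ex)
  have "j \<noteq> 0" using j assms by (cases "j = 0") (auto simp: qsum_def)
  then have "\<not> a \<le> qsum s (j - 1)" unfolding j_def by (intro not_less_Least) simp
  then have p: "1 \<le> j" "qsum s (j - 1) < a" using \<open>j \<noteq> 0\<close> by auto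
  then have "block s a = j" using j le by (intro blockI)
  then show "1 \<le> block s a" "block s a \<le> length s" "qsum s (block s a - 1) < a" "a \<le> qsum s (block s a)"
    using p j le by simp_all
qed

lemma block_eq_iff:
  assumes "a \<in> {1..2*N}" "1 \<le> j" "j \<le> length s"
  shows "block s a = j \<longleftrightarrow> qsum s (j - 1) < a \<and> a \<le> qsum s j"
  using block_bounds[OF assms(1)] blockI[OF assms(2,3)] by auto

lemma block_mono:
  assumes "1 \<le> a" "a \<le> b" "b \<le> 2 * N"
  shows "block s a \<le> block s b"
proof (rule ccontr)
  assume "\<not> block s a \<le> block s b"
  then have "qsum s (block s b) \<le> qsum s (block s a - 1)" by (intro qsum_mono[OF val]) simp
  then show False using block_bounds[of a] block_bounds[of b] assms by simp
qed

lemma bpos_block: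
  assumes a: "a \<in> {1..2*N}"
  shows "bpos (block s) a = block_pos s a - 1"
proof -
  have "{l \<in> {1..<a}. block s l = block s a} = {Suc (qsum s (block s a - 1))..<a}"
  proof (intro Set.set_eqI)
    fix l
    show "l \<in> {l \<in> {1..<a}. block s l = block s a} \<longleftrightarrow> l \<in> {Suc (qsum s (block s a - 1))..<a}"
      using block_eq_iff[of l "block s a"] block_bounds[OF a] a by auto
  qed
  then show ?thesis by (simp add: bpos_def block_pos_def)
qed

text \<open>A block that contained both would have more than \<open>N\<close> points.\<close>

lemma block_shift_ne:
  assumes "1 \<le> a" "a + N \<le> 2 * N"
  shows "block s a \<noteq> block s (a + N)"
proof
  assume eq: "block s a = block s (a + N)"
  define j where "j = block s a"
  have a: "a \<in> {1..2*N}" "a + N \<in> {1..2*N}" using assms by auto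
  note b = block_bounds[OF a(1), folded j_def] block_bounds[OF a(2), folded eq, folded j_def]
  have "qsum s j = qsum s (j - 1) + s ! (j - 1)"
    using b(1,2) take_Suc_conv_app_nth[of "j - 1" s] by (simp add: qsum_def)
  moreover have "s ! (j - 1) \<le> N" using val b(1,2) by (auto simp: valences_def)
  ultimately show False using b by linarith
qed

end

lemma block_replicate_one:
  assumes "a \<in> {1..2*N}"
  shows "block (replicate (2*N) 1) a = a"
proof -
  have q: "qsum (replicate (2*N) 1) j = min j (2*N)" for j
    by (simp add: qsum_def sum_list_replicate)
  have "1 \<le> j \<and> j \<le> length (replicate (2*N) (1::nat)) \<and> min (j - 1) (2*N) < a \<and> a \<le> min j (2*N) \<longleftrightarrow> j = a" for j
    using assms by auto
  then show ?thesis unfolding block_def q by simp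
qed

section \<open>Fused determinants\<close>

lemma pdiff_kap_left:
  assumes ne: "i \<noteq> j" and g: "\<And>x. x i \<noteq> x j \<Longrightarrow> g x = kap p q (x i - x j)" and x: "x i \<noteq> x j"
  shows "pdiff i g x = kap (Suc p) q (x i - x j)"
proof -
  have "((\<lambda>t. kap p q (t - x j)) has_real_derivative kap (Suc p) q (x i - x j) * 1) (at (x i))"
    by (rule DERIV_chain2[OF kap_DERIV]) (use x in \<open>auto intro!: derivative_eq_intros\<close>)
  moreover have "eventually (\<lambda>t. t \<noteq> x j) (nhds (x i))" using x by (intro t1_space_nhds) simp
  then have "eventually (\<lambda>t. g (x(i := t)) = kap p q (t - x j)) (nhds (x i))"
    by eventually_elim (use g[of "x(i := _)"] ne in simp)
  ultimately have "((\<lambda>t. g (x(i := t))) has_real_derivative kap (Suc p) q (x i - x j)) (at (x i))"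
    using DERIV_cong_ev[OF refl, of "\<lambda>t. g (x(i := t))" "\<lambda>t. kap p q (t - x j)" "x i"] by simp
  then show ?thesis unfolding pdiff_def by (rule DERIV_imp_deriv)
qed

lemma pdiff_kap_right:
  assumes ne: "i \<noteq> j" and g: "\<And>x. x i \<noteq> x j \<Longrightarrow> g x = kap p q (x i - x j)" and x: "x i \<noteq> x j"
  shows "pdiff j g x = kap p (Suc q) (x i - x j)"
proof -
  have "g y = kap q p (y j - y i)" if "y j \<noteq> y i" for y
    using g[of y] that kap_minus[of p q "y j - y i"] by simp
  then have "pdiff j g x = kap (Suc q) p (x j - x i)" using ne x by (intro pdiff_kap_left) auto
  then show ?thesis using kap_minus[of p "Suc q" "x j - x i"] by simp
qed

lemma kernel_eq_kap:
  assumes x: "block s a \<noteq> block s b \<Longrightarrow> x (block s a) \<noteq> x (block s b)"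
  shows "kernel s a b x = kap (block_pos s a - 1) (block_pos s b - 1) (x (block s a) - x (block s b))"
proof (cases "block s a = block s b")
  case True
  then show ?thesis by (simp add: kernel_def)
next
  case False
  define i j where "i = block s a" and "j = block s b"
  define K where "K = (\<lambda>x :: nat \<Rightarrow> real. 1 / (pi * (x i - x j)\<^sup>2))"
  have ij: "i \<noteq> j" using False by (simp add: i_def j_def)
  have "(pdiff j ^^ q) K x = kap 0 q (x i - x j)" if "x i \<noteq> x j" for q x
    using that
  proof (induction q arbitrary: x)
    case 0
    then show ?case by (simp add: K_def kap_def numeral_2_eq_2)
  next
    case (Suc q)
    then show ?case using pdiff_kap_right[OF ij Suc.IH Suc.prems] by simp
  qed
  then have "(pdiff i ^^ p) ((pdiff j ^^ q) K) x = kap p q (x i - x j)" if "x i \<noteq> x j" for p q x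
    using that
  proof (induction p arbitrary: x)
    case (Suc p)
    then show ?case using pdiff_kap_left[OF ij Suc.IH[OF Suc.prems(1)] Suc.prems(2)] by simp
  qed simp
  then show ?thesis using False x unfolding kernel_def K_def i_def j_def by simp
qed

lemma kprod_link_up:
  assumes bic: "bicolour N a b" and \<pi>: "\<pi> permutes {0..<N}"
  shows "kprod e x (link_up N a b \<pi>) = (\<Prod>k=0..<N. kap (e (a k)) (e (b (\<pi> k))) (x (a k) - x (b (\<pi> k))))"
proof -
  have "inj_on (\<lambda>k. {a k, b (\<pi> k)}) {0..<N}"
  proof (rule inj_onI)
    fix i k assume ik: "i \<in> {0..<N}" "k \<in> {0..<N}" "{a i, b (\<pi> i)} = {a k, b (\<pi> k)}"
    have "\<pi> k < N" using permutes_lt[OF bic \<pi>] ik by simp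
    then have "a i \<noteq> b (\<pi> k)" using bicolourD(3)[OF bic] ik by simp
    then have "a i = a k" using ik(3) by (auto simp: doubleton_eq_iff)
    then show "i = k" using a_eq_iff[OF bic] ik by simp
  qed
  then show ?thesis unfolding kprod_def link_up_def by (simp add: prod.reindex klink_pair)
qed

lemma det_eq_sum_pairings:
  assumes bic: "bicolour N a b"
  shows "of_real (Determinant.det (Matrix.mat N N (\<lambda>(k, l). kap (e (a k)) (e (b l)) (x (a k) - x (b l)))))
    = (\<Sum>m\<in>pairings N. fcoef N a b m * (of_real (kprod e x m) :: 'a::real_normed_field))"
proof -
  let ?P = "{\<pi>. \<pi> permutes {0..<N}}"
  have finP: "finite ?P" by (rule finite_permutations) simp
  have "(\<Sum>m\<in>pairings N. fcoef N a b m * (of_real (kprod e x m) :: 'a))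
      = (\<Sum>m\<in>pairings N. \<Sum>\<pi>\<in>?P. if link_up N a b \<pi> = m then of_int (sign \<pi>) * of_real (kprod e x (link_up N a b \<pi>)) else 0)"
  proof (rule sum.cong[OF refl])
    fix m
    have "fcoef N a b m = (\<Sum>\<pi>\<in>?P. if link_up N a b \<pi> = m then of_int (sign \<pi>) else (0::'a))"
      unfolding fcoef_def using finP by (simp add: sum.inter_filter[symmetric])
    then show "fcoef N a b m * (of_real (kprod e x m) :: 'a)
        = (\<Sum>\<pi>\<in>?P. if link_up N a b \<pi> = m then of_int (sign \<pi>) * of_real (kprod e x (link_up N a b \<pi>)) else 0)"
      by (simp add: sum_distrib_right) (rule sum.cong[OF refl], simp)
  qed
  also have "\<dots> = (\<Sum>\<pi>\<in>?P. \<Sum>m\<in>pairings N. if link_up N a b \<pi> = m then of_int (sign \<pi>) * of_real (kprod e x (link_up N a b \<pi>)) else 0)"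
    by (rule sum.swap)
  also have "\<dots> = (\<Sum>\<pi>\<in>?P. of_int (sign \<pi>) * of_real (kprod e x (link_up N a b \<pi>)))"
    by (rule sum.cong[OF refl]) (use link_up_pairings[OF bic] in auto)
  also have "\<dots> = of_real (\<Sum>\<pi>\<in>?P. of_int (sign \<pi>) * (\<Prod>k=0..<N. kap (e (a k)) (e (b (\<pi> k))) (x (a k) - x (b (\<pi> k)))))"
    by (simp add: kprod_link_up[OF bic])
  also have "(\<Sum>\<pi>\<in>?P. of_int (sign \<pi>) * (\<Prod>k=0..<N. kap (e (a k)) (e (b (\<pi> k))) (x (a k) - x (b (\<pi> k)))))
      = Determinant.det (Matrix.mat N N (\<lambda>(k, l). kap (e (a k)) (e (b l)) (x (a k) - x (b l))))"
    unfolding Determinant.det_def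
    using permutes_lt[OF bic] by (simp add: atLeast0LessThan lessThan_def)
  finally show ?thesis by simp
qed

text \<open>All points of a block are put at one place, and the point at position r of the block
  carries r derivatives. The value is 0 off \<open>config\<close>, in accordance with the
  representation of rational functions.\<close>

definition fused_fun :: "nat \<Rightarrow> nat list \<Rightarrow> (nat set set \<Rightarrow> complex) \<Rightarrow> cfn" where
  "fused_fun N s c = (\<lambda>x. if x \<in> config (length s) then wsum N c (bpos (block s)) (x \<circ> block s) else 0)"

lemma wsum_sum:
  "wsum N (\<lambda>m. \<Sum>i\<in>I. k i * c i m) e x = (\<Sum>i\<in>I. k i * wsum N (c i) e x)"
  unfolding wsum_def sum_distrib_right sum_distrib_left by (subst sum.swap) (simp add: mult.assoc)

lemma pure_pf_eq_fused_fun: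
  assumes val: "valences N s"
  shows "pure_pf N s \<alpha> = fused_fun N s (zcoef N (unfuse N s \<alpha>))"
proof
  fix x
  show "pure_pf N s \<alpha> x = fused_fun N s (zcoef N (unfuse N s \<alpha>)) x"
  proof (cases "x \<in> config (length s)")
    case True
    let ?X = "x \<circ> block s" and ?e = "bpos (block s)"
    have ker: "kernel s a b x = kap (?e a) (?e b) (?X a - ?X b)" if ab: "a \<in> {1..2*N}" "b \<in> {1..2*N}" for a b
    proof -
      have "block s a \<in> {1..length s}" "block s b \<in> {1..length s}" using block_bounds[OF val] ab by auto
      then have "x (block s a) \<noteq> x (block s b)" if "block s a \<noteq> block s b"
        using True that by (auto simp: config_def dest: inj_onD)
      then show ?thesis using bpos_block[OF val] ab by (simp add: kernel_eq_kap)
    qed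
    have "of_real (Determinant.det (Matrix.mat N N (\<lambda>(k, l). kernel s (left_end \<beta> k) (right_end \<beta> l) x)))
        = wsum N (lcoef N \<beta>) ?e ?X" if "\<beta> \<in> LP N" for \<beta>
    proof -
      have m: "\<beta> \<in> pairings N" using that LP_subset_pairings by blast
      note bic = left_right_end(1)[OF m]
      have "Matrix.mat N N (\<lambda>(k, l). kernel s (left_end \<beta> k) (right_end \<beta> l) x)
          = Matrix.mat N N (\<lambda>(k, l). kap (?e (left_end \<beta> k)) (?e (right_end \<beta> l)) (?X (left_end \<beta> k) - ?X (right_end \<beta> l)))"
        by (rule eq_matI) (use ker bicolourD(4,5)[OF bic] in auto)
      then show ?thesis unfolding wsum_def lcoef_def by (simp only: det_eq_sum_pairings[OF bic])
    qed
    then have "pure_pf N s \<alpha> x = (\<Sum>\<beta> | \<beta> \<in> LP N \<and> path_above N \<beta> (unfuse N s \<alpha>).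
        of_nat (num_ci_tilings N (unfuse N s \<alpha>) \<beta>) * wsum N (lcoef N \<beta>) ?e ?X)"
      using True unfolding pure_pf_def by (simp only: if_True) (rule sum.cong, auto)
    also have "\<dots> = wsum N (zcoef N (unfuse N s \<alpha>)) ?e ?X"
      unfolding zcoef_def by (rule wsum_sum[symmetric])
    finally show ?thesis using True by (simp add: fused_fun_def)
  qed (simp add: pure_pf_def fused_fun_def)
qed

section \<open>Coefficient functions vanishing on links inside blocks\<close>

definition blocked :: "nat \<Rightarrow> nat list \<Rightarrow> (nat set set \<Rightarrow> 'a::real_normed_field) set" where
  "blocked N s = {c \<in> pluecker N. \<forall>m\<in>pairings N. \<not> no_block_link s m \<longrightarrow> c m = 0}"

lemma blocked_link_zero:
  assumes "c \<in> blocked N s" "m \<in> pairings N" "{a, b} \<in> m" "block s a = block s b"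
  shows "c m = 0"
proof -
  have "a \<noteq> b" by (rule pairings_linkD(1)[OF assms(2,3)])
  have "\<not> no_block_link s m"
  proof
    assume "no_block_link s m"
    from this[unfolded no_block_link_def, rule_format, OF assms(3), of a b] \<open>a \<noteq> b\<close> assms(4) show False by simp
  qed
  then show ?thesis using assms(1,2) by (simp add: blocked_def)
qed

lemma blockedI:
  assumes "c \<in> pluecker N" "\<And>m a b. m \<in> pairings N \<Longrightarrow> {a, b} \<in> m \<Longrightarrow> block s a = block s b \<Longrightarrow> c m = 0"
  shows "c \<in> blocked N s"
proof -
  have "c m = 0" if m: "m \<in> pairings N" and nb: "\<not> no_block_link s m" for m
  proof -
    obtain l a b where l: "l \<in> m" "a \<in> l" "b \<in> l" "a \<noteq> b" "block s a = block s b"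
      using nb unfolding no_block_link_def by blast
    obtain u v where "l = {u, v}" using pairings_link[OF m l(1)] by metis
    then have "l = {a, b}" using l by auto
    then show ?thesis using assms(2)[OF m, of a b] l by simp
  qed
  then show ?thesis using assms(1) by (simp add: blocked_def)
qed

text \<open>For neighbours in a block this is \<open>zcoef_nopeak\<close>, since
  \<open>\<alpha>\<close> does not link them. By \<open>vanishing_antisym\<close> the function is
  then antisymmetric under the exchange of \<open>b - 1\<close> and \<open>b\<close>, which turns
  the link {a, b} into the shorter {a, b - 1}.\<close>

lemma zcoef_blocked:
  assumes val: "valences N s" and \<alpha>: "\<alpha> \<in> LP N" "no_block_link s \<alpha>"
  shows "zcoef N \<alpha> \<in> (blocked N s :: (_ \<Rightarrow> 'a::real_normed_field) set)"
proof (rule blockedI[OF zcoef_pluecker])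
  let ?z = "zcoef N \<alpha> :: _ \<Rightarrow> 'a"
  have adj: "?z m = 0" if m: "m \<in> pairings N" "{i, Suc i} \<in> m" "block s i = block s (Suc i)" for m i
  proof (rule zcoef_nopeak[OF \<alpha>(1) _ m(1,2)])
    show "{i, Suc i} \<notin> \<alpha>" using \<alpha>(2) m(3) unfolding no_block_link_def by (metis insertI1 insertI2 n_not_Suc_n)
  qed
  have "?z m = 0" if "m \<in> pairings N" "{a, b} \<in> m" "a < b" "block s a = block s b" for m a b
    using that
  proof (induction "b - a" arbitrary: m b rule: less_induct)
    case less
    show ?case
    proof (cases "b = Suc a")
      case True
      then show ?thesis using adj[of m a] less.prems by simp
    next
      case False
      then have lt: "a < b - 1" using less.prems by simp
      have rng: "a \<in> {1..2*N}" "b \<in> {1..2*N}" using pairings_linkD[OF less.prems(1,2)] by auto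
      have ord: "1 \<le> a" "a \<le> b - 1" "b - 1 \<le> 2 * N" "1 \<le> b - 1" "b - 1 \<le> b" "b \<le> 2 * N"
        using lt rng unfolding atLeastAtMost_iff by linarith+
      have "block s a \<le> block s (b - 1)" "block s (b - 1) \<le> block s b"
        by (rule block_mono[OF val ord(1,2,3)], rule block_mono[OF val ord(4,5,6)])
      then have eq: "block s (b - 1) = block s b" "block s a = block s (b - 1)" using less.prems(4) by auto
      have b1: "b - 1 \<in> {1..2*N}" "Suc (b - 1) = b" using lt rng by auto
      have anti: "antisym_pair N ?z (b - 1) b"
      proof (rule vanishing_antisym[OF zcoef_pluecker b1(1) rng(2)])
        show "b - 1 \<noteq> b" using b1 by simp
        show "?z m = 0" if "m \<in> pairings N" "{b - 1, b} \<in> m" for m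
          using adj[of m "b - 1"] that b1 eq by simp
      qed
      define m' where "m' = pact (swp (b - 1) b) m"
      have "m' \<in> pairings N" unfolding m'_def by (rule pact_swp_pairings[OF less.prems(1) b1(1) rng(2)])
      moreover have "{a, b - 1} \<in> m'"
        using pact_mem[OF less.prems(2), of "swp (b - 1) b"] lt less.prems(3)
        by (simp add: m'_def transpose_apply_other)
      ultimately have "?z m' = 0" using less.hyps[of "b - 1" m'] lt eq by simp
      then show ?thesis using anti less.prems(1) by (simp add: antisym_pair_def m'_def)
    qed
  qed
  note lt = this
  show "?z m = 0" if "m \<in> pairings N" "{a, b} \<in> m" "block s a = block s b" for m a b
  proof (rule linorder_cases[of a b])
    assume "b < a"
    moreover have "{b, a} \<in> m" using that(2) by (simp add: insert_commute)
    ultimately show ?thesis using lt[OF that(1)] that(3) by simp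
  qed (use lt[OF that(1,2) _ that(3)] pairings_linkD(1)[OF that(1,2)] in simp_all)
qed

lemma blocked_eq_span:
  fixes c :: "nat set set \<Rightarrow> 'a::real_normed_field"
  assumes val: "valences N s" and c: "c \<in> blocked N s"
  shows "\<exists>y. c = (\<lambda>m. \<Sum>\<alpha> | \<alpha> \<in> LP N \<and> no_block_link s \<alpha>. y \<alpha> * zcoef N \<alpha> m)"
proof (rule pluecker_span_triangular[where N = N])
  show "{\<alpha> \<in> LP N. no_block_link s \<alpha>} \<subseteq> LP N" by auto
  show "zcoef N \<alpha> \<alpha> = 1" if "\<alpha> \<in> {\<alpha> \<in> LP N. no_block_link s \<alpha>}" for \<alpha> using that by (simp add: zcoef_self)
  show "dpath \<alpha> j \<le> dpath \<gamma> j"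
    if "\<gamma> \<in> LP N" "zcoef N \<alpha> \<gamma> \<noteq> (0::'a)" "j \<le> 2 * N" for \<alpha> \<gamma> j
    using zcoef_triangular[OF that] .
  show "zcoef N \<alpha> \<gamma> = (0::'a)" if "\<alpha> \<in> {\<alpha> \<in> LP N. no_block_link s \<alpha>}" "\<gamma> \<in> LP N - {\<alpha> \<in> LP N. no_block_link s \<alpha>}" for \<alpha> \<gamma>
  proof -
    have "\<gamma> \<in> pairings N" "\<not> no_block_link s \<gamma>" using that(2) LP_subset_pairings by auto
    then show ?thesis using zcoef_blocked[OF val, of \<alpha>, where ?'a = 'a] that(1) by (simp add: blocked_def)
  qed
  show "c \<in> pluecker N" using c by (simp add: blocked_def)
  show "c \<gamma> = 0" if "\<gamma> \<in> LP N - {\<alpha> \<in> LP N. no_block_link s \<alpha>}" for \<gamma>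
    using c that LP_subset_pairings by (auto simp: blocked_def)
qed (rule zcoef_pluecker)

section \<open>Fusing link patterns is injective\<close>

context
  fixes N :: nat and s :: "nat list"
  assumes val: "valences N s"
begin

definition block_rights :: "nat set set \<Rightarrow> nat \<Rightarrow> nat set" where
  "block_rights \<beta> j = {b \<in> {1..2*N}. b \<notin> Min ` \<beta> \<and> block s b = j}"

text \<open>In each block the right ends come first. If a left end preceded a right end, their links
  would have to leave the block in opposite directions and would cross.\<close>

lemma block_rights_initial:
  assumes \<beta>: "\<beta> \<in> LP N" "no_block_link s \<beta>" and b: "b \<in> block_rights \<beta> j"
    and a: "a \<in> {1..2*N}" "a < b" "block s a = j"
  shows "a \<in> block_rights \<beta> j"
proof (rule ccontr)
  assume "a \<notin> block_rights \<beta> j"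
  then have aM: "a \<in> Min ` \<beta>" using a by (simp add: block_rights_def)
  have m: "\<beta> \<in> pairings N" by (rule subsetD[OF LP_subset_pairings \<beta>(1)])
  have b': "b \<in> {1..2*N}" "b \<notin> Min ` \<beta>" "block s b = j" using b unfolding block_rights_def by simp_all
  obtain a' where a': "{a, a'} \<in> \<beta>" "a \<noteq> a'" using pairings_partner[OF m a(1)] by metis
  obtain p where p: "{b, p} \<in> \<beta>" "b \<noteq> p" using pairings_partner[OF m b'(1)] by metis
  have nb: "block s u \<noteq> block s v" if "{u, v} \<in> \<beta>" for u v
  proof -
    have "\<forall>x\<in>{u, v}. \<forall>y\<in>{u, v}. x \<noteq> y \<longrightarrow> block s x \<noteq> block s y"
      using bspec[OF \<beta>(2)[unfolded no_block_link_def] that] .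
    then show ?thesis using pairings_linkD(1)[OF m that] by simp
  qed
  have "\<not> a' < a" using pairings_Min(2)[OF m, of a' a] a' aM by (auto simp: insert_commute)
  then have "a < a'" using a' by simp
  have "\<not> b < p" using pairings_Min(1)[OF m p(1)] b' by auto
  then have "p < b" using p by simp
  have rng: "a' \<in> {1..2*N}" "p \<in> {1..2*N}" using pairings_linkD[OF m] a' p by auto
  have "\<not> a' \<le> b"
  proof
    assume "a' \<le> b"
    then have "block s a \<le> block s a'" "block s a' \<le> block s b"
      using \<open>a < a'\<close> a b' rng by (intro block_mono[OF val]; simp)+
    then show False using nb[OF a'(1)] a(3) b'(3) by simp
  qed
  moreover have "\<not> a \<le> p"
  proof
    assume "a \<le> p"
    then have "block s a \<le> block s p" "block s p \<le> block s b"
      using \<open>p < b\<close> a b' rng by (intro block_mono[OF val]; simp)+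
    then show False using nb[OF p(1)] a(3) b'(3) by simp
  qed
  ultimately show False using LP_noncrossing[OF \<beta>(1), of p b a a'] p(1) a'(1) a(2) by (simp add: insert_commute)
qed

text \<open>Blocks increase along the line, so the larger block number of a fused link is the block
  of its right end. The number of right ends in a block is therefore visible in the fused
  pattern.\<close>

lemma card_block_rights:
  assumes m: "\<beta> \<in> pairings N"
  shows "card (block_rights \<beta> j) = size (filter_mset (\<lambda>S. Max S = j) (fuse_pattern s \<beta>))"
proof -
  have fin: "finite \<beta>" by (rule pairings_finite[OF m])
  have mx: "Max (block s ` l) = block s (Max l)" if l: "l \<in> \<beta>" for l
  proof -
    obtain u v where uv: "l = {u, v}" "u < v" "u \<in> {1..2*N}" "v \<in> {1..2*N}" using pairings_link[OF m l] by metis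
    have "block s u \<le> block s v" using uv by (intro block_mono[OF val]) auto
    then show ?thesis using uv by (simp add: max_def)
  qed
  have "block_rights \<beta> j = Max ` {l \<in> \<beta>. block s (Max l) = j}"
  proof (intro Set.set_eqI iffI)
    fix b assume "b \<in> block_rights \<beta> j"
    then have b: "b \<in> {1..2*N}" "b \<notin> Min ` \<beta>" "block s b = j" by (auto simp: block_rights_def)
    obtain p where p: "{b, p} \<in> \<beta>" "b \<noteq> p" using pairings_partner[OF m b(1)] by metis
    have "\<not> b < p" using pairings_Min(1)[OF m p(1)] b by auto
    then have "Max {b, p} = b" using p by simp
    then show "b \<in> Max ` {l \<in> \<beta>. block s (Max l) = j}" using p b by (intro image_eqI[of _ _ "{b, p}"]) auto
  next
    fix b assume "b \<in> Max ` {l \<in> \<beta>. block s (Max l) = j}"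
    then obtain l where l: "l \<in> \<beta>" "block s (Max l) = j" "b = Max l" by auto
    obtain u v where uv: "l = {u, v}" "u < v" "v \<in> {1..2*N}" using pairings_link[OF m l(1)] by metis
    then show "b \<in> block_rights \<beta> j" using l pairings_Min(2)[OF m, of u v] by (simp add: block_rights_def)
  qed
  moreover have "inj_on Max {l \<in> \<beta>. block s (Max l) = j}"
  proof (rule inj_onI)
    fix l l' assume l: "l \<in> {l \<in> \<beta>. block s (Max l) = j}" "l' \<in> {l \<in> \<beta>. block s (Max l) = j}" "Max l = Max l'"
    have "Max k \<in> k" if k: "k \<in> \<beta>" for k
    proof -
      obtain u v where "k = {u, v}" using pairings_link[OF m k] by metis
      then show ?thesis by (simp add: max_def)
    qed
    from this[of l] this[of l'] l have "Max l \<in> l" "Max l \<in> l'" by simp_all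
    then show "l = l'" using pairings_unique_link[OF m, of l l' "Max l"] l(1,2) by blast
  qed
  ultimately have "card (block_rights \<beta> j) = card {l \<in> \<beta>. block s (Max l) = j}" by (simp add: card_image)
  also have "{l \<in> \<beta>. block s (Max l) = j} = {l \<in> \<beta>. Max (block s ` l) = j}" using mx by auto
  also have "card \<dots> = size (filter_mset (\<lambda>S. Max S = j) (fuse_pattern s \<beta>))"
    using fin by (simp add: fuse_pattern_def filter_mset_image_mset)
  finally show ?thesis .
qed

text \<open>The right ends form an initial segment of each block, and its length is known from the
  fused pattern. Two initial segments are nested, so equal size makes them equal; then all left ends
  agree.\<close>

lemma fuse_pattern_inj:
  assumes \<beta>: "\<beta> \<in> LP N" "no_block_link s \<beta>" and \<gamma>: "\<gamma> \<in> LP N" "no_block_link s \<gamma>"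
    and eq: "fuse_pattern s \<beta> = fuse_pattern s \<gamma>"
  shows "\<beta> = \<gamma>"
proof (rule LP_eqI[OF \<beta>(1) \<gamma>(1)])
  have m: "\<beta> \<in> pairings N" "\<gamma> \<in> pairings N" using \<beta> \<gamma> LP_subset_pairings by blast+
  have card: "card (block_rights \<beta> j) = card (block_rights \<gamma> j)" for j
    using card_block_rights[OF m(1)] card_block_rights[OF m(2)] eq by simp
  have fin: "finite (block_rights \<delta> j)" for \<delta> j by (simp add: block_rights_def)
  have R: "block_rights \<beta> j = block_rights \<gamma> j" for j
  proof -
    have "block_rights \<beta> j \<subseteq> block_rights \<gamma> j \<or> block_rights \<gamma> j \<subseteq> block_rights \<beta> j"
    proof (rule ccontr)
      assume "\<not> ?thesis"
      then obtain a b where ab: "a \<in> block_rights \<beta> j" "a \<notin> block_rights \<gamma> j" "b \<in> block_rights \<gamma> j" "b \<notin> block_rights \<beta> j"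
        by blast
      have rng: "a \<in> {1..2*N}" "block s a = j" "b \<in> {1..2*N}" "block s b = j" using ab by (auto simp: block_rights_def)
      show False
      proof (rule linorder_cases[of a b])
        assume "a < b" then show False using block_rights_initial[OF \<gamma> ab(3) rng(1) _ rng(2)] ab by simp
      next
        assume "b < a" then show False using block_rights_initial[OF \<beta> ab(1) rng(3) _ rng(4)] ab by simp
      qed (use ab in simp)
    qed
    then show ?thesis
    proof
      assume "block_rights \<beta> j \<subseteq> block_rights \<gamma> j"
      then show ?thesis by (rule card_subset_eq[OF fin _ card])
    next
      assume "block_rights \<gamma> j \<subseteq> block_rights \<beta> j"
      then show ?thesis by (rule card_subset_eq[OF fin _ card[symmetric], symmetric])
    qed
  qed
  have iff: "a \<in> Min ` \<beta> \<longleftrightarrow> a \<in> Min ` \<gamma>" if "a \<in> {1..2*N}" for a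
  proof -
    have "a \<in> block_rights \<beta> (block s a) \<longleftrightarrow> a \<in> block_rights \<gamma> (block s a)" by (simp only: R)
    then show ?thesis using that by (simp only: block_rights_def mem_Collect_eq simp_thms not_not)
  qed
  have sub: "a \<in> {1..2*N}" if \<delta>: "\<delta> \<in> pairings N" "a \<in> Min ` \<delta>" for \<delta> a
  proof -
    obtain l where l: "l \<in> \<delta>" "a = Min l" using \<delta>(2) by (elim imageE)
    obtain u v where uv: "l = {u, v}" "u < v" "u \<in> {1..2*N}" using pairings_link[OF \<delta>(1) l(1)] by metis
    then show ?thesis by (simp add: l(2))
  qed
  show "Min ` \<beta> = Min ` \<gamma>"
  proof (rule Set.set_eqI)
    fix a show "a \<in> Min ` \<beta> \<longleftrightarrow> a \<in> Min ` \<gamma>"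
      using iff[of a] sub[OF m(1), of a] sub[OF m(2), of a] by argo
  qed
qed

lemma unfuse_fuse_pattern:
  assumes "\<beta> \<in> LP N" "no_block_link s \<beta>"
  shows "unfuse N s (fuse_pattern s \<beta>) = \<beta>"
  unfolding unfuse_def by (rule the_equality) (use assms fuse_pattern_inj in auto)

end

section \<open>The span of the pure partition functions\<close>

lemma sum_fun_apply: "(\<Sum>i\<in>I. f i) x = (\<Sum>i\<in>I. f i x)"
  by (induction I rule: infinite_finite_induct) auto

lemma wsum_add: "wsum N (\<lambda>m. c m + d m) e x = wsum N c e x + wsum N d e x"
  by (simp add: wsum_def distrib_right sum.distrib)

lemma wsum_scale: "wsum N (\<lambda>m. k * c m) e x = k * wsum N c e x"
  by (simp add: wsum_def sum_distrib_left mult.assoc)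

lemma blocked_add: "c \<in> blocked N s \<Longrightarrow> d \<in> blocked N s \<Longrightarrow> (\<lambda>m. c m + d m) \<in> blocked N s"
  by (simp add: blocked_def pluecker_add)

lemma blocked_scale: "c \<in> blocked N s \<Longrightarrow> (\<lambda>m. k * c m) \<in> blocked N s"
  by (simp add: blocked_def pluecker_scale)

lemma blocked_zero: "(\<lambda>m. 0) \<in> blocked N s"
  by (simp add: blocked_def pluecker_zero)

lemma Sv_eq_fused_fun:
  assumes val: "valences N s"
  shows "Sv N s = fused_fun N s ` blocked N s"
proof -
  define L where "L = {\<beta> \<in> LP N. no_block_link s \<beta>}"
  have finL: "finite L" by (simp add: L_def)
  have gen: "pure_pf N s ` LPv N s = (\<lambda>\<beta>. fused_fun N s (zcoef N \<beta>)) ` L"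
    unfolding LPv_def image_image L_def
    by (rule image_cong[OF refl]) (simp add: pure_pf_eq_fused_fun[OF val] unfuse_fuse_pattern[OF val])
  have lin: "fused_fun N s (\<lambda>m. \<Sum>\<beta>\<in>L. y \<beta> * zcoef N \<beta> m) = (\<Sum>\<beta>\<in>L. cscale (y \<beta>) (fused_fun N s (zcoef N \<beta>)))" for y
    by (rule ext) (simp add: fused_fun_def wsum_sum cscale_def sum_fun_apply)
  show ?thesis
  proof (intro antisym subsetI)
    fix f assume "f \<in> Sv N s"
    then have "f \<in> cfun.span ((\<lambda>\<beta>. fused_fun N s (zcoef N \<beta>)) ` L)" by (simp only: Sv_def gen)
    then show "f \<in> fused_fun N s ` blocked N s"
    proof (induction rule: cfun.span_induct_alt)
      case base
      have "(0 :: cfn) = fused_fun N s (\<lambda>m. 0)" by (rule ext) (simp add: fused_fun_def wsum_def)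
      then show ?case using blocked_zero by blast
    next
      case (step k f g)
      then obtain \<beta> c where \<beta>: "\<beta> \<in> L" "f = fused_fun N s (zcoef N \<beta>)" and c: "c \<in> blocked N s" "g = fused_fun N s c" by auto
      have "cscale k f + g = fused_fun N s (\<lambda>m. k * zcoef N \<beta> m + c m)"
        by (rule ext) (simp add: \<beta> c fused_fun_def cscale_def wsum_add wsum_scale)
      moreover have "(\<lambda>m. k * zcoef N \<beta> m + c m) \<in> blocked N s"
        using \<beta>(1) by (intro blocked_add blocked_scale zcoef_blocked[OF val] c(1)) (auto simp: L_def)
      ultimately show ?case by blast
    qed
  next
    fix f assume "f \<in> fused_fun N s ` blocked N s"
    then obtain c where c: "c \<in> blocked N s" "f = fused_fun N s c" by blast
    obtain y where "c = (\<lambda>m. \<Sum>\<beta>\<in>L. y \<beta> * zcoef N \<beta> m)"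
      using blocked_eq_span[OF val c(1)] unfolding L_def by blast
    then have "f = (\<Sum>\<beta>\<in>L. cscale (y \<beta>) (fused_fun N s (zcoef N \<beta>)))"
      using trans[OF c(2) trans[OF arg_cong[of c _ "fused_fun N s"] lin]] by blast
    moreover have "cscale (y \<beta>) (fused_fun N s (zcoef N \<beta>)) \<in> cfun.span ((\<lambda>\<beta>. fused_fun N s (zcoef N \<beta>)) ` L)"
      if "\<beta> \<in> L" for \<beta>
      by (rule cfun.span_scale, rule cfun.span_base, rule imageI, rule that)
    then have "(\<Sum>\<beta>\<in>L. cscale (y \<beta>) (fused_fun N s (zcoef N \<beta>))) \<in> cfun.span ((\<lambda>\<beta>. fused_fun N s (zcoef N \<beta>)) ` L)"
      by (rule cfun.span_sum)
    ultimately show "f \<in> Sv N s" by (simp only: Sv_def gen)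
  qed
qed

section \<open>The fused limit\<close>

text \<open>The limits of \<open>wsum\<close> and \<open>separates\<close> in epsilon-delta form.
  One delta for all relevant coordinates is wanted, as the intermediate point in
  \<open>wsum_mean_value\<close> is known only to lie in this box.\<close>

lemma near_control:
  fixes c :: "nat set set \<Rightarrow> 'a::real_normed_field"
  assumes sep: "separates N c p" and \<epsilon>: "0 < \<epsilon>"
  shows "\<exists>\<delta>>0. \<forall>y. (\<forall>b\<in>{1..2*N}. \<bar>y b - p b\<bar> < \<delta>) \<longrightarrow>
           separates N c y \<and> dist (wsum N c e y) (wsum N c e p) < \<epsilon>"
proof (rule ccontr)
  assume "\<not> ?thesis"
  then have "\<forall>\<delta>. \<exists>y. 0 < \<delta> \<longrightarrow> (\<forall>b\<in>{1..2*N}. \<bar>y b - p b\<bar> < \<delta>) \<and>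
      \<not> (separates N c y \<and> dist (wsum N c e y) (wsum N c e p) < \<epsilon>)" by blast
  then obtain Y0 where Y0: "\<And>\<delta>. 0 < \<delta> \<Longrightarrow> (\<forall>b\<in>{1..2*N}. \<bar>Y0 \<delta> b - p b\<bar> < \<delta>) \<and>
      \<not> (separates N c (Y0 \<delta>) \<and> dist (wsum N c e (Y0 \<delta>)) (wsum N c e p) < \<epsilon>)" by metis
  \<comment> \<open>The bad points are controlled only on \<open>{1..2*N}\<close>; freezing all
    other coordinates makes every coordinate converge.\<close>
  define Y where "Y \<delta> b = (if b \<in> {1..2*N} then Y0 \<delta> b else p b)" for \<delta> b
  have lim: "((\<lambda>\<delta>. Y \<delta> b) \<longlongrightarrow> p b) (at_right 0)" for b
  proof (rule Lim_transform_bound[OF _ tendsto_ident_at[of 0 "{0<..}"], THEN LIM_zero_cancel])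
    show "\<forall>\<^sub>F \<delta> in at_right 0. norm (Y \<delta> b - p b) \<le> norm \<delta>"
    proof (rule eventually_at_right_less[THEN eventually_mono])
      fix \<delta> :: real assume "0 < \<delta>"
      then show "norm (Y \<delta> b - p b) \<le> norm \<delta>" using Y0[of \<delta>] by (auto simp: Y_def less_imp_le)
    qed
  qed
  have "\<forall>\<^sub>F \<delta> in at_right 0. separates N c (Y \<delta>)" by (rule separates_open[OF sep lim])
  moreover have "\<forall>\<^sub>F \<delta> in at_right 0. dist (wsum N c e (Y \<delta>)) (wsum N c e p) < \<epsilon>"
    by (rule tendstoD[OF wsum_tendsto[OF lim sep] \<epsilon>])
  moreover have "\<forall>\<^sub>F \<delta> in at_right (0::real). 0 < \<delta>" by (rule eventually_at_right_less)
  ultimately have "\<forall>\<^sub>F \<delta> in at_right (0::real). False"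
  proof eventually_elim
    case (elim \<delta>)
    have "wsum N c e (Y \<delta>) = wsum N c e (Y0 \<delta>)" by (rule wsum_cong) (simp_all add: Y_def)
    moreover have "separates N c (Y0 \<delta>)"
      unfolding separates_def
    proof (intro ballI impI allI)
      fix m a b assume m: "m \<in> pairings N" "c m \<noteq> 0" "{a, b} \<in> m"
      then have "Y \<delta> a \<noteq> Y \<delta> b" using elim(1) unfolding separates_def by simp
      then show "Y0 \<delta> a \<noteq> Y0 \<delta> b" using pairings_linkD(2,3)[OF m(1,3)] by (simp add: Y_def)
    qed
    ultimately show ?case using Y0[OF elim(3)] elim(2) by simp
  qed
  then show False by simp
qed

text \<open>The points are treated from the last to the first. When \<open>a\<close> is reached,
  neither \<open>a\<close> nor an earlier point carries a derivative, so by antisymmetry the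
  function of \<open>x a\<close> vanishes at all earlier points of the block.
  \<open>mean_value_zeros\<close> extracts the linear factors, replaces \<open>x a\<close> by a
  nearby value and leaves \<open>bpos blk a\<close> derivatives there.\<close>

lemma wsum_mean_value:
  fixes c :: "nat set set \<Rightarrow> real"
  assumes c: "c \<in> pluecker N"
    and blk_mono: "\<And>i j. 1 \<le> i \<Longrightarrow> i \<le> j \<Longrightarrow> j \<le> 2 * N \<Longrightarrow> blk i \<le> (blk j :: nat)"
    and c0: "\<And>m a b. m \<in> pairings N \<Longrightarrow> {a, b} \<in> m \<Longrightarrow> blk a = blk b \<Longrightarrow> c m = 0"
    and p: "\<And>a b. a \<in> {1..2*N} \<Longrightarrow> b \<in> {1..2*N} \<Longrightarrow> blk a = blk b \<Longrightarrow> p a = p b"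
    and sep: "\<And>y. (\<And>b. b \<in> {1..2*N} \<Longrightarrow> \<bar>y b - p b\<bar> < \<delta>) \<Longrightarrow> separates N c y"
    and x: "inj_on x {1..2*N}" "\<And>b. b \<in> {1..2*N} \<Longrightarrow> \<bar>x b - p b\<bar> < \<delta>"
    and n: "n \<le> 2 * N"
  shows "\<exists>\<theta>. (\<forall>b\<in>{1..2*N}. \<bar>\<theta> b - p b\<bar> < \<delta>) \<and> (\<forall>b\<in>{1..n}. \<theta> b = x b) \<and>
    wsum N c (\<lambda>_. 0) x = (\<Prod>a\<in>{n<..2*N}. (\<Prod>l | l \<in> {1..<a} \<and> blk l = blk a. x a - x l) / fact (bpos blk a))
      * wsum N c (\<lambda>b. if n < b then bpos blk b else 0) \<theta>"
  using n
proof (induction rule: inc_induct)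
  case base
  have "wsum N c (\<lambda>_. 0) x = wsum N c (\<lambda>b. if 2 * N < b then bpos blk b else 0) x"
    by (rule wsum_cong) auto
  then show ?case using x(2) by (intro exI[of _ x]) simp
next
  case (step n)
  define a where "a = Suc n"
  define E where "E = (\<lambda>b. if a < b then bpos blk b else 0)"
  obtain \<theta> where \<theta>: "\<And>b. b \<in> {1..2*N} \<Longrightarrow> \<bar>\<theta> b - p b\<bar> < \<delta>" "\<And>b. b \<in> {1..a} \<Longrightarrow> \<theta> b = x b"
    and eq: "wsum N c (\<lambda>_. 0) x = (\<Prod>a\<in>{a<..2*N}. (\<Prod>l | l \<in> {1..<a} \<and> blk l = blk a. x a - x l) / fact (bpos blk a))
      * wsum N c E \<theta>"
    using step.IH unfolding a_def E_def by blast
  have a: "a \<in> {1..2*N}" using step by (simp add: a_def)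
  define f where "f i t = wsum N c (E(a := i)) (\<theta>(a := t))" for i t
  define S where "S = {l. l \<in> {1..<a} \<and> blk l = blk a}"
  have S: "l \<in> {1..2*N}" "l < a" "blk l = blk a" "l \<in> {1..a}" if "l \<in> S" for l
    using that a by (auto simp: S_def)
  have inS: "inj_on x S" by (rule inj_on_subset[OF x(1)]) (use S(1) in blast)
  have cardS: "card (x ` S) = bpos blk a" using card_image[OF inS] by (simp only: S_def bpos_def)
  have der: "(f i has_real_derivative f (Suc i) z) (at z)" if z: "z \<in> {p a - \<delta><..<p a + \<delta>}" for i z
  proof -
    have "separates N c (\<theta>(a := z))"
    proof (rule sep)
      fix b assume "b \<in> {1..2*N}"
      then show "\<bar>(\<theta>(a := z)) b - p b\<bar> < \<delta>" using \<theta>(1)[of b] z by (auto simp: abs_less_iff)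
    qed
    from wsum_DERIV_coord[OF this a, of "E(a := i)"] show ?thesis by (simp add: f_def[abs_def])
  qed
  have zero: "f 0 w = 0" if w: "w \<in> x ` S" for w
  proof -
    obtain l where l: "l \<in> S" "w = x l" using w by blast
    show ?thesis unfolding f_def
    proof (rule wsum_dup[where blk = blk and a = a and b = l])
      show "blk i \<le> blk j" if "1 \<le> i" "i \<le> j" "j \<le> 2 * N" for i j by (rule blk_mono[OF that])
      show "c m = 0" if "m \<in> pairings N" "{a, b} \<in> m" "blk a = blk b" for m a b by (rule c0[OF that])
    qed (use c a S[OF l(1)] \<theta>(2)[OF S(4)[OF l(1)]] l(2) in \<open>simp_all add: E_def\<close>)
  qed
  have sub: "x ` S \<subseteq> {p a - \<delta><..<p a + \<delta>}"
  proof (rule image_subsetI)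
    fix l assume l: "l \<in> S"
    have "p l = p a" by (rule p[OF S(1)[OF l] a S(3)[OF l]])
    then show "x l \<in> {p a - \<delta><..<p a + \<delta>}" using x(2)[OF S(1)[OF l]] by (auto simp: abs_less_iff)
  qed
  have xa: "x a \<in> {p a - \<delta><..<p a + \<delta>}" using x(2)[OF a] by (auto simp: abs_less_iff)
  have finX: "finite (x ` S)" by (simp add: S_def)
  from mean_value_zeros[OF der finX sub zero xa] obtain \<eta>
    where \<eta>: "\<eta> \<in> {p a - \<delta><..<p a + \<delta>}" "f 0 (x a) = (\<Prod>w\<in>x ` S. x a - w) * f (bpos blk a) \<eta> / fact (bpos blk a)"
    unfolding cardS by blast
  have f0: "f 0 (x a) = wsum N c E \<theta>"
    unfolding f_def by (rule wsum_cong) (use \<theta>(2)[of a] a in \<open>auto simp: E_def\<close>)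
  have fb: "f (bpos blk a) \<eta> = wsum N c (\<lambda>b. if n < b then bpos blk b else 0) (\<theta>(a := \<eta>))"
    unfolding f_def by (rule wsum_cong) (auto simp: E_def a_def)
  have prS: "(\<Prod>w\<in>x ` S. x a - w) = (\<Prod>l\<in>S. x a - x l)" by (simp add: prod.reindex[OF inS])
  have ins: "{n<..2*N} = insert a {a<..2*N}" using a by (auto simp: a_def)
  have "wsum N c (\<lambda>_. 0) x = (\<Prod>a\<in>{n<..2*N}. (\<Prod>l | l \<in> {1..<a} \<and> blk l = blk a. x a - x l) / fact (bpos blk a))
      * wsum N c (\<lambda>b. if n < b then bpos blk b else 0) (\<theta>(a := \<eta>))"
    unfolding eq f0[symmetric] \<eta>(2) fb prS ins by (simp add: S_def)
  moreover have "\<forall>b\<in>{1..2*N}. \<bar>(\<theta>(a := \<eta>)) b - p b\<bar> < \<delta>"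
    using \<theta>(1) \<eta>(1) by (auto simp: abs_less_iff)
  moreover have "\<forall>b\<in>{1..n}. (\<theta>(a := \<eta>)) b = x b" using \<theta>(2) by (auto simp: a_def)
  ultimately show ?case by blast
qed

text \<open>The product over the blocks of 0! 1! ... (s_k - 1)!, the factor between the Vandermonde
  quotient and the derivatives at the fused points.\<close>

definition fuse_const :: "nat \<Rightarrow> nat list \<Rightarrow> real" where
  "fuse_const N s = (\<Prod>a=1..2*N. fact (bpos (block s) a))"

lemma fuse_const_pos: "0 < fuse_const N s"
  unfolding fuse_const_def by (rule prod_pos) simp

text \<open>The denominator of \<open>block_quot\<close>, grouped by the larger index, as
  \<open>wsum_mean_value\<close> produces it.\<close>

definition block_vandermonde :: "nat \<Rightarrow> nat list \<Rightarrow> (nat \<Rightarrow> real) \<Rightarrow> real" where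
  "block_vandermonde N s x = (\<Prod>a=1..2*N. \<Prod>l | l \<in> {1..<a} \<and> block s l = block s a. x a - x l)"

lemma block_quot_eq:
  assumes val: "valences N s"
  shows "block_quot s F x = F x / of_real (block_vandermonde N s x)"
proof -
  let ?A = "\<lambda>k. {(i, j). qsum s (k - 1) < i \<and> i < j \<and> j \<le> qsum s k}"
  have fin: "finite (?A k)" for k
    by (rule finite_subset[of _ "{..qsum s k} \<times> {..qsum s k}"]) auto
  have "(\<Prod>k=1..length s. \<Prod>(i, j)\<in>?A k. x j - x i) = (\<Prod>(k, i, j)\<in>Sigma {1..length s} ?A. x j - x i)"
    by (subst prod.Sigma) (use fin in \<open>auto simp: case_prod_beta'\<close>)
  also have "\<dots> = (\<Prod>(a, l)\<in>Sigma {1..2*N} (\<lambda>a. {l. l \<in> {1..<a} \<and> block s l = block s a}). x a - x l)"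
  proof (rule prod.reindex_bij_witness[where i = "\<lambda>(a, l). (block s a, l, a)" and j = "\<lambda>(k, i, j). (j, i)"])
    fix w assume "w \<in> Sigma {1..length s} ?A"
    then obtain k i j where w: "w = (k, i, j)" "1 \<le> k" "k \<le> length s" "qsum s (k - 1) < i" "i < j" "j \<le> qsum s k" by auto
    have b: "block s i = k" "block s j = k" by (rule blockI[OF val w(2,3)], use w in simp_all)+
    have "j \<in> {1..2*N}" by (rule subsetD[OF block_subset[OF val, of k]]) (use w in simp)
    then show "(case (case w of (k, i, j) \<Rightarrow> (j, i)) of (a, l) \<Rightarrow> (block s a, l, a)) = w"
      "(case w of (k, i, j) \<Rightarrow> (j, i)) \<in> Sigma {1..2*N} (\<lambda>a. {l. l \<in> {1..<a} \<and> block s l = block s a})"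
      "(case (case w of (k, i, j) \<Rightarrow> (j, i)) of (a, l) \<Rightarrow> x a - x l) = (case w of (k, i, j) \<Rightarrow> x j - x i)"
      using w b by simp_all
  next
    fix w assume "w \<in> Sigma {1..2*N} (\<lambda>a. {l. l \<in> {1..<a} \<and> block s l = block s a})"
    then obtain a l where w: "w = (a, l)" "a \<in> {1..2*N}" "l \<in> {1..<a}" "block s l = block s a" by auto
    have "l \<in> {1..2*N}" using w by auto
    then have "qsum s (block s a - 1) < l" using block_bounds(3)[OF val, of l] w(4) by simp
    then show "(case (case w of (a, l) \<Rightarrow> (block s a, l, a)) of (k, i, j) \<Rightarrow> (j, i)) = w"
      "(case w of (a, l) \<Rightarrow> (block s a, l, a)) \<in> Sigma {1..length s} ?A"
      using w block_bounds[OF val w(2)] by auto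
  qed
  also have "\<dots> = block_vandermonde N s x"
    unfolding block_vandermonde_def by (subst prod.Sigma) auto
  finally show ?thesis by (simp only: block_quot_def)
qed

lemma block_vandermonde_nonzero: "x \<in> config (2 * N) \<Longrightarrow> block_vandermonde N s x \<noteq> 0"
proof -
  assume "x \<in> config (2 * N)"
  then have x: "inj_on x {1..2*N}" by (simp add: config_def)
  have "x a - x l \<noteq> 0" if a: "a \<in> {1..2*N}" and l: "l \<in> {1..<a}" for a l
  proof -
    have "l \<in> {1..2*N}" "l \<noteq> a" using a l by auto
    then show ?thesis using inj_on_eq_iff[OF x a] by simp
  qed
  then have "(\<Prod>l | l \<in> {1..<a} \<and> block s l = block s a. x a - x l) \<noteq> 0" if "a \<in> {1..2*N}" for a
    using that by (simp add: prod_zero_iff)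
  then show "block_vandermonde N s x \<noteq> 0" unfolding block_vandermonde_def by (simp add: prod_zero_iff)
qed

lemma eventually_near_fused:
  assumes \<delta>: "0 < \<delta>"
  shows "\<forall>\<^sub>F x in fused_filter N s \<xi>. x \<in> config (2 * N) \<and> (\<forall>b\<in>{1..2*N}. \<bar>x b - \<xi> (block s b)\<bar> < \<delta>)"
proof -
  have "\<forall>\<^sub>F x in fused_filter N s \<xi>. x \<in> config (2 * N)"
    by (simp add: fused_filter_def eventually_at_filter)
  moreover have "\<forall>\<^sub>F x in fused_filter N s \<xi>. \<forall>b\<in>{1..2*N}. \<bar>x b - \<xi> (block s b)\<bar> < \<delta>"
  proof (rule eventually_ball_finite, simp, rule ballI)
    fix b
    have "isCont (\<lambda>x. x b) (\<lambda>a. \<xi> (block s a))"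
      by (rule continuous_on_interior[OF continuous_on_product_coordinates]) simp
    then have "((\<lambda>x. x b) \<longlongrightarrow> \<xi> (block s b)) (fused_filter N s \<xi>)"
      unfolding fused_filter_def isCont_def by (rule tendsto_mono[OF at_le, rotated]) simp
    from tendstoD[OF this \<delta>] show "\<forall>\<^sub>F x in fused_filter N s \<xi>. \<bar>x b - \<xi> (block s b)\<bar> < \<delta>"
      by (simp add: dist_real_def)
  qed
  ultimately show ?thesis by (rule eventually_conj)
qed

text \<open>Required for \<open>Lim\<close> to be the limit. The curve that adds \<epsilon> a to the
  coordinate \<open>a\<close> separates coinciding points for all small \<epsilon> > 0.\<close>

lemma fused_filter_nontrivial: "fused_filter N s \<xi> \<noteq> bot"
proof
  assume bot: "fused_filter N s \<xi> = bot"
  define p where "p a = \<xi> (block s a)" for a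
  define y where "y \<epsilon> = (\<lambda>a. p a + \<epsilon> * real a)" for \<epsilon>
  have "continuous_on UNIV y"
    unfolding y_def by (rule continuous_on_coordinatewise_then_product) (intro continuous_intros)
  then have "isCont y 0" using continuous_on_eq_continuous_at[OF open_UNIV] by blast
  then have lim: "(y \<longlongrightarrow> p) (at_right 0)"
    using tendsto_mono[OF at_le[of "{0<..}" UNIV 0]] by (simp add: isCont_def y_def)
  have ne: "\<forall>\<^sub>F \<epsilon> in at_right 0. y \<epsilon> a \<noteq> y \<epsilon> b" if "a \<noteq> b" for a b
  proof (rule eventually_mono[OF eventually_neq_at_within[of "(p b - p a) / (real a - real b)"]])
    fix \<epsilon> assume "\<epsilon> \<noteq> (p b - p a) / (real a - real b)"
    then show "y \<epsilon> a \<noteq> y \<epsilon> b" using that by (simp add: y_def field_simps)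
  qed
  have "\<forall>\<^sub>F \<epsilon> in at_right 0. \<forall>a\<in>{1..2*N}. \<forall>b\<in>{1..2*N} - {a}. y \<epsilon> a \<noteq> y \<epsilon> b"
    by (intro eventually_ball_finite ballI ne) auto
  then have "\<forall>\<^sub>F \<epsilon> in at_right 0. y \<epsilon> \<in> config (2 * N)"
    by (rule eventually_mono) (auto simp: config_def inj_on_def)
  moreover have "\<forall>\<^sub>F \<epsilon> in at_right 0. y \<epsilon> \<noteq> p"
  proof (rule eventually_mono[OF eventually_at_right_less])
    fix \<epsilon> :: real assume "0 < \<epsilon>"
    then have "y \<epsilon> 1 \<noteq> p 1" by (simp add: y_def)
    then show "y \<epsilon> \<noteq> p" by metis
  qed
  ultimately have "filterlim y (fused_filter N s \<xi>) (at_right 0)"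
    using lim unfolding fused_filter_def p_def[symmetric] by (simp add: filterlim_at eventually_conj_iff p_def[abs_def])
  then have "\<forall>\<^sub>F \<epsilon> in at_right (0::real). False"
    unfolding bot filterlim_iff by (elim allE[of _ "\<lambda>_. False"]) simp
  then show False by simp
qed

lemma blocked_separates:
  assumes val: "valences N s" and c: "c \<in> blocked N s" and \<xi>: "\<xi> \<in> config (length s)"
  shows "separates N c (\<lambda>a. \<xi> (block s a))"
  unfolding separates_def
proof (intro ballI impI allI)
  fix m a b assume m: "m \<in> pairings N" "c m \<noteq> 0" "{a, b} \<in> m"
  have ab: "a \<in> {1..2*N}" "b \<in> {1..2*N}" using pairings_linkD[OF m(1,3)] by auto
  have "block s a \<noteq> block s b" using blocked_link_zero[OF c m(1,3)] m(2) by blast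
  then show "\<xi> (block s a) \<noteq> \<xi> (block s b)"
    using \<xi> block_bounds(1,2)[OF val ab(1)] block_bounds(1,2)[OF val ab(2)]
    unfolding config_def by (auto dest: inj_onD)
qed

lemma fused_tendsto_real:
  fixes c :: "nat set set \<Rightarrow> real"
  assumes val: "valences N s" and c: "c \<in> blocked N s" and \<xi>: "\<xi> \<in> config (length s)"
  shows "((\<lambda>x. wsum N c (\<lambda>_. 0) x / block_vandermonde N s x) \<longlongrightarrow>
    wsum N c (bpos (block s)) (\<xi> \<circ> block s) / fuse_const N s) (fused_filter N s \<xi>)"
proof (rule tendstoI)
  fix \<epsilon> :: real assume \<epsilon>: "0 < \<epsilon>"
  define p where "p a = \<xi> (block s a)" for a
  define e where "e = bpos (block s)"
  have sep: "separates N c p" unfolding p_def by (rule blocked_separates[OF val c \<xi>])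
  have "0 < \<epsilon> * fuse_const N s" using \<epsilon> fuse_const_pos by simp
  from near_control[OF sep this, of e] obtain \<delta> where \<delta>: "0 < \<delta>"
    "\<And>y. (\<And>b. b \<in> {1..2*N} \<Longrightarrow> \<bar>y b - p b\<bar> < \<delta>) \<Longrightarrow> separates N c y"
    "\<And>y. (\<And>b. b \<in> {1..2*N} \<Longrightarrow> \<bar>y b - p b\<bar> < \<delta>) \<Longrightarrow> dist (wsum N c e y) (wsum N c e p) < \<epsilon> * fuse_const N s"
    by meson
  have cP: "c \<in> pluecker N" using c by (simp add: blocked_def)
  show "\<forall>\<^sub>F x in fused_filter N s \<xi>. dist (wsum N c (\<lambda>_. 0) x / block_vandermonde N s x)
      (wsum N c (bpos (block s)) (\<xi> \<circ> block s) / fuse_const N s) < \<epsilon>"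
  proof (rule eventually_mono[OF eventually_near_fused[OF \<delta>(1)]])
    fix x assume x: "x \<in> config (2 * N) \<and> (\<forall>b\<in>{1..2*N}. \<bar>x b - \<xi> (block s b)\<bar> < \<delta>)"
    have "\<exists>\<theta>. (\<forall>b\<in>{1..2*N}. \<bar>\<theta> b - p b\<bar> < \<delta>) \<and> (\<forall>b\<in>{1..0}. \<theta> b = x b) \<and>
      wsum N c (\<lambda>_. 0) x = (\<Prod>a\<in>{0<..2*N}. (\<Prod>l | l \<in> {1..<a} \<and> block s l = block s a. x a - x l) / fact (bpos (block s) a))
      * wsum N c (\<lambda>b. if 0 < b then bpos (block s) b else 0) \<theta>"
    proof (rule wsum_mean_value[OF cP block_mono[OF val]])
      show "c m = 0" if "m \<in> pairings N" "{a, b} \<in> m" "block s a = block s b" for m a b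
        by (rule blocked_link_zero[OF c that])
      show "p a = p b" if "block s a = block s b" for a b using that by (simp add: p_def)
      show "inj_on x {1..2*N}" using x by (simp add: config_def)
      show "\<bar>x b - p b\<bar> < \<delta>" if "b \<in> {1..2*N}" for b using x that by (simp add: p_def)
    qed (use \<delta>(2) in simp_all)
    then obtain \<theta> where \<theta>: "\<And>b. b \<in> {1..2*N} \<Longrightarrow> \<bar>\<theta> b - p b\<bar> < \<delta>"
      and eq: "wsum N c (\<lambda>_. 0) x = (\<Prod>a\<in>{0<..2*N}. (\<Prod>l | l \<in> {1..<a} \<and> block s l = block s a. x a - x l) / fact (bpos (block s) a))
      * wsum N c (\<lambda>b. if 0 < b then bpos (block s) b else 0) \<theta>" by blast
    have "{0<..2*N} = {1..2*N}" by auto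
    then have pr: "(\<Prod>a\<in>{0<..2*N}. (\<Prod>l | l \<in> {1..<a} \<and> block s l = block s a. x a - x l) / fact (bpos (block s) a))
      = block_vandermonde N s x / fuse_const N s"
      by (simp add: block_vandermonde_def fuse_const_def prod_dividef)
    have we: "wsum N c (\<lambda>b. if 0 < b then bpos (block s) b else 0) \<theta> = wsum N c e \<theta>"
      by (rule wsum_cong) (auto simp: e_def)
    have q: "wsum N c (\<lambda>_. 0) x / block_vandermonde N s x = wsum N c e \<theta> / fuse_const N s"
      unfolding eq pr we using block_vandermonde_nonzero[of x N s] x by simp
    have ep: "wsum N c (bpos (block s)) (\<xi> \<circ> block s) = wsum N c e p" by (simp add: e_def p_def[abs_def] comp_def)
    have "dist (wsum N c e \<theta> / fuse_const N s) (wsum N c e p / fuse_const N s)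
      = dist (wsum N c e \<theta>) (wsum N c e p) / fuse_const N s"
      using fuse_const_pos[of N s] by (simp add: dist_real_def flip: diff_divide_distrib)
    also have "\<dots> < \<epsilon>" using \<delta>(3)[OF \<theta>] fuse_const_pos[of N s] by (simp add: divide_less_eq)
    finally show "dist (wsum N c (\<lambda>_. 0) x / block_vandermonde N s x)
      (wsum N c (bpos (block s)) (\<xi> \<circ> block s) / fuse_const N s) < \<epsilon>" by (simp only: q ep)
  qed
qed

lemma Re_wsum: "Re (wsum N c e x) = wsum N (\<lambda>m. Re (c m)) e x"
  and Im_wsum: "Im (wsum N c e x) = wsum N (\<lambda>m. Im (c m)) e x"
  by (simp_all add: wsum_def)

lemma blocked_Re: "c \<in> blocked N s \<Longrightarrow> (\<lambda>m. Re (c m)) \<in> blocked N s"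
  and blocked_Im: "c \<in> blocked N s \<Longrightarrow> (\<lambda>m. Im (c m)) \<in> blocked N s"
  unfolding blocked_def pluecker_def by (auto simp flip: plus_complex.simps)

definition free_fun :: "nat \<Rightarrow> (nat set set \<Rightarrow> complex) \<Rightarrow> cfn" where
  "free_fun N c = (\<lambda>x. if x \<in> config (2 * N) then wsum N c (\<lambda>_. 0) x else 0)"

lemma fused_tendsto:
  assumes val: "valences N s" and c: "c \<in> blocked N s" and \<xi>: "\<xi> \<in> config (length s)"
  shows "(block_quot s (free_fun N c) \<longlongrightarrow> fused_fun N s c \<xi> / of_real (fuse_const N s)) (fused_filter N s \<xi>)"
proof -
  let ?q = "\<lambda>d x. wsum N d (\<lambda>_. 0) x / block_vandermonde N s x"
  have lim: "((\<lambda>x. Complex (?q (\<lambda>m. Re (c m)) x) (?q (\<lambda>m. Im (c m)) x)) \<longlongrightarrow>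
      Complex (wsum N (\<lambda>m. Re (c m)) (bpos (block s)) (\<xi> \<circ> block s) / fuse_const N s)
        (wsum N (\<lambda>m. Im (c m)) (bpos (block s)) (\<xi> \<circ> block s) / fuse_const N s)) (fused_filter N s \<xi>)"
    by (intro tendsto_Complex fused_tendsto_real[OF val _ \<xi>] blocked_Re blocked_Im c)
  have val_eq: "Complex (wsum N (\<lambda>m. Re (c m)) (bpos (block s)) (\<xi> \<circ> block s) / fuse_const N s)
        (wsum N (\<lambda>m. Im (c m)) (bpos (block s)) (\<xi> \<circ> block s) / fuse_const N s)
      = fused_fun N s c \<xi> / of_real (fuse_const N s)"
    using \<xi> by (simp add: fused_fun_def complex_eq_iff Re_wsum Im_wsum)
  have ev: "\<forall>\<^sub>F x in fused_filter N s \<xi>.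
      Complex (?q (\<lambda>m. Re (c m)) x) (?q (\<lambda>m. Im (c m)) x) = block_quot s (free_fun N c) x"
  proof (rule eventually_mono[OF eventually_near_fused[of 1]], simp)
    fix x assume "x \<in> config (2 * N) \<and> (\<forall>b\<in>{1..2*N}. \<bar>x b - \<xi> (block s b)\<bar> < 1)"
    then show "Complex (?q (\<lambda>m. Re (c m)) x) (?q (\<lambda>m. Im (c m)) x) = block_quot s (free_fun N c) x"
      by (simp add: block_quot_eq[OF val] free_fun_def complex_eq_iff Re_wsum Im_wsum)
  qed
  from Lim_transform_eventually[OF lim ev] show ?thesis unfolding val_eq .
qed

lemma extends_free_fun:
  assumes "valences N s" "c \<in> blocked N s"
  shows "extends_to_fused N s (block_quot s (free_fun N c))"
  unfolding extends_to_fused_def using fused_tendsto[OF assms] by blast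

lemma fused_eval_free_fun:
  assumes "valences N s" "c \<in> blocked N s"
  shows "fused_eval N s (block_quot s (free_fun N c)) = cscale (1 / of_real (fuse_const N s)) (fused_fun N s c)"
proof
  fix \<xi>
  show "fused_eval N s (block_quot s (free_fun N c)) \<xi> = cscale (1 / of_real (fuse_const N s)) (fused_fun N s c) \<xi>"
    using tendsto_Lim[OF fused_filter_nontrivial fused_tendsto[OF assms, of \<xi>]]
    by (simp add: fused_eval_def cscale_def fused_fun_def)
qed

lemma valences_ones: "valences N (replicate (2*N) 1)"
  by (auto simp: valences_def sum_list_replicate)

lemma SN_eq: "SN N = free_fun N ` pluecker N"
proof -
  let ?s = "replicate (2*N) 1 :: nat list"
  have "blocked N ?s = (pluecker N :: (_ \<Rightarrow> complex) set)"
  proof (intro subset_antisym subsetI)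
    fix c :: "nat set set \<Rightarrow> complex" assume c: "c \<in> pluecker N"
    show "c \<in> blocked N ?s"
    proof (rule blockedI[OF c])
      fix m a b assume m: "m \<in> pairings N" "{a, b} \<in> m" "block ?s a = block ?s b"
      then show "c m = 0" using pairings_linkD[OF m(1,2)] by (simp add: block_replicate_one del: replicate.simps One_nat_def)
    qed
  qed (simp add: blocked_def)
  moreover have "fused_fun N ?s c = free_fun N c" for c
  proof
    fix x
    have "wsum N c (bpos (block ?s)) (x \<circ> block ?s) = wsum N c (\<lambda>_. 0) x"
    proof (rule wsum_cong)
      fix j assume j: "j \<in> {1..2*N}"
      have "{l \<in> {1..<j}. block ?s l = block ?s j} = {}"
      proof (rule equals0I)
        fix l assume l: "l \<in> {l \<in> {1..<j}. block ?s l = block ?s j}"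
        then have "l \<in> {1..2*N}" "l < j" "block ?s l = block ?s j" using j by auto
        then show False using block_replicate_one[OF j] block_replicate_one[of l N] by simp
      qed
      then show "bpos (block ?s) j = 0" by (simp add: bpos_def)
      show "(x \<circ> block ?s) j = x j" using block_replicate_one[OF j] by simp
    qed
    then show "fused_fun N ?s c x = free_fun N c x" by (simp add: fused_fun_def free_fun_def)
  qed
  ultimately show ?thesis unfolding SN_def Sv_eq_fused_fun[OF valences_ones] by simp
qed

lemma block_qsum:
  assumes val: "valences N s" and k: "1 \<le> k" "k \<le> length s"
  shows "block s (qsum s k) = k" "qsum s k \<in> {1..2*N}"
proof -
  have "qsum s k = qsum s (k - 1) + s ! (k - 1)"
    using k take_Suc_conv_app_nth[of "k - 1" s] by (simp add: qsum_def)
  moreover have "0 < s ! (k - 1)" using val k by (simp add: valences_def)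
  ultimately have lt: "qsum s (k - 1) < qsum s k" by simp
  show "block s (qsum s k) = k" by (rule blockI[OF val k lt order.refl])
  show "qsum s k \<in> {1..2*N}" using block_subset[OF val, of k] lt by auto
qed

lemma fused_fun_injective:
  assumes val: "valences N s" and c: "c \<in> blocked N s" and z: "\<And>\<xi>. fused_fun N s c \<xi> = 0"
  shows "c m = 0"
proof -
  have zero: "wsum N c (fexp (block s) (2*N)) x = 0" if x: "locus N (block s) (2*N) x" for x
  proof -
    \<comment> \<open>Each block is read at its last point, which exists since valences are
      positive.\<close>
    define \<xi> where "\<xi> k = x (qsum s k)" for k
    have cfg: "\<xi> \<in> config (length s)"
      unfolding config_def mem_Collect_eq
    proof (rule inj_onI, rule ccontr)
      fix k l assume kl: "k \<in> {1..length s}" "l \<in> {1..length s}" "\<xi> k = \<xi> l" "k \<noteq> l"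
      then have "1 \<le> k" "k \<le> length s" "1 \<le> l" "l \<le> length s" by simp_all
      note k = block_qsum[OF val this(1,2)] and l = block_qsum[OF val this(3,4)]
      have "qsum s k \<noteq> qsum s l" using k(1) l(1) kl(4) by metis
      from locusD[OF x k(2) l(2) this] show False using kl(3,4) k(1) l(1) by (simp add: \<xi>_def)
    qed
    have \<xi>: "\<xi> (block s a) = x a" if a: "a \<in> {1..2*N}" for a
    proof (cases "qsum s (block s a) = a")
      case False
      have b: "block s (qsum s (block s a)) = block s a" "qsum s (block s a) \<in> {1..2*N}"
        by (rule block_qsum[OF val block_bounds(1,2)[OF val a]])+
      show ?thesis using locusD[OF x b(2) a False] a b by (simp add: \<xi>_def)
    qed (simp add: \<xi>_def)
    have "wsum N c (fexp (block s) (2*N)) x = wsum N c (bpos (block s)) (\<xi> \<circ> block s)"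
      by (rule wsum_cong) (simp_all add: fexp_def \<xi>)
    also have "\<dots> = 0" using z[of \<xi>] cfg by (simp add: fused_fun_def)
    finally show ?thesis .
  qed
  have "d m = 0" if d: "d \<in> blocked N s" "\<And>x. locus N (block s) (2*N) x \<Longrightarrow> wsum N d (fexp (block s) (2*N)) x = 0"
    for d :: "nat set set \<Rightarrow> real"
  proof (rule fused_injective[OF _ block_mono[OF val] _ d(2)])
    show "d \<in> pluecker N" using d(1) by (simp add: blocked_def)
    show "d m = 0" if "m \<in> pairings N" "{a, b} \<in> m" "block s a = block s b" for m a b
      by (rule blocked_link_zero[OF d(1) that])
  qed
  from this[OF blocked_Re[OF c]] this[OF blocked_Im[OF c]] have "Re (c m) = 0" "Im (c m) = 0"
    using zero by (simp_all flip: Re_wsum Im_wsum)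
  then show ?thesis by (simp add: complex_eq_iff)
qed

section \<open>The group algebra acting on coefficient functions\<close>

text \<open>The inverse makes this a left action, and \<open>free_fun\<close> intertwines it with
  the permutation of variables in \<open>ga_act\<close>.\<close>

definition gact :: "nat \<Rightarrow> ((nat \<Rightarrow> nat) \<Rightarrow> complex) \<Rightarrow> (nat set set \<Rightarrow> complex) \<Rightarrow> nat set set \<Rightarrow> complex" where
  "gact n a c = (\<lambda>m. \<Sum>\<sigma> | \<sigma> permutes {1..n}. a \<sigma> * c (pact (inv_into UNIV \<sigma>) m))"

lemma gact_add_left: "gact n (a \<oplus>\<^bsub>group_alg n\<^esub> b) c = gact n a c + gact n b c"
  by (rule ext) (simp add: gact_def group_alg_def distrib_right sum.distrib)

lemma gact_smult: "gact n (k \<odot>\<^bsub>group_alg n\<^esub> a) c = cscale k (gact n a c)"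
  by (rule ext) (simp add: gact_def group_alg_def cscale_def sum_distrib_left mult.assoc)

lemma gact_zero: "gact n \<zero>\<^bsub>group_alg n\<^esub> c = 0"
  by (rule ext) (simp add: gact_def group_alg_def)

lemma gact_add: "gact n a (c + d) = gact n a c + gact n a d"
  by (rule ext) (simp add: gact_def distrib_left sum.distrib)

lemma gact_cscale: "gact n a (cscale k c) = cscale k (gact n a c)"
  by (rule ext) (simp add: gact_def cscale_def sum_distrib_left mult.left_commute)

lemma gact_single:
  assumes "\<sigma> permutes {1..n}"
  shows "gact n (\<lambda>\<rho>. if \<rho> = \<sigma> then 1 else 0) c = (\<lambda>m. c (pact (inv_into UNIV \<sigma>) m))"
proof
  fix m
  have "gact n (\<lambda>\<rho>. if \<rho> = \<sigma> then 1 else 0) c m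
    = (\<Sum>\<rho> | \<rho> permutes {1..n}. if \<rho> = \<sigma> then c (pact (inv_into UNIV \<sigma>) m) else 0)"
    unfolding gact_def by (rule sum.cong) auto
  then show "gact n (\<lambda>\<rho>. if \<rho> = \<sigma> then 1 else 0) c m = c (pact (inv_into UNIV \<sigma>) m)"
    using assms by simp
qed

lemma gact_one: "gact n \<one>\<^bsub>group_alg n\<^esub> c = c"
proof -
  have "inv_into UNIV id = (id :: nat \<Rightarrow> nat)" by (rule inv_id)
  then show ?thesis using gact_single[OF permutes_id, of n c] by (simp add: group_alg_def)
qed

lemma gact_tau:
  assumes "1 \<le> i" "Suc i \<le> n"
  shows "gact n (tau i) c = (\<lambda>m. c (pact (swp i (Suc i)) m))"
proof -
  have p: "swp i (Suc i) permutes {1..n}" using assms by (intro swp_permutes) auto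
  have "inv_into UNIV (swp i (Suc i)) = swp i (Suc i)"
    by (rule inv_unique_comp) simp_all
  then show ?thesis using gact_single[OF p, of c] by (simp add: tau_def)
qed

lemma gact_mult: "gact n (a \<otimes>\<^bsub>group_alg n\<^esub> b) c = gact n a (gact n b c)"
proof
  fix m
  let ?P = "{\<sigma>. \<sigma> permutes {1..n}}"
  have "gact n (a \<otimes>\<^bsub>group_alg n\<^esub> b) c m
    = (\<Sum>\<sigma>\<in>?P. \<Sum>\<rho>\<in>?P. a \<rho> * b (inv_into UNIV \<rho> \<circ> \<sigma>) * c (pact (inv_into UNIV \<sigma>) m))"
    unfolding gact_def by (rule sum.cong) (simp_all add: group_alg_mult_apply sum_distrib_right)
  also have "\<dots> = (\<Sum>\<rho>\<in>?P. \<Sum>\<sigma>\<in>?P. a \<rho> * b (inv_into UNIV \<rho> \<circ> \<sigma>) * c (pact (inv_into UNIV \<sigma>) m))"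
    by (rule sum.swap)
  also have "\<dots> = gact n a (gact n b c) m"
    unfolding gact_def sum_distrib_left
  proof (rule sum.cong[OF refl])
    fix \<rho> assume "\<rho> \<in> ?P"
    then have \<rho>: "\<rho> permutes {1..n}" by simp
    have "(\<Sum>\<sigma>\<in>?P. a \<rho> * b (inv_into UNIV \<rho> \<circ> \<sigma>) * c (pact (inv_into UNIV \<sigma>) m))
      = (\<Sum>\<pi>\<in>?P. a \<rho> * b (inv_into UNIV \<rho> \<circ> (\<rho> \<circ> \<pi>)) * c (pact (inv_into UNIV (\<rho> \<circ> \<pi>)) m))"
      by (rule sum.reindex_bij_witness[where i = "\<lambda>\<pi>. \<rho> \<circ> \<pi>" and j = "\<lambda>\<sigma>. inv_into UNIV \<rho> \<circ> \<sigma>"])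
        (use permutes_compose[OF _ \<rho>] permutes_compose[OF _ permutes_inv[OF \<rho>]] in
          \<open>simp_all add: o_assoc permutes_inv_o[OF \<rho>]\<close>)
    also have "\<dots> = (\<Sum>\<pi>\<in>?P. a \<rho> * (b \<pi> * c (pact (inv_into UNIV \<pi>) (pact (inv_into UNIV \<rho>) m))))"
    proof (rule sum.cong[OF refl])
      fix \<pi> assume "\<pi> \<in> ?P"
      then have \<pi>: "\<pi> permutes {1..n}" by simp
      have "inv_into UNIV \<rho> \<circ> (\<rho> \<circ> \<pi>) = \<pi>" by (simp add: o_assoc permutes_inv_o(2)[OF \<rho>])
      moreover have "inv_into UNIV (\<rho> \<circ> \<pi>) = inv_into UNIV \<pi> \<circ> inv_into UNIV \<rho>"
        by (rule o_inv_distrib[OF permutes_bij[OF \<rho>] permutes_bij[OF \<pi>]])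
      ultimately show "a \<rho> * b (inv_into UNIV \<rho> \<circ> (\<rho> \<circ> \<pi>)) * c (pact (inv_into UNIV (\<rho> \<circ> \<pi>)) m)
        = a \<rho> * (b \<pi> * c (pact (inv_into UNIV \<pi>) (pact (inv_into UNIV \<rho>) m)))"
        by (simp only: pact_comp mult.assoc)
    qed
    finally show "(\<Sum>\<sigma>\<in>?P. a \<rho> * b (inv_into UNIV \<rho> \<circ> \<sigma>) * c (pact (inv_into UNIV \<sigma>) m))
      = (\<Sum>\<pi>\<in>?P. a \<rho> * (b \<pi> * c (pact (inv_into UNIV \<pi>) (pact (inv_into UNIV \<rho>) m))))" .
  qed
  finally show "gact n (a \<otimes>\<^bsub>group_alg n\<^esub> b) c m = gact n a (gact n b c) m" .
qed

lemma gact_pluecker: "c \<in> pluecker N \<Longrightarrow> gact (2 * N) a c \<in> pluecker N"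
  unfolding gact_def by (rule pluecker_sum) (simp add: pluecker_pact permutes_inv)

lemma config_permutes:
  assumes \<sigma>: "\<sigma> permutes {1..n}"
  shows "x \<circ> \<sigma> \<in> config n \<longleftrightarrow> x \<in> config n"
  unfolding config_def mem_Collect_eq
  using comp_inj_on_iff[OF permutes_inj_on[OF \<sigma>, of "{1..n}"], of x]
  unfolding permutes_image[OF \<sigma>] by (rule sym)

lemma ga_act_free_fun: "ga_act (2 * N) a (free_fun N c) = free_fun N (gact (2 * N) a c)"
proof
  fix x
  let ?P = "{\<sigma>. \<sigma> permutes {1..2*N}}"
  have w: "wsum N c (\<lambda>_. 0) (x \<circ> \<sigma>) = (\<Sum>m\<in>pairings N. c (pact (inv_into UNIV \<sigma>) m) * of_real (kprod (\<lambda>_. 0) x m))"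
    if \<sigma>: "\<sigma> permutes {1..2*N}" for \<sigma>
  proof -
    have inv: "pact (inv_into UNIV \<sigma>) (pact \<sigma> m) = m" for m
      by (simp add: pact_comp permutes_inv_o(2)[OF \<sigma>])
    have k: "kprod (\<lambda>_. 0) (x \<circ> \<sigma>) m = kprod (\<lambda>_. 0) x (pact \<sigma> m)" if "m \<in> pairings N" for m
      using kprod_pact[OF that permutes_inj[OF \<sigma>], of "\<lambda>_. 0" x] by (simp add: comp_def)
    have "wsum N c (\<lambda>_. 0) (x \<circ> \<sigma>)
      = (\<Sum>m\<in>pairings N. c (pact (inv_into UNIV \<sigma>) (pact \<sigma> m)) * of_real (kprod (\<lambda>_. 0) x (pact \<sigma> m)))"
      unfolding wsum_def by (rule sum.cong) (simp_all add: inv k)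
    also have "\<dots> = (\<Sum>m\<in>pairings N. c (pact (inv_into UNIV \<sigma>) m) * of_real (kprod (\<lambda>_. 0) x m))"
      by (rule sum_pairings_pact[OF \<sigma>])
    finally show ?thesis .
  qed
  show "ga_act (2 * N) a (free_fun N c) x = free_fun N (gact (2 * N) a c) x"
  proof (cases "x \<in> config (2 * N)")
    case True
    have "ga_act (2 * N) a (free_fun N c) x
      = (\<Sum>\<sigma>\<in>?P. \<Sum>m\<in>pairings N. a \<sigma> * (c (pact (inv_into UNIV \<sigma>) m) * of_real (kprod (\<lambda>_. 0) x m)))"
      unfolding ga_act_def
      by (rule sum.cong) (simp_all add: free_fun_def config_permutes True w sum_distrib_left)
    also have "\<dots> = (\<Sum>m\<in>pairings N. \<Sum>\<sigma>\<in>?P. a \<sigma> * (c (pact (inv_into UNIV \<sigma>) m) * of_real (kprod (\<lambda>_. 0) x m)))"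
      by (rule sum.swap)
    also have "\<dots> = free_fun N (gact (2 * N) a c) x"
      using True by (simp add: free_fun_def wsum_def gact_def sum_distrib_right mult.assoc)
    finally show ?thesis .
  next
    case False
    have "ga_act (2 * N) a (free_fun N c) x = (\<Sum>\<sigma>\<in>?P. 0)"
      unfolding ga_act_def by (rule sum.cong) (simp_all add: free_fun_def config_permutes False)
    then show ?thesis using False by (simp add: free_fun_def)
  qed
qed

section \<open>The Temperley--Lieb relations\<close>

lemma pluecker_lcoef_span:
  assumes c: "c \<in> pluecker N"
  shows "\<exists>y. c = (\<lambda>m. \<Sum>\<beta>\<in>LP N. y \<beta> * lcoef N \<beta> m)"
proof (rule pluecker_span_triangular[where N = N])
  show "lcoef N \<alpha> \<in> pluecker N" if "\<alpha> \<in> LP N" for \<alpha> by (rule lcoef_pluecker[OF subsetD[OF LP_subset_pairings that]])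
  show "lcoef N \<alpha> \<alpha> = 1" if "\<alpha> \<in> LP N" for \<alpha> by (rule lcoef_self[OF subsetD[OF LP_subset_pairings that]])
  show "dpath \<alpha> j \<le> dpath \<gamma> j" if "\<alpha> \<in> LP N" "\<gamma> \<in> LP N" "lcoef N \<alpha> \<gamma> \<noteq> (0 :: 'a)" "j \<le> 2 * N" for \<alpha> \<gamma> j
    by (rule lcoef_triangular[OF subsetD[OF LP_subset_pairings that(1)] subsetD[OF LP_subset_pairings that(2)] that(3,4)])
qed (use c in simp_all)

lemma swp_braid:
  assumes "x \<noteq> y" "y \<noteq> z" "x \<noteq> z"
  shows "pact (swp x y) (pact (swp y z) (pact (swp x y) m)) = pact (swp x z) m"
    "pact (swp y z) (pact (swp x y) (pact (swp y z) m)) = pact (swp x z) m"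
proof -
  have "swp x y \<circ> (swp y z \<circ> swp x y) = swp x z" "swp y z \<circ> (swp x y \<circ> swp y z) = swp x z"
    using assms by (auto simp: fun_eq_iff Transposition.transpose_def)
  then show "pact (swp x y) (pact (swp y z) (pact (swp x y) m)) = pact (swp x z) m"
    "pact (swp y z) (pact (swp x y) (pact (swp y z) m)) = pact (swp x z) m" by (simp_all only: pact_comp)
qed

text \<open>Two of any three points have the same colour, so symmetrising over the three points kills the
  signed sum over bichromatic pairings.\<close>

lemma fcoef_braid_sum:
  assumes bic: "bicolour N a b" and m: "m \<in> pairings N"
    and r: "x \<in> {1..2*N}" "y \<in> {1..2*N}" "z \<in> {1..2*N}" and ne: "x \<noteq> y" "y \<noteq> z" "x \<noteq> z"
  defines "F \<equiv> fcoef N a b :: _ \<Rightarrow> complex" and "T \<equiv> pact (swp x y)" and "U \<equiv> pact (swp y z)"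
  shows "F m + F (T m) + F (U m) + F (U (T m)) + F (T (U m)) + F (T (U (T m))) = 0"
proof -
  have cl: "T m \<in> pairings N" "U m \<in> pairings N" if "m \<in> pairings N" for m
    unfolding T_def U_def by (rule pact_swp_pairings[OF that r(1,2)], rule pact_swp_pairings[OF that r(2,3)])
  have W: "T (U (T m)) = pact (swp x z) m" "U (T (U m)) = pact (swp x z) m" for m
    unfolding T_def U_def by (rule swp_braid[OF ne])+
  have inv: "T (T m) = m" "U (U m) = m" for m by (simp_all add: T_def U_def)
  show ?thesis
  proof (rule fcoef_pigeon[OF bic r])
    assume "x \<in> a ` {0..<N} \<and> y \<in> a ` {0..<N} \<or> x \<in> b ` {0..<N} \<and> y \<in> b ` {0..<N}"
    then have s: "F (T m) = - F m" if "m \<in> pairings N" for m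
      unfolding F_def T_def by (intro fcoef_swp[OF bic that ne(1)])
    show ?thesis using s[OF m] s[OF cl(2)[OF m]] s[OF cl(2)[OF cl(1)[OF m]]] by simp
  next
    assume "x \<in> a ` {0..<N} \<and> z \<in> a ` {0..<N} \<or> x \<in> b ` {0..<N} \<and> z \<in> b ` {0..<N}"
    then have s: "F (pact (swp x z) m) = - F m" if "m \<in> pairings N" for m
      unfolding F_def by (intro fcoef_swp[OF bic that ne(3)])
    have e1: "F (T (U (T m))) = - F m" unfolding W using s[OF m] .
    have e2: "F (U (T m)) = - F (U m)" using s[OF cl(2)[OF m]] by (simp only: W(2)[symmetric] inv)
    have e3: "F (T (U m)) = - F (T m)" using s[OF cl(1)[OF m]] by (simp only: W(1)[symmetric] inv)
    show ?thesis unfolding e1 e2 e3 by simp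
  next
    assume "y \<in> a ` {0..<N} \<and> z \<in> a ` {0..<N} \<or> y \<in> b ` {0..<N} \<and> z \<in> b ` {0..<N}"
    then have s: "F (U m) = - F m" if "m \<in> pairings N" for m
      unfolding F_def U_def by (intro fcoef_swp[OF bic that ne(2)])
    have e: "F (T (U (T m))) = - F (T (U m))" using s[OF cl(1)[OF cl(2)[OF m]]] by (simp only: W)
    show ?thesis unfolding e s[OF m] s[OF cl(1)[OF m]] by simp
  qed
qed

lemma gact_tl_rel:
  assumes c: "c \<in> pluecker N" and i: "1 \<le> i" "i + 2 \<le> 2 * N"
  shows "gact (2 * N) (tl_rel (2 * N) i) c = 0"
proof
  fix m
  let ?T = "pact (swp i (Suc i))" and ?U = "pact (swp (Suc i) (Suc (Suc i)))"
  let ?S = "\<lambda>c m. c m + c (?T m) + c (?U m) + c (?U (?T m)) + c (?T (?U m)) + c (?T (?U (?T m))) :: complex"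
  have t: "gact (2 * N) (tau i) d = (\<lambda>m. d (?T m))" "gact (2 * N) (tau (Suc i)) d = (\<lambda>m. d (?U m))" for d
    by (rule gact_tau; use i in simp)+
  have eq: "gact (2 * N) (tl_rel (2 * N) i) c m = ?S c m"
    unfolding tl_rel_def Let_def gact_add_left gact_mult gact_one t by simp
  have "?S c m = 0"
  proof (cases "m \<in> pairings N")
    case True
    obtain y where y: "c = (\<lambda>m. \<Sum>\<beta>\<in>LP N. y \<beta> * lcoef N \<beta> m)" using pluecker_lcoef_span[OF c] by blast
    have z: "?S (lcoef N \<beta>) m = 0" if \<beta>: "\<beta> \<in> LP N" for \<beta>
      unfolding lcoef_def
      by (rule fcoef_braid_sum[OF left_right_end(1)[OF subsetD[OF LP_subset_pairings \<beta>]] True]) (use i in auto)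
    have "?S c m = (\<Sum>\<beta>\<in>LP N. y \<beta> * ?S (lcoef N \<beta>) m)"
      unfolding y by (simp add: distrib_left sum.distrib)
    also have "\<dots> = 0" by (rule sum.neutral) (use z in simp)
    finally show ?thesis .
  next
    case False
    have r: "i \<in> {1..2*N}" "Suc i \<in> {1..2*N}" "Suc (Suc i) \<in> {1..2*N}" using i by auto
    have cl: "?T m \<notin> pairings N" "?U m \<notin> pairings N" if "m \<notin> pairings N" for m
      using pact_swp_pairings[OF _ r(1,2), of "?T m"] pact_swp_pairings[OF _ r(2,3), of "?U m"] that by auto
    show ?thesis using False cl by (simp add: pluecker_outside[OF c])
  qed
  then show "gact (2 * N) (tl_rel (2 * N) i) c m = 0 m" by (simp add: eq)
qed

text \<open>The annihilator of \<open>pluecker N\<close> in the group algebra is a two-sided ideal,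
  and it contains the generating relations.\<close>

lemma gact_tl_ideal:
  assumes "h \<in> tl_ideal (2 * N)" and c: "c \<in> pluecker N"
  shows "gact (2 * N) h c = 0"
proof -
  let ?G = "group_alg (2 * N)"
  define J where "J = {a \<in> carrier ?G. \<forall>c\<in>pluecker N. gact (2 * N) a c = 0}"
  interpret ring ?G by (rule ring_group_alg)
  have "ideal J ?G"
  proof (rule idealI[OF ring_group_alg])
    show "subgroup J (add_monoid ?G)"
    proof (rule subgroup.intro)
      fix a assume a: "a \<in> J"
      have "gact (2 * N) (\<ominus>\<^bsub>?G\<^esub> a) c = 0" if "c \<in> pluecker N" for c
      proof -
        have "gact (2 * N) (\<ominus>\<^bsub>?G\<^esub> a) c + gact (2 * N) a c = gact (2 * N) (\<ominus>\<^bsub>?G\<^esub> a \<oplus>\<^bsub>?G\<^esub> a) c"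
          by (simp only: gact_add_left)
        also have "\<dots> = 0" using a by (simp add: J_def l_neg gact_zero)
        finally show ?thesis using a that by (simp add: J_def)
      qed
      then show "inv\<^bsub>add_monoid ?G\<^esub> a \<in> J" using a by (simp add: J_def flip: a_inv_def)
    qed (auto simp: J_def gact_add_left gact_zero)
    fix a x assume ax: "a \<in> J" "x \<in> carrier ?G"
    have "gact (2 * N) x (gact (2 * N) a d) = 0" if "d \<in> pluecker N" for d
    proof -
      have "gact (2 * N) a d = 0" using ax that by (simp add: J_def)
      then show ?thesis by (simp add: gact_def fun_eq_iff)
    qed
    then show "x \<otimes>\<^bsub>?G\<^esub> a \<in> J" using ax by (simp add: J_def gact_mult)
    show "a \<otimes>\<^bsub>?G\<^esub> x \<in> J" using ax by (simp add: J_def gact_mult gact_pluecker)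
  qed
  moreover have "tl_rel (2 * N) ` {i. 1 \<le> i \<and> i + 2 \<le> 2 * N} \<subseteq> J"
    using tl_rel_closed gact_tl_rel by (auto simp: J_def)
  ultimately have "tl_ideal (2 * N) \<subseteq> J" unfolding tl_ideal_def by (rule genideal_minimal)
  then show ?thesis using assms by (auto simp: J_def)
qed

lemma tl_class_mem: "x \<in> tl_class n a \<longleftrightarrow> (\<exists>h\<in>tl_ideal n. x = h \<oplus>\<^bsub>group_alg n\<^esub> a)"
  by (simp add: tl_class_def a_r_coset_def')

lemma tl_class_nonempty: "tl_class n a \<noteq> {}"
  using additive_subgroup.zero_closed[OF ideal.axioms(1)[OF ideal_tl_ideal[of n]]] tl_class_mem by blast

lemma gact_tl_class: "x \<in> tl_class (2 * N) a \<Longrightarrow> c \<in> pluecker N \<Longrightarrow> gact (2 * N) x c = gact (2 * N) a c"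
  by (auto simp: tl_class_mem gact_add_left gact_tl_ideal)

text \<open>Stated for any nonempty set whose elements act alike, because a scalar multiple in
  \<open>TL\<close> is formed as a union of cosets.\<close>

lemma tl_act_free_fun:
  assumes "A \<noteq> {}" "\<And>x. x \<in> A \<Longrightarrow> gact (2 * N) x c = d"
  shows "tl_act (2 * N) A (free_fun N c) = free_fun N d"
  unfolding tl_act_def
proof (rule the_equality)
  show "\<forall>x\<in>A. ga_act (2 * N) x (free_fun N c) = free_fun N d" using assms(2) by (simp add: ga_act_free_fun)
  show "G = free_fun N d" if "\<forall>x\<in>A. ga_act (2 * N) x (free_fun N c) = G" for G
    using that assms by (auto simp: ga_act_free_fun)
qed

lemma tl_act_class: "c \<in> pluecker N \<Longrightarrow>
    tl_act (2 * N) (tl_class (2 * N) a) (free_fun N c) = free_fun N (gact (2 * N) a c)"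
  by (rule tl_act_free_fun[OF tl_class_nonempty]) (rule gact_tl_class)

section \<open>Antisymmetrisation\<close>

lemma antisym_permutes:
  fixes c :: "nat set set \<Rightarrow> complex"
  assumes anti: "\<And>m x y. m \<in> pairings N \<Longrightarrow> x \<in> S \<Longrightarrow> y \<in> S \<Longrightarrow> x \<noteq> y \<Longrightarrow> c (pact (swp x y) m) = - c m"
    and S: "S \<subseteq> {1..2*N}" and \<sigma>: "\<sigma> permutes S" and m: "m \<in> pairings N"
  shows "c (pact \<sigma> m) = of_int (sign \<sigma>) * c m"
proof -
  have fin: "finite S" by (rule finite_subset[OF S]) simp
  have "\<forall>m\<in>pairings N. c (pact \<sigma> m) = of_int (sign \<sigma>) * c m"
  proof (rule permutes_induct[OF \<sigma> fin])
    show "\<forall>m\<in>pairings N. c (pact id m) = of_int (sign id) * c m" by simp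
    fix a b p assume ab: "a \<in> S" "b \<in> S" "a \<noteq> b"
      and IH: "\<forall>m\<in>pairings N. c (pact p m) = of_int (sign p) * c m" and p: "p permutes S"
    have "sign (swp a b \<circ> p) = - sign p"
      using ab by (simp add: sign_compose[OF permutation_swap_id permutes_imp_permutation[OF fin p]] sign_swap_id)
    moreover have "c (pact (swp a b \<circ> p) m) = - (of_int (sign p) * c m)" if m: "m \<in> pairings N" for m
    proof -
      have pm: "pact p m \<in> pairings N" by (rule pact_pairings[OF permutes_subset[OF p S] m])
      have "c (pact (swp a b) (pact p m)) = - c (pact p m)" by (rule anti[OF pm ab])
      then show ?thesis using IH m by (simp add: pact_comp)
    qed
    ultimately show "\<forall>m\<in>pairings N. c (pact (swp a b \<circ> p) m) = of_int (sign (swp a b \<circ> p)) * c m" by simp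
  qed
  then show ?thesis using m by simp
qed

text \<open>Left multiplication by the transposition permutes \<open>G\<close> and reverses the
  sign. \<open>G\<close> is kept general: it is the symmetric group of a set in
  \<open>gact_alternator_swp\<close>, and the group of all permutations that respect the blocks in
  \<open>blocked_nontrivial\<close>.\<close>

lemma alternating_sum_swp:
  fixes c :: "nat set set \<Rightarrow> complex"
  assumes G: "\<And>\<sigma>. \<sigma> \<in> G \<Longrightarrow> \<sigma> permutes {1..n}" "\<And>\<sigma>. \<sigma> \<in> G \<Longrightarrow> swp x y \<circ> \<sigma> \<in> G" and ne: "x \<noteq> y"
  shows "(\<Sum>\<sigma>\<in>G. of_int (sign \<sigma>) * c (pact (inv_into UNIV \<sigma>) (pact (swp x y) m)))
    = - (\<Sum>\<sigma>\<in>G. of_int (sign \<sigma>) * c (pact (inv_into UNIV \<sigma>) m))"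
proof -
  have tt: "swp x y \<circ> (swp x y \<circ> \<sigma>) = \<sigma>" for \<sigma> :: "nat \<Rightarrow> nat" by (simp add: o_assoc)
  have "(\<Sum>\<sigma>\<in>G. of_int (sign \<sigma>) * c (pact (inv_into UNIV \<sigma>) (pact (swp x y) m)))
    = (\<Sum>\<sigma>\<in>G. - (of_int (sign \<sigma>) * c (pact (inv_into UNIV \<sigma>) m)))"
  proof (rule sum.reindex_bij_witness[where i = "\<lambda>\<sigma>. swp x y \<circ> \<sigma>" and j = "\<lambda>\<sigma>. swp x y \<circ> \<sigma>"])
    fix \<sigma> assume \<sigma>: "\<sigma> \<in> G"
    then have p: "\<sigma> permutes {1..n}" by (rule G(1))
    have "sign (swp x y \<circ> \<sigma>) = - sign \<sigma>"
      using ne by (simp add: sign_compose[OF permutation_swap_id permutes_imp_permutation[OF _ p]] sign_swap_id)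
    moreover have "inv_into UNIV (swp x y \<circ> \<sigma>) = inv_into UNIV \<sigma> \<circ> swp x y"
    proof -
      have "inv_into UNIV (swp x y) = swp x y" by (rule inv_unique_comp) simp_all
      then show ?thesis using o_inv_distrib[OF permutes_bij[OF swp_permutes[OF UNIV_I UNIV_I, of x y]] permutes_bij[OF p]] by simp
    qed
    ultimately show "- (of_int (sign (swp x y \<circ> \<sigma>)) * c (pact (inv_into UNIV (swp x y \<circ> \<sigma>)) m))
      = of_int (sign \<sigma>) * c (pact (inv_into UNIV \<sigma>) (pact (swp x y) m))"
      by (simp add: pact_comp)
  qed (use tt G(2) in simp_all)
  then show ?thesis by (simp add: sum_negf)
qed

definition alternator :: "nat set \<Rightarrow> (nat \<Rightarrow> nat) \<Rightarrow> complex" where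
  "alternator S = (\<lambda>\<sigma>. if \<sigma> permutes S then of_int (sign \<sigma>) else 0)"

lemma alternator_closed: "S \<subseteq> {1..n} \<Longrightarrow> alternator S \<in> carrier (group_alg n)"
  using permutes_subset by (auto simp: carrier_group_alg alternator_def)

lemma gact_alternator:
  assumes S: "S \<subseteq> {1..n}"
  shows "gact n (alternator S) c m = (\<Sum>\<sigma> | \<sigma> permutes S. of_int (sign \<sigma>) * c (pact (inv_into UNIV \<sigma>) m))"
  unfolding gact_def
  by (rule sum.mono_neutral_cong_right) (use permutes_subset[OF _ S] in \<open>auto simp: alternator_def\<close>)

lemma gact_alternator_swp:
  assumes S: "S \<subseteq> {1..n}" and xy: "x \<in> S" "y \<in> S" "x \<noteq> y"
  shows "gact n (alternator S) c (pact (swp x y) m) = - gact n (alternator S) c m"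
  unfolding gact_alternator[OF S]
proof (rule alternating_sum_swp[OF _ _ xy(3)])
  show "\<sigma> permutes {1..n}" if "\<sigma> \<in> {\<sigma>. \<sigma> permutes S}" for \<sigma> using permutes_subset[OF _ S] that by simp
  show "swp x y \<circ> \<sigma> \<in> {\<sigma>. \<sigma> permutes S}" if "\<sigma> \<in> {\<sigma>. \<sigma> permutes S}" for \<sigma>
    using permutes_compose[OF _ swp_permutes[OF xy(1,2)]] that by simp
qed

lemma gact_alternator_antisym:
  assumes S: "S \<subseteq> {1..2*N}" and m: "m \<in> pairings N"
    and anti: "\<And>m x y. m \<in> pairings N \<Longrightarrow> x \<in> S \<Longrightarrow> y \<in> S \<Longrightarrow> x \<noteq> y \<Longrightarrow> c (pact (swp x y) m) = - c m"
  shows "gact (2 * N) (alternator S) c m = fact (card S) * c m"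
proof -
  have fin: "finite S" by (rule finite_subset[OF S]) simp
  have "gact (2 * N) (alternator S) c m = (\<Sum>\<sigma> | \<sigma> permutes S. c m)"
    unfolding gact_alternator[OF S]
  proof (rule sum.cong[OF refl])
    fix \<sigma> assume "\<sigma> \<in> {\<sigma>. \<sigma> permutes S}"
    then have \<sigma>: "\<sigma> permutes S" by simp
    have "sign (inv_into UNIV \<sigma>) = sign \<sigma>" by (rule sign_inverse[OF permutes_imp_permutation[OF fin \<sigma>]])
    moreover have "sign \<sigma> * sign \<sigma> = 1" by (simp add: sign_def)
    then have "(of_int (sign \<sigma>) * of_int (sign \<sigma>) :: complex) = 1" by (simp flip: of_int_mult)
    ultimately show "of_int (sign \<sigma>) * c (pact (inv_into UNIV \<sigma>) m) = c m"
      using antisym_permutes[where c = c, OF anti S permutes_inv[OF \<sigma>] m] by (simp flip: mult.assoc)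
  qed
  then show ?thesis using card_permutations[OF refl fin] by simp
qed

section \<open>Irreducibility of the space of coefficient functions\<close>

text \<open>The cyclic submodule generated by \<open>c\<close>.\<close>

definition orbit_space :: "nat \<Rightarrow> (nat set set \<Rightarrow> complex) \<Rightarrow> (nat set set \<Rightarrow> complex) set" where
  "orbit_space N c = {gact (2 * N) a c | a. a \<in> carrier (group_alg (2 * N))}"

lemma orbit_space_gact:
  assumes "d \<in> orbit_space N c" "a \<in> carrier (group_alg (2 * N))"
  shows "gact (2 * N) a d \<in> orbit_space N c"
proof -
  interpret ring "group_alg (2 * N)" by (rule ring_group_alg)
  obtain b where b: "d = gact (2 * N) b c" "b \<in> carrier (group_alg (2 * N))" using assms(1) by (auto simp: orbit_space_def)
  then have "gact (2 * N) a d = gact (2 * N) (a \<otimes>\<^bsub>group_alg (2 * N)\<^esub> b) c" by (simp add: gact_mult)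
  then show ?thesis unfolding orbit_space_def using m_closed[OF assms(2) b(2)] by blast
qed

lemma subspace_orbit_space: "cfun.subspace (orbit_space N c)"
proof (rule cfun.subspaceI)
  interpret ring "group_alg (2 * N)" by (rule ring_group_alg)
  show "0 \<in> orbit_space N c" unfolding orbit_space_def using gact_zero[of "2 * N" c] zero_closed by fastforce
  fix d e k assume d: "d \<in> orbit_space N c"
  then obtain a where a: "d = gact (2 * N) a c" "a \<in> carrier (group_alg (2 * N))" by (auto simp: orbit_space_def)
  show "cscale k d \<in> orbit_space N c"
    unfolding a(1) gact_smult[symmetric] orbit_space_def using group_alg_smult(4)[OF a(2)] by blast
  assume "e \<in> orbit_space N c"
  then obtain b where b: "e = gact (2 * N) b c" "b \<in> carrier (group_alg (2 * N))" by (auto simp: orbit_space_def)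
  show "d + e \<in> orbit_space N c"
    unfolding a(1) b(1) gact_add_left[symmetric] orbit_space_def using a_closed[OF a(2) b(2)] by blast
qed

lemma bicolour_permutation:
  assumes ab: "bicolour N a b" and ab': "bicolour N a' b'"
  shows "\<exists>\<sigma>. \<sigma> permutes {1..2*N} \<and> (\<forall>i<N. \<sigma> (a i) = a' i \<and> \<sigma> (b i) = b' i)"
proof -
  let ?I = "{0..<N}"
  define \<sigma> where "\<sigma> x = (if x \<in> a ` ?I then a' (inv_into ?I a x) else if x \<in> b ` ?I then b' (inv_into ?I b x) else x)" for x
  have inj: "inj_on a ?I" "inj_on b ?I" "inj_on a' ?I" "inj_on b' ?I"
    and disj: "a ` ?I \<inter> b ` ?I = {}" "a' ` ?I \<inter> b' ` ?I = {}"
    and un: "a ` ?I \<union> b ` ?I = {1..2*N}" "a' ` ?I \<union> b' ` ?I = {1..2*N}"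
    using ab ab' by (simp_all add: bicolour_def)
  have \<sigma>a: "\<sigma> (a i) = a' i" if "i < N" for i using that inj(1) by (simp add: \<sigma>_def)
  have \<sigma>b: "\<sigma> (b i) = b' i" if i: "i < N" for i
  proof -
    have "b i \<in> b ` ?I" using i by simp
    then have "b i \<notin> a ` ?I" using disj(1) by blast
    then show ?thesis using i inj(2) by (simp add: \<sigma>_def)
  qed
  have ia: "\<sigma> ` a ` ?I = a' ` ?I" unfolding image_image by (rule image_cong[OF refl]) (simp add: \<sigma>a)
  have ib: "\<sigma> ` b ` ?I = b' ` ?I" unfolding image_image by (rule image_cong[OF refl]) (simp add: \<sigma>b)
  have "\<sigma> ` (a ` ?I \<union> b ` ?I) = a' ` ?I \<union> b' ` ?I" by (simp only: image_Un ia ib)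
  then have img: "\<sigma> ` {1..2*N} = {1..2*N}" by (simp only: un)
  then have "inj_on \<sigma> {1..2*N}" by (intro eq_card_imp_inj_on) simp_all
  then have "bij_betw \<sigma> {1..2*N} {1..2*N}" using img by (simp add: bij_betw_def)
  moreover have "\<sigma> x = x" if "x \<notin> {1..2*N}" for x using that un(1) by (auto simp: \<sigma>_def)
  ultimately have "\<sigma> permutes {1..2*N}" by (rule bij_imp_permutes)
  then show ?thesis using \<sigma>a \<sigma>b by blast
qed

lemma fcoef_permuted:
  assumes ab: "bicolour N a b" and \<sigma>: "\<sigma> permutes {1..2*N}" "\<And>i. i < N \<Longrightarrow> \<sigma> (a i) = a' i" "\<And>i. i < N \<Longrightarrow> \<sigma> (b i) = b' i"
  shows "fcoef N a' b' m = fcoef N a b (pact (inv_into UNIV \<sigma>) m)"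
proof -
  have eq: "link_up N a' b' \<pi> = pact \<sigma> (link_up N a b \<pi>)" if \<pi>: "\<pi> permutes {0..<N}" for \<pi>
  proof -
    have "{a' k, b' (\<pi> k)} = \<sigma> ` {a k, b (\<pi> k)}" if "k < N" for k
      using \<sigma>(2)[OF that] \<sigma>(3)[OF permutes_lt[OF ab \<pi> that]] by simp
    then show ?thesis unfolding link_up_def pact_def image_image by (intro image_cong) simp_all
  qed
  have "link_up N a' b' \<pi> = m \<longleftrightarrow> link_up N a b \<pi> = pact (inv_into UNIV \<sigma>) m" if \<pi>: "\<pi> permutes {0..<N}" for \<pi>
  proof
    assume "link_up N a' b' \<pi> = m"
    then show "link_up N a b \<pi> = pact (inv_into UNIV \<sigma>) m"
      using eq[OF \<pi>] by (auto simp: pact_comp permutes_inv_o[OF \<sigma>(1)])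
  next
    assume "link_up N a b \<pi> = pact (inv_into UNIV \<sigma>) m"
    then show "link_up N a' b' \<pi> = m"
      using eq[OF \<pi>] by (simp add: pact_comp permutes_inv_o[OF \<sigma>(1)])
  qed
  then have "{\<pi>. \<pi> permutes {0..<N} \<and> link_up N a' b' \<pi> = m} = {\<pi>. \<pi> permutes {0..<N} \<and> link_up N a b \<pi> = pact (inv_into UNIV \<sigma>) m}"
    by (intro Collect_cong conj_cong refl)
  then show ?thesis by (simp only: fcoef_def)
qed

text \<open>A permutation of the points carries any bicolouring to any other, so a submodule that
  contains one determinant contains them all.\<close>

lemma fcoef_orbit_space:
  assumes ab: "bicolour N a b" "bicolour N a' b'" and mem: "fcoef N a b \<in> orbit_space N c"
  shows "fcoef N a' b' \<in> orbit_space N c"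
proof -
  obtain \<sigma> where \<sigma>: "\<sigma> permutes {1..2*N}" "\<And>i. i < N \<Longrightarrow> \<sigma> (a i) = a' i" "\<And>i. i < N \<Longrightarrow> \<sigma> (b i) = b' i"
    using bicolour_permutation[OF ab] by blast
  have "fcoef N a' b' = gact (2 * N) (\<lambda>\<rho>. if \<rho> = \<sigma> then 1 else 0) (fcoef N a b)"
    unfolding gact_single[OF \<sigma>(1)] by (rule ext) (rule fcoef_permuted[OF ab(1) \<sigma>])
  moreover have "(\<lambda>\<rho>. if \<rho> = \<sigma> then 1 else 0) \<in> carrier (group_alg (2 * N))"
    using \<sigma>(1) by (auto simp: carrier_group_alg)
  ultimately show ?thesis using orbit_space_gact[OF mem] by simp
qed

lemma pluecker_cnj: "c \<in> pluecker N \<Longrightarrow> (\<lambda>m. cnj (c m)) \<in> pluecker N"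
  unfolding pluecker_def by (auto simp flip: complex_cnj_add)

text \<open>The functions \<open>lcoef N \<beta>\<close> span, and the conjugate of \<open>c\<close>
  is among their combinations. If \<open>c\<close> paired to zero with all of them, the sum of the
  squared absolute values of \<open>c\<close> would vanish.\<close>

lemma exists_lcoef_pairing:
  fixes c :: "nat set set \<Rightarrow> complex"
  assumes c: "c \<in> pluecker N" and nz: "c m0 \<noteq> 0"
  shows "\<exists>\<beta>\<in>LP N. (\<Sum>m\<in>pairings N. lcoef N \<beta> m * c m) \<noteq> 0"
proof (rule ccontr)
  assume "\<not> ?thesis"
  then have z: "(\<Sum>m\<in>pairings N. lcoef N \<beta> m * c m) = 0" if "\<beta> \<in> LP N" for \<beta> using that by blast
  obtain y where y: "(\<lambda>m. cnj (c m)) = (\<lambda>m. \<Sum>\<beta>\<in>LP N. y \<beta> * lcoef N \<beta> m)"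
    using pluecker_lcoef_span[OF pluecker_cnj[OF c]] by blast
  have "complex_of_real (\<Sum>m\<in>pairings N. (cmod (c m))\<^sup>2) = (\<Sum>m\<in>pairings N. cnj (c m) * c m)"
    unfolding of_real_sum by (rule sum.cong[OF refl]) (simp only: complex_norm_square mult.commute)
  also have "\<dots> = (\<Sum>m\<in>pairings N. \<Sum>\<beta>\<in>LP N. y \<beta> * (lcoef N \<beta> m * c m))"
    by (rule sum.cong) (simp_all add: fun_cong[OF y] sum_distrib_right mult.assoc)
  also have "\<dots> = (\<Sum>\<beta>\<in>LP N. y \<beta> * (\<Sum>m\<in>pairings N. lcoef N \<beta> m * c m))"
    by (subst sum.swap) (simp add: sum_distrib_left)
  also have "\<dots> = 0" by (rule sum.neutral) (use z in simp)
  finally have "(\<Sum>m\<in>pairings N. (cmod (c m))\<^sup>2) = 0" by (simp only: of_real_eq_0_iff)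
  moreover have "m0 \<in> pairings N" using pluecker_outside[OF c] nz by blast
  ultimately have "(cmod (c m0))\<^sup>2 = 0" by (subst (asm) sum_nonneg_eq_0_iff) simp_all
  then show False using nz by simp
qed

text \<open>The set is that of the right ends of a \<open>\<beta>\<close> whose determinant pairs
  nontrivially with \<open>c\<close>. The multiple is nonzero: moving the alternating sum over to
  the determinant, which is antisymmetric in these points, multiplies the pairing by the number of
  permutations.\<close>

lemma pluecker_irreducible:
  assumes c: "c \<in> pluecker N" "c m0 \<noteq> 0" and w: "w \<in> pluecker N"
  shows "w \<in> orbit_space N c"
proof -
  obtain \<beta> where \<beta>: "\<beta> \<in> LP N" and \<kappa>: "(\<Sum>m\<in>pairings N. lcoef N \<beta> m * c m) \<noteq> 0"
    using exists_lcoef_pairing[OF c] by blast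
  define a b where "a = left_end \<beta>" and "b = right_end \<beta>"
  have bic: "bicolour N a b" unfolding a_def b_def by (rule left_right_end(1)[OF subsetD[OF LP_subset_pairings \<beta>]])
  define S where "S = b ` {0..<N}"
  have S: "S \<subseteq> {1..2*N}" using bic by (auto simp: S_def bicolour_def)
  define d where "d = gact (2 * N) (alternator S) c"
  have d: "d \<in> pluecker N" unfolding d_def by (rule gact_pluecker[OF c(1)])
  have dO: "d \<in> orbit_space N c" using alternator_closed[OF S] by (auto simp: d_def orbit_space_def)
  have d_eq: "d m = d (link_up N a b id) * fcoef N a b m" for m
  proof (rule antisym_eq_fcoef[OF bic])
    show "d m = 0" if "m \<notin> pairings N" for m by (rule pluecker_outside[OF d that])
    show "d (pact (swp (b i) (b j)) m) = - d m" if "i < N" "j < N" "i \<noteq> j" for m i j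
      unfolding d_def by (rule gact_alternator_swp[OF S]) (use that b_eq_iff[OF bic] in \<open>auto simp: S_def\<close>)
  qed
  have "(\<Sum>m\<in>pairings N. fcoef N a b m * d m) = (\<Sum>\<sigma> | \<sigma> permutes S. \<Sum>m\<in>pairings N. fcoef N a b m * c m)"
  proof -
    have "(\<Sum>m\<in>pairings N. fcoef N a b m * d m)
      = (\<Sum>m\<in>pairings N. \<Sum>\<sigma> | \<sigma> permutes S. fcoef N a b m * (of_int (sign \<sigma>) * c (pact (inv_into UNIV \<sigma>) m)))"
      by (simp add: d_def gact_alternator[OF S] sum_distrib_left)
    also have "\<dots> = (\<Sum>\<sigma> | \<sigma> permutes S. \<Sum>m\<in>pairings N. fcoef N a b m * (of_int (sign \<sigma>) * c (pact (inv_into UNIV \<sigma>) m)))"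
      by (rule sum.swap)
    also have "\<dots> = (\<Sum>\<sigma> | \<sigma> permutes S. \<Sum>m\<in>pairings N. fcoef N a b m * c m)"
    proof (rule sum.cong[OF refl])
      fix \<sigma> assume "\<sigma> \<in> {\<sigma>. \<sigma> permutes S}"
      then have \<sigma>: "\<sigma> permutes S" by simp
      have \<sigma>': "\<sigma> permutes {1..2*N}" by (rule permutes_subset[OF \<sigma> S])
      have sg: "(of_int (sign \<sigma>) * of_int (sign \<sigma>) :: complex) = 1"
        by (simp add: sign_def)
      have "(\<Sum>m\<in>pairings N. fcoef N a b m * (of_int (sign \<sigma>) * c (pact (inv_into UNIV \<sigma>) m)))
        = (\<Sum>m\<in>pairings N. fcoef N a b (pact \<sigma> m) * (of_int (sign \<sigma>) * c (pact (inv_into UNIV \<sigma>) (pact \<sigma> m))))"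
        by (rule sum_pairings_pact[OF \<sigma>', symmetric])
      also have "\<dots> = (\<Sum>m\<in>pairings N. fcoef N a b m * c m)"
      proof (rule sum.cong[OF refl])
        fix m assume m: "m \<in> pairings N"
        have "fcoef N a b (pact \<sigma> m) = of_int (sign \<sigma>) * (fcoef N a b m :: complex)"
        proof (rule antisym_permutes[OF _ S \<sigma> m])
          fix m x y assume "m \<in> pairings N" "x \<in> S" "y \<in> S" "x \<noteq> y"
          then show "fcoef N a b (pact (swp x y) m) = - (fcoef N a b m :: complex)"
            unfolding S_def by (intro fcoef_swp[OF bic]) simp_all
        qed
        moreover have "pact (inv_into UNIV \<sigma>) (pact \<sigma> m) = m" by (simp add: pact_comp permutes_inv_o(2)[OF \<sigma>])
        ultimately have "fcoef N a b (pact \<sigma> m) * (of_int (sign \<sigma>) * c (pact (inv_into UNIV \<sigma>) (pact \<sigma> m)))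
          = (of_int (sign \<sigma>) * of_int (sign \<sigma>)) * (fcoef N a b m * c m)" by (simp only: mult_ac)
        then show "fcoef N a b (pact \<sigma> m) * (of_int (sign \<sigma>) * c (pact (inv_into UNIV \<sigma>) (pact \<sigma> m))) = fcoef N a b m * c m"
          by (simp only: sg mult_1)
      qed
      finally show "(\<Sum>m\<in>pairings N. fcoef N a b m * (of_int (sign \<sigma>) * c (pact (inv_into UNIV \<sigma>) m)))
        = (\<Sum>m\<in>pairings N. fcoef N a b m * c m)" .
    qed
    finally show ?thesis .
  qed
  also have "\<dots> \<noteq> 0"
  proof -
    have "finite S" by (rule finite_subset[OF S]) simp
    then have "card {\<sigma>. \<sigma> permutes S} \<noteq> 0" by (simp add: card_permutations)
    then show ?thesis using \<kappa> by (simp add: lcoef_def a_def b_def)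
  qed
  finally have nz: "d (link_up N a b id) \<noteq> 0"
  proof (rule contrapos_nn)
    assume "d (link_up N a b id) = 0"
    then have "d m = 0" for m by (subst d_eq) simp
    then show "(\<Sum>m\<in>pairings N. fcoef N a b m * d m) = 0" by simp
  qed
  have "fcoef N a b = cscale (1 / d (link_up N a b id)) d"
  proof (intro ext)
    fix m
    show "fcoef N a b m = cscale (1 / d (link_up N a b id)) d m"
      unfolding cscale_def using nz by (subst d_eq[of m]) simp
  qed
  then have base: "fcoef N a b \<in> orbit_space N c" using cfun.subspace_scale[OF subspace_orbit_space dO] by simp
  obtain y where y: "w = (\<lambda>m. \<Sum>\<beta>\<in>LP N. y \<beta> * lcoef N \<beta> m)" using pluecker_lcoef_span[OF w] by blast
  have "w = (\<Sum>\<beta>\<in>LP N. cscale (y \<beta>) (lcoef N \<beta>))"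
    by (rule ext) (simp add: y sum_fun_apply cscale_def)
  moreover have "lcoef N \<gamma> \<in> orbit_space N c" if \<gamma>: "\<gamma> \<in> LP N" for \<gamma>
    unfolding lcoef_def
    by (rule fcoef_orbit_space[OF bic left_right_end(1)[OF subsetD[OF LP_subset_pairings \<gamma>]] base])
  ultimately show ?thesis
    by (simp add: cfun.subspace_sum[OF subspace_orbit_space] cfun.subspace_scale[OF subspace_orbit_space])
qed

section \<open>The block antisymmetriser\<close>

lemma block_antisym_alternator: "block_antisym s k = alternator {qsum s (k - 1)<..qsum s k}"
  by (simp only: block_antisym_def alternator_def)

lemma cscale_cscale: "cscale a (cscale b f) = cscale (a * b) f"
  by (simp add: cscale_def mult.assoc)

lemma cscale_one: "cscale 1 f = f"
  by (simp add: cscale_def)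

context
  fixes N :: nat and s :: "nat list"
  assumes val: "valences N s"
begin

lemma card_block:
  assumes "1 \<le> k" "k \<le> length s"
  shows "card {qsum s (k - 1)<..qsum s k} = s ! (k - 1)"
proof -
  have "qsum s k = qsum s (k - 1) + s ! (k - 1)"
    using assms take_Suc_conv_app_nth[of "k - 1" s] by (simp add: qsum_def)
  then show ?thesis by simp
qed

text \<open>By \<open>vanishing_antisym\<close> a blocked function is antisymmetric in each block,
  so every term of the alternating sum returns the function itself.\<close>

lemma gact_block_antisym_blocked:
  assumes k: "1 \<le> k" "k \<le> length s" and c: "c \<in> blocked N s"
  shows "gact (2 * N) (block_antisym s k) c = cscale (fact (s ! (k - 1))) c"
proof
  fix m
  have cP: "c \<in> pluecker N" using c by (simp add: blocked_def)
  let ?S = "{qsum s (k - 1)<..qsum s k}"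
  have S: "?S \<subseteq> {1..2*N}" by (rule block_subset[OF val])
  show "gact (2 * N) (block_antisym s k) c m = cscale (fact (s ! (k - 1))) c m"
  proof (cases "m \<in> pairings N")
    case True
    have "gact (2 * N) (alternator ?S) c m = fact (card ?S) * c m"
    proof (rule gact_alternator_antisym[OF S True])
      fix m x y assume m: "m \<in> pairings N" and xy: "x \<in> ?S" "y \<in> ?S" "x \<noteq> y"
      have xy': "x \<in> {1..2*N}" "y \<in> {1..2*N}" using S xy by blast+
      have "block s x = k" "block s y = k" using block_eq_iff[OF val xy'(1) k] block_eq_iff[OF val xy'(2) k] xy by simp_all
      then have eq: "block s x = block s y" by simp
      have "antisym_pair N c x y"
        by (rule vanishing_antisym[OF cP xy' xy(3)]) (rule blocked_link_zero[OF c _ _ eq])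
      then show "c (pact (swp x y) m) = - c m" using m by (simp add: antisym_pair_def)
    qed
    then show ?thesis by (simp only: block_antisym_alternator card_block[OF k] cscale_def)
  next
    case False
    then show ?thesis
      using pluecker_outside[OF gact_pluecker[OF cP] False] pluecker_outside[OF cP False] by (simp add: cscale_def)
  qed
qed

lemma fact_blocks: "(\<Prod>k\<leftarrow>[1..<Suc (length s)]. fact (s ! (k - 1))) = (\<Prod>v\<leftarrow>s. fact v :: complex)"
proof -
  have "map (\<lambda>k. fact (s ! (k - 1)) :: complex) [1..<Suc (length s)] = map fact s"
    by (rule nth_equalityI) (auto simp del: upt_Suc)
  then show ?thesis by (simp del: upt_Suc)
qed

lemma gact_antisymmetrizer_blocked:
  assumes c: "c \<in> blocked N s"
  shows "gact (2 * N) (block_antisymmetrizer N s) c = c"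
proof -
  let ?X = "\<lambda>ks. foldr (\<lambda>k a. block_antisym s k \<otimes>\<^bsub>group_alg (2*N)\<^esub> a) ks \<one>\<^bsub>group_alg (2*N)\<^esub>"
  have "gact (2 * N) (?X ks) c = cscale (\<Prod>k\<leftarrow>ks. fact (s ! (k - 1))) c"
    if "\<forall>k\<in>set ks. 1 \<le> k \<and> k \<le> length s" for ks
    using that
  proof (induction ks)
    case Nil
    show ?case by (simp add: gact_one cscale_one)
  next
    case (Cons k ks)
    have k: "1 \<le> k" "k \<le> length s" using Cons.prems by auto
    have "gact (2 * N) (?X (k # ks)) c = gact (2 * N) (block_antisym s k) (gact (2 * N) (?X ks) c)"
      by (simp add: gact_mult)
    also have "\<dots> = cscale (\<Prod>k\<leftarrow>ks. fact (s ! (k - 1))) (cscale (fact (s ! (k - 1))) c)"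
      using Cons by (simp add: gact_cscale gact_block_antisym_blocked[OF k c])
    finally show ?case by (simp add: cscale_cscale mult.commute)
  qed
  from this[of "[1..<Suc (length s)]"]
  have X: "gact (2 * N) (?X [1..<Suc (length s)]) c = cscale (\<Prod>v\<leftarrow>s. fact v) c"
    unfolding fact_blocks by (simp only: set_upt) auto
  have "(\<Prod>v\<leftarrow>s. fact v :: complex) \<noteq> 0" by (auto simp: prod_list_zero_iff)
  then show ?thesis
    unfolding block_antisymmetrizer_def Let_def gact_smult X cscale_cscale by (simp add: cscale_one)
qed

lemma block_antisym_absorb:
  assumes "\<forall>k\<in>set ks. 1 \<le> k \<and> k \<le> length s" and "k \<in> set ks"
  shows "block_antisym s k \<otimes>\<^bsub>group_alg (2*N)\<^esub>
      foldr (\<lambda>k a. block_antisym s k \<otimes>\<^bsub>group_alg (2*N)\<^esub> a) ks \<one>\<^bsub>group_alg (2*N)\<^esub>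
    = fact (s ! (k - 1)) \<odot>\<^bsub>group_alg (2*N)\<^esub>
      foldr (\<lambda>k a. block_antisym s k \<otimes>\<^bsub>group_alg (2*N)\<^esub> a) ks \<one>\<^bsub>group_alg (2*N)\<^esub>"
  using assms
proof (induction ks)
  case (Cons l ks)
  let ?G = "group_alg (2*N)"
  interpret ring ?G by (rule ring_group_alg)
  define X where "X = foldr (\<lambda>k a. block_antisym s k \<otimes>\<^bsub>?G\<^esub> a) ks \<one>\<^bsub>?G\<^esub>"
  have X: "X \<in> carrier ?G" using antisym_foldr[OF val, of ks] Cons.prems(1) by (simp add: X_def)
  have B: "block_antisym s j \<in> carrier ?G" for j by (rule block_antisym_closed[OF val])
  have kl: "1 \<le> k" "k \<le> length s" "1 \<le> l" using Cons.prems by auto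
  have "block_antisym s k \<otimes>\<^bsub>?G\<^esub> (block_antisym s l \<otimes>\<^bsub>?G\<^esub> X) = fact (s ! (k - 1)) \<odot>\<^bsub>?G\<^esub> (block_antisym s l \<otimes>\<^bsub>?G\<^esub> X)"
  proof (cases "k = l")
    case True
    then show ?thesis
      using block_antisym_square[OF val kl(1,2)] m_assoc[OF B B X, of k k, symmetric] by (simp only: group_alg_smult)
  next
    case False
    then have "block_antisym s k \<otimes>\<^bsub>?G\<^esub> X = fact (s ! (k - 1)) \<odot>\<^bsub>?G\<^esub> X"
      using Cons unfolding X_def by simp
    moreover have "block_antisym s k \<otimes>\<^bsub>?G\<^esub> (block_antisym s l \<otimes>\<^bsub>?G\<^esub> X) = block_antisym s l \<otimes>\<^bsub>?G\<^esub> (block_antisym s k \<otimes>\<^bsub>?G\<^esub> X)"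
      using block_antisym_commute[OF val kl(1,3)] m_assoc[OF B B X, of k l, symmetric] m_assoc[OF B B X, of l k] by simp
    ultimately show ?thesis by (simp only: group_alg_smult)
  qed
  then show ?case by (simp add: X_def)
qed simp

text \<open>Each block alternator multiplies the block antisymmetriser by a nonzero factorial, so
  the image is antisymmetric in every block. The exchange of the ends of a link fixes the pairing,
  which forces the value 0 there.\<close>

lemma gact_antisymmetrizer_mem:
  assumes c: "c \<in> pluecker N"
  shows "gact (2 * N) (block_antisymmetrizer N s) c \<in> blocked N s"
proof (rule blockedI[OF gact_pluecker[OF c]])
  let ?G = "group_alg (2*N)"
  let ?X = "foldr (\<lambda>k a. block_antisym s k \<otimes>\<^bsub>?G\<^esub> a) [1..<Suc (length s)] \<one>\<^bsub>?G\<^esub>"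
  define e where "e = gact (2 * N) (block_antisymmetrizer N s) c"
  fix m a b assume m: "m \<in> pairings N" "{a, b} \<in> m" and eq: "block s a = block s b"
  have ab: "a \<noteq> b" "a \<in> {1..2*N}" "b \<in> {1..2*N}" by (rule pairings_linkD[OF m])+
  define k where "k = block s a"
  have k: "1 \<le> k" "k \<le> length s" unfolding k_def by (rule block_bounds[OF val ab(2)])+
  let ?S = "{qsum s (k - 1)<..qsum s k}"
  have S: "?S \<subseteq> {1..2*N}" by (rule block_subset[OF val])
  have abS: "a \<in> ?S" "b \<in> ?S" using block_eq_iff[OF val ab(2) k] block_eq_iff[OF val ab(3) k] eq by (simp_all add: k_def)
  have "block_antisym s k \<otimes>\<^bsub>?G\<^esub> ?X = fact (s ! (k - 1)) \<odot>\<^bsub>?G\<^esub> ?X"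
    by (rule block_antisym_absorb) (use k in auto)
  then have "block_antisym s k \<otimes>\<^bsub>?G\<^esub> block_antisymmetrizer N s = fact (s ! (k - 1)) \<odot>\<^bsub>?G\<^esub> block_antisymmetrizer N s"
    unfolding block_antisymmetrizer_def Let_def by (simp only: group_alg_smult mult.commute)
  then have e: "cscale (fact (s ! (k - 1))) e = gact (2 * N) (alternator ?S) e"
    unfolding e_def by (simp only: block_antisym_alternator gact_smult[symmetric] gact_mult[symmetric])
  have "cscale (fact (s ! (k - 1))) e m = - cscale (fact (s ! (k - 1))) e m"
    using gact_alternator_swp[OF S abS ab(1), of e m] unfolding e pact_swp_link[OF m] .
  then have "cscale (fact (s ! (k - 1))) e m = 0" by (rule eq_neg_self)
  then show "gact (2 * N) (block_antisymmetrizer N s) c m = 0" by (simp add: cscale_def e_def)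
qed

text \<open>Since \<open>max s\<^sub>j \<le> N\<close>, the pairing with links \<open>{k, k + N}\<close> has no link inside a block. Antisymmetrising over the
  blocks the signed sum of the pairings between \<open>{1..N}\<close> and its complement gives a blocked function that does not
  vanish there: the only block permutations that contribute preserve both halves, so all terms are nonnegative.\<close>

lemma blocked_nontrivial: "\<exists>c\<in>blocked N s. \<exists>m. c m \<noteq> (0 :: complex)"
proof -
  define a b where "a = (\<lambda>k::nat. Suc k)" and "b = (\<lambda>k. N + Suc k)"
  have img: "a ` {0..<N} = {1..N}" "b ` {0..<N} = {N + 1..2*N}"
  proof -
    show "a ` {0..<N} = {1..N}" by (simp add: a_def image_Suc_atLeastLessThan atLeastLessThanSuc_atLeastAtMost)
    show "b ` {0..<N} = {N + 1..2*N}"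
    proof (intro Set.set_eqI iffI)
      fix x assume "x \<in> {N + 1..2*N}"
      then have "x = b (x - Suc N)" "x - Suc N \<in> {0..<N}" by (auto simp: b_def)
      then show "x \<in> b ` {0..<N}" by (rule image_eqI)
    qed (auto simp: b_def)
  qed
  have bic: "bicolour N a b"
    unfolding bicolour_def img by (auto simp: a_def b_def inj_on_def)
  define m0 where "m0 = link_up N a b id"
  define F where "F = (fcoef N a b :: _ \<Rightarrow> complex)"
  have m0: "m0 \<in> pairings N" unfolding m0_def by (rule link_up_pairings[OF bic permutes_id])
  have F0: "F m0 = 1" unfolding F_def m0_def using fcoef_link_up[OF bic permutes_id] by (simp add: sign_id)
  have antiA: "F (pact (swp x y) m) = - F m" if "m \<in> pairings N" "x \<in> {1..N}" "y \<in> {1..N}" "x \<noteq> y" for m x y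
    unfolding F_def by (rule fcoef_swp[OF bic that(1,4)]) (use that img in simp)
  have antiB: "F (pact (swp x y) m) = - F m" if "m \<in> pairings N" "x \<in> {N+1..2*N}" "y \<in> {N+1..2*N}" "x \<noteq> y" for m x y
    unfolding F_def by (rule fcoef_swp[OF bic that(1,4)]) (use that img in simp)
  define G where "G = {\<sigma>. \<sigma> permutes {1..2*N} \<and> (\<forall>x\<in>{1..2*N}. block s (\<sigma> x) = block s x)}"
  define e where "e m = (\<Sum>\<sigma>\<in>G. of_int (sign \<sigma>) * F (pact (inv_into UNIV \<sigma>) m))" for m
  have finG: "finite G" unfolding G_def by (rule finite_subset[OF _ finite_perms[of 1 "2*N"]]) auto
  have Gp: "\<sigma> permutes {1..2*N}" if "\<sigma> \<in> G" for \<sigma> using that by (simp add: G_def)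
  have "e \<in> pluecker N"
    unfolding e_def
  proof (rule pluecker_sum)
    fix \<sigma> assume "\<sigma> \<in> G"
    then show "(\<lambda>m. F (pact (inv_into UNIV \<sigma>) m)) \<in> pluecker N"
      unfolding F_def by (intro pluecker_pact fcoef_pluecker[OF bic] permutes_inv Gp)
  qed
  then have "e \<in> blocked N s"
  proof (rule blockedI)
    fix m x y assume m: "m \<in> pairings N" "{x, y} \<in> m" and eq: "block s x = block s y"
    have xy: "x \<noteq> y" "x \<in> {1..2*N}" "y \<in> {1..2*N}" by (rule pairings_linkD[OF m])+
    have "e (pact (swp x y) m) = - e m"
      unfolding e_def
    proof (rule alternating_sum_swp[OF Gp _ xy(1)])
      fix \<sigma> assume \<sigma>: "\<sigma> \<in> G"
      have "block s (swp x y z) = block s z" for z using eq by (simp add: Transposition.transpose_def)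
      then show "swp x y \<circ> \<sigma> \<in> G"
        using \<sigma> permutes_compose[OF Gp[OF \<sigma>] swp_permutes[OF xy(2,3)]] by (simp add: G_def)
    qed
    then show "e m = 0" unfolding pact_swp_link[OF m] by (rule eq_neg_self)
  qed
  moreover have "e m0 \<noteq> 0"
  proof -
    have t: "of_int (sign \<sigma>) * F (pact (inv_into UNIV \<sigma>) m0) \<in> {0, 1}" if \<sigma>: "\<sigma> \<in> G" for \<sigma>
    proof (cases "F (pact (inv_into UNIV \<sigma>) m0) = 0")
      case False
      define \<rho> where "\<rho> = inv_into UNIV \<sigma>"
      have \<rho>: "\<rho> permutes {1..2*N}" unfolding \<rho>_def by (rule permutes_inv[OF Gp[OF \<sigma>]])
      have rng: "\<rho> x \<in> {1..2*N}" if "x \<in> {1..2*N}" for x using permutes_in_image[OF \<rho>] that by blast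
      have blk: "block s (\<rho> x) = block s x" if x: "x \<in> {1..2*N}" for x
      proof -
        have "block s (\<sigma> (\<rho> x)) = block s (\<rho> x)" using \<sigma> rng[OF x] by (simp add: G_def)
        then show ?thesis by (simp add: \<rho>_def permutes_inverses(1)[OF Gp[OF \<sigma>]])
      qed
      obtain \<pi> where \<pi>: "pact \<rho> m0 = link_up N a b \<pi>"
        using False fcoef_other[OF bic, of "pact \<rho> m0"] unfolding F_def \<rho>_def by blast
      \<comment> \<open>The link {k, k + N} is carried to a link between the two halves. Suppose its
        ends were interchanged. As \<open>\<rho>\<close> preserves blocks and blocks are intervals,
        the blocks of \<open>k\<close> and of \<open>k + N\<close> would both contain
        \<open>N\<close> and \<open>Suc N\<close>, hence coincide, against
        \<open>block_shift_ne\<close>.\<close>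
      have side: "\<rho> k \<le> N \<and> N < \<rho> (k + N)" if k: "k \<in> {1..N}" for k
      proof (rule ccontr)
        assume neg: "\<not> ?thesis"
        have "{k, k + N} \<in> m0"
          unfolding m0_def link_up_def by (rule image_eqI[of _ _ "k - 1"]) (use k in \<open>auto simp: a_def b_def\<close>)
        then have "{\<rho> k, \<rho> (k + N)} \<in> link_up N a b \<pi>" unfolding \<pi>[symmetric] by (rule pact_mem)
        then obtain i where i: "i < N" "{\<rho> k, \<rho> (k + N)} = {a i, b (\<pi> i)}" by (auto simp: link_up_def)
        then have "a i \<le> N" "N < b (\<pi> i)" by (simp_all add: a_def b_def)
        then have far: "N < \<rho> k" "\<rho> (k + N) \<le> N" using i(2) neg by (auto simp: doubleton_eq_iff)
        have r: "k \<in> {1..2*N}" "k + N \<in> {1..2*N}" using k by auto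
        have q: "1 \<le> k" "k \<le> N" "N \<le> 2 * N" "1 \<le> N" "N \<le> Suc N" "Suc N \<le> 2 * N" "1 \<le> Suc N"
          "Suc N \<le> \<rho> k" "\<rho> k \<le> 2 * N" "1 \<le> \<rho> (k + N)" "\<rho> (k + N) \<le> N" "Suc N \<le> k + N" "k + N \<le> 2 * N"
          using k far rng[OF r(1)] rng[OF r(2)] by auto
        have "block s k \<le> block s N" "block s N \<le> block s (Suc N)" "block s (Suc N) \<le> block s (\<rho> k)"
          "block s (\<rho> (k + N)) \<le> block s N" "block s (Suc N) \<le> block s (k + N)"
          using block_mono[OF val] q by simp_all
        then have "block s k = block s (k + N)" using blk[OF r(1)] blk[OF r(2)] by simp
        then show False using block_shift_ne[OF val, of k] q by simp
      qed
      have sA: "\<rho> x \<in> {1..N}" if "x \<in> {1..N}" for x using side[OF that] rng[of x] that by simp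
      have sB: "\<rho> x \<in> {N+1..2*N}" if "x \<in> {N+1..2*N}" for x
      proof -
        have "x - N \<in> {1..N}" "x - N + N = x" using that by auto
        then show ?thesis using side[of "x - N"] rng[of x] that by simp
      qed
      \<comment> \<open>\<open>\<rho>\<close> preserves both halves, so it is the product of its two
        restrictions, and \<open>F\<close> is antisymmetric in each half. Hence \<open>F\<close> at
        the permuted pairing is the sign of \<open>\<rho>\<close>.\<close>
      define r where "r S x = (if x \<in> S then \<rho> x else x)" for S x
      have r: "r S permutes S" if S: "finite S" "\<And>x. x \<in> S \<Longrightarrow> \<rho> x \<in> S" for S
      proof (rule bij_imp_permutes)
        have "inj_on \<rho> S" by (rule permutes_inj_on[OF \<rho>])
        moreover have "\<rho> ` S = S" by (rule endo_inj_surj[OF S(1) _ calculation]) (use S(2) in blast)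
        ultimately have "bij_betw \<rho> S S" by (simp add: bij_betw_def)
        then show "bij_betw (r S) S S" by (rule bij_betw_cong[THEN iffD1, rotated]) (simp add: r_def)
      qed (simp add: r_def)
      have rA: "r {1..N} permutes {1..N}" by (rule r) (simp, rule sA)
      have rB: "r {N+1..2*N} permutes {N+1..2*N}" by (rule r) (simp, rule sB)
      have comp: "\<rho> = r {1..N} \<circ> r {N+1..2*N}"
      proof
        fix x
        show "\<rho> x = (r {1..N} \<circ> r {N+1..2*N}) x"
        proof (cases "x \<in> {N+1..2*N}")
          case True
          have "\<rho> x \<notin> {1..N}" using sB[OF True] by simp
          then have "r {1..N} (\<rho> x) = \<rho> x" "r {N+1..2*N} x = \<rho> x"
            unfolding r_def by (rule if_not_P, intro if_P True)
          then show ?thesis by simp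
        next
          case False
          show ?thesis
          proof (cases "x \<in> {1..N}")
            case False': False
            have "\<rho> x = x" by (rule permutes_not_in[OF \<rho>]) (use False False' in auto)
            then show ?thesis using False False' by (simp add: r_def)
          qed (use False in \<open>simp add: r_def\<close>)
        qed
      qed
      have sub: "{1..N} \<subseteq> {1..2*N}" "{N+1..2*N} \<subseteq> {1..2*N}" by auto
      have "F (pact \<rho> m0) = F (pact (r {1..N}) (pact (r {N+1..2*N}) m0))" by (simp only: comp pact_comp)
      also have "\<dots> = of_int (sign (r {1..N})) * F (pact (r {N+1..2*N}) m0)"
        by (rule antisym_permutes[OF antiA sub(1) rA pact_pairings[OF permutes_subset[OF rB sub(2)] m0]])
      also have "F (pact (r {N+1..2*N}) m0) = of_int (sign (r {N+1..2*N})) * F m0"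
        by (rule antisym_permutes[OF antiB sub(2) rB m0])
      finally have "F (pact \<rho> m0) = of_int (sign (r {1..N}) * sign (r {N+1..2*N}))" by (simp add: F0)
      also have "sign (r {1..N}) * sign (r {N+1..2*N}) = sign \<rho>"
        unfolding comp using sign_compose[OF permutes_imp_permutation[OF _ rA] permutes_imp_permutation[OF _ rB]] by simp
      also have "sign \<rho> = sign \<sigma>"
        unfolding \<rho>_def by (rule sign_inverse[OF permutes_imp_permutation[OF _ Gp[OF \<sigma>]]]) simp
      finally have "of_int (sign \<sigma>) * F (pact (inv_into UNIV \<sigma>) m0) = of_int (sign \<sigma> * sign \<sigma>)"
        by (simp only: \<rho>_def of_int_mult)
      then show ?thesis by simp
    qed simp
    have idG: "id \<in> G" by (simp add: G_def permutes_id)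
    have "inv_into UNIV id = (id :: nat \<Rightarrow> nat)" by (rule inv_id)
    then have "Re (of_int (sign (id :: nat \<Rightarrow> nat)) * F (pact (inv_into UNIV id) m0)) = 1" by (simp add: F0 sign_id)
    moreover have "Re (of_int (sign (id :: nat \<Rightarrow> nat)) * F (pact (inv_into UNIV id) m0)) \<le> (\<Sum>\<sigma>\<in>G. Re (of_int (sign \<sigma>) * F (pact (inv_into UNIV \<sigma>) m0)))"
    proof (rule member_le_sum[OF idG _ finG])
      have nonneg: "0 \<le> Re z" if "z \<in> {0, 1}" for z using that by auto
      fix \<sigma> assume "\<sigma> \<in> G - {id}"
      then show "0 \<le> Re (of_int (sign \<sigma>) * F (pact (inv_into UNIV \<sigma>) m0))" by (intro nonneg t) simp
    qed
    ultimately have "1 \<le> Re (e m0)" by (simp only: e_def Re_sum)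
    then show ?thesis by auto
  qed
  ultimately show ?thesis by blast
qed

end

section \<open>The valenced action\<close>

lemma subspace_blocked: "cfun.subspace (blocked N s)"
proof (rule cfun.subspaceI)
  show "0 \<in> blocked N s" unfolding zero_fun_def by (rule blocked_zero)
  show "c + d \<in> blocked N s" if "c \<in> blocked N s" "d \<in> blocked N s" for c d :: "nat set set \<Rightarrow> complex"
    using blocked_add[OF that] by (simp add: plus_fun_def)
  show "cscale k c \<in> blocked N s" if "c \<in> blocked N s" for k c
    using blocked_scale[OF that] by (simp add: cscale_def)
qed

lemma blocked_pluecker: "c \<in> blocked N s \<Longrightarrow> c \<in> pluecker N"
  by (simp add: blocked_def)

text \<open>Normalised so that on blocked functions it is the evaluation of the Vandermonde quotient
  of \<open>free_fun N c\<close>.\<close>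

definition fused_map :: "nat \<Rightarrow> nat list \<Rightarrow> (nat set set \<Rightarrow> complex) \<Rightarrow> cfn" where
  "fused_map N s c = cscale (1 / of_real (fuse_const N s)) (fused_fun N s c)"

lemma fused_fun_add: "fused_fun N s (c + d) = fused_fun N s c + fused_fun N s d"
  by (rule ext) (simp add: fused_fun_def plus_fun_def wsum_add)

lemma fused_fun_cscale: "fused_fun N s (cscale k c) = cscale k (fused_fun N s c)"
  by (rule ext) (simp add: fused_fun_def cscale_def wsum_scale)

lemma fused_map_add: "fused_map N s (c + d) = fused_map N s c + fused_map N s d"
  unfolding fused_map_def fused_fun_add by (rule cfun.scale_right_distrib)

lemma fused_map_cscale: "fused_map N s (cscale k c) = cscale k (fused_map N s c)"
  by (simp add: fused_map_def fused_fun_cscale cscale_cscale mult.commute)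

lemma fused_map_inj:
  assumes val: "valences N s" and cd: "c \<in> blocked N s" "d \<in> blocked N s" and eq: "fused_map N s c = fused_map N s d"
  shows "c = d"
proof
  fix m
  let ?k = "1 / of_real (fuse_const N s) :: complex"
  have k: "?k \<noteq> 0" using fuse_const_pos[of N s] by simp
  have "c + cscale (- 1) d \<in> blocked N s"
    using cd by (intro cfun.subspace_add[OF subspace_blocked] cfun.subspace_scale[OF subspace_blocked])
  moreover have "fused_fun N s (c + cscale (- 1) d) \<xi> = 0" for \<xi>
  proof -
    have "fused_map N s (c + cscale (- 1) d) \<xi> = 0"
      unfolding fused_map_add fused_map_cscale eq by (simp add: cscale_def)
    then show ?thesis using k by (simp add: fused_map_def cscale_def)
  qed
  ultimately have "(c + cscale (- 1) d) m = 0" by (rule fused_fun_injective[OF val])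
  then show "c m = d m" by (simp add: cscale_def)
qed

lemma Sv_eq_fused_map:
  assumes val: "valences N s"
  shows "Sv N s = fused_map N s ` blocked N s"
  unfolding Sv_eq_fused_fun[OF val]
proof (intro subset_antisym image_subsetI)
  fix c :: "nat set set \<Rightarrow> complex" assume c: "c \<in> blocked N s"
  let ?K = "of_real (fuse_const N s) :: complex"
  have "fused_map N s (cscale ?K c) = fused_fun N s c"
    unfolding fused_map_cscale using fuse_const_pos[of N s] by (simp add: fused_map_def cscale_cscale cscale_one)
  then show "fused_fun N s c \<in> fused_map N s ` blocked N s"
    using cfun.subspace_scale[OF subspace_blocked c] by (metis imageI)
  have "fused_fun N s (cscale (1 / ?K) c) = fused_map N s c"
    by (simp only: fused_map_def fused_fun_cscale)
  then show "fused_map N s c \<in> fused_fun N s ` blocked N s"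
    using cfun.subspace_scale[OF subspace_blocked c] by (metis imageI)
qed

lemma tl_class_add:
  assumes "a \<in> carrier (group_alg n)" "b \<in> carrier (group_alg n)"
  shows "tl_class n a \<oplus>\<^bsub>TL n\<^esub> tl_class n b = tl_class n (a \<oplus>\<^bsub>group_alg n\<^esub> b)"
proof -
  interpret ideal "tl_ideal n" "group_alg n" by (rule ideal_tl_ideal)
  show ?thesis using a_rcos_sum[OF assms] by (simp add: TL_simps FactRing_def tl_class_def)
qed

lemma TLv_ops:
  "mult (TLv N s) = mult (TL (2 * N))" "add (TLv N s) = add (TL (2 * N))"
  "smult (TLv N s) = smult (TL (2 * N))" "one (TLv N s) = p_idem N s"
  by (simp_all add: TLv_def corner_def)

lemma corner_class:
  assumes val: "valences N s" and a: "a \<in> carrier (group_alg (2 * N))"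
  shows "p_idem N s \<otimes>\<^bsub>TL (2*N)\<^esub> tl_class (2 * N) a \<otimes>\<^bsub>TL (2*N)\<^esub> p_idem N s
    = tl_class (2 * N) (block_antisymmetrizer N s \<otimes>\<^bsub>group_alg (2 * N)\<^esub> a \<otimes>\<^bsub>group_alg (2 * N)\<^esub> block_antisymmetrizer N s)"
proof -
  interpret ring "group_alg (2 * N)" by (rule ring_group_alg)
  show ?thesis unfolding p_idem_def using a block_antisymmetrizer_idem(1)[OF val] by (simp add: tl_class_mult)
qed

lemma gact_corner:
  "gact (2 * N) (P \<otimes>\<^bsub>group_alg (2 * N)\<^esub> a \<otimes>\<^bsub>group_alg (2 * N)\<^esub> P) c = gact (2 * N) P (gact (2 * N) a (gact (2 * N) P c))"
  by (simp add: gact_mult)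

lemma carrier_TLv_cases:
  assumes val: "valences N s" and A: "A \<in> carrier (TLv N s)"
  obtains y where "y \<in> carrier (group_alg (2 * N))" "A = tl_class (2 * N) y"
    "\<And>c. c \<in> blocked N s \<Longrightarrow> gact (2 * N) y c \<in> blocked N s"
proof -
  let ?P = "block_antisymmetrizer N s"
  interpret ring "group_alg (2 * N)" by (rule ring_group_alg)
  obtain x where x: "x \<in> carrier (group_alg (2 * N))"
    and A: "A = p_idem N s \<otimes>\<^bsub>TL (2*N)\<^esub> tl_class (2 * N) x \<otimes>\<^bsub>TL (2*N)\<^esub> p_idem N s"
    using A by (auto simp: TLv_def corner_def carrier_TL)
  show thesis
  proof (rule that)
    show "?P \<otimes>\<^bsub>group_alg (2 * N)\<^esub> x \<otimes>\<^bsub>group_alg (2 * N)\<^esub> ?P \<in> carrier (group_alg (2 * N))"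
      using x block_antisymmetrizer_idem(1)[OF val] by simp
    show "A = tl_class (2 * N) (?P \<otimes>\<^bsub>group_alg (2 * N)\<^esub> x \<otimes>\<^bsub>group_alg (2 * N)\<^esub> ?P)"
      unfolding A by (rule corner_class[OF val x])
    fix c :: "nat set set \<Rightarrow> complex" assume "c \<in> blocked N s"
    then show "gact (2 * N) (?P \<otimes>\<^bsub>group_alg (2 * N)\<^esub> x \<otimes>\<^bsub>group_alg (2 * N)\<^esub> ?P) c \<in> blocked N s"
      unfolding gact_corner by (intro gact_antisymmetrizer_mem[OF val] gact_pluecker blocked_pluecker)
  qed
qed

text \<open>\<open>fused_map\<close> is injective on \<open>blocked N s\<close>, so the choice below is unique on \<open>Sv N s\<close>.\<close>

definition valenced_act :: "nat \<Rightarrow> nat list \<Rightarrow> ((nat \<Rightarrow> nat) \<Rightarrow> complex) set \<Rightarrow> cfn \<Rightarrow> cfn" where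
  "valenced_act N s A g = fused_eval N s (block_quot s (tl_act (2 * N) A
     (free_fun N (SOME c. c \<in> blocked N s \<and> fused_map N s c = g))))"

lemma valenced_act_eq:
  assumes val: "valences N s" and c: "c \<in> blocked N s" and d: "d \<in> blocked N s"
    and A: "A \<noteq> {}" "\<And>x. x \<in> A \<Longrightarrow> gact (2 * N) x c = d"
  shows "valenced_act N s A (fused_map N s c) = fused_map N s d"
proof -
  have "(SOME c'. c' \<in> blocked N s \<and> fused_map N s c' = fused_map N s c) = c"
    by (rule some_equality) (use c fused_map_inj[OF val _ c] in auto)
  then show ?thesis
    by (simp add: valenced_act_def tl_act_free_fun[OF A] fused_eval_free_fun[OF val d] fused_map_def)
qed

lemma valenced_act_class:
  assumes "valences N s" "c \<in> blocked N s" "gact (2 * N) y c \<in> blocked N s"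
  shows "valenced_act N s (tl_class (2 * N) y) (fused_map N s c) = fused_map N s (gact (2 * N) y c)"
  by (rule valenced_act_eq[OF assms tl_class_nonempty]) (rule gact_tl_class[OF _ blocked_pluecker[OF assms(2)]])

lemma alg_module_valenced:
  assumes val: "valences N s"
  shows "alg_module (TLv N s) (Sv N s) (valenced_act N s)"
proof -
  let ?n = "2 * N" and ?act = "valenced_act N s" and ?f = "fused_map N s"
  note V = Sv_eq_fused_map[OF val]
  note act = valenced_act_class[OF val]
  have sub: "c + d \<in> blocked N s" "cscale k c \<in> blocked N s"
    if "c \<in> blocked N s" "d \<in> blocked N s" for c d :: "nat set set \<Rightarrow> complex" and k
    using cfun.subspace_add[OF subspace_blocked that] cfun.subspace_scale[OF subspace_blocked that(1)] .
  have 1: "?act A v \<in> Sv N s" if A: "A \<in> carrier (TLv N s)" and v: "v \<in> Sv N s" for A v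
  proof (rule carrier_TLv_cases[OF val A])
    fix y assume y: "A = tl_class ?n y" "\<And>c. c \<in> blocked N s \<Longrightarrow> gact ?n y c \<in> blocked N s"
    obtain c where c: "c \<in> blocked N s" "v = ?f c" using v unfolding V by blast
    show ?thesis unfolding y(1) c(2) act[OF c(1) y(2)[OF c(1)]] V by (rule imageI[OF y(2)[OF c(1)]])
  qed
  have 2: "?act \<one>\<^bsub>TLv N s\<^esub> v = v" if v: "v \<in> Sv N s" for v
  proof -
    obtain c where c: "c \<in> blocked N s" "v = ?f c" using v unfolding V by blast
    have P: "gact ?n (block_antisymmetrizer N s) c = c" by (rule gact_antisymmetrizer_blocked[OF val c(1)])
    show ?thesis unfolding TLv_ops p_idem_def c(2) using act[OF c(1), of "block_antisymmetrizer N s"] c(1) by (simp add: P)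
  qed
  have 3: "?act (A \<otimes>\<^bsub>TLv N s\<^esub> B) v = ?act A (?act B v)" and 4: "?act (A \<oplus>\<^bsub>TLv N s\<^esub> B) v = ?act A v + ?act B v"
    if A: "A \<in> carrier (TLv N s)" and B: "B \<in> carrier (TLv N s)" and v: "v \<in> Sv N s" for A B v
  proof -
    obtain y where y: "y \<in> carrier (group_alg ?n)" "A = tl_class ?n y" "\<And>c. c \<in> blocked N s \<Longrightarrow> gact ?n y c \<in> blocked N s"
      by (rule carrier_TLv_cases[OF val A]) blast
    obtain z where z: "z \<in> carrier (group_alg ?n)" "B = tl_class ?n z" "\<And>c. c \<in> blocked N s \<Longrightarrow> gact ?n z c \<in> blocked N s"
      by (rule carrier_TLv_cases[OF val B]) blast
    obtain c where c: "c \<in> blocked N s" "v = ?f c" using v unfolding V by blast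
    note bl = y(3)[OF c(1)] z(3)[OF c(1)] y(3)[OF z(3)[OF c(1)]]
    show "?act (A \<otimes>\<^bsub>TLv N s\<^esub> B) v = ?act A (?act B v)"
      unfolding TLv_ops y(2) z(2) c(2) tl_class_mult[OF y(1) z(1)] act[OF c(1) bl(2)] act[OF bl(2,3)]
      using act[OF c(1), of "y \<otimes>\<^bsub>group_alg ?n\<^esub> z"] bl(3) by (simp add: gact_mult)
    show "?act (A \<oplus>\<^bsub>TLv N s\<^esub> B) v = ?act A v + ?act B v"
      unfolding TLv_ops y(2) z(2) c(2) tl_class_add[OF y(1) z(1)] act[OF c(1) bl(2)] act[OF c(1) bl(1)]
      using act[OF c(1), of "y \<oplus>\<^bsub>group_alg ?n\<^esub> z"] sub(1)[OF bl(1,2)] by (simp add: gact_add_left fused_map_add)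
  qed
  have 5: "?act (k \<odot>\<^bsub>TLv N s\<^esub> A) v = cscale k (?act A v)" "?act A (cscale k v) = cscale k (?act A v)"
    if A: "A \<in> carrier (TLv N s)" and v: "v \<in> Sv N s" for k A v
  proof -
    obtain y where y: "y \<in> carrier (group_alg ?n)" "A = tl_class ?n y" "\<And>c. c \<in> blocked N s \<Longrightarrow> gact ?n y c \<in> blocked N s"
      by (rule carrier_TLv_cases[OF val A]) blast
    obtain c where c: "c \<in> blocked N s" "v = ?f c" using v unfolding V by blast
    note bl = y(3)[OF c(1)]
    have cP: "c \<in> pluecker N" by (rule blocked_pluecker[OF c(1)])
    have "?act (k \<odot>\<^bsub>TL ?n\<^esub> A) v = ?f (cscale k (gact ?n y c))"
      unfolding c(2)
    proof (rule valenced_act_eq[OF val c(1) sub(2)[OF bl bl]])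
      obtain a where a: "a \<in> A" using tl_class_nonempty y(2) by blast
      show "k \<odot>\<^bsub>TL ?n\<^esub> A \<noteq> {}" using a tl_class_nonempty[of ?n "k \<odot>\<^bsub>group_alg ?n\<^esub> a"] by (auto simp: TL_simps)
      fix x assume "x \<in> k \<odot>\<^bsub>TL ?n\<^esub> A"
      then obtain a where a: "a \<in> tl_class ?n y" "x \<in> tl_class ?n (k \<odot>\<^bsub>group_alg ?n\<^esub> a)" by (auto simp: TL_simps y(2))
      show "gact ?n x c = cscale k (gact ?n y c)"
        unfolding gact_tl_class[OF a(2) cP] gact_smult gact_tl_class[OF a(1) cP] ..
    qed
    then show "?act (k \<odot>\<^bsub>TLv N s\<^esub> A) v = cscale k (?act A v)"
      unfolding TLv_ops c(2) by (simp add: y(2) act[OF c(1) bl] fused_map_cscale)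
    have "?act (tl_class ?n y) (?f (cscale k c)) = ?f (cscale k (gact ?n y c))"
      using act[OF sub(2)[OF c(1) c(1)], of y k] sub(2)[OF bl bl] by (simp add: gact_cscale)
    then show "?act A (cscale k v) = cscale k (?act A v)"
      unfolding y(2) c(2) act[OF c(1) bl] by (simp add: fused_map_cscale)
  qed
  have 6: "?act A (v + w) = ?act A v + ?act A w"
    if A: "A \<in> carrier (TLv N s)" and v: "v \<in> Sv N s" and w: "w \<in> Sv N s" for A v w
  proof -
    obtain y where y: "y \<in> carrier (group_alg ?n)" "A = tl_class ?n y" "\<And>c. c \<in> blocked N s \<Longrightarrow> gact ?n y c \<in> blocked N s"
      by (rule carrier_TLv_cases[OF val A]) blast
    obtain c where c: "c \<in> blocked N s" "v = ?f c" using v unfolding V by blast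
    obtain d where d: "d \<in> blocked N s" "w = ?f d" using w unfolding V by blast
    have "?act (tl_class ?n y) (?f (c + d)) = ?f (gact ?n y c + gact ?n y d)"
      using act[OF sub(1)[OF c(1) d(1)], of y] sub(1)[OF y(3)[OF c(1)] y(3)[OF d(1)]] by (simp add: gact_add)
    then show ?thesis
      unfolding y(2) c(2) d(2) act[OF c(1) y(3)[OF c(1)]] act[OF d(1) y(3)[OF d(1)]] by (simp add: fused_map_add)
  qed
  show ?thesis
    unfolding alg_module_def
    using ring_TLv[OF val] 1 2 3 4 5 6 cfun.subspace_span[of "pure_pf N s ` LPv N s"] unfolding Sv_def[symmetric] by simp
qed

lemma simple_valenced:
  assumes val: "valences N s"
  shows "simple_alg_module (TLv N s) (Sv N s) (valenced_act N s)"
proof -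
  let ?n = "2 * N" and ?act = "valenced_act N s" and ?f = "fused_map N s" and ?P = "block_antisymmetrizer N s"
  note V = Sv_eq_fused_map[OF val]
  have zero: "?f 0 = 0" using fused_map_cscale[of N s 0 0] by (simp add: cscale_def zero_fun_def)
  have "Sv N s \<noteq> {0}"
  proof
    assume eq: "Sv N s = {0}"
    obtain c m where c: "c \<in> blocked N s" "c m \<noteq> (0 :: complex)" using blocked_nontrivial[OF val] by blast
    have "?f c = ?f 0" using eq c(1) unfolding V zero by blast
    then have "c = 0" by (rule fused_map_inj[OF val c(1) cfun.subspace_0[OF subspace_blocked]])
    then show False using c(2) by simp
  qed
  moreover have "W = {0} \<or> W = Sv N s" if W: "W \<subseteq> Sv N s" "alg_module (TLv N s) W ?act" for W
  proof (cases "W = {0}")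
    case False
    have subW: "cfun.subspace W" and closed: "\<And>A w. A \<in> carrier (TLv N s) \<Longrightarrow> w \<in> W \<Longrightarrow> ?act A w \<in> W"
      using W(2) by (simp_all add: alg_module_def)
    obtain w where w: "w \<in> W" "w \<noteq> 0" using False cfun.subspace_0[OF subW] by blast
    obtain c where c: "c \<in> blocked N s" "w = ?f c" using w(1) W(1) unfolding V by blast
    have "c \<noteq> 0" using w(2) zero c(2) by blast
    then obtain m where m: "c m \<noteq> 0" by (auto simp: fun_eq_iff)
    have "v \<in> W" if v: "v \<in> Sv N s" for v
    proof -
      obtain d where d: "d \<in> blocked N s" "v = ?f d" using v unfolding V by blast
      obtain a where a: "a \<in> carrier (group_alg ?n)" "d = gact ?n a c"
        using pluecker_irreducible[OF blocked_pluecker[OF c(1)] m blocked_pluecker[OF d(1)]] by (auto simp: orbit_space_def)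
      \<comment> \<open>The antisymmetriser fixes both \<open>c\<close> and \<open>d\<close>, so
        enclosing \<open>a\<close> between two copies of it still sends \<open>c\<close> to
        \<open>d\<close>.\<close>
      let ?y = "?P \<otimes>\<^bsub>group_alg ?n\<^esub> a \<otimes>\<^bsub>group_alg ?n\<^esub> ?P"
      have g: "gact ?n ?y c = d"
        unfolding gact_corner gact_antisymmetrizer_blocked[OF val c(1)] a(2)[symmetric] by (rule gact_antisymmetrizer_blocked[OF val d(1)])
      have "tl_class ?n ?y \<in> carrier (TLv N s)"
        unfolding corner_class[OF val a(1), symmetric] TLv_def corner_def using a(1) by (simp add: carrier_TL)
      from closed[OF this w(1)] show "v \<in> W"
        using valenced_act_class[OF val c(1), of ?y] d by (simp add: c(2) g)
    qed
    then show ?thesis using W(1) by blast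
  qed simp
  ultimately show ?thesis using alg_module_valenced[OF val] by (simp add: simple_alg_module_def)
qed

theorem theorem1p4:
  fixes N :: nat and s :: "nat list"
  assumes "valences N s"
  shows "(\<forall>F\<in>SN N. extends_to_fused N s (block_quot s (tl_act (2*N) (p_idem N s) F))) \<and>
    Sv N s = {fused_eval N s (block_quot s (tl_act (2*N) (p_idem N s) F)) | F. F \<in> SN N} \<and>
    (\<exists>act.
       (\<forall>a\<in>carrier (TL (2*N)). \<forall>F\<in>SN N.
          act (p_idem N s \<otimes>\<^bsub>TL (2*N)\<^esub> a \<otimes>\<^bsub>TL (2*N)\<^esub> p_idem N s)
              (fused_eval N s (block_quot s (tl_act (2*N) (p_idem N s) F)))
          = fused_eval N s (block_quot s
              (tl_act (2*N) (p_idem N s \<otimes>\<^bsub>TL (2*N)\<^esub> a \<otimes>\<^bsub>TL (2*N)\<^esub> p_idem N s) F))) \<and>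
       simple_alg_module (TLv N s) (Sv N s) act)"
proof (intro conjI exI)
  let ?n = "2 * N" and ?P = "block_antisymmetrizer N s"
  note val = assms
  have tlp: "tl_act ?n (p_idem N s) (free_fun N c) = free_fun N (gact ?n ?P c)" if "c \<in> pluecker N" for c
    unfolding p_idem_def by (rule tl_act_class[OF that])
  have ev: "fused_eval N s (block_quot s (free_fun N c)) = fused_map N s c" if "c \<in> blocked N s" for c
    unfolding fused_map_def by (rule fused_eval_free_fun[OF val that])
  note PB = gact_antisymmetrizer_mem[OF val]
  show "\<forall>F\<in>SN N. extends_to_fused N s (block_quot s (tl_act ?n (p_idem N s) F))"
  proof
    fix F assume "F \<in> SN N"
    then obtain c where c: "c \<in> pluecker N" "F = free_fun N c" unfolding SN_eq by blast
    show "extends_to_fused N s (block_quot s (tl_act ?n (p_idem N s) F))"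
      unfolding c(2) tlp[OF c(1)] by (rule extends_free_fun[OF val PB[OF c(1)]])
  qed
  show "Sv N s = {fused_eval N s (block_quot s (tl_act ?n (p_idem N s) F)) | F. F \<in> SN N}"
  proof (intro subset_antisym subsetI)
    fix g assume "g \<in> Sv N s"
    then obtain c where c: "c \<in> blocked N s" "g = fused_map N s c" unfolding Sv_eq_fused_map[OF val] by blast
    have "fused_eval N s (block_quot s (tl_act ?n (p_idem N s) (free_fun N c))) = g"
      unfolding tlp[OF blocked_pluecker[OF c(1)]] gact_antisymmetrizer_blocked[OF val c(1)] c(2) by (rule ev[OF c(1)])
    moreover have "free_fun N c \<in> SN N" unfolding SN_eq by (rule imageI[OF blocked_pluecker[OF c(1)]])
    ultimately show "g \<in> {fused_eval N s (block_quot s (tl_act ?n (p_idem N s) F)) | F. F \<in> SN N}" by blast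
  next
    fix g assume "g \<in> {fused_eval N s (block_quot s (tl_act ?n (p_idem N s) F)) | F. F \<in> SN N}"
    then obtain c where c: "c \<in> pluecker N" "g = fused_eval N s (block_quot s (tl_act ?n (p_idem N s) (free_fun N c)))"
      unfolding SN_eq by blast
    show "g \<in> Sv N s" unfolding c(2) tlp[OF c(1)] ev[OF PB[OF c(1)]] Sv_eq_fused_map[OF val] by (rule imageI[OF PB[OF c(1)]])
  qed
  show "\<forall>a\<in>carrier (TL ?n). \<forall>F\<in>SN N.
      valenced_act N s (p_idem N s \<otimes>\<^bsub>TL ?n\<^esub> a \<otimes>\<^bsub>TL ?n\<^esub> p_idem N s) (fused_eval N s (block_quot s (tl_act ?n (p_idem N s) F)))
      = fused_eval N s (block_quot s (tl_act ?n (p_idem N s \<otimes>\<^bsub>TL ?n\<^esub> a \<otimes>\<^bsub>TL ?n\<^esub> p_idem N s) F))"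
  proof (intro ballI)
    fix A F assume "A \<in> carrier (TL ?n)" "F \<in> SN N"
    then obtain a c where a: "a \<in> carrier (group_alg ?n)" "A = tl_class ?n a"
      and c: "c \<in> pluecker N" "F = free_fun N c" unfolding SN_eq carrier_TL by blast
    let ?y = "?P \<otimes>\<^bsub>group_alg ?n\<^esub> a \<otimes>\<^bsub>group_alg ?n\<^esub> ?P"
    have y: "gact ?n ?y d \<in> blocked N s" if "d \<in> pluecker N" for d
      unfolding gact_corner by (intro PB gact_pluecker that)
    have PP: "gact ?n ?y (gact ?n ?P c) = gact ?n ?y c"
      unfolding gact_corner gact_antisymmetrizer_blocked[OF val PB[OF c(1)]] ..
    show "valenced_act N s (p_idem N s \<otimes>\<^bsub>TL ?n\<^esub> A \<otimes>\<^bsub>TL ?n\<^esub> p_idem N s) (fused_eval N s (block_quot s (tl_act ?n (p_idem N s) F)))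
      = fused_eval N s (block_quot s (tl_act ?n (p_idem N s \<otimes>\<^bsub>TL ?n\<^esub> A \<otimes>\<^bsub>TL ?n\<^esub> p_idem N s) F))"
      unfolding a(2) corner_class[OF val a(1)] c(2) tlp[OF c(1)] ev[OF PB[OF c(1)]] tl_act_class[OF c(1)] ev[OF y[OF c(1)]]
        valenced_act_class[OF val PB[OF c(1)] y[OF gact_pluecker[OF c(1)]]] PP ..
  qed
  show "simple_alg_module (TLv N s) (Sv N s) (valenced_act N s)" by (rule simple_valenced[OF val])
qed

end
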